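(* Let $S^1$ act on the unit sphere $\mathbb{S}^4=\{(x,z_1,z_2)\in \mathbb{R}\times\mathbb{C}^2 : |x|^2+|z_1|^2+|z_2|^2=1\}$ (with its round metric) by the suspension of the Hopf action, i.e. $e^{i\theta}\cdot(x,z_1,z_2):=(x,e^{i\theta}z_1,e^{i\theta}z_2)$ for all $e^{i\theta}\in S^1$ and $(x,z_1,z_2)\in\mathbb{S}^4$. Then there exist in $\mathbb{S}^4$: an embedded non-equatorial minimal hypersphere (diffeomorphic to $S^3$), an embedded minimal hypertorus (diffeomorphic to $T^3=S^1\times S^1\times S^1$), and an embedded minimal hypersurface diffeomorphic to $S^1\times S^2$, all of which are invariant under the $S^1$-action.
   Context: A hypersurface is equatorial if it is a totally geodesic great hypersphere $\{p\in\mathbb{S}^4: p\cdot v=0\}$ for some $v\in\mathbb{S}^4$. Minimal means vanishing mean curvature in the round $\mathbb{S}^4$. *)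

theory Defs
  imports "HOL-Analysis.Analysis"
begin

primrec Ck_on :: "nat \<Rightarrow> 'a::euclidean_space set \<Rightarrow> ('a \<Rightarrow> 'b::euclidean_space) \<Rightarrow> bool" where
  "Ck_on 0 U f \<longleftrightarrow> continuous_on U f"
| "Ck_on (Suc k) U f \<longleftrightarrow>
     (\<forall>x\<in>U. f differentiable (at x)) \<and>
     (\<forall>v. Ck_on k U (\<lambda>x. frechet_derivative f (at x) v))"

(* Only meaningful for open U; smooth_map is the notion for arbitrary sets. *)
definition smooth_on :: "'a::euclidean_space set \<Rightarrow> ('a \<Rightarrow> 'b::euclidean_space) \<Rightarrow> bool" where
  "smooth_on U f \<longleftrightarrow> (\<forall>k. Ck_on k U f)"

(* Smooth maps between arbitrary subsets of Euclidean spaces, as in Milnor and in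
   Guillemin-Pollack: near every point of the domain the map extends to a smooth map on
   an open subset of the ambient space. *)
definition smooth_map :: "'a::euclidean_space set \<Rightarrow> ('a \<Rightarrow> 'b::euclidean_space) \<Rightarrow> bool" where
  "smooth_map A f \<longleftrightarrow>
     (\<forall>x\<in>A. \<exists>U g. open U \<and> x \<in> U \<and> smooth_on U g \<and> (\<forall>y\<in>A \<inter> U. g y = f y))"

definition diffeomorphism ::
  "'a::euclidean_space set \<Rightarrow> 'b::euclidean_space set \<Rightarrow> ('a \<Rightarrow> 'b) \<Rightarrow> ('b \<Rightarrow> 'a) \<Rightarrow> bool" where
  "diffeomorphism A B f g \<longleftrightarrow>
     smooth_map A f \<and> f ` A = B \<and> (\<forall>x\<in>A. g (f x) = x) \<and>
     smooth_map B g \<and> g ` B = A \<and> (\<forall>y\<in>B. f (g y) = y)"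

definition diffeomorphic ::
  "'a::euclidean_space set \<Rightarrow> 'b::euclidean_space set \<Rightarrow> bool" (infixr \<open>diffeomorphic\<close> 60) where
  "A diffeomorphic B \<longleftrightarrow> (\<exists>f g. diffeomorphism A B f g)"

(* The product norm and inner product of this type are the Euclidean ones. *)
type_synonym ambient = "real \<times> complex \<times> complex"

definition S4 :: "ambient set" where
  "S4 = {(x, z1, z2). \<bar>x\<bar>\<^sup>2 + (cmod z1)\<^sup>2 + (cmod z2)\<^sup>2 = 1}"

lemma S4_eq_sphere: "S4 = sphere 0 1"
  by (auto simp: S4_def norm_prod_def dist_norm)

(* Embedded means: locally, in the subspace topology, diffeomorphic to an open subset of R^3. *)
definition embedded_hypersurface :: "ambient set \<Rightarrow> bool" where
  "embedded_hypersurface M \<longleftrightarrow>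
     M \<subseteq> S4 \<and>
     (\<forall>p\<in>M. \<exists>W (V :: (real^3) set).
        openin (top_of_set M) W \<and> p \<in> W \<and> open V \<and> W diffeomorphic V)"

(* Velocities at p of smooth curves in M. *)
definition tangent_space :: "ambient set \<Rightarrow> ambient \<Rightarrow> ambient set" where
  "tangent_space M p =
     {v. \<exists>\<epsilon>>0. \<exists>c :: real \<Rightarrow> ambient.
           smooth_on {-\<epsilon><..<\<epsilon>} c \<and> c ` {-\<epsilon><..<\<epsilon>} \<subseteq> M \<and> c 0 = p \<and>
           (c has_vector_derivative v) (at 0)}"

(* Unit normal of M inside the sphere: \<nu> q is tangent to the sphere at q and orthogonal to M.
   Locally every smooth normal field along M is the restriction of such an ambient \<nu>. *)
definition unit_normal_field :: "ambient set \<Rightarrow> ambient set \<Rightarrow> (ambient \<Rightarrow> ambient) \<Rightarrow> bool" where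
  "unit_normal_field M U \<nu> \<longleftrightarrow>
     open U \<and> smooth_on U \<nu> \<and>
     (\<forall>q\<in>M \<inter> U. norm (\<nu> q) = 1 \<and> \<nu> q \<bullet> q = 0 \<and> (\<forall>v\<in>tangent_space M q. \<nu> q \<bullet> v = 0))"

(* Levi-Civita connection of the round sphere: the Euclidean derivative of X in direction v,
   projected orthogonally to the tangent space of the sphere at p. *)
definition sphere_connection :: "(ambient \<Rightarrow> ambient) \<Rightarrow> ambient \<Rightarrow> ambient \<Rightarrow> ambient" where
  "sphere_connection X p v =
     (let w = frechet_derivative X (at p) v in w - (w \<bullet> p) *\<^sub>R p)"

definition second_fundamental_form ::
  "(ambient \<Rightarrow> ambient) \<Rightarrow> ambient \<Rightarrow> ambient \<Rightarrow> ambient \<Rightarrow> real" where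
  "second_fundamental_form \<nu> p v w = - (sphere_connection \<nu> p v \<bullet> w)"

definition orthonormal_basis :: "ambient set \<Rightarrow> ambient set \<Rightarrow> bool" where
  "orthonormal_basis T B \<longleftrightarrow> pairwise orthogonal B \<and> (\<forall>e\<in>B. norm e = 1) \<and> span B = T"

(* The trace of the second fundamental form does not depend on the chosen basis. *)
definition mean_curvature :: "ambient set \<Rightarrow> (ambient \<Rightarrow> ambient) \<Rightarrow> ambient \<Rightarrow> real" where
  "mean_curvature M \<nu> p =
     (\<Sum>e\<in>(SOME B. orthonormal_basis (tangent_space M p) B). second_fundamental_form \<nu> p e e)"

(* Vanishing of the mean curvature does not depend on the local unit normal: replacing \<nu> by
   -\<nu> only changes the sign. Quantifying existentially excludes vacuous truth. *)
definition minimal_hypersurface :: "ambient set \<Rightarrow> bool" where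
  "minimal_hypersurface M \<longleftrightarrow>
     embedded_hypersurface M \<and>
     (\<forall>p\<in>M. \<exists>U \<nu>. p \<in> U \<and> unit_normal_field M U \<nu> \<and> mean_curvature M \<nu> p = 0)"

definition equatorial :: "ambient set \<Rightarrow> bool" where
  "equatorial M \<longleftrightarrow> (\<exists>v\<in>S4. M = {p\<in>S4. p \<bullet> v = 0})"

definition suspended_hopf_action :: "complex \<Rightarrow> ambient \<Rightarrow> ambient" where
  "suspended_hopf_action u = (\<lambda>(x, z1, z2). (x, u * z1, u * z2))"

definition S1_invariant :: "ambient set \<Rightarrow> bool" where
  "S1_invariant M \<longleftrightarrow> (\<forall>\<theta>. suspended_hopf_action (cis \<theta>) ` M = M)"

end

theory Submission
  imports Defs
begin

text \<open>All three hypersurfaces are invariant under the full torus of rotations of \<open>z1\<close> and \<open>z2\<close>, which contains the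
  suspended Hopf circle, so minimality becomes an ordinary differential equation for a curve in the orbit
  space. Writing a point of this space as \<open>x = sin \<theta>\<close>, \<open>|z1|\<^sup>2 = cos\<^sup>2 \<theta> (1 - sin \<psi>) / 2\<close>,
  \<open>|z2|\<^sup>2 = cos\<^sup>2 \<theta> (1 + sin \<psi>) / 2\<close> and the direction of the curve as an angle \<open>\<beta>\<close>, a suitable change of speed
  turns it into a globally Lipschitz system, whose energy \<open>cos \<psi> cos \<beta>\<close> is monotone while \<open>\<theta> \<ge> 0\<close>.
  The product hypersurface \<open>|z1|\<^sup>2 = 1/3\<close> is explicit. For the hypertorus one shoots from \<open>\<psi> = 0\<close>, \<open>\<beta> = \<pi>/2\<close> and varies the
  height \<open>\<theta>\<close>: some profile meets \<open>\<theta> = 0\<close> orthogonally, and two reflections close it to a curve that is star-shaped around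
  \<open>x = 0\<close>, \<open>|z1| = |z2|\<close>. For the hypersphere one shoots from the boundary \<open>z2 = 0\<close>, where the equation is
  singular and is solved by a contraction argument: some profile passes through \<open>\<theta> = \<psi> = 0\<close>, and a point reflection extends
  it to a graph over the \<open>x\<close>-axis that ends on \<open>z1 = 0\<close>.\<close>

section \<open>Smooth maps on open sets\<close>

text \<open>The two ends of the shooting range behave in opposite ways. On
  \<open>\<theta> = pi/2\<close> the equilibrium \<open>\<psi> = \<beta> = 0\<close> has the
  characteristic polynomial \<open>r^2 + 3/2 * r + 1\<close> with complex roots, so profiles from
  near the pole spiral and turn back; profiles from near the equator reach it before they can turn.
  At the critical height the target set is met only at the moment when the equator is met, and this
  coincidence is what the reflections require. The other obstacle is smoothness of the hypersphere
  along its end orbits. With \<open>s = 1 + sin \<psi>\<close> as independent variable the boundary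
  \<open>z2 = 0\<close> becomes the interior point \<open>s = 0\<close> of an interval, and the
  singular equation becomes a fixed point equation for averages over the segment from
  \<open>0\<close> to \<open>s\<close>, whose solution is smooth on both sides. Hence the squared
  moduli of \<open>z1\<close> and \<open>z2\<close> are smooth functions of \<open>x\<close> on an
  interval that extends beyond the end orbit, and dividing out their simple zeros identifies the
  hypersurface with the 3-sphere.\<close>

lemma Ck_on_subset: "Ck_on k U f \<Longrightarrow> V \<subseteq> U \<Longrightarrow> Ck_on k V f"
  by (induction k arbitrary: f) (auto intro: continuous_on_subset)

lemma Ck_on_imp_continuous_on: "Ck_on k U f \<Longrightarrow> continuous_on U f"
proof (cases k)
  case (Suc j)
  moreover assume "Ck_on k U f"
  ultimately show ?thesis
    by (auto intro!: continuous_at_imp_continuous_on dest: differentiable_imp_continuous_within)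
qed auto

lemma Ck_on_SucD: "Ck_on (Suc k) U f \<Longrightarrow> Ck_on k U f"
proof (induction k arbitrary: f)
  case 0
  then show ?case unfolding Ck_on.simps(1) by (rule Ck_on_imp_continuous_on)
next
  case (Suc k)
  then show ?case by auto
qed

text \<open>Openness of \<open>U\<close> makes derivatives at points of \<open>U\<close> depend on
  the values on \<open>U\<close> only, so the identity passes to all iterated directional
  derivatives.\<close>

lemma Ck_on_cong:
  assumes "open U" "\<And>x. x \<in> U \<Longrightarrow> f x = g x"
  shows "Ck_on k U f \<longleftrightarrow> Ck_on k U g"
  using assms(2)
proof (induction k arbitrary: f g)
  case 0
  then show ?case by (auto cong: continuous_on_cong)
next
  case (Suc k)
  have D: "(f has_derivative D) (at x) \<longleftrightarrow> (g has_derivative D) (at x)" if "x \<in> U" for x D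
    using Suc.prems that assms(1)
    by (metis has_derivative_transform_within_open)
  then have "f differentiable (at x) \<longleftrightarrow> g differentiable (at x)" if "x \<in> U" for x
    using that by (simp add: differentiable_def)
  moreover have fd: "frechet_derivative f (at x) = frechet_derivative g (at x)" if "x \<in> U" for x
    using D[OF that] by (simp add: frechet_derivative_def)
  moreover have "Ck_on k U (\<lambda>x. frechet_derivative f (at x) v) \<longleftrightarrow>
      Ck_on k U (\<lambda>x. frechet_derivative g (at x) v)" for v
    by (rule Suc.IH) (simp add: fd)
  ultimately show ?case by simp
qed

text \<open>Lets an explicit derivative replace \<open>frechet_derivative\<close>; the closure
  properties then reduce to differentiation rules and induction on the order.\<close>

lemma Ck_on_SucI:
  assumes "open U" "\<And>x. x \<in> U \<Longrightarrow> (f has_derivative f' x) (at x)" "\<And>v. Ck_on k U (\<lambda>x. f' x v)"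
  shows "Ck_on (Suc k) U f"
proof -
  have "frechet_derivative f (at x) = f' x" if "x \<in> U" for x
    using frechet_derivative_at[OF assms(2)[OF that]] by simp
  then have "Ck_on k U (\<lambda>x. frechet_derivative f (at x) v)" for v
    using assms(3) Ck_on_cong[OF assms(1), of "\<lambda>x. frechet_derivative f (at x) v" "\<lambda>x. f' x v"] by simp
  then show ?thesis using assms(2) by (auto simp: differentiable_def)
qed

lemma Ck_on_SucE:
  assumes "Ck_on (Suc k) U f"
  shows "x \<in> U \<Longrightarrow> (f has_derivative frechet_derivative f (at x)) (at x)"
    and "Ck_on k U (\<lambda>x. frechet_derivative f (at x) v)"
  using assms by (auto simp: frechet_derivative_works)

lemma Ck_on_const: "Ck_on k U (\<lambda>x. c)"
  by (induction k arbitrary: c) (auto simp: frechet_derivative_const)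

lemma Ck_on_bounded_linear_comp:
  assumes "bounded_linear L" "open U" "Ck_on k U f"
  shows "Ck_on k U (\<lambda>x. L (f x))"
  using assms(3)
proof (induction k arbitrary: f)
  case 0
  then show ?case using assms(1) by (auto intro: bounded_linear.continuous_on)
next
  case (Suc k)
  show ?case
    by (rule Ck_on_SucI[OF assms(2), where f' = "\<lambda>x v. L (frechet_derivative f (at x) v)"])
      (auto intro!: bounded_linear.has_derivative[OF assms(1)] Ck_on_SucE(1)[OF Suc.prems]
        Suc.IH Ck_on_SucE(2)[OF Suc.prems])
qed

lemma Ck_on_id: "open U \<Longrightarrow> Ck_on k U (\<lambda>x. x)"
  by (cases k) (auto intro!: Ck_on_SucI[where f' = "\<lambda>x v. v"] Ck_on_const simp del: Ck_on.simps(2))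

lemma Ck_on_bounded_linear: "bounded_linear L \<Longrightarrow> open U \<Longrightarrow> Ck_on k U L"
  using Ck_on_bounded_linear_comp[of L U k "\<lambda>x. x"] Ck_on_id by auto

lemma Ck_on_add:
  assumes "open U" "Ck_on k U f" "Ck_on k U g"
  shows "Ck_on k U (\<lambda>x. f x + g x)"
  using assms(2,3)
proof (induction k arbitrary: f g)
  case 0
  then show ?case by (auto intro: continuous_intros)
next
  case (Suc k)
  show ?case
    by (rule Ck_on_SucI[OF assms(1),
          where f' = "\<lambda>x v. frechet_derivative f (at x) v + frechet_derivative g (at x) v"])
      (auto intro!: has_derivative_add Suc.IH Ck_on_SucE[OF Suc.prems(1)] Ck_on_SucE[OF Suc.prems(2)])
qed

lemma Ck_on_bounded_bilinear:
  fixes f :: "'a::euclidean_space \<Rightarrow> 'b::euclidean_space" and g :: "'a \<Rightarrow> 'c::euclidean_space"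
    and P :: "'b \<Rightarrow> 'c \<Rightarrow> 'd::euclidean_space"
  assumes "bounded_bilinear P" "open U" "Ck_on k U f" "Ck_on k U g"
  shows "Ck_on k U (\<lambda>x. P (f x) (g x))"
  using assms(3,4)
proof (induction k arbitrary: f g)
  case 0
  then show ?case using bounded_bilinear.continuous_on[OF assms(1)] by auto
next
  case (Suc k)
  show ?case
    by (rule Ck_on_SucI[OF assms(2),
          where f' = "\<lambda>x v. P (f x) (frechet_derivative g (at x) v) + P (frechet_derivative f (at x) v) (g x)"])
      (auto intro!: bounded_bilinear.FDERIV[OF assms(1)] Suc.IH Ck_on_SucE[OF Suc.prems(1)]
        Ck_on_SucE[OF Suc.prems(2)] Ck_on_add assms(2) Ck_on_SucD[OF Suc.prems(1)] Ck_on_SucD[OF Suc.prems(2)]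
        simp del: Ck_on.simps)
qed

lemma Ck_on_sum:
  assumes "open U" "\<And>i. i \<in> I \<Longrightarrow> Ck_on k U (f i)"
  shows "Ck_on k U (\<lambda>x. \<Sum>i\<in>I. f i x)"
  using assms(2)
  by (induction I rule: infinite_finite_induct) (auto intro!: Ck_on_const Ck_on_add assms(1))

text \<open>In the chain rule the direction \<open>f' x v\<close> moves with \<open>x\<close>,
  whereas \<open>Ck_on\<close> speaks of fixed directions. Expanding it in \<open>Basis\<close>
  turns the derivative into a sum of products of \<open>f' x v \<bullet> b\<close> and
  \<open>g' (f x) b\<close>, and the induction hypothesis covers the second factor.\<close>

lemma Ck_on_compose:
  fixes f :: "'a::euclidean_space \<Rightarrow> 'b::euclidean_space" and g :: "'b \<Rightarrow> 'c::euclidean_space"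
  assumes "open U" "open V" "\<And>x. x \<in> U \<Longrightarrow> f x \<in> V" "Ck_on k U f" "Ck_on k V g"
  shows "Ck_on k U (\<lambda>x. g (f x))"
  using assms(4,5)
proof (induction k arbitrary: g)
  case 0
  then show ?case using assms(3) continuous_on_compose2[of V g U f] by auto
next
  case (Suc k)
  define f' where "f' x = frechet_derivative f (at x)" for x
  define g' where "g' x = frechet_derivative g (at x)" for x
  have f': "(f has_derivative f' x) (at x)" if "x \<in> U" for x
    using Ck_on_SucE(1)[OF Suc.prems(1) that] by (simp add: f'_def)
  have g': "(g has_derivative g' x) (at x)" if "x \<in> V" for x
    using Ck_on_SucE(1)[OF Suc.prems(2) that] by (simp add: g'_def)
  have eq: "g' (f x) (f' x v) = (\<Sum>b\<in>Basis. (f' x v \<bullet> b) *\<^sub>R g' (f x) b)" if "x \<in> U" for x v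
  proof -
    interpret linear "g' (f x)" using g'[OF assms(3)[OF that]] has_derivative_linear by blast
    have "g' (f x) (f' x v) = g' (f x) (\<Sum>b\<in>Basis. (f' x v \<bullet> b) *\<^sub>R b)"
      by (simp add: euclidean_representation)
    then show ?thesis by (simp add: sum scale)
  qed
  show ?case
  proof (rule Ck_on_SucI[OF assms(1), where f' = "\<lambda>x v. g' (f x) (f' x v)"])
    show "((\<lambda>x. g (f x)) has_derivative (\<lambda>v. g' (f x) (f' x v))) (at x)" if "x \<in> U" for x
      using has_derivative_compose[OF f'[OF that] g'[OF assms(3)[OF that]]] .
    have "Ck_on k U (\<lambda>x. \<Sum>b\<in>Basis. (f' x v \<bullet> b) *\<^sub>R g' (f x) b)" for v
    proof (intro Ck_on_sum assms(1) Ck_on_bounded_bilinear[OF bounded_bilinear_scaleR])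
      fix b :: 'b
      show "Ck_on k U (\<lambda>x. f' x v \<bullet> b)"
        using Ck_on_SucE(2)[OF Suc.prems(1), of v]
        by (intro Ck_on_bounded_linear_comp[OF bounded_linear_inner_left assms(1)]) (simp add: f'_def)
      show "Ck_on k U (\<lambda>x. g' (f x) b)"
        using Suc.IH[of "\<lambda>y. g' y b"] Ck_on_SucD[OF Suc.prems(1)] Ck_on_SucE(2)[OF Suc.prems(2)]
        by (simp add: g'_def)
    qed
    then show "Ck_on k U (\<lambda>x. g' (f x) (f' x v))" for v
      by (subst Ck_on_cong[OF assms(1) eq]) auto
  qed
qed

lemma Ck_on_Un:
  assumes "open U" "open V" "Ck_on k U f" "Ck_on k V f"
  shows "Ck_on k (U \<union> V) f"
  using assms(3,4)
  by (induction k arbitrary: f) (auto intro: continuous_on_open_Un assms(1,2))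

lemma Ck_on_real_SucI:
  fixes f :: "real \<Rightarrow> 'b::euclidean_space"
  assumes "open U" "\<And>x. x \<in> U \<Longrightarrow> (f has_vector_derivative f' x) (at x)" "Ck_on k U f'"
  shows "Ck_on (Suc k) U f"
  by (rule Ck_on_SucI[OF assms(1), where f' = "\<lambda>x v. v *\<^sub>R f' x"])
    (use assms(2) in \<open>auto simp: has_vector_derivative_def
      intro!: Ck_on_bounded_linear_comp[OF bounded_linear_scaleR_right] assms\<close>)

section \<open>Closure properties of smooth maps on open sets\<close>

named_theorems smooth_intros

lemma smooth_on_subset: "smooth_on U f \<Longrightarrow> V \<subseteq> U \<Longrightarrow> smooth_on V f"
  by (auto simp: smooth_on_def intro: Ck_on_subset)

lemma smooth_on_cong: "open U \<Longrightarrow> (\<And>x. x \<in> U \<Longrightarrow> f x = g x) \<Longrightarrow> smooth_on U f \<longleftrightarrow> smooth_on U g"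
  unfolding smooth_on_def using Ck_on_cong by blast

lemma smooth_on_imp_continuous_on: "smooth_on U f \<Longrightarrow> continuous_on U f"
  by (auto simp: smooth_on_def intro: Ck_on_imp_continuous_on)

lemma smooth_on_has_derivative:
  assumes "smooth_on U f" "x \<in> U"
  shows "(f has_derivative frechet_derivative f (at x)) (at x)"
  using assms(1) Ck_on_SucE(1)[OF _ assms(2), of 0 f] unfolding smooth_on_def by blast

lemma smooth_on_const [smooth_intros]: "smooth_on U (\<lambda>x. c)"
  by (simp add: smooth_on_def Ck_on_const)

lemma smooth_on_bounded_linear: "bounded_linear L \<Longrightarrow> open U \<Longrightarrow> smooth_on U L"
  by (simp add: smooth_on_def Ck_on_bounded_linear)

lemma smooth_on_id [smooth_intros]: "open U \<Longrightarrow> smooth_on U (\<lambda>x. x)"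
  by (simp add: smooth_on_def Ck_on_id)

lemma smooth_on_compose:
  "smooth_on V g \<Longrightarrow> smooth_on U f \<Longrightarrow> open U \<Longrightarrow> open V \<Longrightarrow> (\<And>x. x \<in> U \<Longrightarrow> f x \<in> V) \<Longrightarrow> smooth_on U (\<lambda>x. g (f x))"
  by (auto simp: smooth_on_def intro: Ck_on_compose)

lemma smooth_on_bounded_linear_comp:
  "bounded_linear L \<Longrightarrow> open U \<Longrightarrow> smooth_on U f \<Longrightarrow> smooth_on U (\<lambda>x. L (f x))"
  by (auto simp: smooth_on_def intro: Ck_on_bounded_linear_comp)

lemma smooth_on_bounded_bilinear:
  "bounded_bilinear P \<Longrightarrow> open U \<Longrightarrow> smooth_on U f \<Longrightarrow> smooth_on U g \<Longrightarrow> smooth_on U (\<lambda>x. P (f x) (g x))"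
  by (auto simp: smooth_on_def intro: Ck_on_bounded_bilinear)

lemma smooth_on_add [smooth_intros]:
  "open U \<Longrightarrow> smooth_on U f \<Longrightarrow> smooth_on U g \<Longrightarrow> smooth_on U (\<lambda>x. f x + g x)"
  by (auto simp: smooth_on_def intro: Ck_on_add)

lemma smooth_on_minus [smooth_intros]: "open U \<Longrightarrow> smooth_on U f \<Longrightarrow> smooth_on U (\<lambda>x. - f x)"
  by (intro smooth_on_bounded_linear_comp[OF bounded_linear_minus[OF bounded_linear_ident]])

lemma smooth_on_diff [smooth_intros]:
  "open U \<Longrightarrow> smooth_on U f \<Longrightarrow> smooth_on U g \<Longrightarrow> smooth_on U (\<lambda>x. f x - g x)"
  using smooth_on_add[of U f "\<lambda>x. - g x"] smooth_on_minus by auto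

lemma smooth_on_scaleR [smooth_intros]:
  "open U \<Longrightarrow> smooth_on U f \<Longrightarrow> smooth_on U g \<Longrightarrow> smooth_on U (\<lambda>x. f x *\<^sub>R g x)"
  by (rule smooth_on_bounded_bilinear[OF bounded_bilinear_scaleR])

lemma smooth_on_mult [smooth_intros]:
  fixes f g :: "'a::euclidean_space \<Rightarrow> 'b::{euclidean_space, real_normed_algebra}"
  shows "open U \<Longrightarrow> smooth_on U f \<Longrightarrow> smooth_on U g \<Longrightarrow> smooth_on U (\<lambda>x. f x * g x)"
  by (rule smooth_on_bounded_bilinear[OF bounded_bilinear_mult])

lemma smooth_on_inner [smooth_intros]:
  "open U \<Longrightarrow> smooth_on U f \<Longrightarrow> smooth_on U g \<Longrightarrow> smooth_on U (\<lambda>x. f x \<bullet> g x)"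
  by (rule smooth_on_bounded_bilinear[OF bounded_bilinear_inner])

lemma smooth_on_power [smooth_intros]:
  fixes f :: "'a::euclidean_space \<Rightarrow> real"
  shows "open U \<Longrightarrow> smooth_on U f \<Longrightarrow> smooth_on U (\<lambda>x. f x ^ n)"
  by (induction n) (auto intro: smooth_intros)

lemma smooth_on_fst [smooth_intros]: "open U \<Longrightarrow> smooth_on U f \<Longrightarrow> smooth_on U (\<lambda>x. fst (f x))"
  by (rule smooth_on_bounded_linear_comp[OF bounded_linear_fst])

lemma smooth_on_snd [smooth_intros]: "open U \<Longrightarrow> smooth_on U f \<Longrightarrow> smooth_on U (\<lambda>x. snd (f x))"
  by (rule smooth_on_bounded_linear_comp[OF bounded_linear_snd])

lemma smooth_on_Re [smooth_intros]: "open U \<Longrightarrow> smooth_on U f \<Longrightarrow> smooth_on U (\<lambda>x. Re (f x))"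
  by (rule smooth_on_bounded_linear_comp[OF bounded_linear_Re])

lemma smooth_on_Im [smooth_intros]: "open U \<Longrightarrow> smooth_on U f \<Longrightarrow> smooth_on U (\<lambda>x. Im (f x))"
  by (rule smooth_on_bounded_linear_comp[OF bounded_linear_Im])

lemma smooth_on_of_real [smooth_intros]:
  "open U \<Longrightarrow> smooth_on U f \<Longrightarrow> smooth_on U (\<lambda>x. complex_of_real (f x))"
  by (rule smooth_on_bounded_linear_comp[OF bounded_linear_of_real])

lemma smooth_on_Pair [smooth_intros]:
  assumes "open U" "smooth_on U f" "smooth_on U g"
  shows "smooth_on U (\<lambda>x. (f x, g x))"
proof -
  have "smooth_on U (\<lambda>x. (f x, 0) + (0, g x))"
    by (intro smooth_on_add assms smooth_on_bounded_linear_comp[of "\<lambda>y. (y, 0)"]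
        smooth_on_bounded_linear_comp[of "\<lambda>y. (0, y)"] bounded_linear_Pair bounded_linear_ident bounded_linear_zero)
  then show ?thesis by simp
qed

lemma smooth_on_Un: "open U \<Longrightarrow> open V \<Longrightarrow> smooth_on U f \<Longrightarrow> smooth_on V f \<Longrightarrow> smooth_on (U \<union> V) f"
  by (auto simp: smooth_on_def intro: Ck_on_Un)

text \<open>The two functions are differentiable to the same order only together, since each is, up
  to sign, the derivative of the other.\<close>

lemma smooth_on_sin_cos: "smooth_on U (sin :: real \<Rightarrow> real) \<and> smooth_on U (cos :: real \<Rightarrow> real)"
proof -
  have "Ck_on k UNIV (sin :: real \<Rightarrow> real) \<and> Ck_on k UNIV (cos :: real \<Rightarrow> real)" for k
  proof (induction k)
    case 0
    then show ?case by (auto intro: continuous_intros)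
  next
    case (Suc k)
    have "Ck_on k UNIV (\<lambda>x::real. - sin x)"
      using Suc Ck_on_bounded_linear_comp[OF bounded_linear_minus[OF bounded_linear_ident]] by auto
    then have "Ck_on (Suc k) UNIV (sin :: real \<Rightarrow> real)" "Ck_on (Suc k) UNIV (cos :: real \<Rightarrow> real)"
      using Suc by (auto intro!: Ck_on_real_SucI derivative_eq_intros
          simp flip: has_real_derivative_iff_has_vector_derivative simp del: Ck_on.simps)
    then show ?case by blast
  qed
  then show ?thesis by (auto simp: smooth_on_def intro: Ck_on_subset)
qed

lemma smooth_on_sin [smooth_intros]: "open U \<Longrightarrow> smooth_on U f \<Longrightarrow> smooth_on U (\<lambda>x. sin (f x :: real))"
  and smooth_on_cos [smooth_intros]: "open U \<Longrightarrow> smooth_on U f \<Longrightarrow> smooth_on U (\<lambda>x. cos (f x :: real))"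
  using smooth_on_compose[of UNIV _ U f] smooth_on_sin_cos by auto

text \<open>The derivative is minus the square of the function itself, so each order follows from
  the previous one by the product rule.\<close>

lemma Ck_on_inverse: "Ck_on k (- {0}) (inverse :: real \<Rightarrow> real)"
proof (induction k)
  case 0
  then show ?case by (auto intro!: continuous_intros)
next
  case (Suc k)
  have op: "open (- {0::real})" by auto
  have "Ck_on k (- {0}) (\<lambda>x::real. - (inverse x * inverse x))"
    using Suc by (intro Ck_on_bounded_linear_comp[OF bounded_linear_minus[OF bounded_linear_ident]]
        Ck_on_bounded_bilinear[OF bounded_bilinear_mult] op)
  then show ?case
    by (intro Ck_on_real_SucI op)
      (auto intro!: derivative_eq_intros simp: simp flip: has_real_derivative_iff_has_vector_derivative)
qed

lemma smooth_on_divide [smooth_intros]: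
  fixes f g :: "'a::euclidean_space \<Rightarrow> real"
  assumes "open U" "smooth_on U f" "smooth_on U g" "\<And>x. x \<in> U \<Longrightarrow> g x \<noteq> 0"
  shows "smooth_on U (\<lambda>x. f x / g x)"
proof -
  have "smooth_on (- {0}) (inverse :: real \<Rightarrow> real)" by (simp add: smooth_on_def Ck_on_inverse)
  then have "smooth_on U (\<lambda>x. inverse (g x))"
    by (rule smooth_on_compose) (use assms in auto)
  from smooth_on_mult[OF assms(1,2) this] show ?thesis by (simp add: field_simps)
qed

lemma Ck_on_sqrt: "Ck_on k {0<..} sqrt"
proof (induction k)
  case 0
  then show ?case by (auto intro!: continuous_intros)
next
  case (Suc k)
  have "Ck_on k {0<..} (\<lambda>x. inverse (2 * sqrt x))"
    by (rule Ck_on_compose[OF _ _ _ _ Ck_on_inverse])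
      (auto intro!: Ck_on_bounded_linear_comp[OF bounded_linear_mult_right] Suc)
  then show ?case
    by (intro Ck_on_real_SucI)
      (auto intro!: derivative_eq_intros simp: field_simps simp flip: has_real_derivative_iff_has_vector_derivative)
qed

lemma smooth_on_sqrt [smooth_intros]:
  assumes "open U" "smooth_on U f" "\<And>x. x \<in> U \<Longrightarrow> f x > 0"
  shows "smooth_on U (\<lambda>x. sqrt (f x))"
  by (rule smooth_on_compose[of "{0<..}"]) (use assms in \<open>auto simp: smooth_on_def Ck_on_sqrt\<close>)

lemma smooth_on_cmod_square [smooth_intros]:
  assumes "open U" "smooth_on U f"
  shows "smooth_on U (\<lambda>x. (cmod (f x))\<^sup>2)"
  unfolding cmod_power2 by (intro smooth_intros assms)

lemma smooth_on_real_derivative: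
  fixes f f' :: "real \<Rightarrow> real"
  assumes "open U" "smooth_on U f" "\<And>x. x \<in> U \<Longrightarrow> (f has_real_derivative f' x) (at x)"
  shows "smooth_on U f'"
proof -
  have "frechet_derivative f (at x) 1 = f' x" if "x \<in> U" for x
    using frechet_derivative_at[OF assms(3)[OF that, unfolded has_field_derivative_def]] by (metis mult.right_neutral)
  moreover have "Ck_on k U (\<lambda>x. frechet_derivative f (at x) 1)" for k
    using assms(2) unfolding smooth_on_def by (metis Ck_on.simps(2))
  ultimately show ?thesis
    unfolding smooth_on_def using Ck_on_cong[OF assms(1)] by (metis (no_types, lifting))
qed

section \<open>Diffeomorphisms and embedded hypersurfaces\<close>

lemma smooth_on_imp_smooth_map:
  assumes "open U" "A \<subseteq> U" "smooth_on U f"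
  shows "smooth_map A f"
  unfolding smooth_map_def
proof
  fix x assume "x \<in> A"
  with assms show "\<exists>U g. open U \<and> x \<in> U \<and> smooth_on U g \<and> (\<forall>y\<in>A \<inter> U. g y = f y)"
    by (intro exI[of _ U] exI[of _ f]) auto
qed

lemma smooth_map_subset:
  assumes "smooth_map A f" "B \<subseteq> A"
  shows "smooth_map B f"
  unfolding smooth_map_def
proof
  fix x assume "x \<in> B"
  then obtain U g where "open U" "x \<in> U" "smooth_on U g" "\<forall>y\<in>A \<inter> U. g y = f y"
    using assms unfolding smooth_map_def by blast
  with assms(2) show "\<exists>U g. open U \<and> x \<in> U \<and> smooth_on U g \<and> (\<forall>y\<in>B \<inter> U. g y = f y)"
    by (intro exI[of _ U] exI[of _ g]) auto
qed

lemma smooth_map_imp_continuous_on: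
  assumes "smooth_map A f"
  shows "continuous_on A f"
proof (clarsimp simp: continuous_on_eq_continuous_within)
  fix x assume "x \<in> A"
  then obtain U g where U: "open U" "x \<in> U" "smooth_on U g" "\<forall>y\<in>A \<inter> U. g y = f y"
    using assms unfolding smooth_map_def by blast
  then have "continuous (at x within A) g"
    using smooth_on_imp_continuous_on continuous_at_imp_continuous_at_within
      continuous_on_eq_continuous_at by blast
  then show "continuous (at x within A) f"
    using U \<open>x \<in> A\<close> openin_open_Int[OF U(1), of A]
    by (intro continuous_transform_within_openin[of x A g "A \<inter> U" f]) auto
qed

lemma smooth_map_compose:
  assumes f: "smooth_map A f" and g: "smooth_map B g" and "f ` A \<subseteq> B"
  shows "smooth_map A (\<lambda>x. g (f x))"
  unfolding smooth_map_def
proof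
  fix x assume x: "x \<in> A"
  obtain U f1 where U: "open U" "x \<in> U" "smooth_on U f1" "\<forall>y\<in>A \<inter> U. f1 y = f y"
    using f x unfolding smooth_map_def by blast
  have "f x \<in> B" using x assms(3) by blast
  then obtain V g1 where V: "open V" "f x \<in> V" "smooth_on V g1" "\<forall>y\<in>B \<inter> V. g1 y = g y"
    using g unfolding smooth_map_def by blast
  have op: "open (f1 -` V \<inter> U)"
    using continuous_open_preimage[OF smooth_on_imp_continuous_on[OF U(3)] U(1) V(1)] by (simp add: Int_commute)
  have "smooth_on (f1 -` V \<inter> U) (\<lambda>x. g1 (f1 x))"
    by (rule smooth_on_compose[OF V(3) smooth_on_subset[OF U(3)] op V(1)]) auto
  moreover have "x \<in> f1 -` V \<inter> U" using U V x by auto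
  moreover have "\<forall>y\<in>A \<inter> (f1 -` V \<inter> U). g1 (f1 y) = g (f y)"
    using U(4) V(4) assms(3) by fastforce
  ultimately show "\<exists>U h. open U \<and> x \<in> U \<and> smooth_on U h \<and> (\<forall>y\<in>A \<inter> U. h y = g (f y))"
    using op by blast
qed

lemma smooth_map_compose_smooth_on:
  assumes "smooth_on V g" "open V" "smooth_map A f" "f ` A \<subseteq> V"
  shows "smooth_map A (\<lambda>x. g (f x))"
  using smooth_map_compose[OF assms(3) smooth_on_imp_smooth_map[OF assms(2) order.refl assms(1)] assms(4)] .

lemma smooth_map_Pair:
  assumes "smooth_map A f" "smooth_map A g"
  shows "smooth_map A (\<lambda>x. (f x, g x))"
  unfolding smooth_map_def
proof
  fix x assume x: "x \<in> A"
  obtain U f1 where U: "open U" "x \<in> U" "smooth_on U f1" "\<forall>y\<in>A \<inter> U. f1 y = f y"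
    using assms(1) x unfolding smooth_map_def by blast
  obtain V g1 where V: "open V" "x \<in> V" "smooth_on V g1" "\<forall>y\<in>A \<inter> V. g1 y = g y"
    using assms(2) x unfolding smooth_map_def by blast
  have "smooth_on (U \<inter> V) (\<lambda>x. (f1 x, g1 x))"
    using U V by (intro smooth_intros) (auto intro: smooth_on_subset)
  then show "\<exists>W h. open W \<and> x \<in> W \<and> smooth_on W h \<and> (\<forall>y\<in>A \<inter> W. h y = (f y, g y))"
    using U V by (intro exI[of _ "U \<inter> V"] exI[of _ "\<lambda>x. (f1 x, g1 x)"]) auto
qed

lemma diffeomorphismI:
  assumes "smooth_map A f" "smooth_map B g"
    "\<And>x. x \<in> A \<Longrightarrow> f x \<in> B \<and> g (f x) = x" "\<And>y. y \<in> B \<Longrightarrow> g y \<in> A \<and> f (g y) = y"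
  shows "diffeomorphism A B f g"
proof -
  have "f ` A = B" "g ` B = A" using assms(3,4) by (metis image_eqI subsetI subset_antisym image_subsetI)+
  with assms show ?thesis unfolding diffeomorphism_def by auto
qed

lemma diffeomorphismD:
  assumes "diffeomorphism A B f g"
  shows "smooth_map A f" "smooth_map B g" "\<And>x. x \<in> A \<Longrightarrow> f x \<in> B" "\<And>y. y \<in> B \<Longrightarrow> g y \<in> A"
    "\<And>x. x \<in> A \<Longrightarrow> g (f x) = x" "\<And>y. y \<in> B \<Longrightarrow> f (g y) = y"
  using assms unfolding diffeomorphism_def by blast+

lemma diffeomorphism_sym: "diffeomorphism A B f g \<Longrightarrow> diffeomorphism B A g f"
  unfolding diffeomorphism_def by (elim conjE) (intro conjI)

lemma diffeomorphism_trans: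
  assumes "diffeomorphism A B f g" "diffeomorphism B C f' g'"
  shows "diffeomorphism A C (\<lambda>x. f' (f x)) (\<lambda>y. g (g' y))"
proof -
  note d = diffeomorphismD[OF assms(1)] and d' = diffeomorphismD[OF assms(2)]
  show ?thesis
  proof (rule diffeomorphismI)
    show "smooth_map A (\<lambda>x. f' (f x))" by (rule smooth_map_compose[OF d(1) d'(1)]) (use d(3) in blast)
    show "smooth_map C (\<lambda>y. g (g' y))" by (rule smooth_map_compose[OF d'(2) d(2)]) (use d'(4) in blast)
    show "f' (f x) \<in> C \<and> g (g' (f' (f x))) = x" if "x \<in> A" for x
      using d'(3)[OF d(3)[OF that]] d'(5)[OF d(3)[OF that]] d(5)[OF that] by simp
    show "g (g' y) \<in> A \<and> f' (f (g (g' y))) = y" if "y \<in> C" for y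
      using d(4)[OF d'(4)[OF that]] d(6)[OF d'(4)[OF that]] d'(6)[OF that] by simp
  qed
qed

lemma diffeomorphic_trans: "A diffeomorphic B \<Longrightarrow> B diffeomorphic C \<Longrightarrow> A diffeomorphic C"
  unfolding diffeomorphic_def by (elim exE) (intro exI, rule diffeomorphism_trans)

lemma diffeomorphism_restrict:
  assumes "diffeomorphism A B f g" and W: "openin (top_of_set A) W"
  shows "openin (top_of_set B) (f ` W)" "diffeomorphism W (f ` W) f g"
proof -
  note d = diffeomorphismD[OF assms(1)]
  have WA: "W \<subseteq> A" using W openin_imp_subset by blast
  have "f ` W = B \<inter> g -` W"
  proof
    show "f ` W \<subseteq> B \<inter> g -` W" using d(3,5) WA by force
    show "B \<inter> g -` W \<subseteq> f ` W" using d(6) by (metis IntE image_eqI subsetI vimageE)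
  qed
  then show "openin (top_of_set B) (f ` W)"
    using continuous_openin_preimage[OF smooth_map_imp_continuous_on[OF d(2)] _ W] d(4) by auto
  have "f ` W \<subseteq> B" using d(3) WA by blast
  then show "diffeomorphism W (f ` W) f g"
    using WA d(5) by (intro diffeomorphismI smooth_map_subset[OF d(1)] smooth_map_subset[OF d(2)]) auto
qed

section \<open>Spheres, charts and products\<close>

lemma diffeomorphic_sphere:
  assumes "DIM('a::euclidean_space) = DIM('b::euclidean_space)"
  shows "sphere (0::'a) 1 diffeomorphic sphere (0::'b) 1"
proof -
  obtain f :: "'a \<Rightarrow> 'b" and g where fg: "linear f" "linear g" "f ` UNIV = UNIV" "g ` UNIV = UNIV"
    "\<And>x. norm (f x) = norm x" "\<And>y. norm (g y) = norm y" "\<And>x. g (f x) = x" "\<And>y. f (g y) = y"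
    using isometries_subspaces[of "UNIV :: 'a set" "UNIV :: 'b set"] assms by auto
  have "diffeomorphism (sphere 0 1) (sphere 0 1) f g"
    using fg by (intro diffeomorphismI)
      (auto intro!: smooth_on_imp_smooth_map[of UNIV] smooth_on_bounded_linear simp: linear_conv_bounded_linear)
  then show ?thesis unfolding diffeomorphic_def by blast
qed

text \<open>The model space is a type parameter because products of circles and spheres come with
  product models such as \<open>real \<times> real \<times> real\<close>; only
  \<open>locally_euclidean_change_type\<close> passes to \<open>real^3\<close>.\<close>

definition locally_euclidean :: "'e::euclidean_space itself \<Rightarrow> 'a::euclidean_space set \<Rightarrow> bool" where
  "locally_euclidean _ N \<longleftrightarrow>
     (\<forall>p\<in>N. \<exists>W (V :: 'e set). openin (top_of_set N) W \<and> p \<in> W \<and> open V \<and> W diffeomorphic V)"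

lemma locally_euclidean_diffeomorphic:
  assumes "M diffeomorphic N" "locally_euclidean TYPE('e::euclidean_space) N"
  shows "locally_euclidean TYPE('e) M"
  unfolding locally_euclidean_def
proof
  fix p assume p: "p \<in> M"
  obtain f g where d: "diffeomorphism M N f g" using assms(1) unfolding diffeomorphic_def by blast
  note dd = diffeomorphismD[OF d]
  have "f p \<in> N" using dd(3)[OF p] .
  then obtain W and V :: "'e set" where W: "openin (top_of_set N) W" "f p \<in> W" "open V" "W diffeomorphic V"
    using assms(2) unfolding locally_euclidean_def by blast
  note r = diffeomorphism_restrict[OF diffeomorphism_sym[OF d] W(1)]
  have "g ` W diffeomorphic V"
    using diffeomorphism_sym[OF r(2)] W(4) diffeomorphic_trans unfolding diffeomorphic_def by blast
  moreover have "p \<in> g ` W" using W(2) dd(5)[OF p] by (metis image_eqI)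
  ultimately show "\<exists>W (V :: 'e set). openin (top_of_set M) W \<and> p \<in> W \<and> open V \<and> W diffeomorphic V"
    using r(1) W(3) by blast
qed

lemma locally_euclidean_change_type:
  assumes "locally_euclidean TYPE('e::euclidean_space) N" "DIM('e) = DIM('f::euclidean_space)"
  shows "locally_euclidean TYPE('f) N"
proof -
  obtain f :: "'e \<Rightarrow> 'f" and g where fg: "linear f" "linear g" "f ` UNIV = UNIV" "g ` UNIV = UNIV"
    "\<And>x. norm (f x) = norm x" "\<And>y. norm (g y) = norm y" "\<And>x. g (f x) = x" "\<And>y. f (g y) = y"
    using isometries_subspaces[of "UNIV :: 'e set" "UNIV :: 'f set"] assms(2) by auto
  have "V diffeomorphic (f ` V)" for V
    unfolding diffeomorphic_def
    by (intro exI[of _ f] exI[of _ g] diffeomorphismI)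
      (auto intro!: smooth_on_imp_smooth_map[of UNIV] smooth_on_bounded_linear
        simp: fg(1,2,7,8) simp flip: linear_conv_bounded_linear)
  moreover have "open (f ` V)" if "open V" for V
    using open_surjective_linear_image[OF that fg(1,3)] .
  ultimately show ?thesis
    using assms(1) unfolding locally_euclidean_def by (meson diffeomorphic_trans)
qed

lemma locally_euclidean_Times:
  fixes N1 :: "'a::euclidean_space set" and N2 :: "'b::euclidean_space set"
  assumes "locally_euclidean TYPE('e::euclidean_space) N1" "locally_euclidean TYPE('f::euclidean_space) N2"
  shows "locally_euclidean TYPE('e \<times> 'f) (N1 \<times> N2)"
  unfolding locally_euclidean_def
proof
  fix p assume p: "p \<in> N1 \<times> N2"
  obtain W1 and V1 :: "'e set" where W1: "openin (top_of_set N1) W1" "fst p \<in> W1" "open V1" "W1 diffeomorphic V1"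
    using assms(1) p unfolding locally_euclidean_def by (metis mem_Times_iff)
  obtain W2 and V2 :: "'f set" where W2: "openin (top_of_set N2) W2" "snd p \<in> W2" "open V2" "W2 diffeomorphic V2"
    using assms(2) p unfolding locally_euclidean_def by (metis mem_Times_iff)
  obtain f1 g1 where d1: "diffeomorphism W1 V1 f1 g1" using W1(4) unfolding diffeomorphic_def by blast
  obtain f2 g2 where d2: "diffeomorphism W2 V2 f2 g2" using W2(4) unfolding diffeomorphic_def by blast
  note d = diffeomorphismD[OF d1] diffeomorphismD[OF d2]
  have sm: "smooth_map (A1 \<times> A2) (\<lambda>z. (h1 (fst z), h2 (snd z)))"
    if "smooth_map A1 h1" "smooth_map A2 h2"
    for A1 :: "'x::euclidean_space set" and A2 :: "'y::euclidean_space set"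
      and h1 :: "'x \<Rightarrow> 'z::euclidean_space" and h2 :: "'y \<Rightarrow> 'w::euclidean_space"
    by (intro smooth_map_Pair smooth_map_compose[OF _ that(1)] smooth_map_compose[OF _ that(2)]
        smooth_on_imp_smooth_map[of UNIV] smooth_intros) auto
  have "diffeomorphism (W1 \<times> W2) (V1 \<times> V2) (\<lambda>z. (f1 (fst z), f2 (snd z))) (\<lambda>z. (g1 (fst z), g2 (snd z)))"
    using d by (intro diffeomorphismI sm) auto
  then have "(W1 \<times> W2) diffeomorphic (V1 \<times> V2)" unfolding diffeomorphic_def by blast
  moreover have "openin (top_of_set (N1 \<times> N2)) (W1 \<times> W2)" using W1(1) W2(1) by (rule openin_Times)
  moreover have "p \<in> W1 \<times> W2" using W1(2) W2(2) by (simp add: mem_Times_iff)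
  ultimately show "\<exists>W (V :: ('e \<times> 'f) set). openin (top_of_set (N1 \<times> N2)) W \<and> p \<in> W \<and> open V \<and> W diffeomorphic V"
    using open_Times[OF W1(3) W2(3)] by blast
qed

text \<open>Stereographic projection from the pole \<open>(0, \<sigma>)\<close> with \<open>\<sigma> = \<plusminus>1\<close>.\<close>

lemma stereographic:
  fixes \<sigma> :: real
  assumes \<sigma>: "\<sigma>\<^sup>2 = 1"
  shows "(sphere (0 :: 'e::euclidean_space \<times> real) 1 - {(0, \<sigma>)}) diffeomorphic (UNIV :: 'e set)"
proof -
  define f :: "'e \<times> real \<Rightarrow> 'e" where "f z = (1 / (1 - \<sigma> * snd z)) *\<^sub>R fst z" for z
  define g :: "'e \<Rightarrow> 'e \<times> real" where
    "g v = ((2 / (1 + v \<bullet> v)) *\<^sub>R v, \<sigma> * (v \<bullet> v - 1) / (1 + v \<bullet> v))" for v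
  have \<sigma>': "\<sigma> * \<sigma> = 1" using \<sigma> by (simp add: power2_eq_square)
  have sph: "z \<in> sphere 0 1 \<longleftrightarrow> fst z \<bullet> fst z + snd z * snd z = 1" for z :: "'e \<times> real"
    by (cases z) (simp add: norm_eq_1 inner_prod_def)
  have ne: "1 - \<sigma> * snd z \<noteq> 0" if "z \<in> sphere 0 1 - {(0, \<sigma>)}" for z :: "'e \<times> real"
  proof
    assume *: "1 - \<sigma> * snd z = 0"
    then have "snd z = \<sigma>" using \<sigma>' by (metis diff_eq_diff_eq eq_iff_diff_eq_0 mult.assoc mult.left_neutral mult.right_neutral)
    then have "fst z \<bullet> fst z = 0" using that \<sigma>' sph[of z] by (simp del: inner_eq_zero_iff mem_sphere mem_sphere_0)
    then have "fst z = 0" by simp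
    then show False using that \<open>snd z = \<sigma>\<close> by (metis DiffD2 prod.collapse singletonI)
  qed
  have op: "open {z :: 'e \<times> real. 1 - \<sigma> * snd z \<noteq> 0}"
    by (intro open_Collect_neq continuous_intros)
  have pos: "1 + v \<bullet> v > 0" for v :: 'e by (simp add: add_pos_nonneg)
  have "diffeomorphism (sphere 0 1 - {(0, \<sigma>)}) UNIV f g"
  proof (rule diffeomorphismI)
    show "smooth_map (sphere 0 1 - {(0, \<sigma>)}) f"
    proof (rule smooth_on_imp_smooth_map[OF op])
      show "sphere 0 1 - {(0, \<sigma>)} \<subseteq> {z :: 'e \<times> real. 1 - \<sigma> * snd z \<noteq> 0}" using ne by blast
      show "smooth_on {z. 1 - \<sigma> * snd z \<noteq> 0} f"
        unfolding f_def by (intro smooth_intros op) simp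
    qed
    have "1 + v \<bullet> v \<noteq> 0" for v :: 'e using pos[of v] by simp
    then have "smooth_on UNIV g"
      unfolding g_def by (intro smooth_intros open_UNIV)
    then show "smooth_map UNIV g"
      by (intro smooth_on_imp_smooth_map[OF open_UNIV]) auto
    show "f z \<in> UNIV \<and> g (f z) = z" if z: "z \<in> sphere 0 1 - {(0, \<sigma>)}" for z
    proof -
      obtain y t where zt: "z = (y, t)" by (cases z)
      \<comment> \<open>Everything becomes rational in \<open>d\<close>, because
        \<open>\<sigma> * \<sigma> = 1\<close> gives \<open>1 - t * t = d * (2 - d)\<close>.\<close>
      define d where "d = 1 - \<sigma> * t"
      have d: "d \<noteq> 0" using ne[OF z] by (simp add: zt d_def)
      have yy: "y \<bullet> y = d * (2 - d)"
      proof -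
        have "y \<bullet> y = 1 - t * t" using z sph[of z] by (simp add: zt del: mem_sphere_0 mem_sphere)
        also have "\<dots> = d * (2 - d)" using \<sigma>' unfolding d_def by algebra
        finally show ?thesis .
      qed
      have vv: "f z \<bullet> f z = (2 - d) / d"
        using d by (simp add: f_def zt yy divide_simps flip: d_def)
      have a: "1 + f z \<bullet> f z = 2 / d" using d by (simp add: vv field_simps)
      have b: "f z \<bullet> f z - 1 = 2 * (1 - d) / d" using d by (simp add: vv field_simps)
      have "\<sigma> * (1 - d) = t" using \<sigma>' unfolding d_def by algebra
      moreover have "\<sigma> * (2 * (1 - d) / d) / (2 / d) = \<sigma> * (1 - d)" using d by (simp add: divide_simps)
      ultimately have "\<sigma> * (2 * (1 - d) / d) / (2 / d) = t" by simp
      then show ?thesis unfolding g_def a b using d by (simp add: f_def zt flip: d_def)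
    qed
    show "g v \<in> sphere 0 1 - {(0, \<sigma>)} \<and> f (g v) = v" for v
    proof -
      define n where "n = v \<bullet> v"
      have n: "1 + n \<noteq> 0" "n \<ge> 0" using pos[of v] by (auto simp: n_def)
      have "fst (g v) \<bullet> fst (g v) + snd (g v) * snd (g v) = (2 / (1 + n)) * (2 / (1 + n)) * n + (\<sigma> * \<sigma>) * ((n - 1) / (1 + n)) * ((n - 1) / (1 + n))"
        by (simp add: g_def n_def)
      also have "\<dots> = (4 * n + (n - 1) * (n - 1)) / ((1 + n) * (1 + n))"
        by (simp add: \<sigma>' add_divide_distrib)
      also have "4 * n + (n - 1) * (n - 1) = (1 + n) * (1 + n)" by algebra
      also have "(1 + n) * (1 + n) / ((1 + n) * (1 + n)) = 1" using n by simp
      finally have 1: "g v \<in> sphere 0 1" by (subst sph)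
      have 2: "1 - \<sigma> * snd (g v) = 2 / (1 + n)"
      proof -
        have "\<sigma> * snd (g v) = \<sigma> * \<sigma> * ((n - 1) / (1 + n))" by (simp add: g_def n_def)
        then show ?thesis using n \<sigma>' by (simp add: field_simps)
      qed
      have "g v \<noteq> (0, \<sigma>)" using 2 n \<sigma>' by auto
      moreover have "f (g v) = v"
      proof -
        have "1 / (2 / (1 + n)) * (2 / (1 + n)) = 1" using n by simp
        then show ?thesis unfolding f_def 2 by (simp only: g_def fst_conv scaleR_scaleR scaleR_one flip: n_def)
      qed
      ultimately show ?thesis using 1 by blast
    qed
  qed
  then show ?thesis unfolding diffeomorphic_def by blast
qed

lemma locally_euclidean_sphere:
  assumes "DIM('a::euclidean_space) = Suc (DIM('e::euclidean_space))"
  shows "locally_euclidean TYPE('e) (sphere (0::'a) 1)"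
proof -
  have "locally_euclidean TYPE('e) (sphere (0 :: 'e \<times> real) 1)"
    unfolding locally_euclidean_def
  proof
    fix p :: "'e \<times> real" assume p: "p \<in> sphere 0 1"
    \<comment> \<open>The centre of projection must differ from \<open>p\<close>; at least one of
      the two poles does.\<close>
    obtain \<sigma> :: real where \<sigma>: "\<sigma>\<^sup>2 = 1" "p \<noteq> (0, \<sigma>)"
    proof (cases "p = (0, 1)")
      case True
      then show thesis using that[of "-1"] by simp
    next
      case False
      then show thesis using that[of 1] by simp
    qed
    have "openin (top_of_set (sphere 0 1)) (sphere 0 1 - {(0 :: 'e, \<sigma>)})"
      by (rule openin_delete) simp
    then show "\<exists>W (V :: 'e set). openin (top_of_set (sphere 0 1)) W \<and> p \<in> W \<and> open V \<and> W diffeomorphic V"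
      using stereographic[OF \<sigma>(1)] p \<sigma>(2) open_UNIV by blast
  qed
  then show ?thesis
    by (rule locally_euclidean_diffeomorphic[OF diffeomorphic_sphere, rotated]) (simp add: assms)
qed

lemma embedded_hypersurfaceI:
  assumes "M \<subseteq> S4" "M diffeomorphic N" "locally_euclidean TYPE(real^3) N"
  shows "embedded_hypersurface M"
proof -
  have "locally_euclidean TYPE(real^3) M"
    by (rule locally_euclidean_diffeomorphic[OF assms(2,3)])
  then show ?thesis
    unfolding embedded_hypersurface_def locally_euclidean_def by (rule conjI[OF assms(1)])
qed

section \<open>Tangent spaces and traces\<close>

lemma embedded_hypersurfaceD:
  assumes "embedded_hypersurface M" "p \<in> M"
  shows "\<exists>W (V :: (real^3) set). openin (top_of_set M) W \<and> p \<in> W \<and> open V \<and> W diffeomorphic V"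
  using assms unfolding embedded_hypersurface_def by (elim conjE) (rule bspec)

text \<open>Velocities of curves are not visibly closed under addition. The differential
  \<open>A\<close> of a local parametrisation \<open>g1\<close> sends lines to curves in
  \<open>M\<close>, so its range consists of velocities; a smooth extension \<open>f1\<close> of the
  chart is a left inverse of \<open>g1\<close> near \<open>f p\<close>, which makes \<open>A\<close>
  injective.\<close>

lemma subspace_in_tangent_space:
  assumes "embedded_hypersurface M" "p \<in> M"
  obtains S where "subspace S" "dim S = 3" "S \<subseteq> tangent_space M p"
proof -
  from embedded_hypersurfaceD[OF assms] obtain W and V :: "(real^3) set"
    where W: "openin (top_of_set M) W" "p \<in> W" "open V" "W diffeomorphic V"
    by metis
  obtain f g where "diffeomorphism W V f g" using W(4) unfolding diffeomorphic_def by metis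
  note d = diffeomorphismD[OF this]
  have WM: "W \<subseteq> M" using W(1) openin_imp_subset by blast
  have "f p \<in> V" using d(3) W(2) by blast
  then obtain V1 g1 where V1: "open V1" "f p \<in> V1" "smooth_on V1 g1" "\<forall>y\<in>V \<inter> V1. g1 y = g y"
    using d(2) unfolding smooth_map_def by blast
  obtain U f1 where U: "open U" "p \<in> U" "smooth_on U f1" "\<forall>y\<in>W \<inter> U. f1 y = f y"
    using d(1) W(2) unfolding smooth_map_def by blast
  define A where "A = frechet_derivative g1 (at (f p))"
  have gp: "g1 (f p) = p" using V1(2,4) d(5) W(2) \<open>f p \<in> V\<close> by simp
  have A: "(g1 has_derivative A) (at (f p))"
    unfolding A_def by (rule smooth_on_has_derivative[OF V1(3,2)])
  have lin: "linear A" using A has_derivative_linear by blast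
  obtain r where r: "r > 0" "ball (f p) r \<subseteq> V \<inter> V1"
    using open_Int[OF W(3) V1(1)] \<open>f p \<in> V\<close> V1(2) by (meson IntI openE)
  have "A v \<in> tangent_space M p" for v
  proof -
    \<comment> \<open>The summand \<open>1\<close> covers the case \<open>v = 0\<close>.\<close>
    define \<epsilon> where "\<epsilon> = r / (norm v + 1)"
    have \<epsilon>: "\<epsilon> > 0" using r by (simp add: \<epsilon>_def add_nonneg_pos)
    have inb: "f p + t *\<^sub>R v \<in> ball (f p) r" if "t \<in> {-\<epsilon><..<\<epsilon>}" for t
    proof -
      have "\<bar>t\<bar> * norm v \<le> \<bar>t\<bar> * (norm v + 1)" by (simp add: mult_left_mono)
      also have "\<dots> < \<epsilon> * (norm v + 1)" using that by (intro mult_strict_right_mono) (auto simp: add_nonneg_pos)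
      also have "\<dots> = r" using norm_ge_zero[of v] by (simp add: \<epsilon>_def add_nonneg_eq_0_iff)
      finally show ?thesis by (simp add: dist_norm)
    qed
    define c where "c t = g1 (f p + t *\<^sub>R v)" for t :: real
    have "smooth_on {-\<epsilon><..<\<epsilon>} c" unfolding c_def
      by (rule smooth_on_compose[OF V1(3) _ _ V1(1)]) (use inb r in \<open>auto intro!: smooth_intros\<close>)
    moreover have "c ` {-\<epsilon><..<\<epsilon>} \<subseteq> M"
    proof
      fix y assume "y \<in> c ` {-\<epsilon><..<\<epsilon>}"
      then obtain t where t: "t \<in> {-\<epsilon><..<\<epsilon>}" "y = c t" by blast
      have "f p + t *\<^sub>R v \<in> V \<inter> V1" using inb[OF t(1)] r by blast
      then have "y = g (f p + t *\<^sub>R v)" "f p + t *\<^sub>R v \<in> V" using V1(4) t by (auto simp: c_def)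
      then show "y \<in> M" using d(4) WM by blast
    qed
    moreover have "(c has_vector_derivative A v) (at 0)"
    proof -
      have "(c has_derivative (\<lambda>t. A (t *\<^sub>R v))) (at 0)"
        unfolding c_def
        by (rule has_derivative_compose[where f = "\<lambda>t. f p + t *\<^sub>R v" and g = g1])
          (auto intro!: derivative_eq_intros A)
      then show ?thesis using lin by (simp add: has_vector_derivative_def linear_cmul)
    qed
    moreover have "c 0 = p" by (simp add: c_def gp)
    ultimately show ?thesis unfolding tangent_space_def using \<epsilon> by blast
  qed
  then have 1: "range A \<subseteq> tangent_space M p" by blast
  have "inj A"
  proof -
    define D where "D = frechet_derivative f1 (at p)"
    have "(f1 has_derivative D) (at (g1 (f p)))"
      unfolding D_def gp by (rule smooth_on_has_derivative[OF U(3,2)])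
    from has_derivative_compose[OF A this]
    have DA: "((\<lambda>x. f1 (g1 x)) has_derivative (\<lambda>v. D (A v))) (at (f p))" .
    have "\<forall>\<^sub>F x in nhds (f p). f1 (g1 x) = x"
    proof -
      have "continuous (at (f p)) g1" using A has_derivative_continuous by blast
      then have "\<forall>\<^sub>F x in nhds (f p). g1 x \<in> U"
        using U(1,2) gp by (metis continuous_at_open eventually_nhds isCont_def tendsto_at_iff_tendsto_nhds topological_tendstoD)
      moreover have "\<forall>\<^sub>F x in nhds (f p). x \<in> V \<inter> V1"
        using eventually_nhds_in_open[OF open_Int[OF W(3) V1(1)]] \<open>f p \<in> V\<close> V1(2) by blast
      ultimately show ?thesis
      proof eventually_elim
        case (elim x)
        then have "g1 x = g x" "g x \<in> W" using V1(4) d(4) by auto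
        then show ?case using elim U(4) d(6) by auto
      qed
    qed
    then obtain S where S: "open S" "f p \<in> S" "\<forall>x\<in>S. f1 (g1 x) = x"
      by (auto simp: eventually_nhds)
    have "((\<lambda>x. x) has_derivative (\<lambda>v. D (A v))) (at (f p))"
      by (rule has_derivative_transform_within_open[OF DA S(1,2)]) (use S(3) in auto)
    then have "(\<lambda>v. D (A v)) = (\<lambda>v. v)"
      using has_derivative_unique[OF _ has_derivative_ident] by blast
    then show ?thesis by (metis injI)
  qed
  then have "dim (range A) = DIM(real^3)"
    using lin dim_image_eq[of A "UNIV :: (real^3) set"] by simp
  moreover have "subspace (range A)" using lin linear_subspace_image[of A UNIV] by simp
  ultimately show thesis using that[of "range A"] 1 by simp
qed

text \<open>Expanding the vectors of \<open>B\<close> in \<open>E\<close> and exchanging the sums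
  yields the expansion of the vectors of \<open>E\<close> in \<open>B\<close>. This is what frees
  \<open>mean_curvature\<close> from the basis picked by \<open>SOME\<close>.\<close>

lemma trace_orthonormal:
  fixes L :: "'a::euclidean_space \<Rightarrow> 'a"
  assumes L: "linear L" and B: "finite B" "pairwise orthogonal B" "\<And>e. e \<in> B \<Longrightarrow> norm e = 1"
    and E: "finite E" "pairwise orthogonal E" "\<And>e. e \<in> E \<Longrightarrow> norm e = 1" and span: "span B = span E"
  shows "(\<Sum>e\<in>B. L e \<bullet> e) = (\<Sum>e\<in>E. L e \<bullet> e)"
proof -
  have exp: "x = (\<Sum>f\<in>F. (x \<bullet> f) *\<^sub>R f)"
    if "finite F" "pairwise orthogonal F" "\<And>e. e \<in> F \<Longrightarrow> norm e = 1" "x \<in> span F" for F and x :: 'a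
    by (rule sym, rule orthonormal_basis_expand) (use that in auto)
  have "(\<Sum>e\<in>B. L e \<bullet> e) = (\<Sum>e\<in>B. L (\<Sum>f\<in>E. (e \<bullet> f) *\<^sub>R f) \<bullet> e)"
    using exp[OF E] span by (intro sum.cong refl) (metis span_base)
  also have "\<dots> = (\<Sum>e\<in>B. \<Sum>f\<in>E. (e \<bullet> f) * (L f \<bullet> e))"
    using L by (simp add: linear_sum linear_cmul inner_sum_left)
  also have "\<dots> = (\<Sum>f\<in>E. \<Sum>e\<in>B. (e \<bullet> f) * (L f \<bullet> e))" by (rule sum.swap)
  also have "\<dots> = (\<Sum>f\<in>E. L f \<bullet> (\<Sum>e\<in>B. (f \<bullet> e) *\<^sub>R e))"
    by (simp add: inner_sum_right inner_commute)
  also have "\<dots> = (\<Sum>f\<in>E. L f \<bullet> f)"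
    using exp[OF B] span by (intro sum.cong refl) (metis span_base)
  finally show ?thesis .
qed

section \<open>Mean curvature of hypersurfaces invariant under the torus of rotations\<close>

lemma inner_self_on_S4: "p \<in> S4 \<Longrightarrow> p \<bullet> p = 1"
  unfolding S4_eq_sphere by (simp add: norm_eq_1)

lemma tangent_space_perp_position:
  assumes "M \<subseteq> S4" "v \<in> tangent_space M p"
  shows "p \<bullet> v = 0"
proof -
  obtain \<epsilon> c where c: "\<epsilon> > 0" "c ` {-\<epsilon><..<\<epsilon>} \<subseteq> M" "c 0 = p" "(c has_vector_derivative v) (at 0)"
    using assms(2) unfolding tangent_space_def by auto
  have "((\<lambda>s. c s \<bullet> c s) has_vector_derivative (c 0 \<bullet> v + v \<bullet> c 0)) (at 0)"
    using bounded_bilinear.has_vector_derivative[OF bounded_bilinear_inner c(4) c(4)] .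
  moreover have "((\<lambda>s. c s \<bullet> c s) has_vector_derivative 0) (at 0)"
  proof (rule has_vector_derivative_transform_within_open[of "\<lambda>_. 1" _ _ "{-\<epsilon><..<\<epsilon>}"])
    show "1 = c s \<bullet> c s" if "s \<in> {-\<epsilon><..<\<epsilon>}" for s
    proof -
      have "c s \<in> S4" using that c(2) assms(1) by blast
      then show ?thesis using inner_self_on_S4 by simp
    qed
  qed (use c(1) in auto)
  ultimately have "c 0 \<bullet> v + v \<bullet> c 0 = 0" by (rule vector_derivative_unique_at)
  then show ?thesis by (simp add: c(3) inner_commute)
qed

text \<open>A dimension count: the set of velocities lies between a 3-dimensional subspace and the
  orthogonal complement of \<open>p\<close> and \<open>n\<close>, which has dimension
  \<open>5 - 2\<close>. In particular the velocities form a subspace.\<close>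

lemma tangent_space_eq:
  assumes emb: "embedded_hypersurface M" and p: "p \<in> M" and n: "norm n = 1" "n \<bullet> p = 0"
    and tn: "\<And>v. v \<in> tangent_space M p \<Longrightarrow> n \<bullet> v = 0"
  shows "tangent_space M p = {v. p \<bullet> v = 0 \<and> n \<bullet> v = 0}" "dim {v. p \<bullet> v = 0 \<and> n \<bullet> v = 0} = 3"
proof -
  have MS: "M \<subseteq> S4" using emb unfolding embedded_hypersurface_def by simp
  obtain S where S: "subspace S" "dim S = 3" "S \<subseteq> tangent_space M p"
    using subspace_in_tangent_space[OF emb p] by metis
  define T where "T = {v. p \<bullet> v = 0 \<and> n \<bullet> v = 0}"
  have sub: "subspace T" unfolding T_def subspace_def by (simp add: inner_add_right)
  have pp: "p \<bullet> p = 1" using p MS inner_self_on_S4 by blast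
  have "pairwise orthogonal {p, n}" using n by (auto simp: pairwise_def orthogonal_def inner_commute)
  moreover have "0 \<notin> {p, n}" using pp n by auto
  ultimately have "independent {p, n}" by (rule pairwise_orthogonal_independent)
  moreover have "p \<noteq> n" using n pp by auto
  ultimately have d2: "dim {p, n} = 2" by (simp add: dim_eq_card_independent)
  have "dim {y \<in> UNIV. \<forall>x\<in>span {p, n}. orthogonal x y} + dim (span {p, n}) = dim (UNIV :: ambient set)"
    by (rule dim_subspace_orthogonal_to_vectors) auto
  moreover have "{y \<in> UNIV. \<forall>x\<in>span {p, n}. orthogonal x y} = T"
  proof (intro subset_antisym subsetI)
    fix y assume "y \<in> {y \<in> UNIV. \<forall>x\<in>span {p, n}. orthogonal x y}"
    then have "orthogonal p y" "orthogonal n y" by (auto intro: span_base)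
    then show "y \<in> T" by (simp add: T_def orthogonal_def)
  next
    fix y assume "y \<in> T"
    then have "orthogonal y x" if "x \<in> span {p, n}" for x
      using orthogonal_to_span[OF that, of y] by (auto simp: T_def orthogonal_def inner_commute)
    then show "y \<in> {y \<in> UNIV. \<forall>x\<in>span {p, n}. orthogonal x y}" by (simp add: orthogonal_commute)
  qed
  ultimately have dT: "dim T = 3" using d2 by simp
  have 1: "tangent_space M p \<subseteq> T" unfolding T_def using tangent_space_perp_position[OF MS] tn by blast
  have "S \<subseteq> T" using 1 S(3) by blast
  then have "S = T" using subspace_dim_equal[OF S(1) sub] S(2) dT by simp
  then show "tangent_space M p = {v. p \<bullet> v = 0 \<and> n \<bullet> v = 0}" using 1 S(3) unfolding T_def by blast
  show "dim {v. p \<bullet> v = 0 \<and> n \<bullet> v = 0} = 3" using dT unfolding T_def .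
qed

text \<open>The given frame spans the tangent space by dimension, so the trace may be computed in
  it. The radial correction in \<open>sphere_connection\<close> disappears because tangent vectors
  are orthogonal to \<open>p\<close>.\<close>

lemma mean_curvature_frame:
  assumes emb: "embedded_hypersurface M" and p: "p \<in> M" "p \<in> U" and nf: "unit_normal_field M U \<nu>"
    and e: "norm e1 = 1" "norm e2 = 1" "norm e3 = 1" "e1 \<bullet> e2 = 0" "e1 \<bullet> e3 = 0" "e2 \<bullet> e3 = 0"
    and eT: "p \<bullet> e1 = 0" "p \<bullet> e2 = 0" "p \<bullet> e3 = 0" "\<nu> p \<bullet> e1 = 0" "\<nu> p \<bullet> e2 = 0" "\<nu> p \<bullet> e3 = 0"
    and tr: "frechet_derivative \<nu> (at p) e1 \<bullet> e1 + frechet_derivative \<nu> (at p) e2 \<bullet> e2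
      + frechet_derivative \<nu> (at p) e3 \<bullet> e3 = 0"
  shows "mean_curvature M \<nu> p = 0"
proof -
  define D where "D = frechet_derivative \<nu> (at p)"
  have "smooth_on U \<nu>" using nf unfolding unit_normal_field_def by simp
  then have "linear D" using smooth_on_has_derivative[OF _ p(2)] has_derivative_linear unfolding D_def by blast
  have nu: "norm (\<nu> p) = 1" "\<nu> p \<bullet> p = 0" "\<And>v. v \<in> tangent_space M p \<Longrightarrow> \<nu> p \<bullet> v = 0"
    using nf p unfolding unit_normal_field_def by auto
  define T where "T = tangent_space M p"
  note T = tangent_space_eq[OF emb p(1) nu]
  have Teq: "T = {v. p \<bullet> v = 0 \<and> \<nu> p \<bullet> v = 0}" unfolding T_def by (rule T(1))
  define E where "E = {e1, e2, e3}"
  have E: "finite E" "pairwise orthogonal E" "\<And>e. e \<in> E \<Longrightarrow> norm e = 1"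
    using e by (auto simp: E_def pairwise_def orthogonal_def inner_commute)
  have ne: "e1 \<noteq> e2" "e1 \<noteq> e3" "e2 \<noteq> e3" using e by auto
  have "0 \<notin> E" using E(3)[of 0] by auto
  then have "independent E" using E(2) pairwise_orthogonal_independent by blast
  then have "dim (span E) = 3" using ne by (simp add: dim_eq_card_independent E_def)
  moreover have subT: "subspace T" unfolding Teq subspace_def by (simp add: inner_add_right)
  moreover have "span E \<subseteq> T" by (rule span_minimal[OF _ subT]) (use eT in \<open>auto simp: E_def Teq\<close>)
  ultimately have spE: "span E = T"
    using subspace_dim_equal[OF subspace_span subT, of E] T(2) unfolding Teq by simp
  then have "orthonormal_basis T E" using E by (simp add: orthonormal_basis_def)
  define B where "B = (SOME B. orthonormal_basis T B)"
  have "orthonormal_basis T B" unfolding B_def using \<open>orthonormal_basis T E\<close> by (rule someI)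
  then have B: "pairwise orthogonal B" "\<And>e. e \<in> B \<Longrightarrow> norm e = 1" "span B = T"
    by (auto simp: orthonormal_basis_def)
  have "0 \<notin> B" using B(2)[of 0] by auto
  then have "finite B" using B(1) pairwise_orthogonal_independent finiteI_independent by blast
  have "mean_curvature M \<nu> p = (\<Sum>e\<in>B. - (D e \<bullet> e))"
    unfolding mean_curvature_def T_def[symmetric] B_def[symmetric]
  proof (rule sum.cong[OF refl])
    fix e assume "e \<in> B"
    then have "e \<in> T" using B(3) span_base by blast
    then have "p \<bullet> e = 0" unfolding Teq by simp
    then show "second_fundamental_form \<nu> p e e = - (D e \<bullet> e)"
      by (simp add: second_fundamental_form_def sphere_connection_def Let_def D_def inner_diff_left)
  qed
  also have "\<dots> = - (\<Sum>e\<in>B. D e \<bullet> e)" by (simp add: sum_negf)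
  also have "(\<Sum>e\<in>B. D e \<bullet> e) = (\<Sum>e\<in>E. D e \<bullet> e)"
    by (rule trace_orthonormal[OF \<open>linear D\<close> \<open>finite B\<close> B(1,2) E]) (use spE B(3) in auto)
  also have "\<dots> = 0" using tr ne by (simp add: E_def D_def)
  finally show ?thesis by simp
qed

text \<open>Hypersurfaces invariant under the torus action rotating \<open>z\<^sub>1\<close> and \<open>z\<^sub>2\<close>, described by a profile
  curve \<open>(X, u, v) = (x, |z\<^sub>1|\<^sup>2, |z\<^sub>2|\<^sup>2)\<close> whose parameter \<open>t\<close> is a smooth function near \<open>p\<close>; the
  (not normalised) normal is \<open>(A, B z\<^sub>1, C z\<^sub>2)\<close>.\<close>

lemma rotational_minimal:
  fixes X u v A B C X' u' v' :: "real \<Rightarrow> real" and t :: "ambient \<Rightarrow> real"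
  assumes emb: "embedded_hypersurface M" and pM: "(x, z1, z2) \<in> M" "(x, z1, z2) \<in> U"
    and U: "open U" "smooth_on U t" "\<And>q. q \<in> U \<Longrightarrow> t q \<in> I" "open I"
    and sm: "smooth_on I u" "smooth_on I v" "smooth_on I A" "smooth_on I B" "smooth_on I C"
    and dX: "\<And>s. s \<in> I \<Longrightarrow> (X has_real_derivative X' s) (at s)"
    and du: "\<And>s. s \<in> I \<Longrightarrow> (u has_real_derivative u' s) (at s)"
    and dv: "\<And>s. s \<in> I \<Longrightarrow> (v has_real_derivative v' s) (at s)"
    and M: "\<And>y w1 w2. (y, w1, w2) \<in> M \<Longrightarrow> (y, w1, w2) \<in> U \<Longrightarrow> y = X (t (y, w1, w2)) \<and>
              (cmod w1)\<^sup>2 = u (t (y, w1, w2)) \<and> (cmod w2)\<^sup>2 = v (t (y, w1, w2))"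
    and perp1: "\<And>s. s \<in> I \<Longrightarrow> A s * X s + B s * u s + C s * v s = 0"
    and perp2: "\<And>s. s \<in> I \<Longrightarrow> A s * X' s + B s * u' s / 2 + C s * v' s / 2 = 0"
    and sph: "\<And>s. s \<in> I \<Longrightarrow> X s * X' s + u' s / 2 + v' s / 2 = 0"
    and \<tau>: "\<tau> = t (x, z1, z2)"
    and Npos: "(A \<tau>)\<^sup>2 + (B \<tau>)\<^sup>2 * u \<tau> + (C \<tau>)\<^sup>2 * v \<tau> > 0"
    and reg: "X' \<tau> \<noteq> 0 \<or> u' \<tau> \<noteq> 0 \<or> v' \<tau> \<noteq> 0"
    and dA: "(A has_real_derivative a) (at \<tau>)" and dB: "(B has_real_derivative b) (at \<tau>)"
    and dC: "(C has_real_derivative c) (at \<tau>)"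
    and curv: "(z1 \<noteq> 0 \<and> z2 \<noteq> 0 \<and>
         (B \<tau> + C \<tau>) * ((X' \<tau>)\<^sup>2 + (u' \<tau>)\<^sup>2 / (4 * u \<tau>) + (v' \<tau>)\<^sup>2 / (4 * v \<tau>))
          + a * X' \<tau> + b * u' \<tau> / 2 + c * v' \<tau> / 2
          + B \<tau> * (u' \<tau>)\<^sup>2 / (4 * u \<tau>) + C \<tau> * (v' \<tau>)\<^sup>2 / (4 * v \<tau>) = 0)
       \<or> (z1 \<noteq> 0 \<and> z2 = 0 \<and> B \<tau> + 2 * C \<tau> = 0) \<or> (z1 = 0 \<and> z2 \<noteq> 0 \<and> 2 * B \<tau> + C \<tau> = 0)"
  shows "\<exists>U' \<nu>. (x, z1, z2) \<in> U' \<and> unit_normal_field M U' \<nu> \<and> mean_curvature M \<nu> (x, z1, z2) = 0"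
proof -
  define p where "p = (x, z1, z2)"
  \<comment> \<open>Squared length of the normal before normalisation. It is positive at
    \<open>\<tau>\<close>, hence on an open set of parameters, to which everything is
    restricted.\<close>
  define N where "N s = (A s)\<^sup>2 + (B s)\<^sup>2 * u s + (C s)\<^sup>2 * v s" for s
  define I' where "I' = {s \<in> I. N s > 0}"
  have smN: "smooth_on I N" unfolding N_def by (intro smooth_intros sm U(4))
  have opI': "open I'"
  proof -
    have "I' = N -` {0<..} \<inter> I" by (auto simp: I'_def)
    then show ?thesis
      using continuous_open_preimage[OF smooth_on_imp_continuous_on[OF smN] U(4), of "{0<..}"] by (simp add: Int_commute)
  qed
  define U' where "U' = {q \<in> U. t q \<in> I'}"
  have opU': "open U'"
  proof -
    have "U' = t -` I' \<inter> U" by (auto simp: U'_def)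
    then show ?thesis
      using continuous_open_preimage[OF smooth_on_imp_continuous_on[OF U(2)] U(1) opI'] by (simp add: Int_commute)
  qed
  have smt: "smooth_on U' t" by (rule smooth_on_subset[OF U(2)]) (auto simp: U'_def)
  have I'I: "I' \<subseteq> I" by (auto simp: I'_def)
  note sm' = sm[THEN smooth_on_subset, OF I'I]
  define f where "f s = 1 / sqrt (N s)" for s
  have smf: "smooth_on I' f" unfolding f_def
    by (intro smooth_intros opI' smooth_on_subset[OF smN I'I]) (auto simp: I'_def)
  define \<nu> where "\<nu> q = (f (t q) * A (t q), (f (t q) * B (t q)) *\<^sub>R fst (snd q), (f (t q) * C (t q)) *\<^sub>R snd (snd q))" for q :: ambient
  have smg: "smooth_on U' (\<lambda>q. f (t q) * g (t q))" if "smooth_on I' g" for g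
    by (rule smooth_on_compose[where V = I' and g = "\<lambda>s. f s * g s"])
      (use smt opU' in \<open>auto intro!: smooth_intros smf that opI' simp: U'_def\<close>)
  have smnu: "smooth_on U' \<nu>"
    unfolding \<nu>_def by (intro smooth_intros opU' smg sm')
  \<comment> \<open>Obtained by differentiating the three relations for \<open>M\<close> along a
    curve with velocity \<open>w\<close>. Only the \<open>x\<close> component and the radial
    components of \<open>w\<close> are tied to the rate \<open>s\<close> of the parameter; the
    angular ones are free.\<close>
  have rel: "fst w = X' (t q) * s" "fst (snd q) \<bullet> fst (snd w) = u' (t q) / 2 * s" "snd (snd q) \<bullet> snd (snd w) = v' (t q) / 2 * s"
    if q: "q \<in> U" "w \<in> tangent_space M q" and s: "s = frechet_derivative t (at q) w" for q w s
  proof -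
    obtain \<epsilon> c where c: "\<epsilon> > 0" "c ` {-\<epsilon><..<\<epsilon>} \<subseteq> M" "c 0 = q" "(c has_vector_derivative w) (at 0)"
      using q(2) unfolding tangent_space_def by auto
    have "(t has_derivative frechet_derivative t (at q)) (at (c 0))"
      unfolding c(3) by (rule smooth_on_has_derivative[OF U(2) q(1)])
    from vector_derivative_diff_chain_within[OF c(4) has_derivative_at_withinI[OF this]]
    have tc: "((\<lambda>r. t (c r)) has_real_derivative s) (at 0)"
      by (simp add: o_def s has_real_derivative_iff_has_vector_derivative)
    have "continuous (at 0) c" using c(4) has_vector_derivative_continuous by blast
    then have "\<forall>\<^sub>F r in nhds 0. c r \<in> U"
      using U(1) q(1) c(3) by (metis isCont_def tendsto_at_iff_tendsto_nhds topological_tendstoD)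
    moreover have "\<forall>\<^sub>F r in nhds 0. r \<in> {-\<epsilon><..<\<epsilon>}" using c(1) by (intro eventually_nhds_in_open) auto
    ultimately have "\<forall>\<^sub>F r in nhds 0. c r \<in> M \<inter> U"
      by eventually_elim (use c(2) in blast)
    then obtain R where R: "open R" "0 \<in> R" "\<And>r. r \<in> R \<Longrightarrow> c r \<in> M \<inter> U" by (auto simp: eventually_nhds)
    have MR: "fst (c r) = X (t (c r)) \<and> (fst (snd (c r)) \<bullet> fst (snd (c r))) = u (t (c r)) \<and>
        (snd (snd (c r)) \<bullet> snd (snd (c r))) = v (t (c r))" if "r \<in> R" for r
      using M[of "fst (c r)" "fst (snd (c r))" "snd (snd (c r))"] R(3)[OF that] by (simp add: dot_square_norm)
    have tq: "t (c 0) \<in> I" using U(3) q(1) c(3) by simp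
    have eq: "d = F' * s" if "(g has_vector_derivative d) (at 0)" "(F has_real_derivative F') (at (t (c 0)))"
      "\<And>r. r \<in> R \<Longrightarrow> g r = F (t (c r))" for g F d F'
    proof -
      have "((\<lambda>r. F (t (c r))) has_real_derivative F' * s) (at 0)" by (rule DERIV_chain2[OF that(2) tc])
      then have "((\<lambda>r. F (t (c r))) has_vector_derivative F' * s) (at 0)"
        by (simp add: has_real_derivative_iff_has_vector_derivative)
      then have "(g has_vector_derivative F' * s) (at 0)"
        by (rule has_vector_derivative_transform_within_open[OF _ R(1,2)]) (simp add: that(3))
      with that(1) show ?thesis by (rule vector_derivative_unique_at)
    qed
    have c1: "((\<lambda>r. fst (c r)) has_vector_derivative fst w) (at 0)"
      by (rule bounded_linear.has_vector_derivative[OF bounded_linear_fst c(4)])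
    have c2': "((\<lambda>r. snd (c r)) has_vector_derivative snd w) (at 0)"
      by (rule bounded_linear.has_vector_derivative[OF bounded_linear_snd c(4)])
    have c2: "((\<lambda>r. fst (snd (c r))) has_vector_derivative fst (snd w)) (at 0)"
      by (rule bounded_linear.has_vector_derivative[OF bounded_linear_fst c2'])
    have c3: "((\<lambda>r. snd (snd (c r))) has_vector_derivative snd (snd w)) (at 0)"
      by (rule bounded_linear.has_vector_derivative[OF bounded_linear_snd c2'])
    show "fst w = X' (t q) * s" using eq[OF c1 dX[OF tq]] MR c(3) by simp
    have "fst (snd (c 0)) \<bullet> fst (snd w) + fst (snd w) \<bullet> fst (snd (c 0)) = u' (t (c 0)) * s"
      by (rule eq[OF bounded_bilinear.has_vector_derivative[OF bounded_bilinear_inner c2 c2] du[OF tq]]) (use MR in blast)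
    then show "fst (snd q) \<bullet> fst (snd w) = u' (t q) / 2 * s" by (simp add: c(3) inner_commute)
    have "snd (snd (c 0)) \<bullet> snd (snd w) + snd (snd w) \<bullet> snd (snd (c 0)) = v' (t (c 0)) * s"
      by (rule eq[OF bounded_bilinear.has_vector_derivative[OF bounded_bilinear_inner c3 c3] dv[OF tq]]) (use MR in blast)
    then show "snd (snd q) \<bullet> snd (snd w) = v' (t q) / 2 * s" by (simp add: c(3) inner_commute)
  qed
  have nf: "unit_normal_field M U' \<nu>"
    unfolding unit_normal_field_def
  proof (intro conjI ballI)
    show "open U'" "smooth_on U' \<nu>" by (fact opU' smnu)+
  next
    fix q assume q: "q \<in> M \<inter> U'"
    define \<sigma> where "\<sigma> = t q"
    have qU: "q \<in> U" "\<sigma> \<in> I" "N \<sigma> > 0" using q by (auto simp: U'_def I'_def \<sigma>_def)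
    have m: "fst q = X \<sigma>" "(cmod (fst (snd q)))\<^sup>2 = u \<sigma>" "(cmod (snd (snd q)))\<^sup>2 = v \<sigma>"
      using M[of "fst q" "fst (snd q)" "snd (snd q)"] q qU by (auto simp: \<sigma>_def)
    have ff: "(f \<sigma>)\<^sup>2 * N \<sigma> = 1" using qU(3) by (simp add: f_def power_divide)
    have "(norm (\<nu> q))\<^sup>2 = (f \<sigma>)\<^sup>2 * N \<sigma>"
      unfolding power2_norm_eq_inner using m(2,3)[folded dot_square_norm]
      by (simp add: \<nu>_def inner_prod_def N_def power2_eq_square algebra_simps flip: \<sigma>_def)
    then have "(norm (\<nu> q))\<^sup>2 = 1" using ff by simp
    then show "norm (\<nu> q) = 1" using power2_eq_1_iff[of "norm (\<nu> q)"] norm_ge_zero[of "\<nu> q"] by linarith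
    have "\<nu> q \<bullet> q = f \<sigma> * (A \<sigma> * X \<sigma> + B \<sigma> * u \<sigma> + C \<sigma> * v \<sigma>)"
      by (simp add: \<nu>_def inner_prod_def m dot_square_norm algebra_simps flip: \<sigma>_def)
    then show "\<nu> q \<bullet> q = 0" using perp1[OF qU(2)] by simp
    fix w assume w: "w \<in> tangent_space M q"
    define s where "s = frechet_derivative t (at q) w"
    note r = rel[OF qU(1) w s_def]
    have "\<nu> q \<bullet> w = f \<sigma> * A \<sigma> * fst w + f \<sigma> * B \<sigma> * (fst (snd q) \<bullet> fst (snd w)) + f \<sigma> * C \<sigma> * (snd (snd q) \<bullet> snd (snd w))"
      by (simp add: \<nu>_def inner_prod_def flip: \<sigma>_def)
    also have "\<dots> = f \<sigma> * s * (A \<sigma> * X' \<sigma> + B \<sigma> * u' \<sigma> / 2 + C \<sigma> * v' \<sigma> / 2)"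
      by (simp add: r algebra_simps flip: \<sigma>_def)
    finally show "\<nu> q \<bullet> w = 0" using perp2[OF qU(2)] by simp
  qed
  have pU: "p \<in> U'" "p \<in> M" "p \<in> U" using pM Npos by (auto simp: p_def U'_def I'_def N_def U(3) \<tau>)
  have tp: "t p = \<tau>" by (simp add: p_def \<tau>)
  have \<tau>I: "\<tau> \<in> I" "\<tau> \<in> I'" using pU by (auto simp: U'_def tp I'_def)
  have m: "x = X \<tau>" "(cmod z1)\<^sup>2 = u \<tau>" "(cmod z2)\<^sup>2 = v \<tau>" using M[OF pM] by (auto simp: \<tau>)
  have mi: "z1 \<bullet> z1 = u \<tau>" "z2 \<bullet> z2 = v \<tau>" using m by (auto simp: dot_square_norm)
  have nup: "norm (\<nu> p) = 1" "\<nu> p \<bullet> p = 0" "\<And>w. w \<in> tangent_space M p \<Longrightarrow> \<nu> p \<bullet> w = 0"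
    using nf pU unfolding unit_normal_field_def by auto
  note TS = tangent_space_eq(1)[OF emb pU(2) nup]
  define Dt where "Dt = frechet_derivative t (at p)"
  have Dt: "(t has_derivative Dt) (at p)" unfolding Dt_def by (rule smooth_on_has_derivative[OF U(2) pU(3)])
  obtain f' where f': "(f has_real_derivative f') (at \<tau>)"
    using smooth_on_has_derivative[OF smf \<tau>I(2)] real_differentiable_def[of f \<tau>]
    unfolding differentiable_def by blast
  have dg: "((\<lambda>s. f s * g s) has_real_derivative (f' * g \<tau> + f \<tau> * g')) (at \<tau>)"
    if "(g has_real_derivative g') (at \<tau>)" for g g'
    by (auto intro!: derivative_eq_intros f' that)
  have dgt: "((\<lambda>q. f (t q) * g (t q)) has_derivative (\<lambda>e. Dt e * (f' * g \<tau> + f \<tau> * g'))) (at p)"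
    if "(g has_real_derivative g') (at \<tau>)" for g g'
  proof -
    have "((\<lambda>s. f s * g s) has_real_derivative (f' * g \<tau> + f \<tau> * g')) (at (t p))"
      using dg[OF that] by (simp add: tp)
    from DERIV_compose_FDERIV[OF this Dt] show ?thesis .
  qed
  define ga gb gc where "ga = f' * A \<tau> + f \<tau> * a" and "gb = f' * B \<tau> + f \<tau> * b" and "gc = f' * C \<tau> + f \<tau> * c"
  define D where "D e = (Dt e * ga,
      (f \<tau> * B \<tau>) *\<^sub>R fst (snd e) + (Dt e * gb) *\<^sub>R z1,
      (f \<tau> * C \<tau>) *\<^sub>R snd (snd e) + (Dt e * gc) *\<^sub>R z2)" for e :: ambient
  have "(\<nu> has_derivative D) (at p)"
    unfolding \<nu>_def[abs_def] D_def ga_def gb_def gc_def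
    by (rule derivative_eq_intros dgt dA dB dC refl | simp add: tp)+ (simp add: p_def)
  then have fD: "frechet_derivative \<nu> (at p) = D" using frechet_derivative_at by metis
  have nuE: "\<nu> p = (f \<tau> * A \<tau>, (f \<tau> * B \<tau>) *\<^sub>R z1, (f \<tau> * C \<tau>) *\<^sub>R z2)"
    by (simp add: \<nu>_def tp) (simp add: p_def)
  have DtT: "fst e = X' \<tau> * Dt e" "z1 \<bullet> fst (snd e) = u' \<tau> / 2 * Dt e" "z2 \<bullet> snd (snd e) = v' \<tau> / 2 * Dt e"
    if "p \<bullet> e = 0" "\<nu> p \<bullet> e = 0" for e
    using rel[OF pU(3) _ Dt_def[THEN fun_cong], of e] that TS by (auto simp: tp) (auto simp: p_def)
  \<comment> \<open>By \<open>reg\<close>, motions without \<open>x\<close> and radial components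
    leave the parameter fixed to first order; along them \<open>\<nu>\<close> is differentiated as
    if its coefficients were constant.\<close>
  have Dt0: "Dt e = 0" if "p \<bullet> e = 0" "\<nu> p \<bullet> e = 0" "fst e = 0" "z1 \<bullet> fst (snd e) = 0" "z2 \<bullet> snd (snd e) = 0" for e
    using DtT[OF that(1,2)] that(3-5) reg by auto
  have Dperp: "D e \<bullet> e = f \<tau> * B \<tau> * (fst (snd e) \<bullet> fst (snd e)) + f \<tau> * C \<tau> * (snd (snd e) \<bullet> snd (snd e))"
    if "p \<bullet> e = 0" "\<nu> p \<bullet> e = 0" "fst e = 0" "z1 \<bullet> fst (snd e) = 0" "z2 \<bullet> snd (snd e) = 0" for e
    using Dt0[OF that] by (simp add: D_def inner_prod_def)
  have rot: "z \<bullet> (\<i> * z) = 0" "(\<i> * z) \<bullet> (\<i> * z) = z \<bullet> z" for z :: complex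
    by (auto simp: inner_complex_def algebra_simps)
  \<comment> \<open>\<open>r1\<close> and \<open>r2\<close> are the unit tangents of the two circles
    that make up the torus orbit.\<close>
  define r1 where "r1 = (0::real, (1 / cmod z1) *\<^sub>R (\<i> * z1), 0::complex)"
  define r2 where "r2 = (0::real, 0::complex, (1 / cmod z2) *\<^sub>R (\<i> * z2))"
  have zz: "z \<bullet> z / (cmod z * cmod z) = 1" if "z \<noteq> 0" for z
    using that by (simp add: dot_square_norm power2_eq_square)
  have r1: "norm r1 = 1" "p \<bullet> r1 = 0" "\<nu> p \<bullet> r1 = 0" "D r1 \<bullet> r1 = f \<tau> * B \<tau>" if "z1 \<noteq> 0"
  proof -
    show *: "norm r1 = 1" "p \<bullet> r1 = 0" "\<nu> p \<bullet> r1 = 0"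
      using that by (simp_all add: r1_def norm_prod_def norm_mult inner_prod_def nuE rot) (simp_all add: p_def rot)
    show "D r1 \<bullet> r1 = f \<tau> * B \<tau>"
      using zz[OF that] by (subst Dperp[OF *(2,3)]) (simp_all add: r1_def rot)
  qed
  have r2: "norm r2 = 1" "p \<bullet> r2 = 0" "\<nu> p \<bullet> r2 = 0" "D r2 \<bullet> r2 = f \<tau> * C \<tau>" if "z2 \<noteq> 0"
  proof -
    show *: "norm r2 = 1" "p \<bullet> r2 = 0" "\<nu> p \<bullet> r2 = 0"
      using that by (simp_all add: r2_def norm_prod_def norm_mult inner_prod_def nuE rot) (simp_all add: p_def rot)
    show "D r2 \<bullet> r2 = f \<tau> * C \<tau>"
      using zz[OF that] by (subst Dperp[OF *(2,3)]) (simp_all add: r2_def rot)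
  qed
  note frame = mean_curvature_frame[OF emb pU(2,1) nf, unfolded fD]
  have "mean_curvature M \<nu> p = 0"
    using curv
  proof (elim disjE conjE)
    assume z: "z1 \<noteq> 0" "z2 \<noteq> 0"
      and ode: "(B \<tau> + C \<tau>) * ((X' \<tau>)\<^sup>2 + (u' \<tau>)\<^sup>2 / (4 * u \<tau>) + (v' \<tau>)\<^sup>2 / (4 * v \<tau>))
          + a * X' \<tau> + b * u' \<tau> / 2 + c * v' \<tau> / 2
          + B \<tau> * (u' \<tau>)\<^sup>2 / (4 * u \<tau>) + C \<tau> * (v' \<tau>)\<^sup>2 / (4 * v \<tau>) = 0"
    have uv: "u \<tau> > 0" "v \<tau> > 0" using m z by (auto simp flip: m)
    \<comment> \<open>The velocity of the profile curve, lifted orthogonally to the orbits and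
      normalised so that the parameter has rate \<open>1\<close>.\<close>
    define E where "E = (X' \<tau>, (u' \<tau> / (2 * u \<tau>)) *\<^sub>R z1, (v' \<tau> / (2 * v \<tau>)) *\<^sub>R z2)"
    define n where "n = (X' \<tau>)\<^sup>2 + (u' \<tau>)\<^sup>2 / (4 * u \<tau>) + (v' \<tau>)\<^sup>2 / (4 * v \<tau>)"
    have n: "n > 0"
    proof -
      have "0 \<le> (X' \<tau>)\<^sup>2" "0 \<le> (u' \<tau>)\<^sup>2 / (4 * u \<tau>)" "0 \<le> (v' \<tau>)\<^sup>2 / (4 * v \<tau>)" using uv by auto
      moreover have "(X' \<tau>)\<^sup>2 > 0 \<or> (u' \<tau>)\<^sup>2 / (4 * u \<tau>) > 0 \<or> (v' \<tau>)\<^sup>2 / (4 * v \<tau>) > 0" using uv reg by auto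
      ultimately show ?thesis unfolding n_def by linarith
    qed
    have EE: "E \<bullet> E = n"
      using uv by (simp add: E_def inner_prod_def n_def mi power2_eq_square field_simps)
    have pE: "p \<bullet> E = 0"
      using uv sph[OF \<tau>I(1)] by (simp add: E_def p_def inner_prod_def mi m(1))
    have nE: "\<nu> p \<bullet> E = 0"
    proof -
      have "\<nu> p \<bullet> E = f \<tau> * (A \<tau> * X' \<tau> + B \<tau> * u' \<tau> / 2 + C \<tau> * v' \<tau> / 2)"
        using uv by (simp add: E_def nuE inner_prod_def mi algebra_simps)
      then show ?thesis using perp2[OF \<tau>I(1)] by simp
    qed
    have "Dt E = 1"
    proof -
      have "z1 \<bullet> fst (snd E) = u' \<tau> / 2" "z2 \<bullet> snd (snd E) = v' \<tau> / 2" using uv by (auto simp: E_def mi)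
      then show ?thesis using DtT[OF pE nE] reg by (auto simp: E_def)
    qed
    have DE: "D E \<bullet> E = ga * X' \<tau> + gb * u' \<tau> / 2 + gc * v' \<tau> / 2 + f \<tau> * (B \<tau> * (u' \<tau>)\<^sup>2 / (4 * u \<tau>) + C \<tau> * (v' \<tau>)\<^sup>2 / (4 * v \<tau>))"
      using uv by (simp add: D_def \<open>Dt E = 1\<close> inner_prod_def inner_add_left) (simp add: E_def mi power2_eq_square field_simps)
    define e3 where "e3 = (1 / sqrt n) *\<^sub>R E"
    have e3: "norm e3 = 1" "p \<bullet> e3 = 0" "\<nu> p \<bullet> e3 = 0"
      using n EE pE nE by (auto simp: e3_def norm_eq_sqrt_inner)
    have lin: "linear D" using \<open>(\<nu> has_derivative D) (at p)\<close> has_derivative_linear by blast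
    have De3: "D e3 \<bullet> e3 = D E \<bullet> E / n"
      using n by (simp add: e3_def linear_cmul[OF lin] flip: real_sqrt_mult)
    have r3: "r1 \<bullet> r2 = 0" "r1 \<bullet> e3 = 0" "r2 \<bullet> e3 = 0"
      using rot(1)[of z1] rot(1)[of z2] by (auto simp: r1_def r2_def e3_def E_def inner_prod_def inner_commute)
    \<comment> \<open>The derivative \<open>f'\<close> of the normalising factor multiplies an
      expression that vanishes by \<open>perp2\<close>, so the curvature sum is that of the
      unnormalised normal up to the factor \<open>f \<tau>\<close>.\<close>
    have "n * (f \<tau> * B \<tau> + f \<tau> * C \<tau>) + D E \<bullet> E
      = f' * (A \<tau> * X' \<tau> + B \<tau> * u' \<tau> / 2 + C \<tau> * v' \<tau> / 2) + f \<tau> * ((B \<tau> + C \<tau>) * n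
          + a * X' \<tau> + b * u' \<tau> / 2 + c * v' \<tau> / 2
          + B \<tau> * (u' \<tau>)\<^sup>2 / (4 * u \<tau>) + C \<tau> * (v' \<tau>)\<^sup>2 / (4 * v \<tau>))"
      unfolding DE ga_def gb_def gc_def by (simp add: algebra_simps add_divide_distrib)
    also have "\<dots> = 0" using perp2[OF \<tau>I(1)] ode by (simp add: n_def)
    finally have "n * (f \<tau> * B \<tau> + f \<tau> * C \<tau>) + D E \<bullet> E = 0" .
    then have "f \<tau> * B \<tau> + f \<tau> * C \<tau> + D E \<bullet> E / n = 0" using n by (simp add: field_simps)
    then show ?thesis
      by (intro frame[OF r1(1)[OF z(1)] r2(1)[OF z(2)] e3(1) r3 r1(2)[OF z(1)] r2(2)[OF z(2)] e3(2) r1(3)[OF z(1)] r2(3)[OF z(2)] e3(3)])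
        (simp add: r1(4)[OF z(1)] r2(4)[OF z(2)] De3)
  next
    \<comment> \<open>The second circle has collapsed to a point. The whole \<open>z2\<close> plane
      is now tangent, and each of its two directions contributes \<open>C\<close>.\<close>
    assume z: "z1 \<noteq> 0" "z2 = 0" and k: "B \<tau> + 2 * C \<tau> = 0"
    define s1 where "s1 = (0::real, 0::complex, 1::complex)"
    define s2 where "s2 = (0::real, 0::complex, \<i>)"
    have s: "norm s1 = 1" "norm s2 = 1" "r1 \<bullet> s1 = 0" "r1 \<bullet> s2 = 0" "s1 \<bullet> s2 = 0"
      "p \<bullet> s1 = 0" "p \<bullet> s2 = 0" "\<nu> p \<bullet> s1 = 0" "\<nu> p \<bullet> s2 = 0"
      using z by (simp_all add: s1_def s2_def r1_def nuE norm_prod_def inner_prod_def inner_complex_def) (simp_all add: p_def)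
    have "D s1 \<bullet> s1 = f \<tau> * C \<tau>" "D s2 \<bullet> s2 = f \<tau> * C \<tau>"
      by (subst Dperp[OF s(6,8)] Dperp[OF s(7,9)]; use z in \<open>simp add: s1_def s2_def inner_complex_def\<close>)+
    moreover have "f \<tau> * B \<tau> + f \<tau> * C \<tau> + f \<tau> * C \<tau> = f \<tau> * (B \<tau> + 2 * C \<tau>)" by (simp add: algebra_simps)
    ultimately show ?thesis
      using k by (intro frame[OF r1(1)[OF z(1)] s(1,2,3,4,5) r1(2)[OF z(1)] s(6,7) r1(3)[OF z(1)] s(8,9)])
        (simp add: r1(4)[OF z(1)])
  next
    assume z: "z1 = 0" "z2 \<noteq> 0" and k: "2 * B \<tau> + C \<tau> = 0"
    define s1 where "s1 = (0::real, 1::complex, 0::complex)"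
    define s2 where "s2 = (0::real, \<i>, 0::complex)"
    have s: "norm s1 = 1" "norm s2 = 1" "r2 \<bullet> s1 = 0" "r2 \<bullet> s2 = 0" "s1 \<bullet> s2 = 0"
      "p \<bullet> s1 = 0" "p \<bullet> s2 = 0" "\<nu> p \<bullet> s1 = 0" "\<nu> p \<bullet> s2 = 0"
      using z by (simp_all add: s1_def s2_def r2_def nuE norm_prod_def inner_prod_def inner_complex_def) (simp_all add: p_def)
    have "D s1 \<bullet> s1 = f \<tau> * B \<tau>" "D s2 \<bullet> s2 = f \<tau> * B \<tau>"
      by (subst Dperp[OF s(6,8)] Dperp[OF s(7,9)]; use z in \<open>simp add: s1_def s2_def inner_complex_def\<close>)+
    moreover have "f \<tau> * C \<tau> + f \<tau> * B \<tau> + f \<tau> * B \<tau> = f \<tau> * (2 * B \<tau> + C \<tau>)" by (simp add: algebra_simps)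
    ultimately show ?thesis
      using k by (intro frame[OF r2(1)[OF z(2)] s(1,2,3,4,5) r2(2)[OF z(2)] s(6,7) r2(3)[OF z(2)] s(8,9)])
        (simp add: r2(4)[OF z(2)])
  qed
  then show ?thesis using pU(1) nf unfolding p_def by blast
qed

section \<open>Volterra equations and the flow of the profile equation\<close>

text \<open>Banach's theorem for bounded continuous functions of the whole parameter
  \<open>x\<close>, so that continuous dependence comes together with existence. Integrals are
  rescaled to \<open>{0..1}\<close> and \<open>\<sigma>\<close> rescales the argument accordingly;
  in this form both a regular flow and an equation with a singular point at the origin are covered.
  The Lipschitz weight \<open>k\<close> enters only through its integral.\<close>

lemma volterra_fixed_point:
  fixes G :: "'d::euclidean_space \<Rightarrow> real \<Rightarrow> 'b::euclidean_space \<Rightarrow> 'b" and \<sigma> :: "'d \<Rightarrow> real \<Rightarrow> 'd"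
  assumes G: "continuous_on UNIV (\<lambda>(x, z, w). G x z w)" and \<sigma>: "continuous_on UNIV (\<lambda>(x, z). \<sigma> x z)"
    and bound: "\<And>x z w. z \<in> {0..1} \<Longrightarrow> norm (G x z w) \<le> b"
    and lip: "\<And>x z w w'. z \<in> {0..1} \<Longrightarrow> norm (G x z w - G x z w') \<le> k x z * norm (w - w')"
    and k: "\<And>x. k x integrable_on {0..1}" "\<And>x. integral {0..1} (k x) \<le> c"
      "\<And>x z. z \<in> {0..1} \<Longrightarrow> 0 \<le> k x z" and c: "0 \<le> c" "c < 1"
  obtains v where "continuous_on UNIV v" "\<And>x. v x = integral {0..1} (\<lambda>z. G x z (v (\<sigma> x z)))"
proof -
  define T where "T v = (\<lambda>x. integral (cbox 0 1) (\<lambda>z. G x z (apply_bcontfun v (\<sigma> x z))))" for v :: "'d \<Rightarrow>\<^sub>C 'b"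
  have cont: "continuous_on UNIV (\<lambda>(x, z). G x z (apply_bcontfun v (\<sigma> x z)))" for v :: "'d \<Rightarrow>\<^sub>C 'b"
  proof -
    have "continuous_on UNIV (\<lambda>q. apply_bcontfun v (case q of (x, z) \<Rightarrow> \<sigma> x z))"
      by (rule continuous_on_compose2[OF continuous_on_apply_bcontfun \<sigma>]) auto
    then have "continuous_on UNIV (\<lambda>q. (fst q, snd q, apply_bcontfun v (\<sigma> (fst q) (snd q))))"
      by (intro continuous_intros) (simp add: case_prod_beta)
    from continuous_on_compose2[OF G this] show ?thesis by (simp add: case_prod_beta)
  qed
  have contz: "continuous_on (cbox 0 1) (\<lambda>z. G x z (apply_bcontfun v (\<sigma> x z)))" for v :: "'d \<Rightarrow>\<^sub>C 'b" and x
  proof -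
    have "continuous_on (cbox 0 1) (\<lambda>z::real. (x, z))" by (intro continuous_intros)
    from continuous_on_compose2[OF cont[of v] this] show ?thesis by simp
  qed
  note intg = integrable_continuous[OF contz]
  have Tb: "T v \<in> bcontfun" for v
  proof (rule bcontfun_normI)
    show "continuous_on UNIV (T v)"
      unfolding T_def by (rule integral_continuous_on_param) (rule continuous_on_subset[OF cont subset_UNIV])
    show "norm (T v x) \<le> b" for x
    proof -
      have "norm (T v x) \<le> b * (1 - 0)"
        unfolding T_def cbox_interval
        by (rule integral_bound[OF zero_le_one contz[unfolded cbox_interval] bound])
      then show ?thesis by simp
    qed
  qed
  have lipT: "dist (T v x) (T w x) \<le> c * dist v w" for v w x
  proof -
    have "dist (T v x) (T w x) = norm (integral (cbox 0 1) (\<lambda>z. G x z (apply_bcontfun v (\<sigma> x z)) - G x z (apply_bcontfun w (\<sigma> x z))))"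
      unfolding T_def dist_norm by (subst integral_diff[OF intg intg]) simp
    also have "\<dots> \<le> integral (cbox 0 1) (\<lambda>z. k x z * dist v w)"
    proof (rule integral_norm_bound_integral)
      show "(\<lambda>z. G x z (apply_bcontfun v (\<sigma> x z)) - G x z (apply_bcontfun w (\<sigma> x z))) integrable_on cbox 0 1"
        by (intro integrable_diff intg)
      show "(\<lambda>z. k x z * dist v w) integrable_on cbox 0 1"
        using k(1)[of x] by (intro integrable_on_mult_left) simp
      show "norm (G x z (apply_bcontfun v (\<sigma> x z)) - G x z (apply_bcontfun w (\<sigma> x z))) \<le> k x z * dist v w"
        if "z \<in> cbox 0 1" for z
      proof -
        have z: "z \<in> {0..1}" using that by simp
        have "norm (apply_bcontfun v (\<sigma> x z) - apply_bcontfun w (\<sigma> x z)) \<le> dist v w"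
          using dist_bounded[of v "\<sigma> x z" w] by (simp add: dist_norm)
        then show ?thesis using lip[OF z] mult_left_mono[OF _ k(3)[OF z]] order_trans by blast
      qed
    qed
    also have "\<dots> = integral {0..1} (k x) * dist v w" by simp
    also have "\<dots> \<le> c * dist v w" by (intro mult_right_mono k(2)) simp
    finally show ?thesis .
  qed
  have "\<exists>!v. Bcontfun (T v) = v"
  proof (rule banach_fix_type[OF c])
    show "\<forall>v w. dist (Bcontfun (T v)) (Bcontfun (T w)) \<le> c * dist v w"
      by (intro allI dist_bound) (simp add: Bcontfun_inverse Tb lipT)
  qed
  then obtain v where v: "Bcontfun (T v) = v" by blast
  have "apply_bcontfun v = T v" using Bcontfun_inverse[OF Tb[of v]] unfolding v .
  then have "apply_bcontfun v x = integral {0..1} (\<lambda>z. G x z (apply_bcontfun v (\<sigma> x z)))" for x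
    unfolding T_def cbox_interval by (rule fun_cong)
  then show thesis by (rule that[OF continuous_on_apply_bcontfun])
qed

text \<open>By substitution the scaled average is the integral of \<open>g\<close> from
  \<open>0\<close> to \<open>t\<close>, written in a way that treats both signs of \<open>t\<close>
  alike.\<close>

lemma averaged_primitive_derivative:
  fixes g :: "real \<Rightarrow> 'b::euclidean_space"
  assumes g: "continuous_on {-r..r} g" and t: "\<bar>t\<bar> < r"
  shows "((\<lambda>t. t *\<^sub>R integral {0..1} (\<lambda>z. g (t * z))) has_vector_derivative g t) (at t)"
proof -
  \<comment> \<open>Starting the primitive at \<open>-r\<close> avoids a case distinction on the
    sign of \<open>t\<close>.\<close>
  define P where "P s = integral {-r..s} g" for s
  have P: "(P has_vector_derivative g s) (at s within {-r..r})" if "s \<in> {-r..r}" for s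
    unfolding P_def by (rule integral_has_vector_derivative[OF g that])
  have r: "r > 0" using t by linarith
  have eq: "s *\<^sub>R integral {0..1} (\<lambda>z. g (s * z)) = P s - P 0" if s: "s \<in> {-r<..<r}" for s
  proof -
    have "((\<lambda>z. s *\<^sub>R g (s * z)) has_integral (P (s * 1) - P (s * 0))) {0..1}"
    proof (rule fundamental_theorem_of_calculus)
      show "(0::real) \<le> 1" by simp
      show "((\<lambda>z. P (s * z)) has_vector_derivative s *\<^sub>R g (s * z)) (at z within {0..1})" if z: "z \<in> {0..1}" for z
      proof -
        have m: "s * z \<in> {-r..r}" if "z \<in> {0..1}" for z
        proof -
          have "\<bar>s * z\<bar> \<le> \<bar>s\<bar> * 1" unfolding abs_mult using that by (intro mult_left_mono) auto
          then show ?thesis using s by auto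
        qed
        have "(P has_vector_derivative g (s * z)) (at (s * z) within (\<lambda>z. s * z) ` {0..1})"
          by (rule has_vector_derivative_within_subset[OF P[OF m[OF z]]]) (use m in auto)
        moreover have "((\<lambda>z. s * z) has_vector_derivative s) (at z within {0..1})"
          unfolding has_real_derivative_iff_has_vector_derivative[symmetric]
          by (rule derivative_eq_intros refl | simp)+
        ultimately show ?thesis using vector_diff_chain_within by (fastforce simp: o_def)
      qed
    qed
    then have "integral {0..1} (\<lambda>z. s *\<^sub>R g (s * z)) = P (s * 1) - P (s * 0)" by (rule integral_unique)
    then show ?thesis by simp
  qed
  have "(P has_vector_derivative g t) (at t)"
  proof -
    have "(P has_vector_derivative g t) (at t within {-r<..<r})"
      by (rule has_vector_derivative_within_subset[OF P]) (use t in auto)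
    then show ?thesis by (subst (asm) at_within_open) (use t in auto)
  qed
  then have "((\<lambda>s. P s - P 0) has_vector_derivative g t) (at t)"
    by (auto intro!: derivative_eq_intros)
  then show ?thesis
    by (rule has_vector_derivative_transform_within_open[where S = "{-r<..<r}"]) (use t eq in auto)
qed

text \<open>Picard iteration on the whole line at once. The unknown is
  \<open>exp (- K * \<bar>t\<bar>) *\<^sub>R (\<Phi> t p - p)\<close>: bounded because
  \<open>F\<close> is, and with \<open>K = 2 * L\<close> the weight brings the contraction constant
  down to \<open>1/2\<close> for all times. Joint continuity in time and initial point is part of
  the fixed point theorem.\<close>

lemma global_flow:
  fixes F :: "'a::euclidean_space \<Rightarrow> 'a"
  assumes bd: "\<And>x. norm (F x) \<le> m" and lip: "\<And>x y. norm (F x - F y) \<le> L * norm (x - y)" and L: "L > 0"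
  obtains \<Phi> :: "real \<Rightarrow> 'a \<Rightarrow> 'a"
  where "continuous_on UNIV (\<lambda>(t, p). \<Phi> t p)" "\<And>p. \<Phi> 0 p = p"
    "\<And>t p. ((\<lambda>t. \<Phi> t p) has_vector_derivative F (\<Phi> t p)) (at t)"
proof -
  define K where "K = 2 * L"
  have K: "K > 0" using L by (simp add: K_def)
  have m: "m \<ge> 0" using order_trans[OF norm_ge_zero bd] .
  have Fc: "continuous_on UNIV F"
    by (rule lipschitz_on_continuous_on[of L]) (use lip L in \<open>auto intro!: lipschitz_onI simp: dist_norm\<close>)
  \<comment> \<open>Here \<open>x\<close> is the pair of time and initial point; the inner
    exponential undoes the weight at the earlier time \<open>fst x * z\<close>.\<close>
  define G :: "real \<times> 'a \<Rightarrow> real \<Rightarrow> 'a \<Rightarrow> 'a" where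
    "G x z w = (exp (- K * \<bar>fst x\<bar>) * fst x) *\<^sub>R F (snd x + exp (K * \<bar>fst x\<bar> * z) *\<^sub>R w)" for x z w
  define \<sigma> :: "real \<times> 'a \<Rightarrow> real \<Rightarrow> real \<times> 'a" where "\<sigma> x z = (fst x * z, snd x)" for x z
  define k :: "real \<times> 'a \<Rightarrow> real \<Rightarrow> real" where
    "k x z = exp (- K * \<bar>fst x\<bar>) * \<bar>fst x\<bar> * (L * exp (K * \<bar>fst x\<bar> * z))" for x z
  have ek: "exp (- K * \<bar>t\<bar>) * \<bar>t\<bar> \<le> 1 / K" for t :: real
  proof -
    have "K * \<bar>t\<bar> \<le> exp (K * \<bar>t\<bar>)" using exp_ge_add_one_self[of "K * \<bar>t\<bar>"] by linarith
    then have "exp (- K * \<bar>t\<bar>) * (K * \<bar>t\<bar>) \<le> exp (- K * \<bar>t\<bar>) * exp (K * \<bar>t\<bar>)" by (intro mult_left_mono) auto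
    also have "\<dots> = 1" by (simp flip: exp_add)
    finally show ?thesis using K by (simp add: field_simps)
  qed
  have hi: "((\<lambda>z. exp (- K * \<bar>t\<bar>) * \<bar>t\<bar> * (L * exp (K * \<bar>t\<bar> * z))) has_integral (L / K * (1 - exp (- K * \<bar>t\<bar>)))) {0..1}" for t :: real
  proof -
    have hi0: "((\<lambda>z. exp (- K * \<bar>t\<bar>) * \<bar>t\<bar> * (L * exp (K * \<bar>t\<bar> * z))) has_integral
      (exp (- K * \<bar>t\<bar>) * (L / K * exp (K * \<bar>t\<bar> * 1)) - exp (- K * \<bar>t\<bar>) * (L / K * exp (K * \<bar>t\<bar> * 0)))) {0..1}"
    proof (rule fundamental_theorem_of_calculus)
      show "((\<lambda>z. exp (- K * \<bar>t\<bar>) * (L / K * exp (K * \<bar>t\<bar> * z))) has_vector_derivative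
          exp (- K * \<bar>t\<bar>) * \<bar>t\<bar> * (L * exp (K * \<bar>t\<bar> * z))) (at z within {0..1})" for z
        unfolding has_real_derivative_iff_has_vector_derivative[symmetric]
        by (rule derivative_eq_intros refl)+ (use K in simp)
    qed simp
    have e: "exp (- K * \<bar>t\<bar>) * (L / K * exp (K * \<bar>t\<bar> * 1)) - exp (- K * \<bar>t\<bar>) * (L / K * exp (K * \<bar>t\<bar> * 0))
      = L / K * (1 - exp (- K * \<bar>t\<bar>))"
    proof -
      have "exp (- K * \<bar>t\<bar>) * (L / K * exp (K * \<bar>t\<bar> * 1)) = L / K * (exp (- K * \<bar>t\<bar>) * exp (K * \<bar>t\<bar>))" by simp
      also have "exp (- K * \<bar>t\<bar>) * exp (K * \<bar>t\<bar>) = 1" by (simp flip: exp_add)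
      finally have 1: "exp (- K * \<bar>t\<bar>) * (L / K * exp (K * \<bar>t\<bar> * 1)) = L / K * 1" .
      show ?thesis unfolding 1 mult_zero_right exp_zero right_diff_distrib by (simp only: mult.commute mult_1_right)
    qed
    show ?thesis using hi0 unfolding e .
  qed
  have "continuous_on UNIV (\<lambda>q :: (real \<times> 'a) \<times> real \<times> 'a.
      F (snd (fst q) + exp (K * \<bar>fst (fst q)\<bar> * fst (snd q)) *\<^sub>R snd (snd q)))"
    by (rule continuous_on_compose2[OF Fc]) (auto intro!: continuous_intros)
  then have Gc: "continuous_on UNIV (\<lambda>(x, z, w). G x z w)"
    unfolding G_def case_prod_beta by (intro continuous_intros)
  have sc: "continuous_on UNIV (\<lambda>(x, z). \<sigma> x z)"
    unfolding \<sigma>_def case_prod_beta by (intro continuous_intros)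
  have Gb: "norm (G x z w) \<le> m / K" for x z w
  proof -
    have "norm (G x z w) \<le> (exp (- K * \<bar>fst x\<bar>) * \<bar>fst x\<bar>) * m"
      unfolding G_def norm_scaleR by (simp add: abs_mult mult_left_mono bd)
    also have "\<dots> \<le> (1 / K) * m" by (intro mult_right_mono ek m)
    finally show ?thesis by simp
  qed
  have Gl: "norm (G x z w - G x z w') \<le> k x z * norm (w - w')" for x z w w'
  proof -
    have "norm (G x z w - G x z w') = exp (- K * \<bar>fst x\<bar>) * \<bar>fst x\<bar> *
        norm (F (snd x + exp (K * \<bar>fst x\<bar> * z) *\<^sub>R w) - F (snd x + exp (K * \<bar>fst x\<bar> * z) *\<^sub>R w'))"
      unfolding G_def by (simp add: abs_mult flip: scaleR_diff_right)
    also have "\<dots> \<le> exp (- K * \<bar>fst x\<bar>) * \<bar>fst x\<bar> *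
        (L * norm (snd x + exp (K * \<bar>fst x\<bar> * z) *\<^sub>R w - (snd x + exp (K * \<bar>fst x\<bar> * z) *\<^sub>R w')))"
      by (intro mult_left_mono lip) auto
    also have "\<dots> = k x z * norm (w - w')"
      by (simp add: k_def flip: scaleR_diff_right)
    finally show ?thesis .
  qed
  have k1: "k x integrable_on {0..1}" for x
    using hi[of "fst x"] unfolding k_def by (rule has_integral_integrable)
  have k2: "integral {0..1} (k x) \<le> 1/2" for x
  proof -
    have "integral {0..1} (k x) = L / K * (1 - exp (- K * \<bar>fst x\<bar>))"
      using hi[of "fst x"] unfolding k_def by (rule integral_unique)
    also have "\<dots> \<le> L / K * 1" using L K by (intro mult_left_mono) auto
    finally show ?thesis using L by (simp add: K_def)
  qed
  have k3: "0 \<le> k x z" for x z using L by (simp add: k_def)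
  have "\<exists>v. continuous_on UNIV v \<and> (\<forall>x. v x = integral {0..1} (\<lambda>z. G x z (v (\<sigma> x z))))"
  proof (rule volterra_fixed_point[OF Gc sc Gb Gl k1 k2 k3])
    fix v :: "real \<times> 'a \<Rightarrow> 'a"
    assume "continuous_on UNIV v" "\<And>x. v x = integral {0..1} (\<lambda>z. G x z (v (\<sigma> x z)))"
    then show "\<exists>v. continuous_on UNIV v \<and> (\<forall>x. v x = integral {0..1} (\<lambda>z. G x z (v (\<sigma> x z))))"
      by (intro exI[of _ v] conjI allI)
  qed simp_all
  then obtain v where v: "continuous_on UNIV v" "\<forall>x. v x = integral {0..1} (\<lambda>z. G x z (v (\<sigma> x z)))"
    by blast
  define \<Phi> where "\<Phi> t p = p + exp (K * \<bar>t\<bar>) *\<^sub>R v (t, p)" for t p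
  have cont: "continuous_on UNIV (\<lambda>(t, p). \<Phi> t p)"
    unfolding \<Phi>_def case_prod_beta prod.collapse by (intro continuous_intros v(1))
  have eq: "\<Phi> t p = p + t *\<^sub>R integral {0..1} (\<lambda>z. F (\<Phi> (t * z) p))" for t p
  proof -
    have "v (t, p) = integral {0..1} (\<lambda>z. (exp (- K * \<bar>t\<bar>) * t) *\<^sub>R F (p + exp (K * \<bar>t\<bar> * z) *\<^sub>R v (t * z, p)))"
      by (subst v(2)[rule_format]) (simp add: G_def \<sigma>_def)
    also have "\<dots> = (exp (- K * \<bar>t\<bar>) * t) *\<^sub>R integral {0..1} (\<lambda>z. F (p + exp (K * \<bar>t\<bar> * z) *\<^sub>R v (t * z, p)))"
      by (rule integral_cmul)
    also have "integral {0..1} (\<lambda>z. F (p + exp (K * \<bar>t\<bar> * z) *\<^sub>R v (t * z, p))) = integral {0..1} (\<lambda>z. F (\<Phi> (t * z) p))"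
      by (rule integral_cong) (simp add: \<Phi>_def abs_mult mult.assoc)
    finally have "exp (K * \<bar>t\<bar>) *\<^sub>R v (t, p) = (exp (K * \<bar>t\<bar>) * exp (- K * \<bar>t\<bar>) * t) *\<^sub>R integral {0..1} (\<lambda>z. F (\<Phi> (t * z) p))"
      by (simp add: mult.assoc)
    also have "exp (K * \<bar>t\<bar>) * exp (- K * \<bar>t\<bar>) = 1" by (simp flip: exp_add)
    finally show ?thesis by (simp add: \<Phi>_def)
  qed
  show thesis
  proof (rule that[OF cont])
    show "\<Phi> 0 p = p" for p by (rule trans[OF eq]) simp
    show "((\<lambda>t. \<Phi> t p) has_vector_derivative F (\<Phi> t p)) (at t)" for t p
    proof -
      have "continuous_on UNIV (\<lambda>t. \<Phi> t p)"
      proof -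
        have "continuous_on UNIV (\<lambda>t. (t, p))" by (intro continuous_intros)
        from continuous_on_compose2[OF cont this subset_UNIV] show ?thesis by (simp only: prod.case)
      qed
      then have "continuous_on UNIV (\<lambda>t. F (\<Phi> t p))" by (rule continuous_on_compose2[OF Fc]) (rule subset_UNIV)
      then have "continuous_on {-(\<bar>t\<bar> + 1)..\<bar>t\<bar> + 1} (\<lambda>t. F (\<Phi> t p))" by (rule continuous_on_subset) simp
      then have "((\<lambda>t. t *\<^sub>R integral {0..1} (\<lambda>z. F (\<Phi> (t * z) p))) has_vector_derivative F (\<Phi> t p)) (at t)"
        by (rule averaged_primitive_derivative) linarith
      then have "((\<lambda>t. p + t *\<^sub>R integral {0..1} (\<lambda>z. F (\<Phi> (t * z) p))) has_vector_derivative F (\<Phi> t p)) (at t)"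
        using has_vector_derivative_add[OF has_vector_derivative_const] by fastforce
      then show ?thesis unfolding eq[symmetric] .
    qed
  qed
qed

text \<open>Gronwall's argument for the squared distance \<open>d\<close>, with
  \<open>\<bar>d'\<bar> \<le> 2 * L * d\<close>, applied forwards and backwards from
  \<open>a\<close>.\<close>

lemma ode_unique:
  fixes x y :: "real \<Rightarrow> 'a::euclidean_space"
  assumes lip: "\<And>x y. norm (F x - F y) \<le> L * norm (x - y)"
    and x: "\<And>t. (x has_vector_derivative F (x t)) (at t)" and y: "\<And>t. (y has_vector_derivative F (y t)) (at t)"
    and 0: "x a = y a"
  shows "x t = y t"
proof -
  define d where "d t = (x t - y t) \<bullet> (x t - y t)" for t
  define d' where "d' t = 2 * ((x t - y t) \<bullet> (F (x t) - F (y t)))" for t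
  have d: "(d has_real_derivative d' t) (at t)" for t
    using bounded_bilinear.has_vector_derivative[OF bounded_bilinear_inner
        has_vector_derivative_diff[OF x[of t] y[of t]] has_vector_derivative_diff[OF x[of t] y[of t]]]
    by (simp add: d_def[abs_def] d'_def has_real_derivative_iff_has_vector_derivative inner_commute)
  have b: "\<bar>d' t\<bar> \<le> 2 * L * d t" for t
  proof -
    have "\<bar>(x t - y t) \<bullet> (F (x t) - F (y t))\<bar> \<le> norm (x t - y t) * (L * norm (x t - y t))"
      using Cauchy_Schwarz_ineq2[of "x t - y t" "F (x t) - F (y t)"] mult_left_mono[OF lip[of "x t" "y t"] norm_ge_zero[of "x t - y t"]]
      by linarith
    moreover have "d t = norm (x t - y t) * norm (x t - y t)" by (simp only: d_def dot_square_norm power2_eq_square)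
    ultimately show ?thesis by (simp only: d'_def abs_mult) (simp add: ac_simps)
  qed
  have "d t = 0"
  proof (cases "a \<le> t")
    case True
    have "d t * exp (- (2 * L * t)) \<le> d a * exp (- (2 * L * a))"
    proof (rule DERIV_nonpos_imp_nonincreasing[OF True])
      fix s
      have "((\<lambda>t. d t * exp (- (2 * L * t))) has_real_derivative (d' s - 2 * L * d s) * exp (- (2 * L * s))) (at s)"
        by (rule derivative_eq_intros d refl)+ (simp add: algebra_simps)
      moreover have "(d' s - 2 * L * d s) * exp (- (2 * L * s)) \<le> 0" using b[of s] by (intro mult_nonpos_nonneg) auto
      ultimately show "\<exists>D. ((\<lambda>t. d t * exp (- (2 * L * t))) has_real_derivative D) (at s) \<and> D \<le> 0" by blast
    qed
    then have "d t * exp (- (2 * L * t)) \<le> 0" using 0 by (simp add: d_def)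
    then have "d t \<le> 0" by (simp add: mult_le_0_iff)
    then show ?thesis using inner_ge_zero[of "x t - y t"] unfolding d_def by linarith
  next
    case False
    have "d t * exp (2 * L * t) \<le> d a * exp (2 * L * a)"
    proof (rule DERIV_nonneg_imp_nondecreasing[of t a "\<lambda>t. d t * exp (2 * L * t)"])
      show "t \<le> a" using False by simp
    next
      fix s
      have "((\<lambda>t. d t * exp (2 * L * t)) has_real_derivative (d' s + 2 * L * d s) * exp (2 * L * s)) (at s)"
      proof -
        have "((\<lambda>t. exp (2 * L * t)) has_real_derivative exp (2 * L * s) * (2 * L)) (at s)"
          by (rule DERIV_fun_exp[OF DERIV_cmult_Id])
        from DERIV_mult[OF d this] show ?thesis by (rule DERIV_cong) (simp add: algebra_simps)
      qed
      moreover have "(d' s + 2 * L * d s) * exp (2 * L * s) \<ge> 0" using b[of s] by (intro mult_nonneg_nonneg) auto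
      ultimately show "\<exists>D. ((\<lambda>t. d t * exp (2 * L * t)) has_real_derivative D) (at s) \<and> D \<ge> 0" by blast
    qed
    then have "d t * exp (2 * L * t) \<le> 0" using 0 by (simp add: d_def)
    then have "d t \<le> 0" by (simp add: mult_le_0_iff)
    then show ?thesis using inner_ge_zero[of "x t - y t"] unfolding d_def by linarith
  qed
  then show ?thesis by (simp add: d_def)
qed

section \<open>The profile system and its flow\<close>

definition bounded_lipschitz :: "('a::real_normed_vector \<Rightarrow> real) \<Rightarrow> bool" where
  "bounded_lipschitz f \<longleftrightarrow> (\<exists>B L. \<forall>x y. \<bar>f x\<bar> \<le> B \<and> \<bar>f x - f y\<bar> \<le> L * norm (x - y))"

lemma bounded_lipschitz_const: "bounded_lipschitz (\<lambda>_. c)"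
  unfolding bounded_lipschitz_def by (intro exI[of _ "\<bar>c\<bar>"] exI[of _ 0]) auto

text \<open>Boundedness belongs to the notion precisely so that products of Lipschitz functions stay
  Lipschitz; trigonometric polynomials such as the components of \<open>profile_field\<close> are
  then covered.\<close>

lemma bounded_lipschitz_mult:
  assumes "bounded_lipschitz f" "bounded_lipschitz g"
  shows "bounded_lipschitz (\<lambda>x. f x * g x)"
proof -
  obtain B L where f: "\<And>x y. \<bar>f x\<bar> \<le> B" "\<And>x y. \<bar>f x - f y\<bar> \<le> L * norm (x - y)"
    using assms(1) unfolding bounded_lipschitz_def by blast
  obtain C M where g: "\<And>x y. \<bar>g x\<bar> \<le> C" "\<And>x y. \<bar>g x - g y\<bar> \<le> M * norm (x - y)"
    using assms(2) unfolding bounded_lipschitz_def by blast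
  have "0 \<le> B" "0 \<le> C" using order_trans[OF abs_ge_zero f(1)] order_trans[OF abs_ge_zero g(1)] by blast+
  show ?thesis unfolding bounded_lipschitz_def
  proof (intro exI allI conjI)
    fix x y
    show "\<bar>f x * g x\<bar> \<le> B * C" unfolding abs_mult by (intro mult_mono f g \<open>0 \<le> B\<close>) auto
    have "\<bar>f x * g x - f y * g y\<bar> = \<bar>f x * (g x - g y) + (f x - f y) * g y\<bar>" by (simp add: algebra_simps)
    also have "\<dots> \<le> \<bar>f x\<bar> * \<bar>g x - g y\<bar> + \<bar>f x - f y\<bar> * \<bar>g y\<bar>" by (metis abs_mult abs_triangle_ineq)
    also have "\<dots> \<le> B * (M * norm (x - y)) + (L * norm (x - y)) * C"
      by (intro add_mono mult_mono f g \<open>0 \<le> B\<close> order_trans[OF abs_ge_zero f(2)]) auto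
    finally show "\<bar>f x * g x - f y * g y\<bar> \<le> (B * M + L * C) * norm (x - y)" by (simp add: algebra_simps)
  qed
qed

lemma bounded_lipschitz_diff:
  assumes "bounded_lipschitz f" "bounded_lipschitz g"
  shows "bounded_lipschitz (\<lambda>x. f x - g x)"
proof -
  obtain B L where f: "\<And>x y. \<bar>f x\<bar> \<le> B" "\<And>x y. \<bar>f x - f y\<bar> \<le> L * norm (x - y)"
    using assms(1) unfolding bounded_lipschitz_def by blast
  obtain C M where g: "\<And>x y. \<bar>g x\<bar> \<le> C" "\<And>x y. \<bar>g x - g y\<bar> \<le> M * norm (x - y)"
    using assms(2) unfolding bounded_lipschitz_def by blast
  show ?thesis unfolding bounded_lipschitz_def
  proof (intro exI allI conjI)
    fix x y
    show "\<bar>f x - g x\<bar> \<le> B + C" using f(1)[of x] g(1)[of x] by linarith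
    show "\<bar>f x - g x - (f y - g y)\<bar> \<le> (L + M) * norm (x - y)"
      using f(2)[of x y] g(2)[of x y] by (simp add: distrib_right)
  qed
qed

lemma abs_sin_diff_le: "\<bar>sin a - sin b\<bar> \<le> \<bar>a - b :: real\<bar>"
proof -
  have "\<bar>sin a - sin b\<bar> = 2 * (\<bar>sin ((a - b) / 2)\<bar> * \<bar>cos ((a + b) / 2)\<bar>)" by (simp add: sin_diff_sin abs_mult)
  also have "\<dots> \<le> 2 * (\<bar>(a - b) / 2\<bar> * 1)" by (intro mult_left_mono mult_mono abs_sin_x_le_abs_x) auto
  finally show ?thesis by simp
qed

lemma abs_cos_diff_le: "\<bar>cos a - cos b\<bar> \<le> \<bar>a - b :: real\<bar>"
  using abs_sin_diff_le[of "a + pi/2" "b + pi/2"] by (simp add: sin_add)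

lemma bounded_lipschitz_sin_cos:
  assumes "\<And>x y. \<bar>f x - f y\<bar> \<le> norm (x - y)"
  shows "bounded_lipschitz (\<lambda>x. sin (f x))" "bounded_lipschitz (\<lambda>x. cos (f x))"
proof -
  have "\<bar>sin (f x) - sin (f y)\<bar> \<le> 1 * norm (x - y)" "\<bar>cos (f x) - cos (f y)\<bar> \<le> 1 * norm (x - y)" for x y
    using order_trans[OF abs_sin_diff_le assms] order_trans[OF abs_cos_diff_le assms] by simp_all
  then show "bounded_lipschitz (\<lambda>x. sin (f x))" "bounded_lipschitz (\<lambda>x. cos (f x))"
    unfolding bounded_lipschitz_def using abs_sin_le_one abs_cos_le_one by blast+
qed

text \<open>The components are the derivatives of \<open>\<psi>\<close>, \<open>\<beta>\<close>,
  \<open>\<theta>\<close>. The orbit space carries the metric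
  \<open>d\<theta>^2 + cos^2 \<theta> d\<psi>^2 / 4\<close>, and curves are geodesics for the length
  weighted by the orbit volume, a multiple of \<open>cos^2 \<theta> cos \<psi>\<close>. The angle
  \<open>\<beta>\<close> is measured from the direction of decreasing \<open>\<theta>\<close>, and
  the speed \<open>1/2 * cos \<theta> * cos \<psi>\<close> clears all denominators.\<close>

definition profile_field :: "real \<times> real \<times> real \<Rightarrow> real \<times> real \<times> real" where
  "profile_field = (\<lambda>(\<psi>, \<beta>, \<theta>). (sin \<beta> * cos \<psi>,
     - (3/2 * sin \<theta> * (sin \<beta> * cos \<psi>)) - sin \<psi> * cos \<beta>, - (1/2 * (cos \<theta> * (cos \<psi> * cos \<beta>)))))"

lemma profile_field_lipschitz:
  obtains m L where "\<And>x. norm (profile_field x) \<le> m"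
    "\<And>x y. norm (profile_field x - profile_field y) \<le> L * norm (x - y)" "L > 0"
proof -
  have p: "\<bar>fst x - fst y\<bar> \<le> norm (x - y)" "\<bar>fst (snd x) - fst (snd y)\<bar> \<le> norm (x - y)"
    "\<bar>snd (snd x) - snd (snd y)\<bar> \<le> norm (x - y)" for x y :: "real \<times> real \<times> real"
  proof -
    have "norm (snd (x - y)) \<le> norm (x - y)" by (metis norm_snd_le prod.collapse)
    moreover have "norm (fst (x - y)) \<le> norm (x - y)" by (metis norm_fst_le prod.collapse)
    moreover have "norm (fst (snd (x - y))) \<le> norm (snd (x - y))" by (metis norm_fst_le prod.collapse)
    moreover have "norm (snd (snd (x - y))) \<le> norm (snd (x - y))" by (metis norm_snd_le prod.collapse)
    ultimately show "\<bar>fst x - fst y\<bar> \<le> norm (x - y)" "\<bar>fst (snd x) - fst (snd y)\<bar> \<le> norm (x - y)"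
      "\<bar>snd (snd x) - snd (snd y)\<bar> \<le> norm (x - y)" by simp_all
  qed
  note sc = bounded_lipschitz_sin_cos[OF p(1)] bounded_lipschitz_sin_cos[OF p(2)] bounded_lipschitz_sin_cos[OF p(3)]
  define f1 f2 f3 where "f1 x = fst (profile_field x)" and "f2 x = fst (snd (profile_field x))"
    and "f3 x = snd (snd (profile_field x))" for x
  have "bounded_lipschitz (\<lambda>x::real \<times> real \<times> real. sin (fst (snd x)) * cos (fst x))"
    by (intro bounded_lipschitz_mult sc)
  then have "bounded_lipschitz f1" by (simp add: f1_def[abs_def] profile_field_def case_prod_beta)
  moreover have "bounded_lipschitz (\<lambda>x::real \<times> real \<times> real. 0 - 3/2 * sin (snd (snd x)) * (sin (fst (snd x)) * cos (fst x)) - sin (fst x) * cos (fst (snd x)))"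
    by (intro bounded_lipschitz_mult bounded_lipschitz_diff bounded_lipschitz_const sc)
  then have "bounded_lipschitz f2" by (simp add: f2_def[abs_def] profile_field_def case_prod_beta)
  moreover have "bounded_lipschitz (\<lambda>x::real \<times> real \<times> real. 0 - 1/2 * (cos (snd (snd x)) * (cos (fst x) * cos (fst (snd x)))))"
    by (intro bounded_lipschitz_mult bounded_lipschitz_diff bounded_lipschitz_const sc)
  then have "bounded_lipschitz f3" by (simp add: f3_def[abs_def] profile_field_def case_prod_beta)
  ultimately obtain B1 L1 B2 L2 B3 L3 where
    b: "\<And>x. \<bar>f1 x\<bar> \<le> B1" "\<And>x. \<bar>f2 x\<bar> \<le> B2" "\<And>x. \<bar>f3 x\<bar> \<le> B3" and
    l: "\<And>x y. \<bar>f1 x - f1 y\<bar> \<le> L1 * norm (x - y)" "\<And>x y. \<bar>f2 x - f2 y\<bar> \<le> L2 * norm (x - y)"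
      "\<And>x y. \<bar>f3 x - f3 y\<bar> \<le> L3 * norm (x - y)"
    unfolding bounded_lipschitz_def by metis
  have nrm: "norm z \<le> \<bar>fst z\<bar> + \<bar>fst (snd z)\<bar> + \<bar>snd (snd z)\<bar>" for z :: "real \<times> real \<times> real"
    using norm_Pair_le[of "fst z" "snd z"] norm_Pair_le[of "fst (snd z)" "snd (snd z)"] by simp
  have p3: "norm (profile_field x) \<le> B1 + B2 + B3" for x
    using nrm[of "profile_field x"] b(1)[of x] b(2)[of x] b(3)[of x] by (simp add: f1_def f2_def f3_def)
  have q3: "norm (profile_field x - profile_field y) \<le> (\<bar>L1\<bar> + \<bar>L2\<bar> + \<bar>L3\<bar> + 1) * norm (x - y)" for x y
  proof -
    have "norm (profile_field x - profile_field y) \<le> \<bar>f1 x - f1 y\<bar> + \<bar>f2 x - f2 y\<bar> + \<bar>f3 x - f3 y\<bar>"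
      using nrm[of "profile_field x - profile_field y"] by (simp add: f1_def f2_def f3_def)
    also have "\<dots> \<le> (L1 + L2 + L3) * norm (x - y)" using l[of x y] by (simp add: distrib_right)
    also have "\<dots> \<le> (\<bar>L1\<bar> + \<bar>L2\<bar> + \<bar>L3\<bar> + 1) * norm (x - y)" by (intro mult_right_mono) auto
    finally show ?thesis .
  qed
  show thesis by (rule that[OF p3 q3]) linarith
qed

definition profile_solution :: "(real \<Rightarrow> real) \<Rightarrow> (real \<Rightarrow> real) \<Rightarrow> (real \<Rightarrow> real) \<Rightarrow> bool" where
  "profile_solution \<psi> \<beta> \<theta> \<longleftrightarrow> (\<forall>t.
     (\<psi> has_real_derivative sin (\<beta> t) * cos (\<psi> t)) (at t) \<and>
     (\<beta> has_real_derivative - (3/2 * sin (\<theta> t) * (sin (\<beta> t) * cos (\<psi> t))) - sin (\<psi> t) * cos (\<beta> t)) (at t) \<and>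
     (\<theta> has_real_derivative - (1/2 * (cos (\<theta> t) * (cos (\<psi> t) * cos (\<beta> t))))) (at t))"

lemma profile_solutionD:
  assumes "profile_solution \<psi> \<beta> \<theta>"
  shows "(\<psi> has_real_derivative sin (\<beta> t) * cos (\<psi> t)) (at t)"
    "(\<beta> has_real_derivative - (3/2 * sin (\<theta> t) * (sin (\<beta> t) * cos (\<psi> t))) - sin (\<psi> t) * cos (\<beta> t)) (at t)"
    "(\<theta> has_real_derivative - (1/2 * (cos (\<theta> t) * (cos (\<psi> t) * cos (\<beta> t))))) (at t)"
  using assms unfolding profile_solution_def by blast+

lemma profile_solution_iff:
  "profile_solution \<psi> \<beta> \<theta> \<longleftrightarrow>
    (\<forall>t. ((\<lambda>t. (\<psi> t, \<beta> t, \<theta> t)) has_vector_derivative profile_field (\<psi> t, \<beta> t, \<theta> t)) (at t))"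
proof (intro iffI allI)
  fix t assume "profile_solution \<psi> \<beta> \<theta>"
  note d = profile_solutionD[OF this, unfolded has_real_derivative_iff_has_vector_derivative]
  show "((\<lambda>t. (\<psi> t, \<beta> t, \<theta> t)) has_vector_derivative profile_field (\<psi> t, \<beta> t, \<theta> t)) (at t)"
    unfolding profile_field_def prod.case by (intro has_vector_derivative_Pair d)
next
  assume *: "\<forall>t. ((\<lambda>t. (\<psi> t, \<beta> t, \<theta> t)) has_vector_derivative profile_field (\<psi> t, \<beta> t, \<theta> t)) (at t)"
  show "profile_solution \<psi> \<beta> \<theta>"
    unfolding profile_solution_def has_real_derivative_iff_has_vector_derivative
  proof (intro allI conjI)
    fix t
    note d = *[rule_format, of t]
    note d1 = bounded_linear.has_vector_derivative[OF bounded_linear_fst d]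
    note d2 = bounded_linear.has_vector_derivative[OF bounded_linear_snd d]
    note d21 = bounded_linear.has_vector_derivative[OF bounded_linear_fst d2]
    note d22 = bounded_linear.has_vector_derivative[OF bounded_linear_snd d2]
    show "(\<psi> has_vector_derivative sin (\<beta> t) * cos (\<psi> t)) (at t)"
      using d1 by (simp add: profile_field_def)
    show "(\<beta> has_vector_derivative - (3/2 * sin (\<theta> t) * (sin (\<beta> t) * cos (\<psi> t))) - sin (\<psi> t) * cos (\<beta> t)) (at t)"
      using d21 by (simp add: profile_field_def)
    show "(\<theta> has_vector_derivative - (1/2 * (cos (\<theta> t) * (cos (\<psi> t) * cos (\<beta> t))))) (at t)"
      using d22 by (simp add: profile_field_def)
  qed
qed

lemma profile_flow:
  obtains \<Psi> B \<Theta> :: "real \<Rightarrow> real \<times> real \<times> real \<Rightarrow> real"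
  where "continuous_on UNIV (\<lambda>(t, p). \<Psi> t p)" "continuous_on UNIV (\<lambda>(t, p). B t p)"
    "continuous_on UNIV (\<lambda>(t, p). \<Theta> t p)"
    "\<And>p. \<Psi> 0 p = fst p" "\<And>p. B 0 p = fst (snd p)" "\<And>p. \<Theta> 0 p = snd (snd p)"
    "\<And>p. profile_solution (\<lambda>t. \<Psi> t p) (\<lambda>t. B t p) (\<lambda>t. \<Theta> t p)"
proof -
  obtain m L where "\<And>x. norm (profile_field x) \<le> m"
    "\<And>x y. norm (profile_field x - profile_field y) \<le> L * norm (x - y)" "L > 0"
    using profile_field_lipschitz by metis
  then obtain \<Phi> where \<Phi>: "continuous_on UNIV (\<lambda>(t, p). \<Phi> t p)" "\<And>p. \<Phi> 0 p = p"
    "\<And>t p. ((\<lambda>t. \<Phi> t p) has_vector_derivative profile_field (\<Phi> t p)) (at t)"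
    using global_flow[of profile_field m L] by metis
  show thesis
  proof (rule that[of "\<lambda>t p. fst (\<Phi> t p)" "\<lambda>t p. fst (snd (\<Phi> t p))" "\<lambda>t p. snd (snd (\<Phi> t p))"])
    show "profile_solution (\<lambda>t. fst (\<Phi> t p)) (\<lambda>t. fst (snd (\<Phi> t p))) (\<lambda>t. snd (snd (\<Phi> t p)))" for p
      unfolding profile_solution_iff using \<Phi>(3) by simp
  qed (use \<Phi>(1) in \<open>auto simp: \<Phi>(2) case_prod_beta intro!: continuous_intros\<close>)
qed

lemma profile_solution_unique:
  assumes "profile_solution \<psi> \<beta> \<theta>" "profile_solution \<psi>' \<beta>' \<theta>'" "\<psi> a = \<psi>' a" "\<beta> a = \<beta>' a" "\<theta> a = \<theta>' a"
  shows "\<psi> t = \<psi>' t \<and> \<beta> t = \<beta>' t \<and> \<theta> t = \<theta>' t"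
proof -
  obtain m L where "\<And>x y. norm (profile_field x - profile_field y) \<le> L * norm (x - y)"
    using profile_field_lipschitz by metis
  from ode_unique[OF this, of "\<lambda>t. (\<psi> t, \<beta> t, \<theta> t)" "\<lambda>t. (\<psi>' t, \<beta>' t, \<theta>' t)" a t]
  show ?thesis using assms by (simp add: profile_solution_iff)
qed

section \<open>Descending profiles\<close>

text \<open>Integrating factor: \<open>E\<close> is the exponential of a primitive of
  \<open>a\<close>. Hence a solution of a scalar linear equation keeps its sign, and one zero makes
  it vanish identically.\<close>

lemma linear_ode_sign:
  fixes f a :: "real \<Rightarrow> real"
  assumes f: "\<And>t. (f has_real_derivative a t * f t) (at t)" and a: "continuous_on UNIV a"
  obtains E where "\<And>t. E t > 0" "\<And>t. f t = f s * E t"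
proof -
  define A where "A t = t *\<^sub>R integral {0..1} (\<lambda>z. a (t * z))" for t
  have A: "(A has_real_derivative a t) (at t)" for t
  proof -
    have "continuous_on {-(\<bar>t\<bar> + 1)..\<bar>t\<bar> + 1} a" using a by (rule continuous_on_subset) simp
    then have "(A has_vector_derivative a t) (at t)"
      unfolding A_def[abs_def] by (rule averaged_primitive_derivative) linarith
    then show ?thesis by (simp add: has_real_derivative_iff_has_vector_derivative)
  qed
  have "((\<lambda>t. f t * exp (- A t)) has_real_derivative 0) (at t)" for t
    by (rule derivative_eq_intros f A refl)+ (simp add: algebra_simps)
  then have "f t * exp (- A t) = f s * exp (- A s)" for t
    using DERIV_isconst_all by blast
  then have "f t = f s * exp (A t - A s)" for t
    by (simp add: exp_diff exp_minus field_simps)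
  then show thesis by (rule that[rotated]) simp
qed

text \<open>The bound makes \<open>f\<close> times \<open>exp (K * t)\<close> nondecreasing and
  \<open>f\<close> times \<open>exp (- K * t)\<close> nonincreasing, so positivity spreads in both
  directions.\<close>

lemma gronwall_positive:
  fixes f f' :: "real \<Rightarrow> real"
  assumes f: "\<And>t. (f has_real_derivative f' t) (at t)" and b: "\<And>t. \<bar>f' t\<bar> \<le> K * f t" and pos: "f a > 0"
  shows "f t > 0"
proof (cases "a \<le> t")
  case True
  have "f a * exp (K * a) \<le> f t * exp (K * t)"
  proof (rule DERIV_nonneg_imp_nondecreasing[of a t "\<lambda>t. f t * exp (K * t)", OF True])
    fix s
    have "((\<lambda>t. exp (K * t)) has_real_derivative exp (K * s) * K) (at s)"
      by (rule DERIV_fun_exp[OF DERIV_cmult_Id])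
    from DERIV_mult[OF f this]
    have "((\<lambda>t. f t * exp (K * t)) has_real_derivative (f' s + K * f s) * exp (K * s)) (at s)"
      by (rule DERIV_cong) (simp add: algebra_simps)
    moreover have "(f' s + K * f s) * exp (K * s) \<ge> 0" using b[of s] by (intro mult_nonneg_nonneg) auto
    ultimately show "\<exists>D. ((\<lambda>t. f t * exp (K * t)) has_real_derivative D) (at s) \<and> 0 \<le> D" by blast
  qed
  moreover have "f a * exp (K * a) > 0" using pos by simp
  ultimately have "f t * exp (K * t) > 0" by linarith
  then show ?thesis by (simp add: zero_less_mult_iff)
next
  case False
  have "f a * exp (- K * a) \<le> f t * exp (- K * t)"
  proof (rule DERIV_nonpos_imp_nonincreasing[of t a "\<lambda>t. f t * exp (- K * t)"])
    show "t \<le> a" using False by simp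
  next
    fix s
    have "((\<lambda>t. exp (- K * t)) has_real_derivative exp (- K * s) * (- K)) (at s)"
      by (rule DERIV_fun_exp[OF DERIV_cmult_Id])
    from DERIV_mult[OF f this]
    have "((\<lambda>t. f t * exp (- K * t)) has_real_derivative (f' s - K * f s) * exp (- K * s)) (at s)"
      by (rule DERIV_cong) (simp add: algebra_simps)
    moreover have "(f' s - K * f s) * exp (- K * s) \<le> 0" using b[of s] by (intro mult_nonpos_nonneg) auto
    ultimately show "\<exists>D. ((\<lambda>t. f t * exp (- K * t)) has_real_derivative D) (at s) \<and> D \<le> 0" by blast
  qed
  moreover have "f a * exp (- K * a) > 0" using pos by simp
  ultimately have "f t * exp (- K * t) > 0" by linarith
  then show ?thesis by (simp add: zero_less_mult_iff)
qed

lemma cos_pos_range: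
  fixes f :: "real \<Rightarrow> real"
  assumes c: "\<And>t. isCont f t" and pos: "\<And>t. cos (f t) > 0" and a: "\<bar>f a\<bar> < pi/2"
  shows "\<bar>f t\<bar> < pi/2"
proof (rule ccontr)
  assume "\<not> \<bar>f t\<bar> < pi/2"
  then have "f t \<ge> pi/2 \<or> f t \<le> - (pi/2)" by linarith
  moreover have ivt: "\<exists>s. f s = y" if "(f a \<le> y \<and> y \<le> f t) \<or> (f t \<le> y \<and> y \<le> f a)" for y
  proof (cases "a \<le> t")
    case True
    then show ?thesis using that IVT[of f a y t] IVT2[of f t y a] c by blast
  next
    case False
    then have "t \<le> a" by simp
    then show ?thesis using that IVT[of f t y a] IVT2[of f a y t] c by blast
  qed
  ultimately obtain s where "f s = pi/2 \<or> f s = - (pi/2)" using a by (metis abs_less_iff less_imp_le minus_le_iff neg_le_iff_le)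
  then have "cos (f s) = 0" by (elim disjE) (simp_all only: cos_minus cos_pi_half)
  then show False using pos[of s] by simp
qed

text \<open>Variant for a start at \<open>pi/2\<close> itself, where the cosine is still zero and
  becomes positive only afterwards.\<close>

lemma cos_pos_less_pi_half:
  fixes f :: "real \<Rightarrow> real"
  assumes c: "\<And>t. isCont f t" and f0: "f 0 \<le> pi/2" and pos: "\<And>s. 0 < s \<Longrightarrow> s \<le> t \<Longrightarrow> cos (f s) > 0" and t: "0 < t"
  shows "f t < pi/2"
proof (rule ccontr)
  assume n: "\<not> f t < pi/2"
  \<comment> \<open>Capped at \<open>pi\<close>, because the cosine is positive again beyond
    \<open>3/2 * pi\<close>.\<close>
  define y where "y = min (f t) pi"
  have y: "pi/2 \<le> y" "y \<le> pi" "y \<le> f t" using n by (auto simp: y_def)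
  obtain s where s: "0 \<le> s" "s \<le> t" "f s = y"
    using IVT[of f 0 y t] c f0 y t by auto
  show False
  proof (cases "s = 0")
    case True
    then have "y = pi/2" using s f0 y by simp
    then have "f t = pi/2" using pi_gt_zero by (auto simp: y_def min_def split: if_splits)
    then have "cos (f t) = 0" by (simp only: cos_pi_half)
    then show False using pos[of t] t by simp
  next
    case False
    have "cos y \<le> cos (pi/2)" using y by (intro cos_monotone_0_pi_le) auto
    then show False using pos[of s] s False by simp
  qed
qed

section \<open>Invariant regions and the energy of a profile\<close>

context
  fixes \<psi> \<beta> \<theta> :: "real \<Rightarrow> real"
  assumes sol: "profile_solution \<psi> \<beta> \<theta>"
begin

lemma profile_continuous: "isCont \<psi> t" "isCont \<beta> t" "isCont \<theta> t"
  using profile_solutionD[OF sol] DERIV_isCont by blast+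

lemma profile_continuous_on: "continuous_on A \<psi>" "continuous_on A \<beta>" "continuous_on A \<theta>"
  using profile_continuous continuous_at_imp_continuous_on by blast+

text \<open>Both cosines solve scalar linear equations. From an interior start, the pole
  (\<open>cos \<theta> = 0\<close>) and the orbits with \<open>z1 = 0\<close> or
  \<open>z2 = 0\<close> (\<open>cos \<psi> = 0\<close>) are therefore not reached in finite
  time.\<close>

lemma profile_cos_pos:
  "cos (\<theta> a) > 0 \<Longrightarrow> cos (\<theta> t) > 0" "cos (\<psi> a) > 0 \<Longrightarrow> cos (\<psi> t) > 0" "cos (\<theta> a) = 0 \<Longrightarrow> cos (\<theta> t) = 0"
proof -
  have d: "((\<lambda>t. cos (\<theta> t)) has_real_derivative (1/2 * sin (\<theta> t) * (cos (\<psi> t) * cos (\<beta> t))) * cos (\<theta> t)) (at t)" for t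
    by (rule derivative_eq_intros profile_solutionD[OF sol] refl)+ (simp add: algebra_simps)
  have ca: "continuous_on UNIV (\<lambda>t. 1/2 * sin (\<theta> t) * (cos (\<psi> t) * cos (\<beta> t)))"
    by (intro continuous_intros profile_continuous_on)
  obtain E where "\<And>t. E t > 0" "\<And>t. cos (\<theta> t) = cos (\<theta> a) * E t"
    using linear_ode_sign[OF d ca, where s = a] by blast
  then show "cos (\<theta> a) > 0 \<Longrightarrow> cos (\<theta> t) > 0" "cos (\<theta> a) = 0 \<Longrightarrow> cos (\<theta> t) = 0"
    by (metis mult_pos_pos, metis mult_zero_left)
  have d: "((\<lambda>t. cos (\<psi> t)) has_real_derivative (- (sin (\<psi> t) * sin (\<beta> t))) * cos (\<psi> t)) (at t)" for t
    by (rule derivative_eq_intros profile_solutionD[OF sol] refl)+ (simp add: algebra_simps)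
  have ca: "continuous_on UNIV (\<lambda>t. - (sin (\<psi> t) * sin (\<beta> t)))"
    by (intro continuous_intros profile_continuous_on)
  obtain E where "\<And>t. E t > 0" "\<And>t. cos (\<psi> t) = cos (\<psi> a) * E t"
    using linear_ode_sign[OF d ca, where s = a] by blast
  then show "cos (\<psi> a) > 0 \<Longrightarrow> cos (\<psi> t) > 0" by (metis mult_pos_pos)
qed

text \<open>The two contributions with \<open>sin \<psi>\<close> cancel; what remains has the sign
  of \<open>sin \<theta>\<close>.\<close>

lemma profile_energy_derivative:
  "((\<lambda>t. cos (\<psi> t) * cos (\<beta> t)) has_real_derivative 3/2 * sin (\<theta> t) * (sin (\<beta> t))\<^sup>2 * (cos (\<psi> t))\<^sup>2) (at t)"
  by (rule derivative_eq_intros profile_solutionD[OF sol] refl)+ (simp add: algebra_simps power2_eq_square)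

text \<open>The unstable equilibrium \<open>\<psi> = \<beta> = 0\<close>, the cone over the Clifford torus, is never reached.\<close>

lemma profile_energy_less_1:
  assumes "(cos (\<psi> a) * cos (\<beta> a))\<^sup>2 < 1"
  shows "(cos (\<psi> t) * cos (\<beta> t))\<^sup>2 < 1"
proof -
  define e where "e t = cos (\<psi> t) * cos (\<beta> t)" for t
  define e' where "e' t = 3/2 * sin (\<theta> t) * (sin (\<beta> t))\<^sup>2 * (cos (\<psi> t))\<^sup>2" for t
  have e: "(e has_real_derivative e' t) (at t)" for t
    using profile_energy_derivative unfolding e_def[abs_def] e'_def .
  have "((\<lambda>t. 1 - (e t)\<^sup>2) has_real_derivative - (2 * e t * e' t)) (at t)" for t
    by (rule derivative_eq_intros e refl)+ simp
  \<comment> \<open>Since \<open>sin^2 \<beta> * cos^2 \<psi> = cos^2 \<psi> - e^2\<close>, the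
    derivative is controlled by \<open>1 - e^2\<close> itself, the form that Gronwall's argument
    asks for.\<close>
  moreover have "\<bar>- (2 * e t * e' t)\<bar> \<le> 3 * (1 - (e t)\<^sup>2)" for t
  proof -
    have "(sin (\<beta> t))\<^sup>2 * (cos (\<psi> t))\<^sup>2 = (cos (\<psi> t))\<^sup>2 - (e t)\<^sup>2"
      by (simp add: e_def sin_squared_eq power_mult_distrib algebra_simps)
    also have "\<dots> \<le> 1 - (e t)\<^sup>2" using abs_cos_le_one[of "\<psi> t"] by (simp add: abs_square_le_1)
    finally have 1: "(sin (\<beta> t))\<^sup>2 * (cos (\<psi> t))\<^sup>2 \<le> 1 - (e t)\<^sup>2" .
    have "\<bar>e t\<bar> \<le> 1 * 1" unfolding e_def abs_mult by (intro mult_mono) auto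
    then have "\<bar>e t\<bar> * \<bar>sin (\<theta> t)\<bar> \<le> 1 * 1" by (intro mult_mono) auto
    then have "\<bar>e t\<bar> * \<bar>sin (\<theta> t)\<bar> * ((sin (\<beta> t))\<^sup>2 * (cos (\<psi> t))\<^sup>2) \<le> 1 * ((sin (\<beta> t))\<^sup>2 * (cos (\<psi> t))\<^sup>2)"
      by (intro mult_right_mono) auto
    moreover have "\<bar>- (2 * e t * e' t)\<bar> = 3 * (\<bar>e t\<bar> * \<bar>sin (\<theta> t)\<bar> * ((sin (\<beta> t))\<^sup>2 * (cos (\<psi> t))\<^sup>2))"
      by (simp add: e'_def abs_mult)
    moreover have "3 * (\<bar>e t\<bar> * \<bar>sin (\<theta> t)\<bar> * ((sin (\<beta> t))\<^sup>2 * (cos (\<psi> t))\<^sup>2)) \<le> 3 * (1 - (e t)\<^sup>2)"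
      by (intro mult_left_mono) (use calculation(1) 1 in auto)
    ultimately show ?thesis by (simp only:)
  qed
  ultimately have "1 - (e t)\<^sup>2 > 0"
    by (rule gronwall_positive[where a = a]) (use assms in \<open>simp add: e_def\<close>)
  then show ?thesis by (simp add: e_def)
qed

lemma profile_energy_mono:
  assumes "\<And>r. s \<le> r \<Longrightarrow> r \<le> t \<Longrightarrow> sin (\<theta> r) \<ge> 0" "s \<le> t"
  shows "cos (\<psi> s) * cos (\<beta> s) \<le> cos (\<psi> t) * cos (\<beta> t)"
proof (rule DERIV_nonneg_imp_nondecreasing[of s t "\<lambda>t. cos (\<psi> t) * cos (\<beta> t)", OF assms(2)])
  fix r assume "s \<le> r" "r \<le> t"
  then have "3/2 * sin (\<theta> r) * (sin (\<beta> r))\<^sup>2 * (cos (\<psi> r))\<^sup>2 \<ge> 0" using assms(1) by simp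
  then show "\<exists>y. ((\<lambda>t. cos (\<psi> t) * cos (\<beta> t)) has_real_derivative y) (at r) \<and> 0 \<le> y"
    using profile_energy_derivative by blast
qed

end

locale descending_profile =
  fixes \<psi> \<beta> \<theta> :: "real \<Rightarrow> real"
  assumes sol: "profile_solution \<psi> \<beta> \<theta>"
    and \<psi>0: "\<bar>\<psi> 0\<bar> < pi/2" and \<theta>0: "0 < \<theta> 0" "\<theta> 0 < pi/2" and \<beta>0: "\<bar>\<beta> 0\<bar> \<le> pi/2"
begin

abbreviation e where "e t \<equiv> cos (\<psi> t) * cos (\<beta> t)"

lemma cos_\<psi>_pos: "cos (\<psi> t) > 0"
  by (rule profile_cos_pos(2)[OF sol, of 0]) (use \<psi>0 in \<open>auto intro!: cos_gt_zero_pi\<close>)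

lemma cos_\<theta>_pos: "cos (\<theta> t) > 0"
  by (rule profile_cos_pos(1)[OF sol, of 0]) (use \<theta>0 in \<open>auto intro!: cos_gt_zero_pi\<close>)

lemma \<psi>_range: "\<bar>\<psi> t\<bar> < pi/2"
  by (rule cos_pos_range[OF profile_continuous(1)[OF sol] cos_\<psi>_pos \<psi>0])

lemma \<theta>_range: "\<bar>\<theta> t\<bar> < pi/2"
  by (rule cos_pos_range[OF profile_continuous(3)[OF sol] cos_\<theta>_pos, of 0]) (use \<theta>0 in auto)

lemma e0: "e 0 \<ge> 0"
  using cos_\<psi>_pos[of 0] cos_ge_zero[of "\<beta> 0"] \<beta>0 by (intro mult_nonneg_nonneg) auto

context
  fixes T :: real
  assumes \<theta>T: "\<forall>t\<in>{0..T}. \<theta> t \<ge> 0"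
begin

lemma sin_\<theta>_nonneg: "0 \<le> t \<Longrightarrow> t \<le> T \<Longrightarrow> sin (\<theta> t) \<ge> 0"
proof -
  assume "0 \<le> t" "t \<le> T"
  then have "\<theta> t \<ge> 0" using \<theta>T by auto
  moreover have "\<theta> t \<le> pi" using \<theta>_range[of t] pi_gt_zero by linarith
  ultimately show ?thesis by (rule sin_ge_zero)
qed

lemma e_mono: "0 \<le> s \<Longrightarrow> s \<le> t \<Longrightarrow> t \<le> T \<Longrightarrow> e s \<le> e t"
  by (rule profile_energy_mono[OF sol]) (use sin_\<theta>_nonneg in auto)

text \<open>For a horizontal start \<open>e 0 = 0\<close> and monotonicity alone gives nothing; then
  \<open>sin (\<beta> 0)\<close> has absolute value \<open>1\<close>, the energy has positive
  derivative at time \<open>0\<close>, and it becomes positive immediately.\<close>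

lemma e_pos: "0 < t \<Longrightarrow> t \<le> T \<Longrightarrow> e t > 0"
proof (cases "e 0 = 0")
  case False
  assume "0 < t" "t \<le> T"
  then have "e 0 \<le> e t" by (intro e_mono) auto
  then show ?thesis using e0 False by linarith
next
  case True
  assume t: "0 < t" "t \<le> T"
  have "cos (\<beta> 0) = 0" using True cos_\<psi>_pos[of 0] by simp
  then have "(sin (\<beta> 0))\<^sup>2 = 1" by (simp add: sin_squared_eq)
  then have "3/2 * sin (\<theta> 0) * (sin (\<beta> 0))\<^sup>2 * (cos (\<psi> 0))\<^sup>2 > 0"
    using \<theta>0 cos_\<psi>_pos[of 0] sin_gt_zero[of "\<theta> 0"] by simp
  from DERIV_pos_inc_right[OF profile_energy_derivative[OF sol] this]
  obtain d where d: "d > 0" "\<And>h. h > 0 \<Longrightarrow> h < d \<Longrightarrow> e 0 < e (0 + h)" by blast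
  define h where "h = min (d/2) t"
  have "e 0 < e h" using d(2)[of h] d(1) t by (simp add: h_def min_less_iff_disj)
  also have "e h \<le> e t" using d(1) t by (intro e_mono) (auto simp: h_def)
  finally show ?thesis using True by simp
qed

lemma cos_\<beta>_pos: "0 < t \<Longrightarrow> t \<le> T \<Longrightarrow> cos (\<beta> t) > 0"
  using e_pos[of t] cos_\<psi>_pos[of t] by (simp add: zero_less_mult_iff)

lemma \<theta>_strict: "0 \<le> s \<Longrightarrow> s < t \<Longrightarrow> t \<le> T \<Longrightarrow> \<theta> t < \<theta> s"
proof -
  assume st: "0 \<le> s" "s < t" "t \<le> T"
  obtain z where z: "s < z" "z < t" "\<theta> t - \<theta> s = (t - s) * (- (1/2 * (cos (\<theta> z) * e z)))"
    using MVT2[OF st(2), of \<theta> "\<lambda>z. - (1/2 * (cos (\<theta> z) * e z))"] profile_solutionD(3)[OF sol] by blast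
  have "cos (\<theta> z) * e z > 0" using e_pos[of z] cos_\<theta>_pos[of z] z st by simp
  then have "(t - s) * (- (1/2 * (cos (\<theta> z) * e z))) < 0" using st by (intro mult_pos_neg) auto
  then show ?thesis using z(3) by linarith
qed

lemma \<beta>_range: "0 < t \<Longrightarrow> t \<le> T \<Longrightarrow> \<bar>\<beta> t\<bar> < pi/2"
proof -
  assume t: "0 < t" "t \<le> T"
  have "\<beta> t < pi/2"
    by (rule cos_pos_less_pi_half[OF profile_continuous(2)[OF sol] _ _ t(1)]) (use \<beta>0 cos_\<beta>_pos t in auto)
  moreover have "- \<beta> t < pi/2"
    by (rule cos_pos_less_pi_half[of "\<lambda>s. - \<beta> s", OF _ _ _ t(1)])
      (use \<beta>0 cos_\<beta>_pos t profile_continuous(2)[OF sol] in auto)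
  ultimately show ?thesis by linarith
qed

end

text \<open>From time \<open>1\<close> on the energy has a positive lower bound, and
  \<open>cos \<theta>\<close> increases while \<open>\<theta>\<close> decreases to zero, so
  \<open>\<theta>\<close> falls at a definite rate.\<close>

lemma exit_time:
  obtains T where "T > 0" "\<theta> T < 0"
proof (rule ccontr)
  assume "\<not> thesis"
  then have "\<forall>t>0. \<theta> t \<ge> 0" using that by force
  then have nn: "\<theta> t \<ge> 0" if "t \<ge> 0" for t using that \<theta>0 by (cases "t = 0") auto
  have nnT: "\<forall>t\<in>{0..T}. \<theta> t \<ge> 0" for T using nn by simp
  define k where "k = 1/2 * (cos (\<theta> 0) * e 1)"
  have k: "k > 0" using e_pos[OF nnT, of 1 1] cos_\<theta>_pos by (simp add: k_def)
  \<comment> \<open>Counting starts at time \<open>1\<close> because \<open>e 0\<close> may vanish.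
    By time \<open>T\<close> the height has dropped by at least \<open>pi\<close>, more than the
    range of \<open>\<theta>\<close> allows.\<close>
  define T where "T = 1 + pi / k"
  have T: "T > 1" using k by (simp add: T_def)
  obtain z where z: "1 < z" "z < T" "\<theta> T - \<theta> 1 = (T - 1) * (- (1/2 * (cos (\<theta> z) * e z)))"
    using MVT2[OF T, of \<theta> "\<lambda>z. - (1/2 * (cos (\<theta> z) * e z))"] profile_solutionD(3)[OF sol] by blast
  have "e 1 \<le> e z" using z by (intro e_mono[OF nnT, of _ _ z]) auto
  moreover have "cos (\<theta> 0) \<le> cos (\<theta> z)"
  proof -
    have "\<theta> z < \<theta> 0" using z by (intro \<theta>_strict[OF nnT, of _ _ z]) auto
    then show ?thesis using nn[of z] z \<theta>0 by (intro cos_monotone_0_pi_le) auto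
  qed
  ultimately have "cos (\<theta> 0) * e 1 \<le> cos (\<theta> z) * e z"
    using cos_\<theta>_pos[of z] e_pos[OF nnT, of 1 1] by (intro mult_mono[of _ _ "e 1" "e z"]) auto
  then have "(T - 1) * k \<le> (T - 1) * (1/2 * (cos (\<theta> z) * e z))" using T by (intro mult_left_mono) (auto simp: k_def)
  moreover have "(T - 1) * k = pi" using k by (simp add: T_def)
  ultimately have "\<theta> T \<le> \<theta> 1 - pi" using z(3) by simp
  then show False using nn[of T] T \<theta>_range[of 1] pi_gt_zero by linarith
qed

text \<open>The quotient \<open>n = e / sin \<theta>\<close> satisfies \<open>n' \<ge> n\<^sup>2 / 4\<close> for small \<open>\<theta>\<close>, hence blows up in finite
  time; this forces the curve to the equator before \<open>\<beta>\<close> can change its sign.\<close>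

lemma descent_time:
  assumes T: "\<forall>t\<in>{0..T}. \<theta> t \<ge> 0" and \<theta>4: "\<theta> 0 \<le> pi/4"
    and t1: "0 \<le> t1" and n2: "n2 > 0" "t1 < T \<Longrightarrow> n2 * sin (\<theta> t1) \<le> e t1"
  shows "T \<le> t1 + 4 / n2"
proof (rule ccontr)
  assume "\<not> ?thesis"
  then have lt: "T > t1 + 4 / n2" by simp
  moreover have "4 / n2 > 0" using n2 by simp
  ultimately have T1: "t1 < T" by linarith
  define t2 where "t2 = t1 + 4 / n2"
  have t2: "t1 < t2" "t2 < T" using lt n2(1) by (auto simp: t2_def)
  have \<theta>pos: "\<theta> t > 0" if "0 \<le> t" "t < T" for t
  proof -
    have "\<theta> T < \<theta> t" by (rule \<theta>_strict[OF T that order.refl])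
    moreover have "\<theta> T \<ge> 0" using T that by auto
    ultimately show ?thesis by linarith
  qed
  have sp: "sin (\<theta> t) > 0" if "0 \<le> t" "t < T" for t
    using \<theta>pos[OF that] \<theta>_range[of t] by (intro sin_gt_zero) auto
  define n where "n t = e t / sin (\<theta> t)" for t
  have n: "(n has_real_derivative 3/2 * (sin (\<beta> t))\<^sup>2 * (cos (\<psi> t))\<^sup>2 + 1/2 * (cos (\<theta> t))\<^sup>2 * (n t)\<^sup>2) (at t)"
    if "0 \<le> t" "t < T" for t
  proof -
    have "((\<lambda>t. sin (\<theta> t)) has_real_derivative cos (\<theta> t) * (- (1/2 * (cos (\<theta> t) * e t)))) (at t)"
      by (rule derivative_eq_intros profile_solutionD(3)[OF sol] refl)+
    from DERIV_divide[OF profile_energy_derivative[OF sol] this] sp[OF that]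
    have "(n has_real_derivative (3/2 * sin (\<theta> t) * (sin (\<beta> t))\<^sup>2 * (cos (\<psi> t))\<^sup>2 * sin (\<theta> t)
        - e t * (cos (\<theta> t) * (- (1/2 * (cos (\<theta> t) * e t))))) / (sin (\<theta> t) * sin (\<theta> t))) (at t)"
      unfolding n_def[abs_def] by simp
    moreover have "(3/2 * sin (\<theta> t) * (sin (\<beta> t))\<^sup>2 * (cos (\<psi> t))\<^sup>2 * sin (\<theta> t)
        - e t * (cos (\<theta> t) * (- (1/2 * (cos (\<theta> t) * e t))))) / (sin (\<theta> t) * sin (\<theta> t))
      = 3/2 * (sin (\<beta> t))\<^sup>2 * (cos (\<psi> t))\<^sup>2 + 1/2 * (cos (\<theta> t))\<^sup>2 * (n t)\<^sup>2"
      using sp[OF that] by (simp add: n_def field_simps power2_eq_square)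
    ultimately show ?thesis by simp
  qed
  have c2: "(cos (\<theta> t))\<^sup>2 \<ge> 1/2" if "0 \<le> t" "t < T" for t
  proof -
    have "\<theta> t \<le> \<theta> 0" using \<theta>_strict[OF T, of 0 t] that by (cases "t = 0") auto
    then have "cos (pi/4) \<le> cos (\<theta> t)" using \<theta>pos[OF that] \<theta>4 by (intro cos_monotone_0_pi_le) auto
    then have "(cos (pi/4))\<^sup>2 \<le> (cos (\<theta> t))\<^sup>2" by (intro power_mono) (auto simp: cos_45)
    then show ?thesis by (simp add: cos_45 power_divide)
  qed
  have n1: "n t1 \<ge> n2" using n2(2)[OF T1] sp[of t1] t1 T1 by (simp add: n_def field_simps)
  have npos: "n t > 0" if "t1 \<le> t" "t \<le> t2" for t
  proof (cases "t = t1")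
    case True
    then show ?thesis using n1 n2 by simp
  next
    case False
    then show ?thesis using e_pos[OF T, of t] sp[of t] that t1 t2 by (simp add: n_def)
  qed
  \<comment> \<open>The differential inequality in integrated form. A start with
    \<open>n \<ge> n2\<close> at \<open>t1\<close> leaves room for \<open>1 / n > 0\<close> only up
    to \<open>t1 + 4 / n2 = t2\<close>.\<close>
  have "1 / n t2 + t2 / 4 \<le> 1 / n t1 + t1 / 4"
  proof (rule DERIV_nonpos_imp_nonincreasing[of t1 t2 "\<lambda>t. 1 / n t + t / 4"])
    show "t1 \<le> t2" using t2 by simp
  next
    fix t assume t: "t1 \<le> t" "t \<le> t2"
    then have t': "0 \<le> t" "t < T" using t1 t2 by auto
    define n' where "n' = 3/2 * (sin (\<beta> t))\<^sup>2 * (cos (\<psi> t))\<^sup>2 + 1/2 * (cos (\<theta> t))\<^sup>2 * (n t)\<^sup>2"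
    have "((\<lambda>t. 1 / n t + t / 4) has_real_derivative (- n' / (n t)\<^sup>2 + 1/4)) (at t)"
      using npos[OF t] n[OF t', folded n'_def] by (auto intro!: derivative_eq_intros simp: power2_eq_square)
    moreover have "1/4 * (n t)\<^sup>2 \<le> n'"
    proof -
      have "1/2 * (n t)\<^sup>2 \<le> (cos (\<theta> t))\<^sup>2 * (n t)\<^sup>2" using c2[OF t'] by (intro mult_right_mono) auto
      moreover have "0 \<le> 3/2 * (sin (\<beta> t))\<^sup>2 * (cos (\<psi> t))\<^sup>2" by simp
      ultimately show ?thesis unfolding n'_def by linarith
    qed
    then have "- n' / (n t)\<^sup>2 + 1/4 \<le> 0" using npos[OF t] by (simp add: field_simps)
    ultimately show "\<exists>y. ((\<lambda>t. 1 / n t + t / 4) has_real_derivative y) (at t) \<and> y \<le> 0" by blast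
  qed
  moreover have "1 / n t2 > 0" using npos[of t2] t2 by simp
  moreover have "1 / n t1 \<le> 1 / n2" using n1 n2 by (simp add: frac_le)
  moreover define a b c where "a = 1 / n t1" and "b = 1 / n t2" and "c = 1 / n2"
  ultimately have "b + t2 / 4 \<le> a + t1 / 4" "b > 0" "a \<le> c" by simp_all
  then have "(t2 - t1) / 4 < c" by argo
  then have "(t2 - t1) / 4 < 1 / n2" by (simp only: c_def)
  then show False using n2 by (simp add: t2_def)
qed

text \<open>While \<open>\<theta> \<ge> 0\<close>, the derivative of \<open>cos \<beta>\<close> is
  at most \<open>cos \<beta> + 3/2 * \<theta> 0\<close>. If both summands are small at the start,
  exponential growth during time \<open>\<tau>\<close> does not bring \<open>cos \<beta>\<close> up
  to the value \<open>1\<close> that it has at a zero of \<open>\<beta>\<close>.\<close>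

lemma \<beta>_stays_positive:
  assumes T: "0 \<le> T" "\<forall>t\<in>{0..T}. \<theta> t \<ge> 0" and \<beta>pos: "\<beta> 0 > 0"
    and small: "T \<le> \<tau>" "(cos (\<beta> 0) + 3/2 * \<theta> 0) * exp \<tau> < 1"
  shows "\<beta> T > 0"
proof (rule ccontr)
  assume "\<not> \<beta> T > 0"
  then have "\<exists>s\<ge>0. s \<le> T \<and> \<beta> s = 0"
    by (intro IVT2) (use T \<beta>pos profile_continuous(2)[OF sol] in auto)
  then obtain s where s: "0 \<le> s" "s \<le> T" "\<beta> s = 0" by blast
  define r where "r t = (cos (\<beta> t) + 3/2 * \<theta> 0) * exp (- t)" for t
  have "r s \<le> r 0"
  proof (rule DERIV_nonpos_imp_nonincreasing[OF s(1)])
    fix t assume t: "0 \<le> t" "t \<le> s"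
    define b where "b = - (3/2 * sin (\<theta> t) * (sin (\<beta> t) * cos (\<psi> t))) - sin (\<psi> t) * cos (\<beta> t)"
    have "(r has_real_derivative (- sin (\<beta> t) * b - (cos (\<beta> t) + 3/2 * \<theta> 0)) * exp (- t)) (at t)"
      unfolding r_def[abs_def]
      by (rule derivative_eq_intros profile_solutionD(2)[OF sol, of t, folded b_def] refl)+ (simp add: algebra_simps)
    moreover have "- sin (\<beta> t) * b \<le> cos (\<beta> t) + 3/2 * \<theta> 0"
    proof -
      have "e 0 \<le> e t" using t s by (intro e_mono[OF T(2)]) auto
      then have "e t \<ge> 0" using e0 by linarith
      then have cb: "cos (\<beta> t) \<ge> 0" using cos_\<psi>_pos[of t] by (simp add: zero_le_mult_iff)
      have th: "0 \<le> sin (\<theta> t)" "sin (\<theta> t) \<le> \<theta> 0"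
      proof -
        show "0 \<le> sin (\<theta> t)" using sin_\<theta>_nonneg[OF T(2)] t s by simp
        have "sin (\<theta> t) \<le> \<theta> t" using T(2) t s sin_x_le_x[of "\<theta> t"] by simp
        also have "\<theta> t \<le> \<theta> 0" using \<theta>_strict[OF T(2), of 0 t] t s by (cases "t = 0") auto
        finally show "sin (\<theta> t) \<le> \<theta> 0" .
      qed
      have "- sin (\<beta> t) * b = 3/2 * (sin (\<theta> t) * ((sin (\<beta> t))\<^sup>2 * cos (\<psi> t))) + (sin (\<beta> t) * sin (\<psi> t)) * cos (\<beta> t)"
        by (simp add: b_def power2_eq_square algebra_simps)
      also have "\<dots> \<le> 3/2 * (\<theta> 0 * 1) + 1 * cos (\<beta> t)"
      proof (intro add_mono mult_left_mono mult_mono mult_right_mono cb th)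
        have "(sin (\<beta> t))\<^sup>2 * cos (\<psi> t) \<le> 1 * 1"
          using cos_\<psi>_pos[of t] by (intro mult_mono) (auto simp: abs_square_le_1)
        then show "(sin (\<beta> t))\<^sup>2 * cos (\<psi> t) \<le> 1" by simp
        have "\<bar>sin (\<beta> t) * sin (\<psi> t)\<bar> \<le> 1 * 1" unfolding abs_mult by (intro mult_mono) auto
        then show "sin (\<beta> t) * sin (\<psi> t) \<le> 1" by simp
      qed (use \<theta>0 cos_\<psi>_pos[of t] in auto)
      finally show ?thesis by simp
    qed
    then have "(- sin (\<beta> t) * b - (cos (\<beta> t) + 3/2 * \<theta> 0)) * exp (- t) \<le> 0" by (intro mult_nonpos_nonneg) auto
    ultimately show "\<exists>y. (r has_real_derivative y) (at t) \<and> y \<le> 0" by blast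
  qed
  then have "(1 + 3/2 * \<theta> 0) * exp (- s) \<le> cos (\<beta> 0) + 3/2 * \<theta> 0" by (simp add: r_def s(3))
  then have "(1 + 3/2 * \<theta> 0) * exp (- s) * exp s \<le> (cos (\<beta> 0) + 3/2 * \<theta> 0) * exp s" by (intro mult_right_mono) auto
  then have "1 + 3/2 * \<theta> 0 \<le> (cos (\<beta> 0) + 3/2 * \<theta> 0) * exp s" by (simp add: mult.assoc flip: exp_add)
  also have "\<dots> \<le> (cos (\<beta> 0) + 3/2 * \<theta> 0) * exp \<tau>"
    using s small(1) \<theta>0 \<beta>0 by (intro mult_left_mono add_nonneg_nonneg cos_ge_zero) auto
  finally show False using small(2) \<theta>0 by linarith
qed

end

section \<open>Slices and oscillation\<close>

lemma uniformly_close_slice: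
  fixes f :: "real \<times> real \<Rightarrow> real"
  assumes f: "continuous_on (UNIV \<times> {a..b}) f" and c: "c \<in> {a..b}" and \<epsilon>: "\<epsilon> > 0"
  obtains \<delta> where "\<delta> > 0" "\<And>c' t. c' \<in> {a..b} \<Longrightarrow> \<bar>c' - c\<bar> < \<delta> \<Longrightarrow> t \<in> {0..T} \<Longrightarrow> \<bar>f (t, c') - f (t, c)\<bar> < \<epsilon>"
proof -
  have "uniformly_continuous_on ({0..T} \<times> {a..b}) f"
    by (intro compact_uniformly_continuous continuous_on_subset[OF f] compact_Times) auto
  then obtain \<delta> where \<delta>: "\<delta> > 0"
    "\<And>x x'. x \<in> {0..T} \<times> {a..b} \<Longrightarrow> x' \<in> {0..T} \<times> {a..b} \<Longrightarrow> dist x' x < \<delta> \<Longrightarrow> dist (f x') (f x) < \<epsilon>"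
    using \<epsilon> unfolding uniformly_continuous_on_def by metis
  show thesis
  proof (rule that[OF \<delta>(1)])
    fix c' t assume "c' \<in> {a..b}" "\<bar>c' - c\<bar> < \<delta>" "t \<in> {0..T}"
    then show "\<bar>f (t, c') - f (t, c)\<bar> < \<epsilon>"
      using \<delta>(2)[of "(t, c)" "(t, c')"] c by (simp add: dist_Pair_Pair dist_real_def)
  qed
qed

text \<open>The parameter is the infimum of those whose profile enters \<open>K\<close> before
  falling below the equator. Small parameters do not belong to this set; parameters near
  \<open>pi/2\<close> do, by continuity from the pole. At the infimum \<open>K\<close> is reached
  because the entry times are bounded and a subsequence converges. The open set \<open>K'\<close> is
  not reached above the equator, since slightly smaller parameters would reach it too.\<close>

lemma first_hit:
  fixes \<Psi> B \<Theta> :: "real \<times> real \<Rightarrow> real" and K K' :: "(real \<times> real) set"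
  assumes cont: "continuous_on (UNIV \<times> {0..pi/2}) \<Psi>" "continuous_on (UNIV \<times> {0..pi/2}) B"
      "continuous_on (UNIV \<times> {0..pi/2}) \<Theta>"
    and dp: "\<And>c. 0 < c \<Longrightarrow> c < pi/2 \<Longrightarrow> descending_profile (\<lambda>t. \<Psi> (t, c)) (\<lambda>t. B (t, c)) (\<lambda>t. \<Theta> (t, c))"
    and K: "closed K" "open K'" "K' \<subseteq> K"
    and small: "\<delta>0 > 0" "\<And>c T. 0 < c \<Longrightarrow> c < \<delta>0 \<Longrightarrow> T \<ge> 0 \<Longrightarrow> \<forall>t\<in>{0..T}. \<Theta> (t, c) \<ge> 0 \<Longrightarrow> (\<Psi> (T, c), B (T, c)) \<notin> K"
    and big: "T1 \<ge> 0" "(\<Psi> (T1, pi/2), B (T1, pi/2)) \<in> K'" "\<forall>t\<in>{0..T1}. \<Theta> (t, pi/2) = pi/2"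
  obtains c T where "0 < c" "c < pi/2" "T \<ge> 0" "\<forall>t\<in>{0..T}. \<Theta> (t, c) \<ge> 0" "(\<Psi> (T, c), B (T, c)) \<in> K"
    "\<And>t. t \<ge> 0 \<Longrightarrow> \<forall>s\<in>{0..t}. \<Theta> (s, c) > 0 \<Longrightarrow> (\<Psi> (t, c), B (t, c)) \<notin> K'"
proof -
  define C where "C = {c. 0 < c \<and> c < pi/2 \<and> (\<exists>T\<ge>0. (\<forall>t\<in>{0..T}. \<Theta> (t, c) \<ge> 0) \<and> (\<Psi> (T, c), B (T, c)) \<in> K)}"
  have near: "\<exists>\<delta>>0. \<forall>c'\<in>{0..pi/2}. \<bar>c' - c\<bar> < \<delta> \<longrightarrow> (\<forall>s\<in>{0..t}. \<Theta> (s, c') > 0) \<and> (\<Psi> (t, c'), B (t, c')) \<in> K'"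
    if c: "c \<in> {0..pi/2}" and t: "t \<ge> 0" "\<forall>s\<in>{0..t}. \<Theta> (s, c) > 0" "(\<Psi> (t, c), B (t, c)) \<in> K'" for c t
  proof -
    have "continuous_on {0..t} (\<lambda>s. \<Theta> (s, c))"
      by (rule continuous_on_compose2[OF cont(3)]) (use c in \<open>auto intro!: continuous_intros\<close>)
    then obtain s0 where s0: "s0 \<in> {0..t}" "\<And>s. s \<in> {0..t} \<Longrightarrow> \<Theta> (s0, c) \<le> \<Theta> (s, c)"
      using continuous_attains_inf[of "{0..t}"] t(1) by (auto simp: Bex_def Ball_def)
    have m: "\<Theta> (s0, c) > 0" using s0 t(2) by blast
    obtain \<epsilon> where \<epsilon>: "\<epsilon> > 0" "ball (\<Psi> (t, c), B (t, c)) \<epsilon> \<subseteq> K'"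
      using K(2) t(3) openE by blast
    have "\<epsilon>/2 > 0" using \<epsilon> by simp
    obtain \<delta>1 where \<delta>1: "\<delta>1 > 0" "\<And>c' s. c' \<in> {0..pi/2} \<Longrightarrow> \<bar>c' - c\<bar> < \<delta>1 \<Longrightarrow> s \<in> {0..t} \<Longrightarrow> \<bar>\<Theta> (s, c') - \<Theta> (s, c)\<bar> < \<Theta> (s0, c)"
      using uniformly_close_slice[OF cont(3) c m, of t] by blast
    obtain \<delta>2 where \<delta>2: "\<delta>2 > 0" "\<And>c' s. c' \<in> {0..pi/2} \<Longrightarrow> \<bar>c' - c\<bar> < \<delta>2 \<Longrightarrow> s \<in> {0..t} \<Longrightarrow> \<bar>\<Psi> (s, c') - \<Psi> (s, c)\<bar> < \<epsilon>/2"
      using uniformly_close_slice[OF cont(1) c \<open>\<epsilon>/2 > 0\<close>, of t] by blast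
    obtain \<delta>3 where \<delta>3: "\<delta>3 > 0" "\<And>c' s. c' \<in> {0..pi/2} \<Longrightarrow> \<bar>c' - c\<bar> < \<delta>3 \<Longrightarrow> s \<in> {0..t} \<Longrightarrow> \<bar>B (s, c') - B (s, c)\<bar> < \<epsilon>/2"
      using uniformly_close_slice[OF cont(2) c \<open>\<epsilon>/2 > 0\<close>, of t] by blast
    have "(\<forall>s\<in>{0..t}. \<Theta> (s, c') > 0) \<and> (\<Psi> (t, c'), B (t, c')) \<in> K'"
      if c': "c' \<in> {0..pi/2}" "\<bar>c' - c\<bar> < min \<delta>1 (min \<delta>2 \<delta>3)" for c'
    proof (intro conjI ballI)
      show "\<Theta> (s, c') > 0" if "s \<in> {0..t}" for s
        using \<delta>1(2)[of c' s] s0(2)[OF that] c' that by auto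
      have a: "\<bar>\<Psi> (t, c') - \<Psi> (t, c)\<bar> < \<epsilon>/2" "\<bar>B (t, c') - B (t, c)\<bar> < \<epsilon>/2"
        using \<delta>2(2)[of c' t] \<delta>3(2)[of c' t] c' t(1) by auto
      have "dist (\<Psi> (t, c), B (t, c)) (\<Psi> (t, c'), B (t, c')) \<le> \<bar>\<Psi> (t, c) - \<Psi> (t, c')\<bar> + \<bar>B (t, c) - B (t, c')\<bar>"
        using norm_Pair_le[of "\<Psi> (t, c) - \<Psi> (t, c')" "B (t, c) - B (t, c')"] by (simp add: dist_norm)
      then have "dist (\<Psi> (t, c), B (t, c)) (\<Psi> (t, c'), B (t, c')) < \<epsilon>" using a by linarith
      then show "(\<Psi> (t, c'), B (t, c')) \<in> K'" using \<epsilon>(2) by auto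
    qed
    then show ?thesis using \<delta>1(1) \<delta>2(1) \<delta>3(1) by (intro exI[of _ "min \<delta>1 (min \<delta>2 \<delta>3)"]) auto
  qed
  have inC: "c' \<in> C" if "0 < c'" "c' < pi/2" "t \<ge> 0" "\<forall>s\<in>{0..t}. \<Theta> (s, c') > 0" "(\<Psi> (t, c'), B (t, c')) \<in> K'" for c' t
    using that K(3) unfolding C_def by (auto intro!: exI[of _ t] less_imp_le)
  have "\<exists>c. c \<in> C"
  proof -
    have "\<forall>s\<in>{0..T1}. \<Theta> (s, pi/2) > 0" using big(3) pi_half_gt_zero by metis
    then obtain \<delta> where \<delta>: "\<delta> > 0" "\<forall>c'\<in>{0..pi/2}. \<bar>c' - pi/2\<bar> < \<delta> \<longrightarrow> (\<forall>s\<in>{0..T1}. \<Theta> (s, c') > 0) \<and> (\<Psi> (T1, c'), B (T1, c')) \<in> K'"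
      using near[of "pi/2" T1] big(1,2) by auto
    define c' where "c' = pi/2 - min (\<delta>/2) (pi/4)"
    have "0 < c'" "c' < pi/2" "\<bar>c' - pi/2\<bar> < \<delta>" using \<delta>(1) pi_gt_zero by (auto simp: c'_def min_def)
    then show ?thesis using inC[of c' T1] \<delta>(2) big(1) by auto
  qed
  then have ne: "C \<noteq> {}" by blast
  have bb: "bdd_below C" unfolding C_def by (auto intro!: bdd_belowI[of _ 0])
  define c where "c = Inf C"
  have "\<delta>0 \<le> x" if "x \<in> C" for x
    using that small(2)[of x] unfolding C_def by (auto simp: not_less[symmetric])
  then have "\<delta>0 \<le> c" unfolding c_def using ne by (intro cInf_greatest)
  then have c0: "c > 0" using small(1) by simp
  have c1: "c < pi/2"
  proof -
    obtain x where x: "x \<in> C" using ne by blast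
    then have "c \<le> x" unfolding c_def by (rule cInf_lower[OF _ bb])
    then show ?thesis using x unfolding C_def by auto
  qed
  have cI: "c \<in> {0..pi/2}" using c0 c1 by auto
  interpret dpc: descending_profile "\<lambda>t. \<Psi> (t, c)" "\<lambda>t. B (t, c)" "\<lambda>t. \<Theta> (t, c)" by (rule dp[OF c0 c1])
  \<comment> \<open>Profiles with parameter near \<open>c\<close> are below the equator at time
    \<open>Te\<close>, which bounds the entry times along the minimising sequence.\<close>
  obtain Te where Te: "Te > 0" "\<Theta> (Te, c) < 0" using dpc.exit_time by blast
  obtain \<delta>e where \<delta>e: "\<delta>e > 0" "\<And>c' s. c' \<in> {0..pi/2} \<Longrightarrow> \<bar>c' - c\<bar> < \<delta>e \<Longrightarrow> s \<in> {0..Te} \<Longrightarrow> \<bar>\<Theta> (s, c') - \<Theta> (s, c)\<bar> < - \<Theta> (Te, c)"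
    using uniformly_close_slice[OF cont(3) cI, of "- \<Theta> (Te, c)" Te] Te(2) by auto
  have "\<exists>x\<in>C. x < c + min \<delta>e (1 / real (Suc n))" for n
  proof -
    have "c < c + min \<delta>e (1 / real (Suc n))" using \<delta>e(1) by simp
    then show ?thesis using cInf_lessD[OF ne] unfolding c_def by blast
  qed
  then obtain x where x: "\<And>n. x n \<in> C" "\<And>n. x n < c + min \<delta>e (1 / real (Suc n))" by metis
  have xc: "c \<le> x n" for n unfolding c_def by (rule cInf_lower[OF x(1) bb])
  have xI: "x n \<in> {0..pi/2}" for n using x(1)[of n] unfolding C_def by auto
  have "\<exists>T\<ge>0. (\<forall>t\<in>{0..T}. \<Theta> (t, x n) \<ge> 0) \<and> (\<Psi> (T, x n), B (T, x n)) \<in> K" for n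
    using x(1)[of n] unfolding C_def by blast
  then obtain T where T: "\<And>n. T n \<ge> 0" "\<And>n. \<forall>t\<in>{0..T n}. \<Theta> (t, x n) \<ge> 0" "\<And>n. (\<Psi> (T n, x n), B (T n, x n)) \<in> K"
    by metis
  have TTe: "T n \<le> Te" for n
  proof (rule ccontr)
    assume "\<not> T n \<le> Te"
    then have "\<Theta> (Te, x n) \<ge> 0" using T(2)[of n] Te(1) by auto
    moreover have "\<bar>x n - c\<bar> < \<delta>e" using xc[of n] x(2)[of n] by auto
    ultimately show False using \<delta>e(2)[OF xI[of n], of Te] Te by auto
  qed
  have "x \<longlonglongrightarrow> c"
  proof (rule real_tendsto_sandwich[of "\<lambda>_. c" x _ "\<lambda>n. c + 1 / real (Suc n)"])
    show "\<forall>\<^sub>F n in sequentially. c \<le> x n" using xc by simp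
    show "\<forall>\<^sub>F n in sequentially. x n \<le> c + 1 / real (Suc n)"
      using x(2) by (intro always_eventually allI) (smt (verit) min.cobounded2)
    show "(\<lambda>n. c + 1 / real (Suc n)) \<longlonglongrightarrow> c"
      using tendsto_add[OF tendsto_const LIMSEQ_inverse_real_of_nat, of c] by (simp add: inverse_eq_divide)
  qed simp
  have "compact {0..Te}" by simp
  then obtain T' r where T': "T' \<in> {0..Te}" "strict_mono r" "(T \<circ> r) \<longlonglongrightarrow> T'"
    unfolding compact_def using T(1) TTe by (metis atLeastAtMost_iff)
  have xr: "(x \<circ> r) \<longlonglongrightarrow> c" using \<open>x \<longlonglongrightarrow> c\<close> T'(2) LIMSEQ_subseq_LIMSEQ by blast
  have lim: "(\<lambda>n. f (s n, x (r n))) \<longlonglongrightarrow> f (s', c)"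
    if f: "continuous_on (UNIV \<times> {0..pi/2}) f" and s: "s \<longlonglongrightarrow> s'" for f :: "real \<times> real \<Rightarrow> real" and s s'
  proof (rule continuous_on_tendsto_compose[OF f, of "\<lambda>n. (s n, x (r n))" "(s', c)"])
    show "(\<lambda>n. (s n, x (r n))) \<longlonglongrightarrow> (s', c)" using s xr by (auto intro!: tendsto_Pair simp: o_def)
  qed (use cI xI in auto)
  have T'0: "\<Theta> (t, c) \<ge> 0" if t: "0 \<le> t" "t < T'" for t
  proof (rule tendsto_lowerbound[OF lim[OF cont(3) tendsto_const]])
    have "\<forall>\<^sub>F n in sequentially. t < (T \<circ> r) n" using T'(3) t(2) by (rule order_tendstoD)
    then show "\<forall>\<^sub>F n in sequentially. 0 \<le> \<Theta> (t, x (r n))"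
      by eventually_elim (use T(2) t(1) in auto)
  qed simp
  have T'1: "\<Theta> (T', c) \<ge> 0"
  proof (rule tendsto_lowerbound[OF lim[OF cont(3)]])
    show "(\<lambda>n. T (r n)) \<longlonglongrightarrow> T'" using T'(3) by (simp add: o_def)
    show "\<forall>\<^sub>F n in sequentially. 0 \<le> \<Theta> (T (r n), x (r n))"
      using T(1,2) by (intro always_eventually allI) auto
  qed simp
  have inK: "(\<Psi> (T', c), B (T', c)) \<in> K"
  proof (rule closed_sequentially[OF K(1)])
    have Tr: "(\<lambda>n. T (r n)) \<longlonglongrightarrow> T'" using T'(3) by (simp add: o_def)
    show "(\<lambda>n. (\<Psi> (T (r n), x (r n)), B (T (r n), x (r n)))) \<longlonglongrightarrow> (\<Psi> (T', c), B (T', c))"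
      by (intro tendsto_Pair lim cont(1,2) Tr)
    show "(\<Psi> (T (r n), x (r n)), B (T (r n), x (r n))) \<in> K" for n by (rule T(3))
  qed
  have notK: "(\<Psi> (t, c), B (t, c)) \<notin> K'" if t: "t \<ge> 0" "\<forall>s\<in>{0..t}. \<Theta> (s, c) > 0" for t
  proof
    assume "(\<Psi> (t, c), B (t, c)) \<in> K'"
    then obtain \<delta> where \<delta>: "\<delta> > 0" "\<forall>c'\<in>{0..pi/2}. \<bar>c' - c\<bar> < \<delta> \<longrightarrow> (\<forall>s\<in>{0..t}. \<Theta> (s, c') > 0) \<and> (\<Psi> (t, c'), B (t, c')) \<in> K'"
      using near[OF cI t] by blast
    \<comment> \<open>Positive, smaller than the infimum, and close enough to \<open>c\<close> for
      the continuity statement.\<close>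
    define c' where "c' = c - min (\<delta>/2) (c/2)"
    have c': "0 < c'" "c' < c" "\<bar>c' - c\<bar> < \<delta>" using \<delta>(1) c0 by (auto simp: c'_def min_def)
    then have "c' \<in> C" using inC[of c' t] \<delta>(2) t(1) c1 by auto
    then have "c \<le> c'" unfolding c_def by (rule cInf_lower[OF _ bb])
    then show False using c' by simp
  qed
  have all: "\<forall>t\<in>{0..T'}. \<Theta> (t, c) \<ge> 0"
  proof
    fix t assume "t \<in> {0..T'}"
    then show "\<Theta> (t, c) \<ge> 0" using T'0[of t] T'1 by (cases "t = T'") auto
  qed
  show thesis
    by (rule that[OF c0 c1 _ all inK notK]) (use T'(1) in auto)
qed

text \<open>On the invariant set \<open>\<theta> = \<pi>/2\<close> the field describes torus-invariant minimal hypersurfaces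
  of \<open>\<real>\<^sup>4\<close>; the vector \<open>(sin \<psi>, sin \<beta>)\<close> rotates clockwise at a definite rate there.\<close>

lemma cone_oscillation:
  assumes sol: "profile_solution \<psi> \<beta> \<theta>" and \<theta>: "\<And>t. \<theta> t = pi/2"
    and \<psi>: "\<bar>\<psi> a\<bar> < pi/2" and \<beta>: "\<bar>\<beta> a\<bar> < pi/2" and ne: "\<psi> a \<noteq> 0 \<or> \<beta> a \<noteq> 0"
  obtains T where "T \<ge> a" "\<psi> T < 0" "\<beta> T < 0"
proof -
  define e where "e t = cos (\<psi> t) * cos (\<beta> t)" for t
  have cpa: "cos (\<psi> a) > 0" "cos (\<beta> a) > 0" using \<psi> \<beta> by (auto intro!: cos_gt_zero_pi)
  have cp: "cos (\<psi> t) > 0" for t by (rule profile_cos_pos(2)[OF sol cpa(1)])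
  have ea: "e a > 0" using cpa by (simp add: e_def)
  have em: "e a \<le> e t" if "a \<le> t" for t
    unfolding e_def using that by (intro profile_energy_mono[OF sol]) (simp_all add: \<theta>)
  have cb: "cos (\<beta> t) \<ge> e a" if "a \<le> t" for t
  proof -
    have "cos (\<psi> t) * cos (\<beta> t) > 0" using em[OF that] ea unfolding e_def[of t] by linarith
    then have pos: "cos (\<beta> t) > 0" using cp[of t] by (simp add: zero_less_mult_iff)
    have "e a \<le> cos (\<psi> t) * cos (\<beta> t)" using em[OF that] by (simp add: e_def)
    also have "\<dots> \<le> 1 * cos (\<beta> t)" using pos by (intro mult_right_mono) auto
    finally show ?thesis by simp
  qed
  have cps: "cos (\<psi> t) \<ge> e a" if "a \<le> t" for t
  proof -
    have "e a \<le> cos (\<psi> t) * cos (\<beta> t)" using em[OF that] by (simp add: e_def)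
    also have "\<dots> \<le> cos (\<psi> t) * 1" using cp[of t] by (intro mult_left_mono) auto
    finally show ?thesis by simp
  qed
  have \<psi>r: "\<bar>\<psi> t\<bar> < pi/2" for t by (rule cos_pos_range[OF profile_continuous(1)[OF sol] cp \<psi>])
  have \<beta>r: "\<bar>\<beta> t\<bar> < pi/2" if "a \<le> t" for t
  proof (cases "t = a")
    case False
    have c: "isCont (\<lambda>s. \<beta> (a + s)) s" for s
      by (rule isCont_o2[where f = "\<lambda>s. a + s"]) (intro continuous_intros, rule profile_continuous(2)[OF sol])
    have "\<beta> (a + (t - a)) < pi/2"
      by (rule cos_pos_less_pi_half[of "\<lambda>s. \<beta> (a + s)", OF c]) (use \<beta> False that cb ea in \<open>auto intro: order_less_le_trans\<close>)
    moreover have "- \<beta> (a + (t - a)) < pi/2"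
      by (rule cos_pos_less_pi_half[of "\<lambda>s. - \<beta> (a + s)"]) (use \<beta> False that cb ea c in \<open>auto intro: order_less_le_trans\<close>)
    ultimately show ?thesis by simp
  qed (use \<beta> in simp)
  have "(e a)\<^sup>2 < 1"
  proof -
    have "cos (\<psi> a) < 1 \<or> cos (\<beta> a) < 1"
    proof (rule ccontr)
      assume "\<not> ?thesis"
      then have "cos (\<psi> a) = 1" "cos (\<beta> a) = 1" using cos_le_one[of "\<psi> a"] cos_le_one[of "\<beta> a"] by linarith+
      then have "sin (\<psi> a) = 0" "sin (\<beta> a) = 0" using sin_cos_squared_add[of "\<psi> a"] sin_cos_squared_add[of "\<beta> a"] by auto
      then have "\<psi> a = 0" "\<beta> a = 0" using sin_eq_0_pi[of "\<psi> a"] sin_eq_0_pi[of "\<beta> a"] \<psi> \<beta> pi_gt_zero by (simp_all add: abs_less_iff)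
      then show False using ne by simp
    qed
    then have "e a < 1"
    proof
      assume "cos (\<psi> a) < 1"
      then have "cos (\<psi> a) * cos (\<beta> a) < 1 * cos (\<beta> a)" using cpa by (intro mult_strict_right_mono) auto
      then show ?thesis using cos_le_one[of "\<beta> a"] unfolding e_def by linarith
    next
      assume "cos (\<beta> a) < 1"
      then have "cos (\<psi> a) * cos (\<beta> a) < cos (\<psi> a) * 1" using cpa by (intro mult_strict_left_mono) auto
      then show ?thesis using cos_le_one[of "\<psi> a"] unfolding e_def by linarith
    qed
    then show ?thesis using ea by (simp add: power_less_one_iff)
  qed
  then have e1: "(e t)\<^sup>2 < 1" for t unfolding e_def by (rule profile_energy_less_1[OF sol])
  \<comment> \<open>In the range where they are used the sines have the signs of the angles;
    \<open>R > 0\<close> then says that the equilibrium is avoided.\<close>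
  define X Y where "X t = sin (\<psi> t)" and "Y t = sin (\<beta> t)" for t
  define X' Y' where "X' t = cos (\<psi> t) * (sin (\<beta> t) * cos (\<psi> t))"
    and "Y' t = cos (\<beta> t) * (- (3/2 * (sin (\<beta> t) * cos (\<psi> t))) - sin (\<psi> t) * cos (\<beta> t))" for t
  define R where "R t = (X t)\<^sup>2 + (Y t)\<^sup>2" for t
  have R: "R t > 0" for t
  proof (rule ccontr)
    assume "\<not> R t > 0"
    then have "R t = 0" unfolding R_def by (smt (verit) zero_le_power2)
    then have "X t = 0" "Y t = 0" by (simp_all add: R_def)
    then have "(cos (\<psi> t))\<^sup>2 = 1" "(cos (\<beta> t))\<^sup>2 = 1" by (simp_all add: X_def Y_def cos_squared_eq)
    then have "(e t)\<^sup>2 = 1" by (simp add: e_def power_mult_distrib)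
    then show False using e1[of t] by simp
  qed
  have dX: "(X has_real_derivative X' t) (at t)" for t
    unfolding X_def[abs_def] X'_def by (rule derivative_eq_intros profile_solutionD(1)[OF sol] refl)+
  have dY: "(Y has_real_derivative Y' t) (at t)" for t
    unfolding Y_def[abs_def] Y'_def using profile_solutionD(2)[OF sol, of t]
    by (auto intro!: derivative_eq_intros simp: \<theta>)
  define w where "w t = (X t * Y' t - Y t * X' t) / R t" for t
  define q where "q t = (X t * X' t + Y t * Y' t) / R t" for t
  have cXY: "continuous_on UNIV X" "continuous_on UNIV Y" "continuous_on UNIV X'" "continuous_on UNIV Y'"
    unfolding X_def[abs_def] Y_def[abs_def] X'_def[abs_def] Y'_def[abs_def]
    by (intro continuous_intros profile_continuous_on[OF sol])+
  have Rne: "(X t)\<^sup>2 + (Y t)\<^sup>2 \<noteq> 0" for t using R[of t] unfolding R_def by (rule less_imp_neq[THEN not_sym])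
  have cw: "continuous_on UNIV w"
    unfolding w_def[abs_def] R_def by (intro continuous_intros cXY ballI Rne)
  have cq: "continuous_on UNIV q"
    unfolding q_def[abs_def] R_def by (intro continuous_intros cXY ballI Rne)
  have sq: "(X t / sqrt (R t))\<^sup>2 + (Y t / sqrt (R t))\<^sup>2 = 1" for t
  proof -
    have "(sqrt (R t))\<^sup>2 = R t" using R[of t] by simp
    then have "(X t / sqrt (R t))\<^sup>2 + (Y t / sqrt (R t))\<^sup>2 = ((X t)\<^sup>2 + (Y t)\<^sup>2) / R t"
      by (simp add: power_divide add_divide_distrib)
    also have "\<dots> = 1" using R[of t] unfolding R_def[symmetric] by simp
    finally show ?thesis .
  qed
  obtain \<alpha>0 where \<alpha>0: "X a / sqrt (R a) = cos \<alpha>0" "Y a / sqrt (R a) = sin \<alpha>0"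
    using sincos_total_2pi[OF sq[of a]] by metis
  define A where "A t = t *\<^sub>R integral {0..1} (\<lambda>z. w (t * z))" for t
  have A: "(A has_real_derivative w t) (at t)" for t
  proof -
    have "continuous_on {-(\<bar>t\<bar> + 1)..\<bar>t\<bar> + 1} w" using cw by (rule continuous_on_subset) simp
    then have "(A has_vector_derivative w t) (at t)"
      unfolding A_def[abs_def] by (rule averaged_primitive_derivative) linarith
    then show ?thesis by (simp add: has_real_derivative_iff_has_vector_derivative)
  qed
  \<comment> \<open>A continuous polar angle of \<open>(X, Y)\<close>, obtained by integrating the
    angular velocity \<open>w\<close> from an initial angle instead of choosing branches.\<close>
  define \<alpha> where "\<alpha> t = \<alpha>0 + A t - A a" for t
  have d\<alpha>: "(\<alpha> has_real_derivative w t) (at t)" for t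
    unfolding \<alpha>_def[abs_def] by (auto intro!: derivative_eq_intros A)
  have lin: "X' t = q t * X t - w t * Y t" "Y' t = w t * X t + q t * Y t" for t
  proof -
    have "R t * X' t = (X t * X' t + Y t * Y' t) * X t - (X t * Y' t - Y t * X' t) * Y t"
      "R t * Y' t = (X t * Y' t - Y t * X' t) * X t + (X t * X' t + Y t * Y' t) * Y t"
      unfolding R_def by algebra+
    then show "X' t = q t * X t - w t * Y t" "Y' t = w t * X t + q t * Y t"
      using R[of t] unfolding q_def w_def by (auto simp: field_simps)
  qed
  \<comment> \<open>Coordinates of \<open>(X, Y)\<close> in the frame turned by
    \<open>\<alpha>\<close>. Both solve the same scalar linear equation, so \<open>V\<close> stays
    zero and \<open>U\<close> stays positive, which confirms that \<open>\<alpha>\<close> is the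
    polar angle.\<close>
  define U V where "U t = X t * cos (\<alpha> t) + Y t * sin (\<alpha> t)" and "V t = - X t * sin (\<alpha> t) + Y t * cos (\<alpha> t)" for t
  have dU: "(U has_real_derivative q t * U t) (at t)" for t
    unfolding U_def[abs_def]
    by (rule derivative_eq_intros dX dY d\<alpha> refl)+ (simp add: lin algebra_simps)
  obtain E where E: "\<And>t. E t > 0" "\<And>t. U t = U a * E t" using linear_ode_sign[OF dU cq, where s = a] by blast
  have dV: "(V has_real_derivative q t * V t) (at t)" for t
    unfolding V_def[abs_def]
    by (rule derivative_eq_intros dX dY d\<alpha> refl)+ (simp add: lin algebra_simps)
  obtain E' where E': "\<And>t. E' t > 0" "\<And>t. V t = V a * E' t" using linear_ode_sign[OF dV cq, where s = a] by blast
  have XYa: "X a = sqrt (R a) * cos (\<alpha> a)" "Y a = sqrt (R a) * sin (\<alpha> a)"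
    using \<alpha>0 R[of a] by (simp_all add: \<alpha>_def field_simps)
  have cs: "cos x * cos x + sin x * sin x = 1" for x :: real
    using sin_cos_squared_add2[of x] by (simp add: power2_eq_square)
  have "V a = 0" unfolding V_def XYa by simp
  then have V: "V t = 0" for t using E'(2)[of t] by simp
  have "U a = sqrt (R a) * (cos (\<alpha> a) * cos (\<alpha> a) + sin (\<alpha> a) * sin (\<alpha> a))" unfolding U_def XYa by algebra
  then have "U a > 0" using R[of a] by (simp add: cs)
  then have U: "U t > 0" for t using E(1)[of t] E(2)[of t] by simp
  have XY: "X t = U t * cos (\<alpha> t)" "Y t = U t * sin (\<alpha> t)" for t
  proof -
    have "X t * (cos (\<alpha> t) * cos (\<alpha> t) + sin (\<alpha> t) * sin (\<alpha> t)) = U t * cos (\<alpha> t) - V t * sin (\<alpha> t)"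
      "Y t * (cos (\<alpha> t) * cos (\<alpha> t) + sin (\<alpha> t) * sin (\<alpha> t)) = U t * sin (\<alpha> t) + V t * cos (\<alpha> t)"
      unfolding U_def V_def by algebra+
    then show "X t = U t * cos (\<alpha> t)" "Y t = U t * sin (\<alpha> t)" by (simp_all add: cs V)
  qed
  define r where "r = (e a)\<^sup>2 / 4"
  have r: "r > 0" using ea by (simp add: r_def)
  have wr: "w t \<le> - r" if t: "a \<le> t" for t
  proof -
    define p s where "p = sin (\<psi> t) * cos (\<beta> t)" and "s = sin (\<beta> t) * cos (\<psi> t)"
    \<comment> \<open>The angular momentum is minus a quadratic form with negative discriminant
      \<open>9/4 - 4\<close>; being definite, it never lets the rotation stop.\<close>
    have "X t * Y' t - Y t * X' t = - (p\<^sup>2 + 3/2 * p * s + s\<^sup>2)"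
      unfolding X_def Y_def X'_def Y'_def p_def s_def by algebra
    also have "\<dots> \<le> - (1/4 * (p\<^sup>2 + s\<^sup>2))"
    proof -
      have "p\<^sup>2 + 3/2 * p * s + s\<^sup>2 - 1/4 * (p\<^sup>2 + s\<^sup>2) = 3/4 * (p + s)\<^sup>2" by algebra
      moreover have "3/4 * (p + s)\<^sup>2 \<ge> 0" by simp
      ultimately show ?thesis by linarith
    qed
    also have "\<dots> \<le> - (1/4 * ((e a)\<^sup>2 * R t))"
    proof -
      have "(X t)\<^sup>2 * (e a)\<^sup>2 \<le> (X t)\<^sup>2 * (cos (\<beta> t))\<^sup>2" using cb[OF t] ea by (intro mult_left_mono power_mono) auto
      moreover have "(Y t)\<^sup>2 * (e a)\<^sup>2 \<le> (Y t)\<^sup>2 * (cos (\<psi> t))\<^sup>2" using cps[OF t] ea by (intro mult_left_mono power_mono) auto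
      ultimately have "(e a)\<^sup>2 * R t \<le> p\<^sup>2 + s\<^sup>2" unfolding p_def s_def R_def X_def Y_def by (simp add: power_mult_distrib algebra_simps)
      then show ?thesis by simp
    qed
    finally have "w t \<le> - (1/4 * ((e a)\<^sup>2 * R t)) / R t"
      unfolding w_def using R[of t] by (intro divide_right_mono) auto
    then show ?thesis using R[of t] by (simp add: r_def)
  qed
  obtain n :: nat where n: "real n \<ge> \<bar>\<alpha> a\<bar>" using real_arch_simple by blast
  \<comment> \<open>The middle of the third quadrant, enough turns down to lie below the initial
    angle. Since the angle falls at rate at least \<open>r\<close>, it passes
    \<open>y\<close>.\<close>
  define y where "y = - (pi/2 + pi/4 + 2 * real n * pi)"
  have "real n * 1 \<le> real n * (2 * pi)" using pi_gt3 by (intro mult_left_mono) auto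
  then have "real n \<le> 2 * real n * pi" by (simp add: mult_ac)
  then have ya: "y \<le> \<alpha> a" using n pi_gt_zero unfolding y_def by linarith
  define T where "T = a + (\<alpha> a - y) / r"
  have Ta: "a \<le> T" using ya r by (simp add: T_def)
  have "\<alpha> T + r * T \<le> \<alpha> a + r * a"
  proof (rule DERIV_nonpos_imp_nonincreasing[OF Ta, of "\<lambda>t. \<alpha> t + r * t"])
    fix t assume "a \<le> t" "t \<le> T"
    then show "\<exists>y. ((\<lambda>t. \<alpha> t + r * t) has_real_derivative y) (at t) \<and> y \<le> 0"
      using wr[of t] by (intro exI[of _ "w t + r"]) (auto intro!: derivative_eq_intros d\<alpha>)
  qed
  moreover have "r * T = r * a + (\<alpha> a - y)" using r by (simp add: T_def field_simps)
  ultimately have "\<alpha> T \<le> y" by linarith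
  then obtain t where t: "a \<le> t" "\<alpha> t = y"
    using IVT2[of \<alpha> T y a] ya Ta DERIV_isCont[OF d\<alpha>] by blast
  have "cos y = - sin (pi/4)" "sin y = - cos (pi/4)"
    unfolding y_def cos_minus sin_minus cos_add sin_add cos_2npi sin_2npi cos_pi_half sin_pi_half by simp_all
  then have "cos y < 0" "sin y < 0" by (simp_all add: sin_45 cos_45)
  then have neg: "X t < 0" "Y t < 0" using XY[of t] U[of t] t by (simp_all add: mult_pos_neg)
  have "\<psi> t < 0"
  proof (rule ccontr)
    assume "\<not> \<psi> t < 0"
    then have "sin (\<psi> t) \<ge> 0" using \<psi>r[of t] pi_gt_zero by (intro sin_ge_zero) linarith+
    then show False using neg(1) by (simp add: X_def)
  qed
  moreover have "\<beta> t < 0"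
  proof (rule ccontr)
    assume "\<not> \<beta> t < 0"
    then have "sin (\<beta> t) \<ge> 0" using \<beta>r[OF t(1)] pi_gt_zero by (intro sin_ge_zero) linarith+
    then show False using neg(2) by (simp add: Y_def)
  qed
  ultimately show thesis by (rule that[OF t(1)])
qed

section \<open>Shooting\<close>

lemma isCont_pos_right:
  fixes f :: "real \<Rightarrow> real"
  assumes "isCont f T" "\<forall>t\<in>{0..T}. f t > 0" "T \<ge> 0"
  obtains d where "d > 0" "\<forall>t\<in>{0..T + d}. f t > 0"
proof -
  have "f T > 0" using assms by simp
  then obtain d where d: "d > 0" "\<forall>x. dist x T < d \<longrightarrow> dist (f x) (f T) < f T"
    using assms(1) unfolding continuous_at_eps_delta by (metis dist_norm real_norm_def)
  have "\<forall>t\<in>{0..T + d/2}. f t > 0"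
  proof
    fix t assume t: "t \<in> {0..T + d/2}"
    show "f t > 0"
    proof (cases "t \<le> T")
      case False
      then have "dist t T < d" using t d(1) by (auto simp: dist_real_def)
      then show ?thesis using d(2) by (auto simp: dist_real_def)
    qed (use assms t in auto)
  qed
  then show thesis using that[of "d/2"] d(1) by simp
qed

lemma isCont_neg_left:
  fixes f :: "real \<Rightarrow> real"
  assumes "isCont f T" "f T < 0"
  obtains d where "d > 0" "\<And>t. \<bar>t - T\<bar> < d \<Longrightarrow> f t < 0"
proof -
  obtain d where d: "d > 0" "\<forall>x. dist x T < d \<longrightarrow> dist (f x) (f T) < - f T"
    using assms unfolding continuous_at_eps_delta by (metis dist_norm neg_0_less_iff_less real_norm_def)
  show thesis
  proof (rule that[OF d(1)])
    fix t assume "\<bar>t - T\<bar> < d"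
    then have "dist (f t) (f T) < - f T" using d(2) by (simp add: dist_real_def)
    then show "f t < 0" by (auto simp: dist_real_def)
  qed
qed

lemma derivative_bound:
  fixes f f' :: "real \<Rightarrow> real"
  assumes f: "\<And>t. (f has_real_derivative f' t) (at t)" and k: "\<And>t. \<bar>f' t\<bar> \<le> k" and t: "t \<ge> 0"
  shows "\<bar>f t - f 0\<bar> \<le> k * t"
proof (cases "t = 0")
  case False
  then have "0 < t" using t by simp
  from MVT2[OF this, of f f'] f obtain z where "f t - f 0 = (t - 0) * f' z" by blast
  then have "\<bar>f t - f 0\<bar> = t * \<bar>f' z\<bar>" using t by (simp add: abs_mult)
  also have "\<dots> \<le> t * k" using k t by (intro mult_left_mono)
  finally show ?thesis by (simp add: mult.commute)
qed simp

text \<open>\<open>cos \<theta>\<close> stays zero, so \<open>\<theta>'\<close> vanishes. This plane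
  carries the limit problem at the upper end of the shooting range.\<close>

lemma profile_pole_invariant:
  assumes "profile_solution \<psi> \<beta> \<theta>" "\<theta> 0 = pi/2"
  shows "\<theta> t = pi/2"
proof -
  have "cos (\<theta> s) = 0" for s by (rule profile_cos_pos(3)[OF assms(1), of 0]) (simp only: assms(2) cos_pi_half)
  then have "\<And>s. (\<theta> has_real_derivative 0) (at s)" using profile_solutionD(3)[OF assms(1)] by simp
  then show ?thesis using DERIV_isconst_all[of \<theta> t 0] assms(2) by metis
qed

lemma profile_family:
  fixes P :: "real \<Rightarrow> real \<times> real \<times> real"
  assumes "continuous_on {0..pi/2} P"
  obtains \<Psi> B \<Theta> :: "real \<times> real \<Rightarrow> real"
  where "continuous_on (UNIV \<times> {0..pi/2}) \<Psi>" "continuous_on (UNIV \<times> {0..pi/2}) B" "continuous_on (UNIV \<times> {0..pi/2}) \<Theta>"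
    "\<And>c. \<Psi> (0, c) = fst (P c)" "\<And>c. B (0, c) = fst (snd (P c))" "\<And>c. \<Theta> (0, c) = snd (snd (P c))"
    "\<And>c. profile_solution (\<lambda>t. \<Psi> (t, c)) (\<lambda>t. B (t, c)) (\<lambda>t. \<Theta> (t, c))"
proof -
  obtain \<Psi>0 B0 \<Theta>0 :: "real \<Rightarrow> real \<times> real \<times> real \<Rightarrow> real" where
    c: "continuous_on UNIV (\<lambda>(t, p). \<Psi>0 t p)" "continuous_on UNIV (\<lambda>(t, p). B0 t p)"
    "continuous_on UNIV (\<lambda>(t, p). \<Theta>0 t p)" and
    i: "\<And>p. \<Psi>0 0 p = fst p" "\<And>p. B0 0 p = fst (snd p)" "\<And>p. \<Theta>0 0 p = snd (snd p)" and
    s: "\<And>p. profile_solution (\<lambda>t. \<Psi>0 t p) (\<lambda>t. B0 t p) (\<lambda>t. \<Theta>0 t p)"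
    by (rule profile_flow) (rule that; assumption)
  have P: "continuous_on (UNIV \<times> {0..pi/2}) (\<lambda>q. (fst q, P (snd q)))"
    by (intro continuous_intros continuous_on_compose2[OF assms]) auto
  have cc: "continuous_on (UNIV \<times> {0..pi/2}) (\<lambda>q. F (fst q) (P (snd q)))"
    if "continuous_on UNIV (\<lambda>(t, p). F t p)" for F :: "real \<Rightarrow> real \<times> real \<times> real \<Rightarrow> real"
    using continuous_on_compose2[OF that P subset_UNIV] by simp
  show thesis
    by (rule that[OF cc[OF c(1)] cc[OF c(2)] cc[OF c(3)]]) (simp_all add: i s)
qed

text \<open>The target is \<open>\<beta> \<le> 0\<close>. On the way \<open>\<psi>\<close> is
  positive, so a zero of \<open>\<beta>\<close> is crossed with slope
  \<open>- sin \<psi> < 0\<close> and leads into the interior of the target. At the critical height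
  this cannot happen above the equator, hence the first zero of \<open>\<beta>\<close> lies on it,
  where \<open>\<beta> = 0\<close> means an orthogonal crossing.\<close>

lemma torus_profile:
  obtains \<psi> \<beta> \<theta> :: "real \<Rightarrow> real" and \<sigma> :: real
  where "descending_profile \<psi> \<beta> \<theta>" "\<psi> 0 = 0" "\<beta> 0 = pi/2" "\<sigma> > 0" "\<theta> \<sigma> = 0" "\<beta> \<sigma> = 0"
    "\<And>t. 0 \<le> t \<Longrightarrow> t < \<sigma> \<Longrightarrow> 0 < \<theta> t" "\<And>t. 0 \<le> t \<Longrightarrow> t < \<sigma> \<Longrightarrow> 0 < \<beta> t"
    "\<And>t. 0 < t \<Longrightarrow> t \<le> \<sigma> \<Longrightarrow> \<beta> t < pi/2" "\<And>t. 0 < t \<Longrightarrow> t \<le> \<sigma> \<Longrightarrow> 0 < \<psi> t"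
proof -
  define P where "P c = (0::real, pi/2, c)" for c :: real
  have cP: "continuous_on {0..pi/2} P" unfolding P_def[abs_def] by (intro continuous_intros)
  obtain \<Psi> B \<Theta> :: "real \<times> real \<Rightarrow> real" where
    cont: "continuous_on (UNIV \<times> {0..pi/2}) \<Psi>" "continuous_on (UNIV \<times> {0..pi/2}) B" "continuous_on (UNIV \<times> {0..pi/2}) \<Theta>" and
    init': "\<And>c. \<Psi> (0, c) = fst (P c)" "\<And>c. B (0, c) = fst (snd (P c))" "\<And>c. \<Theta> (0, c) = snd (snd (P c))" and
    sol: "\<And>c. profile_solution (\<lambda>t. \<Psi> (t, c)) (\<lambda>t. B (t, c)) (\<lambda>t. \<Theta> (t, c))"
    by (rule profile_family[OF cP]) (rule that; assumption)
  have init: "\<Psi> (0, c) = 0" "B (0, c) = pi/2" "\<Theta> (0, c) = c" for c by (simp_all add: init' P_def)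
  have dp: "descending_profile (\<lambda>t. \<Psi> (t, c)) (\<lambda>t. B (t, c)) (\<lambda>t. \<Theta> (t, c))" if "0 < c" "c < pi/2" for c
    by (rule descending_profile.intro[OF sol]) (use that pi_gt_zero in \<open>simp_all add: init\<close>)
  have sc: "\<bar>sin x * cos y\<bar> \<le> 1" for x y :: real
    using mult_mono[OF abs_sin_le_one abs_cos_le_one, of y x] by (simp add: abs_mult)
  have \<beta>near: "\<bar>B (t, c) - pi/2\<bar> \<le> 5/2 * t" if "t \<ge> 0" for t c
  proof -
    have "\<bar>- (3/2 * sin x * (sin y * cos z)) - sin z * cos y\<bar> \<le> 5/2" for x y z :: real
    proof -
      have "\<bar>sin x\<bar> * \<bar>sin y * cos z\<bar> \<le> 1 * 1" by (intro mult_mono sc) auto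
      moreover have "\<bar>3/2 * sin x * (sin y * cos z)\<bar> = 3/2 * (\<bar>sin x\<bar> * \<bar>sin y * cos z\<bar>)" by (simp add: abs_mult)
      ultimately have "\<bar>3/2 * sin x * (sin y * cos z)\<bar> \<le> 3/2" by linarith
      then show ?thesis using sc[of z y] by linarith
    qed
    from derivative_bound[OF profile_solutionD(2)[OF sol] this that, of c] show ?thesis by (simp only: init)
  qed
  have \<psi>near: "\<bar>\<Psi> (t, c)\<bar> \<le> t" if "t \<ge> 0" for t c
    using derivative_bound[OF profile_solutionD(1)[OF sol] sc that, of c] by (simp add: init)
  define K :: "(real \<times> real) set" where "K = {x. snd x \<le> 0}"
  define K' :: "(real \<times> real) set" where "K' = {x. snd x < 0}"
  have K: "closed K" "open K'" "K' \<subseteq> K" unfolding K_def K'_def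
    by (auto intro!: closed_Collect_le open_Collect_less continuous_intros)
  \<comment> \<open>The second bound makes \<open>3/2 * c * exp 101\<close> less than
    \<open>1\<close>; at the start \<open>cos \<beta>\<close> is zero, and \<open>101\<close>
    exceeds the descent time \<open>1/5 + 100\<close> found below.\<close>
  define \<delta>0 where "\<delta>0 = min (pi/4) (1 / (2 * exp 101))"
  have \<delta>0: "\<delta>0 > 0" by (simp add: \<delta>0_def)
  have small: "(\<Psi> (T, c), B (T, c)) \<notin> K"
    if c: "0 < c" "c < \<delta>0" and T: "T \<ge> 0" "\<forall>t\<in>{0..T}. \<Theta> (t, c) \<ge> 0" for c T
  proof -
    have c': "c < pi/4" "c < pi/2" using c pi_gt_zero by (auto simp: \<delta>0_def)
    interpret descending_profile "\<lambda>t. \<Psi> (t, c)" "\<lambda>t. B (t, c)" "\<lambda>t. \<Theta> (t, c)" by (rule dp[OF c(1) c'(2)])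
    \<comment> \<open>At time \<open>0\<close> the energy vanishes, so the descent is timed from
      \<open>1/5\<close>. Until then \<open>sin \<beta> \<ge> 1/2\<close> and
      \<open>cos \<psi> \<ge> 4/5\<close>, and the mean value theorem gives an energy of at least
      \<open>3/10 * 4/25 = 6/125\<close> times \<open>sin \<theta>\<close>, which is more than
      \<open>1/25\<close> times it.\<close>
    have "T \<le> 1/5 + 4 / (1/25)"
    proof (rule descent_time[OF T(2)])
      show "\<Theta> (0, c) \<le> pi/4" using c' by (simp add: init)
      show "1/25 * sin (\<Theta> (1/5, c)) \<le> e (1/5)" if t1: "1/5 < T"
      proof -
        have z15: "(0::real) < 1/5" by simp
        obtain z where z: "0 < z" "z < 1/5" "e (1/5) - e 0 = (1/5 - 0) * (3/2 * sin (\<Theta> (z, c)) * (sin (B (z, c)))\<^sup>2 * (cos (\<Psi> (z, c)))\<^sup>2)"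
          using MVT2[OF z15, of "\<lambda>t. e t" "\<lambda>z. 3/2 * sin (\<Theta> (z, c)) * (sin (B (z, c)))\<^sup>2 * (cos (\<Psi> (z, c)))\<^sup>2"]
            profile_energy_derivative[OF sol] by blast
        have e0: "e 0 = 0" by (simp add: init)
        have "\<bar>sin (B (z, c)) - 1\<bar> \<le> 1/2"
          using abs_sin_diff_le[of "B (z, c)" "pi/2"] \<beta>near[of z c] z by simp
        then have "(1/2)\<^sup>2 \<le> (sin (B (z, c)))\<^sup>2" by (intro power_mono) (auto simp: abs_le_iff)
        moreover have "\<bar>cos (\<Psi> (z, c)) - 1\<bar> \<le> 1/5"
          using abs_cos_diff_le[of "\<Psi> (z, c)" 0] \<psi>near[of z c] z by simp
        then have "(4/5)\<^sup>2 \<le> (cos (\<Psi> (z, c)))\<^sup>2" by (intro power_mono) (auto simp: abs_le_iff)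
        ultimately have p: "(1/2)\<^sup>2 * (4/5)\<^sup>2 \<le> (sin (B (z, c)))\<^sup>2 * (cos (\<Psi> (z, c)))\<^sup>2" by (intro mult_mono) auto
        have "\<Theta> (1/5, c) < \<Theta> (z, c)" using \<theta>_strict[OF T(2), of z "1/5"] z t1 by simp
        moreover have "\<bar>\<Theta> (1/5, c)\<bar> < pi/2" "\<bar>\<Theta> (z, c)\<bar> < pi/2" by (rule \<theta>_range)+
        ultimately have "sin (\<Theta> (1/5, c)) \<le> sin (\<Theta> (z, c))" by (intro sin_monotone_2pi_le) auto
        moreover have "0 \<le> sin (\<Theta> (1/5, c))" using sin_\<theta>_nonneg[OF T(2)] t1 by simp
        ultimately have "sin (\<Theta> (1/5, c)) * ((1/2)\<^sup>2 * (4/5)\<^sup>2) \<le> sin (\<Theta> (z, c)) * ((sin (B (z, c)))\<^sup>2 * (cos (\<Psi> (z, c)))\<^sup>2)"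
          by (intro mult_mono[OF _ p]) auto
        moreover have "e (1/5) = 3/10 * (sin (\<Theta> (z, c)) * ((sin (B (z, c)))\<^sup>2 * (cos (\<Psi> (z, c)))\<^sup>2))"
          using z(3) e0 by simp
        ultimately show ?thesis using \<open>0 \<le> sin (\<Theta> (1/5, c))\<close> by (simp add: power2_eq_square)
      qed
    qed auto
    then have "T \<le> 101" by simp
    have "B (T, c) > 0"
    proof (rule \<beta>_stays_positive[OF T _ \<open>T \<le> 101\<close>])
      have "c * (2 * exp 101) < 1" using c by (simp add: \<delta>0_def field_simps)
      then show "(cos (B (0, c)) + 3/2 * \<Theta> (0, c)) * exp 101 < 1" using c by (simp add: init)
    qed (use pi_gt_zero in \<open>simp add: init\<close>)
    then show ?thesis by (simp add: K_def)
  qed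
  have big: "\<exists>T1\<ge>0. (\<Psi> (T1, pi/2), B (T1, pi/2)) \<in> K' \<and> (\<forall>t\<in>{0..T1}. \<Theta> (t, pi/2) = pi/2)"
  proof -
    have pole: "\<Theta> (t, pi/2) = pi/2" for t
      by (rule profile_pole_invariant[OF sol]) (simp add: init)
    have "((\<lambda>t. B (t, pi/2)) has_real_derivative - (3/2)) (at 0)"
      using profile_solutionD(2)[OF sol[of "pi/2"], of 0] by (simp add: init)
    then obtain d where d: "d > 0" "\<And>h. 0 < h \<Longrightarrow> h < d \<Longrightarrow> B (0 + h, pi/2) < B (0, pi/2)"
      using DERIV_neg_dec_right[of "\<lambda>t. B (t, pi/2)" "- (3/2)" 0] by auto
    \<comment> \<open>The start has \<open>\<beta> = pi/2\<close>, on the edge of the range of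
      \<open>cone_oscillation\<close>; a short time later the direction lies strictly
      inside.\<close>
    define a where "a = min (d/2) (1/5)"
    have a: "a > 0" "a < d" "a \<le> 1/5" using d(1) by (auto simp: a_def min_def)
    have b1: "B (a, pi/2) < pi/2" using d(2)[of a] a by (simp add: init)
    have b2: "B (a, pi/2) > 0" using \<beta>near[OF less_imp_le[OF a(1)], of "pi/2"] a pi_gt3 by linarith
    have "\<bar>\<Psi> (a, pi/2)\<bar> < pi/2" using \<psi>near[of a "pi/2"] a pi_gt3 by linarith
    then obtain T where T: "T \<ge> a" "\<Psi> (T, pi/2) < 0" "B (T, pi/2) < 0"
      using cone_oscillation[OF sol[of "pi/2"] pole, of a] b1 b2 by auto
    then show ?thesis using a pole by (intro exI[of _ T]) (auto simp: K'_def)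
  qed
  then obtain T1 where T1: "T1 \<ge> 0" "(\<Psi> (T1, pi/2), B (T1, pi/2)) \<in> K'" "\<forall>t\<in>{0..T1}. \<Theta> (t, pi/2) = pi/2" by blast
  obtain c T where c: "0 < c" "c < pi/2" and T: "T \<ge> 0" "\<forall>t\<in>{0..T}. \<Theta> (t, c) \<ge> 0" "(\<Psi> (T, c), B (T, c)) \<in> K"
    and nK: "\<And>t. t \<ge> 0 \<Longrightarrow> \<forall>s\<in>{0..t}. \<Theta> (s, c) > 0 \<Longrightarrow> (\<Psi> (t, c), B (t, c)) \<notin> K'"
    by (rule first_hit[OF cont dp K \<delta>0 small T1]) (assumption | rule that; assumption)+
  define \<psi> \<beta> \<theta> where "\<psi> t = \<Psi> (t, c)" and "\<beta> t = B (t, c)" and "\<theta> t = \<Theta> (t, c)" for t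
  have desc: "descending_profile \<psi> \<beta> \<theta>" unfolding \<psi>_def[abs_def] \<beta>_def[abs_def] \<theta>_def[abs_def] by (rule dp[OF c])
  interpret descending_profile \<psi> \<beta> \<theta> by (rule desc)
  have T': "T \<ge> 0" "\<forall>t\<in>{0..T}. \<theta> t \<ge> 0" "\<beta> T \<le> 0" using T by (auto simp: \<theta>_def \<beta>_def K_def)
  have nneg: "\<beta> t \<ge> 0" if "t \<ge> 0" "\<forall>s\<in>{0..t}. \<theta> s > 0" for t
    using nK[OF that(1)] that(2) by (simp add: K'_def \<beta>_def \<theta>_def not_less)
  have i: "\<psi> 0 = 0" "\<beta> 0 = pi/2" by (simp_all add: \<psi>_def \<beta>_def init)
  have Tpos: "T > 0" using T' i pi_gt_zero by (cases "T = 0") auto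
  have \<theta>pos: "\<theta> t > 0" if "0 \<le> t" "t < T" for t
  proof -
    have "\<theta> T < \<theta> t" by (rule \<theta>_strict[OF T'(2) that order.refl])
    moreover have "\<theta> T \<ge> 0" using T'(2) Tpos by auto
    ultimately show ?thesis by linarith
  qed
  have \<beta>nn: "\<beta> t \<ge> 0" if "0 \<le> t" "t < T" for t using nneg[of t] \<theta>pos that by auto
  have \<beta>T: "\<beta> T = 0"
  proof (rule ccontr)
    assume "\<beta> T \<noteq> 0"
    then have "\<beta> T < 0" using T' by simp
    then obtain d where d: "d > 0" "\<And>t. \<bar>t - T\<bar> < d \<Longrightarrow> \<beta> t < 0"
      using isCont_neg_left[OF profile_continuous(2)[OF sol]] by blast
    define t where "t = max 0 (T - d/2)"
    have "0 \<le> t" "t < T" "\<bar>t - T\<bar> < d" using d(1) Tpos by (auto simp: t_def)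
    then show False using d(2)[of t] \<beta>nn[of t] by simp
  qed
  have \<beta>hi: "\<beta> t < pi/2" if "0 < t" "t \<le> T" for t using \<beta>_range[OF T'(2) that] by simp
  have \<psi>pos: "\<psi> t > 0" if t: "0 < t" "t \<le> T" for t
  proof -
    have "(\<psi> has_real_derivative 1) (at 0)" using profile_solutionD(1)[OF sol, of 0] by (simp add: i)
    then obtain d where d: "d > 0" "\<And>h. 0 < h \<Longrightarrow> h < d \<Longrightarrow> \<psi> 0 < \<psi> (0 + h)"
      using DERIV_pos_inc_right[of \<psi> 1 0] by auto
    define h where "h = min (d/2) t"
    have h: "0 < h" "h < d" "h \<le> t" using d(1) t by (auto simp: h_def min_def)
    have "\<psi> h \<le> \<psi> t"
    proof (rule DERIV_nonneg_imp_nondecreasing[OF h(3)])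
      fix s assume s: "h \<le> s" "s \<le> t"
      have "0 \<le> \<beta> s" using \<beta>nn[of s] \<beta>T s h t by (cases "s = T") auto
      then have "sin (\<beta> s) \<ge> 0" using \<beta>hi[of s] s h t pi_gt_zero by (intro sin_ge_zero) auto
      then show "\<exists>y. (\<psi> has_real_derivative y) (at s) \<and> 0 \<le> y"
        using profile_solutionD(1)[OF sol, of s] mult_nonneg_nonneg[OF _ less_imp_le[OF cos_\<psi>_pos]] by blast
    qed
    then show ?thesis using d(2)[OF h(1,2)] i by simp
  qed
  \<comment> \<open>Zeros of \<open>\<beta>\<close> are transversal, which excludes both a zero
    above the equator and a zero before time \<open>T\<close>.\<close>
  have down: "\<exists>h0>0. \<forall>h. 0 < h \<longrightarrow> h < h0 \<longrightarrow> \<beta> (t + h) < 0" if t: "0 < t" "t \<le> T" "\<beta> t = 0" for t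
  proof -
    have "(\<beta> has_real_derivative - sin (\<psi> t)) (at t)" using profile_solutionD(2)[OF sol, of t] by (simp add: t(3))
    moreover have "- sin (\<psi> t) < 0" using \<psi>pos[OF t(1,2)] \<psi>_range[of t] pi_gt_zero by (simp add: sin_gt_zero)
    ultimately show ?thesis using DERIV_neg_dec_right[of \<beta> "- sin (\<psi> t)" t] t(3) by auto
  qed
  have \<theta>T: "\<theta> T = 0"
  proof (rule ccontr)
    assume "\<theta> T \<noteq> 0"
    then have "\<theta> T > 0" using T'(2) Tpos by (metis atLeastAtMost_iff less_eq_real_def order.refl)
    then have "\<forall>t\<in>{0..T}. \<theta> t > 0" using \<theta>pos by (metis atLeastAtMost_iff less_eq_real_def)
    then obtain d where d: "d > 0" "\<forall>t\<in>{0..T + d}. \<theta> t > 0"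
      using isCont_pos_right[OF profile_continuous(3)[OF sol] _ T'(1)] by blast
    obtain h0 where h0: "h0 > 0" "\<forall>h. 0 < h \<longrightarrow> h < h0 \<longrightarrow> \<beta> (T + h) < 0" using down[OF Tpos _ \<beta>T] by auto
    define h where "h = min (h0/2) d"
    have h: "0 < h" "h < h0" "h \<le> d" using h0(1) d(1) by (auto simp: h_def min_def)
    have "\<beta> (T + h) \<ge> 0" using d(2) h T'(1) by (intro nneg) auto
    then show False using h0(2) h by force
  qed
  have \<beta>pos: "\<beta> t > 0" if t: "0 \<le> t" "t < T" for t
  proof (rule ccontr)
    assume "\<not> \<beta> t > 0"
    then have b0: "\<beta> t = 0" using \<beta>nn[OF t] by simp
    then have "t > 0" using i pi_gt_zero t by (cases "t = 0") auto
    then obtain h0 where h0: "h0 > 0" "\<forall>h. 0 < h \<longrightarrow> h < h0 \<longrightarrow> \<beta> (t + h) < 0" using down[of t] b0 t by auto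
    define h where "h = min (h0/2) ((T - t)/2)"
    have h: "0 < h" "h < h0" "t + h < T" using h0(1) t by (auto simp: h_def min_def field_simps)
    then show False using h0(2) \<beta>nn[of "t + h"] t by force
  qed
  show thesis by (rule that[OF desc i Tpos \<theta>T \<beta>T \<theta>pos \<beta>pos \<beta>hi \<psi>pos])
qed

text \<open>\<open>b c\<close> and \<open>q c\<close> stand for the direction and height with which
  a curve leaving the singular orbit at height \<open>c\<close> arrives at
  \<open>\<psi> = \<psi>1\<close>. The target is the quadrant \<open>\<psi> \<le> 0\<close>,
  \<open>\<beta> \<le> 0\<close>, entered by curves that have crossed \<open>\<psi> = 0\<close> and
  turned back; the critical curve can touch it only at a point with
  \<open>\<psi> = \<theta> = 0\<close>, the centre of the point reflection.\<close>

lemma sphere_profile: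
  fixes b q :: "real \<Rightarrow> real" and \<psi>1 :: real
  assumes cont: "continuous_on {0..pi/2} b" "continuous_on {0..pi/2} q"
    and \<psi>1: "- (pi/2) < \<psi>1" "\<psi>1 < 0"
    and q: "\<And>c. 0 < c \<Longrightarrow> c < pi/2 \<Longrightarrow> 0 < q c \<and> q c < pi/2" "q (pi/2) = pi/2" "q 0 = 0"
    and b: "\<And>c. 0 < c \<Longrightarrow> c \<le> pi/2 \<Longrightarrow> 0 < b c \<and> b c < pi/2" "b 0 = pi/2"
    and n2: "n2 > 0" "\<And>c. 0 < c \<Longrightarrow> c < pi/2 \<Longrightarrow> n2 * sin (q c) \<le> cos \<psi>1 * cos (b c)"
  obtains \<psi> \<beta> \<theta> :: "real \<Rightarrow> real" and c \<sigma> :: real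
  where "0 < c" "c < pi/2" "descending_profile \<psi> \<beta> \<theta>" "\<psi> 0 = \<psi>1" "\<beta> 0 = b c" "\<theta> 0 = q c" "\<sigma> > 0" "\<theta> \<sigma> = 0" "\<psi> \<sigma> = 0"
    "\<forall>t\<in>{0..\<sigma>}. 0 \<le> \<theta> t"
proof -
  define P where "P c = (\<psi>1, b c, q c)" for c :: real
  have cP: "continuous_on {0..pi/2} P" unfolding P_def[abs_def] by (intro continuous_intros cont)
  obtain \<Psi> B \<Theta> :: "real \<times> real \<Rightarrow> real" where
    cont': "continuous_on (UNIV \<times> {0..pi/2}) \<Psi>" "continuous_on (UNIV \<times> {0..pi/2}) B" "continuous_on (UNIV \<times> {0..pi/2}) \<Theta>" and
    init': "\<And>c. \<Psi> (0, c) = fst (P c)" "\<And>c. B (0, c) = fst (snd (P c))" "\<And>c. \<Theta> (0, c) = snd (snd (P c))" and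
    sol: "\<And>c. profile_solution (\<lambda>t. \<Psi> (t, c)) (\<lambda>t. B (t, c)) (\<lambda>t. \<Theta> (t, c))"
    by (rule profile_family[OF cP]) (rule that; assumption)
  have init: "\<Psi> (0, c) = \<psi>1" "B (0, c) = b c" "\<Theta> (0, c) = q c" for c by (simp_all add: init' P_def)
  have dp: "descending_profile (\<lambda>t. \<Psi> (t, c)) (\<lambda>t. B (t, c)) (\<lambda>t. \<Theta> (t, c))" if "0 < c" "c < pi/2" for c
    by (rule descending_profile.intro[OF sol]) (use that \<psi>1 q(1)[OF that] b(1)[of c] in \<open>simp_all add: init\<close>)
  define K :: "(real \<times> real) set" where "K = {x. fst x \<le> 0} \<inter> {x. snd x \<le> 0}"
  define K' :: "(real \<times> real) set" where "K' = {x. fst x < 0} \<inter> {x. snd x < 0}"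
  have K: "closed K" "open K'" "K' \<subseteq> K" unfolding K_def K'_def
    by (auto intro!: closed_Int open_Int closed_Collect_le open_Collect_less continuous_intros)
  \<comment> \<open>The lower bound on \<open>e 0 / sin (\<theta> 0)\<close> is uniform in
    \<open>c\<close>, so one descent time serves all small parameters.\<close>
  define \<tau> where "\<tau> = 4 / n2"
  have "\<exists>\<delta>0>0. \<forall>c. 0 < c \<longrightarrow> c < \<delta>0 \<longrightarrow> c < pi/2 \<and> q c \<le> pi/4 \<and> (cos (b c) + 3/2 * q c) * exp \<tau> < 1"
  proof -
    define m where "m = min (pi/4) (1 / (6 * exp \<tau>))"
    have m: "m > 0" by (simp add: m_def)
    have z: "(0::real) \<in> {0..pi/2}" using pi_gt_zero by simp
    obtain d1 where d1: "d1 > 0" "\<forall>c\<in>{0..pi/2}. dist c 0 < d1 \<longrightarrow> dist (b c) (b 0) < m"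
      using cont(1) z m unfolding continuous_on_iff by blast
    obtain d2 where d2: "d2 > 0" "\<forall>c\<in>{0..pi/2}. dist c 0 < d2 \<longrightarrow> dist (q c) (q 0) < m"
      using cont(2) z m unfolding continuous_on_iff by blast
    show ?thesis
    proof (intro exI[of _ "min (min d1 d2) (pi/2)"] conjI allI impI)
      show "min (min d1 d2) (pi/2) > 0" using d1 d2 pi_gt_zero by simp
      fix c assume c: "0 < c" "c < min (min d1 d2) (pi/2)"
      then show "c < pi/2" by simp
      have cI: "c \<in> {0..pi/2}" "dist c 0 < d1" "dist c 0 < d2" using c by (auto simp: dist_real_def)
      have q': "\<bar>q c\<bar> < m" using d2(2) cI q(3) by (auto simp: dist_real_def)
      then have "\<bar>q c\<bar> < pi/4" unfolding m_def by linarith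
      then show "q c \<le> pi/4" by linarith
      have "\<bar>cos (b c)\<bar> \<le> \<bar>b c - pi/2\<bar>" using abs_cos_diff_le[of "b c" "pi/2"] by simp
      also have "\<dots> < m" using d1(2) cI b(2) by (auto simp: dist_real_def)
      finally have "cos (b c) + 3/2 * q c < 5/2 * m" using q' by linarith
      then have "(cos (b c) + 3/2 * q c) * exp \<tau> < 5/2 * m * exp \<tau>" by (intro mult_strict_right_mono) auto
      also have "\<dots> \<le> 5/2 * (1 / (6 * exp \<tau>)) * exp \<tau>" by (intro mult_right_mono mult_left_mono) (auto simp: m_def)
      also have "\<dots> < 1" by simp
      finally show "(cos (b c) + 3/2 * q c) * exp \<tau> < 1" .
    qed
  qed
  then obtain \<delta>0 where \<delta>0: "\<delta>0 > 0" "\<And>c. 0 < c \<Longrightarrow> c < \<delta>0 \<Longrightarrow> c < pi/2 \<and> q c \<le> pi/4 \<and> (cos (b c) + 3/2 * q c) * exp \<tau> < 1"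
    by blast
  have small: "(\<Psi> (T, c), B (T, c)) \<notin> K"
    if c: "0 < c" "c < \<delta>0" and T: "T \<ge> 0" "\<forall>t\<in>{0..T}. \<Theta> (t, c) \<ge> 0" for c T
  proof -
    note c' = \<delta>0(2)[OF c]
    interpret descending_profile "\<lambda>t. \<Psi> (t, c)" "\<lambda>t. B (t, c)" "\<lambda>t. \<Theta> (t, c)" by (rule dp) (use c c' in auto)
    have "T \<le> 0 + 4 / n2"
      by (rule descent_time[OF T(2)]) (use c c' n2 in \<open>auto simp: init\<close>)
    then have "T \<le> \<tau>" by (simp add: \<tau>_def)
    have "B (T, c) > 0"
      by (rule \<beta>_stays_positive[OF T _ \<open>T \<le> \<tau>\<close>]) (use c c' b(1)[of c] in \<open>auto simp: init\<close>)
    then show ?thesis by (simp add: K_def)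
  qed
  have big: "\<exists>T1\<ge>0. (\<Psi> (T1, pi/2), B (T1, pi/2)) \<in> K' \<and> (\<forall>t\<in>{0..T1}. \<Theta> (t, pi/2) = pi/2)"
  proof -
    have pole: "\<Theta> (t, pi/2) = pi/2" for t
      by (rule profile_pole_invariant[OF sol]) (simp add: init q)
    obtain T where T: "T \<ge> 0" "\<Psi> (T, pi/2) < 0" "B (T, pi/2) < 0"
      using cone_oscillation[OF sol[of "pi/2"] pole, of 0] b(1)[of "pi/2"] \<psi>1 pi_gt_zero by (auto simp: init)
    then show ?thesis using pole by (intro exI[of _ T]) (auto simp: K'_def)
  qed
  then obtain T1 where T1: "T1 \<ge> 0" "(\<Psi> (T1, pi/2), B (T1, pi/2)) \<in> K'" "\<forall>t\<in>{0..T1}. \<Theta> (t, pi/2) = pi/2" by blast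
  obtain c T where c: "0 < c" "c < pi/2" and T: "T \<ge> 0" "\<forall>t\<in>{0..T}. \<Theta> (t, c) \<ge> 0" "(\<Psi> (T, c), B (T, c)) \<in> K"
    and nK: "\<And>t. t \<ge> 0 \<Longrightarrow> \<forall>s\<in>{0..t}. \<Theta> (s, c) > 0 \<Longrightarrow> (\<Psi> (t, c), B (t, c)) \<notin> K'"
    by (rule first_hit[OF cont' dp K \<delta>0(1) small T1]) (assumption | rule that; assumption)+
  define \<psi> \<beta> \<theta> where "\<psi> t = \<Psi> (t, c)" and "\<beta> t = B (t, c)" and "\<theta> t = \<Theta> (t, c)" for t
  have desc: "descending_profile \<psi> \<beta> \<theta>" unfolding \<psi>_def[abs_def] \<beta>_def[abs_def] \<theta>_def[abs_def] by (rule dp[OF c])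
  interpret descending_profile \<psi> \<beta> \<theta> by (rule desc)
  have T': "T \<ge> 0" "\<forall>t\<in>{0..T}. \<theta> t \<ge> 0" "\<psi> T \<le> 0" "\<beta> T \<le> 0" using T by (auto simp: \<theta>_def \<beta>_def \<psi>_def K_def)
  have nneg: "\<not> (\<psi> t < 0 \<and> \<beta> t < 0)" if "t \<ge> 0" "\<forall>s\<in>{0..t}. \<theta> s > 0" for t
    using nK[OF that(1)] that(2) by (auto simp: K'_def \<beta>_def \<theta>_def \<psi>_def)
  have i: "\<psi> 0 = \<psi>1" "\<beta> 0 = b c" "\<theta> 0 = q c" by (simp_all add: \<psi>_def \<beta>_def \<theta>_def init)
  have Tpos: "T > 0" using T' i b(1)[of c] c by (cases "T = 0") auto
  have \<theta>pos: "\<theta> t > 0" if "0 \<le> t" "t < T" for t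
  proof -
    have "\<theta> T < \<theta> t" by (rule \<theta>_strict[OF T'(2) that order.refl])
    moreover have "\<theta> T \<ge> 0" using T'(2) Tpos by auto
    ultimately show ?thesis by linarith
  qed
  have left: "\<exists>t. 0 \<le> t \<and> t < T \<and> \<bar>t - T\<bar> < d" if "d > 0" for d
    using that Tpos by (intro exI[of _ "max 0 (T - d/2)"]) auto
  have nn: "\<not> (\<psi> t < 0 \<and> \<beta> t < 0)" if "0 \<le> t" "t < T" for t using nneg[of t] \<theta>pos that by auto
  \<comment> \<open>If \<open>\<psi> T < 0\<close>, then \<open>\<beta> < 0\<close> just before
    \<open>T\<close>: by continuity, or because \<open>\<beta>' = - sin \<psi> > 0\<close> where
    \<open>\<beta>\<close> vanishes. The curve would then be in \<open>K'\<close> above the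
    equator.\<close>
  have "\<psi> T = 0"
  proof (rule ccontr)
    assume "\<psi> T \<noteq> 0"
    then have neg: "\<psi> T < 0" using T' by simp
    then obtain d where d: "d > 0" "\<And>t. \<bar>t - T\<bar> < d \<Longrightarrow> \<psi> t < 0"
      using isCont_neg_left[OF profile_continuous(1)[OF sol]] by blast
    have "\<exists>d'>0. \<forall>t. T - d' < t \<longrightarrow> t < T \<longrightarrow> \<beta> t < 0"
    proof (cases "\<beta> T = 0")
      case True
      have "(\<beta> has_real_derivative - sin (\<psi> T)) (at T)" using profile_solutionD(2)[OF sol, of T] by (simp add: True)
      moreover have "- sin (\<psi> T) > 0"
        using neg \<psi>_range[of T] sin_gt_zero[of "- \<psi> T"] pi_gt_zero by (simp add: abs_less_iff)
      ultimately obtain d' where "d' > 0" "\<And>h. 0 < h \<Longrightarrow> h < d' \<Longrightarrow> \<beta> (T - h) < \<beta> T"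
        using DERIV_pos_inc_left[of \<beta> "- sin (\<psi> T)" T] by auto
      then have "\<forall>t. T - d' < t \<longrightarrow> t < T \<longrightarrow> \<beta> t < 0" using True
        by (metis add_diff_cancel_left' diff_add_cancel diff_gt_0_iff_gt diff_less_eq less_diff_eq)
      then show ?thesis using \<open>d' > 0\<close> by blast
    next
      case False
      then have "\<beta> T < 0" using T' by simp
      then obtain d' where d': "d' > 0" "\<And>t. \<bar>t - T\<bar> < d' \<Longrightarrow> \<beta> t < 0"
        using isCont_neg_left[OF profile_continuous(2)[OF sol]] by blast
      have "\<forall>t. T - d' < t \<longrightarrow> t < T \<longrightarrow> \<beta> t < 0" by (intro allI impI d'(2)) linarith
      then show ?thesis using d'(1) by blast
    qed
    then obtain d' where d': "d' > 0" "\<forall>t. T - d' < t \<longrightarrow> t < T \<longrightarrow> \<beta> t < 0" by blast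
    obtain t where t: "0 \<le> t" "t < T" "\<bar>t - T\<bar> < min d d'" using left[of "min d d'"] d(1) d'(1) by auto
    have "\<psi> t < 0" using d(2) t by simp
    moreover have "T - d' < t" using t(2,3) by linarith
    ultimately show False using nn[OF t(1,2)] d'(2) t(2) by blast
  qed
  \<comment> \<open>Above the equator, \<open>\<beta> T < 0\<close> would make \<open>\<psi>\<close>
    decrease through zero and lead into \<open>K'\<close> right after \<open>T\<close>.\<close>
  have "\<theta> T = 0"
  proof (rule ccontr)
    assume "\<theta> T \<noteq> 0"
    then have "\<theta> T > 0" using T'(2) Tpos by (metis atLeastAtMost_iff less_eq_real_def order.refl)
    then have "\<forall>t\<in>{0..T}. \<theta> t > 0" using \<theta>pos by (metis atLeastAtMost_iff less_eq_real_def)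
    then obtain d where d: "d > 0" "\<forall>t\<in>{0..T + d}. \<theta> t > 0"
      using isCont_pos_right[OF profile_continuous(3)[OF sol] _ T'(1)] by blast
    \<comment> \<open>With \<open>\<psi> T = 0\<close> this would be the equilibrium, where the
      energy is \<open>1\<close>; at the start it is at most \<open>cos \<psi>1 < 1\<close>.\<close>
    have "\<beta> T \<noteq> 0"
    proof
      assume "\<beta> T = 0"
      then have "(e T)\<^sup>2 = 1" using \<open>\<psi> T = 0\<close> by simp
      moreover have "(e 0)\<^sup>2 < 1"
      proof -
        have "0 \<le> e 0" by (rule e0)
        moreover have "e 0 \<le> cos \<psi>1 * 1" using cos_\<psi>_pos[of 0] by (simp add: i mult_left_le)
        moreover have "cos \<psi>1 < 1"
        proof -
          have "cos (- \<psi>1) < cos 0" using \<psi>1 pi_gt_zero by (intro cos_monotone_0_pi) auto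
          then show ?thesis by simp
        qed
        ultimately have "0 \<le> e 0" "e 0 < 1" by linarith+
        then show ?thesis by (simp only: power_less_one_iff) simp
      qed
      ultimately show False using profile_energy_less_1[OF sol, of 0 T] by simp
    qed
    then have bT: "\<beta> T < 0" using T' by simp
    then obtain d1 where d1: "d1 > 0" "\<And>t. \<bar>t - T\<bar> < d1 \<Longrightarrow> \<beta> t < 0"
      using isCont_neg_left[OF profile_continuous(2)[OF sol]] by blast
    have "(\<psi> has_real_derivative sin (\<beta> T)) (at T)" using profile_solutionD(1)[OF sol, of T] by (simp add: \<open>\<psi> T = 0\<close>)
    moreover have "sin (\<beta> T) < 0"
      using bT \<beta>_range[OF T'(2) Tpos order.refl] sin_gt_zero[of "- \<beta> T"] pi_gt_zero by (simp add: abs_less_iff)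
    ultimately obtain d2 where d2: "d2 > 0" "\<And>h. 0 < h \<Longrightarrow> h < d2 \<Longrightarrow> \<psi> (T + h) < \<psi> T"
      using DERIV_neg_dec_right[of \<psi> "sin (\<beta> T)" T] by auto
    define h where "h = min (min (d1/2) (d2/2)) d"
    have h: "0 < h" "h < d1" "h < d2" "h \<le> d" using d(1) d1(1) d2(1) by (auto simp: h_def min_def)
    have "\<not> (\<psi> (T + h) < 0 \<and> \<beta> (T + h) < 0)" using d(2) h T'(1) by (intro nneg) auto
    then show False using d1(2)[of "T + h"] d2(2)[of h] h \<open>\<psi> T = 0\<close> by auto
  qed
  show thesis by (rule that[OF c desc i Tpos \<open>\<theta> T = 0\<close> \<open>\<psi> T = 0\<close> T'(2)])
qed

section \<open>Minimality along a profile\<close>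

text \<open>Bootstrapping: each order of differentiability of \<open>y\<close> passes through the
  right-hand side to \<open>y'\<close>.\<close>

lemma ode_smooth:
  fixes y :: "real \<Rightarrow> 'a::euclidean_space"
  assumes "open I" "open V" "\<And>t. t \<in> I \<Longrightarrow> y t \<in> V"
    and y: "\<And>t. t \<in> I \<Longrightarrow> (y has_vector_derivative F (y t)) (at t)" and F: "smooth_on V F"
  shows "smooth_on I y"
proof -
  have "Ck_on k I y" for k
  proof (induction k)
    case 0
    have "continuous (at t) y" if "t \<in> I" for t using has_vector_derivative_continuous[OF y[OF that]] .
    then show ?case by (auto intro!: continuous_at_imp_continuous_on)
  next
    case (Suc k)
    have ck: "Ck_on k I (\<lambda>t. F (y t))"
      using F by (intro Ck_on_compose[OF assms(1,2,3) Suc]) (auto simp: smooth_on_def)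
    show ?case by (rule Ck_on_real_SucI[OF assms(1) _ ck]) (rule y)
  qed
  then show ?thesis by (simp add: smooth_on_def)
qed

text \<open>The inverse solves the autonomous equation \<open>g' = 1 / f' (g)\<close>, so its
  smoothness is a case of \<open>ode_smooth\<close>.\<close>

lemma smooth_inverse_increasing:
  fixes f f' :: "real \<Rightarrow> real"
  assumes f: "smooth_on {a<..<b} f" and d: "\<And>t. t \<in> {a<..<b} \<Longrightarrow> (f has_real_derivative f' t) (at t)"
    and pos: "\<And>t. t \<in> {a<..<b} \<Longrightarrow> f' t > 0"
  obtains g where "open (f ` {a<..<b})" "smooth_on (f ` {a<..<b}) g" "\<And>t. t \<in> {a<..<b} \<Longrightarrow> g (f t) = t"
    "\<And>y. y \<in> f ` {a<..<b} \<Longrightarrow> (g has_real_derivative 1 / f' (g y)) (at y)"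
proof -
  define I where "I = {a<..<b}"
  have opI: "open I" by (simp add: I_def)
  have mono: "f s < f t" if "s \<in> I" "t \<in> I" "s < t" for s t
  proof (rule DERIV_pos_imp_increasing[OF that(3)])
    fix x assume "s \<le> x" "x \<le> t"
    then have "x \<in> {a<..<b}" using that by (auto simp: I_def)
    then show "\<exists>y. (f has_real_derivative y) (at x) \<and> 0 < y" using d pos by blast
  qed
  have inj: "inj_on f I"
  proof (rule inj_onI)
    fix s t assume "s \<in> I" "t \<in> I" "f s = f t"
    then show "s = t" using mono[of s t] mono[of t s] by (cases s t rule: linorder_cases) auto
  qed
  define g where "g = inv_into I f"
  have gf: "g (f t) = t" if "t \<in> I" for t using inv_into_f_f[OF inj that] by (simp add: g_def)
  have fg: "f (g y) = y" "g y \<in> I" if "y \<in> f ` I" for y using that gf by auto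
  have cont: "isCont f t" if "t \<in> I" for t using d that DERIV_isCont unfolding I_def by blast
  have op: "\<exists>l r. l < y \<and> y < r \<and> {l<..<r} \<subseteq> f ` I" if y: "y \<in> f ` I" for y
  proof -
    obtain t where t: "t \<in> I" "y = f t" using y by blast
    obtain s r where sr: "a < s" "s < t" "t < r" "r < b" using t(1) dense[of a t] dense[of t b] by (auto simp: I_def)
    have I: "s \<in> I" "r \<in> I" using sr by (auto simp: I_def)
    have "{f s<..<f r} \<subseteq> f ` I"
    proof
      fix z assume z: "z \<in> {f s<..<f r}"
      have "\<exists>x\<ge>s. x \<le> r \<and> f x = z"
        by (rule IVT) (use z sr cont in \<open>auto simp: I_def\<close>)
      then obtain x where "s \<le> x" "x \<le> r" "f x = z" by blast
      then show "z \<in> f ` I" using sr by (auto simp: I_def intro!: image_eqI[of _ _ x])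
    qed
    moreover have "f s < y" "y < f r" using mono I t sr by auto
    ultimately show ?thesis by blast
  qed
  have opf: "open (f ` I)"
  proof (subst open_subopen, rule)
    fix y assume "y \<in> f ` I"
    then obtain l r where "l < y" "y < r" "{l<..<r} \<subseteq> f ` I" using op by blast
    then show "\<exists>T. open T \<and> y \<in> T \<and> T \<subseteq> f ` I" by (intro exI[of _ "{l<..<r}"]) auto
  qed
  have cg: "isCont g y" if y: "y \<in> f ` I" for y
  proof -
    obtain t where t: "t \<in> I" "y = f t" using y by blast
    define d where "d = min ((t - a) / 2) ((b - t) / 2)"
    have t': "a < t" "t < b" using t(1) by (auto simp: I_def)
    then have d0: "d > 0" by (simp add: d_def)
    have dz: "z \<in> I" if "\<bar>z - t\<bar> \<le> d" for z
    proof -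
      have "2 * d \<le> t - a" "2 * d \<le> b - t" unfolding d_def by (auto simp: min_def)
      then show ?thesis using that d0 by (auto simp: I_def abs_le_iff)
    qed
    note dp = d0 dz
    have "isCont g (f t)"
      by (rule isCont_inverse_function[OF dp(1)]) (use gf cont dp(2) in auto)
    then show ?thesis by (simp add: t)
  qed
  have dg: "(g has_real_derivative 1 / f' (g y)) (at y)" if y: "y \<in> f ` I" for y
  proof -
    obtain l r where lr: "l < y" "y < r" "{l<..<r} \<subseteq> f ` I" using op[OF y] by blast
    have gi: "g y \<in> {a<..<b}" using fg(2)[OF y] by (simp add: I_def)
    have "(g has_real_derivative inverse (f' (g y))) (at y)"
    proof (rule DERIV_inverse_function[OF d[OF gi] _ lr(1,2) _ cg[OF y]])
      show "f' (g y) \<noteq> 0" using pos[OF gi] by simp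
      show "f (g z) = z" if "l < z" "z < r" for z using fg(1)[of z] lr(3) that by auto
    qed
    then show ?thesis by (simp add: inverse_eq_divide)
  qed
  have "smooth_on I f'" using smooth_on_real_derivative[of I f f'] f d by (simp add: I_def)
  then have h: "smooth_on I (\<lambda>t. 1 / f' t)"
    by (intro smooth_intros opI) (use pos in \<open>auto simp: I_def less_imp_neq[THEN not_sym]\<close>)
  have "smooth_on (f ` I) g"
  proof (rule ode_smooth[OF opf opI fg(2) _ h])
    show "(g has_vector_derivative 1 / f' (g y)) (at y)" if "y \<in> f ` I" for y
      using dg[OF that] by (simp add: has_real_derivative_iff_has_vector_derivative)
  qed
  then show thesis using that opf gf dg unfolding I_def by blast
qed

lemma profile_smooth:
  assumes "profile_solution \<psi> \<beta> \<theta>"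
  shows "smooth_on UNIV \<psi>" "smooth_on UNIV \<beta>" "smooth_on UNIV \<theta>"
proof -
  have "smooth_on UNIV profile_field"
    unfolding profile_field_def case_prod_beta by (intro smooth_intros open_UNIV)
  then have s: "smooth_on UNIV (\<lambda>t. (\<psi> t, \<beta> t, \<theta> t))"
    by (rule ode_smooth[where F = profile_field and V = UNIV, rotated 4])
      (use assms in \<open>auto simp: profile_solution_iff\<close>)
  show "smooth_on UNIV \<psi>" "smooth_on UNIV \<beta>" "smooth_on UNIV \<theta>"
    using smooth_on_fst[OF open_UNIV s] smooth_on_fst[OF open_UNIV smooth_on_snd[OF open_UNIV s]]
      smooth_on_snd[OF open_UNIV smooth_on_snd[OF open_UNIV s]] by simp_all
qed

text \<open>Here \<open>S, K, s, c, q, k\<close> stand for \<open>sin \<theta>, cos \<theta>, sin \<psi>, cos \<psi>, sin \<beta>, cos \<beta>\<close> and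
  \<open>t, p, w\<close> for \<open>\<theta>', \<psi>', \<beta>'\<close>.\<close>

lemma profile_normal_identity1:
  fixes S K s c q k :: real
  shows "q * K\<^sup>2 * c * S + (- (q * S * c) - k * (1 + s)) * (K\<^sup>2 * (1 - s) / 2) + (- (q * S * c) + k * (1 - s)) * (K\<^sup>2 * (1 + s) / 2) = 0"
  by (simp add: power2_eq_square field_simps)
text \<open>The right-hand side vanishes once \<open>t\<close> and \<open>p\<close> are components
  of the profile field; this is orthogonality of the normal to the curve.\<close>

lemma profile_normal_identity2:
  fixes S K s c q k :: real
  assumes "S\<^sup>2 + K\<^sup>2 = 1" "s\<^sup>2 + c\<^sup>2 = 1" 
  shows "q * K\<^sup>2 * c * (K * t) + (- (q * S * c) - k * (1 + s)) * (- (K * S * t * (1 - s)) - K\<^sup>2 * c * p / 2) / 2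
    + (- (q * S * c) + k * (1 - s)) * (- (K * S * t * (1 + s)) + K\<^sup>2 * c * p / 2) / 2 = K * t * q * c + K\<^sup>2 * c * k * p / 2"
proof -
  have "q * K\<^sup>2 * c * (K * t) + (- (q * S * c) - k * (1 + s)) * (- (K * S * t * (1 - s)) - K\<^sup>2 * c * p / 2) / 2
    + (- (q * S * c) + k * (1 - s)) * (- (K * S * t * (1 + s)) + K\<^sup>2 * c * p / 2) / 2 = K * t * q * c * (S\<^sup>2 + K\<^sup>2) + K\<^sup>2 * c * k * p / 2"
    by (simp add: power2_eq_square field_simps)
  then show ?thesis using assms by simp
qed
lemma profile_norm_identity:
  fixes S K s c q k :: real
  assumes "S * S = 1 - K * K" "s * s = 1 - c * c" "q * q = 1 - k * k"
  shows "(q * K\<^sup>2 * c)\<^sup>2 + (- (q * S * c) - k * (1 + s))\<^sup>2 * (K\<^sup>2 * (1 - s) / 2) + (- (q * S * c) + k * (1 - s))\<^sup>2 * (K\<^sup>2 * (1 + s) / 2) = K\<^sup>2 * c\<^sup>2"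
proof -
  have r: "S * (S * x) = (1 - K * K) * x" "s * (s * x) = (1 - c * c) * x" "q * (q * x) = (1 - k * k) * x" for x
    using assms by (metis mult.assoc)+
  show ?thesis by (simp add: power2_eq_square field_simps r assms)
qed
text \<open>Because \<open>c^2 = (1 - s) * (1 + s)\<close>, the division in
  \<open>u'^2 / (4 * u)\<close> is exact, and the curvature condition becomes a polynomial
  identity.\<close>

lemma profile_speed_identity1:
  fixes S K s c q k :: real
  assumes "s * s = 1 - c * c" 
  shows "(- (K * S * t * (1 - s)) - K\<^sup>2 * c * p / 2)\<^sup>2 = (((1 - s) * S\<^sup>2 * t\<^sup>2
        + S * t * K * c * p + K\<^sup>2 * (1 + s) * p\<^sup>2 / 4) / 2) * (4 * (K\<^sup>2 * (1 - s) / 2))"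
proof -
  have r:  "s * (s * x) = (1 - c * c) * x" for x
    using assms by (metis mult.assoc)+
  show ?thesis by (simp add: power2_eq_square field_simps r assms)
qed
lemma profile_speed_identity2:
  fixes S K s c q k :: real
  assumes "s * s = 1 - c * c" 
  shows "(- (K * S * t * (1 + s)) + K\<^sup>2 * c * p / 2)\<^sup>2 = (((1 + s) * S\<^sup>2 * t\<^sup>2
        - S * t * K * c * p + K\<^sup>2 * (1 - s) * p\<^sup>2 / 4) / 2) * (4 * (K\<^sup>2 * (1 + s) / 2))"
proof -
  have r:  "s * (s * x) = (1 - c * c) * x" for x
    using assms by (metis mult.assoc)+
  show ?thesis by (simp add: power2_eq_square field_simps r assms)
qed
text \<open>The condition \<open>curv\<close> of \<open>rotational_minimal\<close>, with the
  polynomials \<open>Pu\<close> and \<open>Pv\<close> in place of \<open>u'^2 / (4 * u)\<close> and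
  \<open>v'^2 / (4 * v)\<close>. Among these identities it is the one that involves
  \<open>w\<close>, the equation for \<open>\<beta>'\<close>.\<close>

lemma profile_curvature_identity:
  fixes S K s c q k :: real
  assumes "S * S = 1 - K * K" "s * s = 1 - c * c" "q * q = 1 - k * k"
   and p: "p = q * c" and t: "t = - (1/2 * (K * (c * k)))" and w: "w = - (3/2 * S * (q * c)) - s * k"
   and B: "B = - (q * S * c) - k * (1 + s)" and C: "C = - (q * S * c) + k * (1 - s)"
   and Pu: "Pu = ((1 - s) * S\<^sup>2 * t\<^sup>2 + S * t * K * c * p + K\<^sup>2 * (1 + s) * p\<^sup>2 / 4) / 2"
   and Pv: "Pv = ((1 + s) * S\<^sup>2 * t\<^sup>2 - S * t * K * c * p + K\<^sup>2 * (1 - s) * p\<^sup>2 / 4) / 2"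
  shows "(B + C) * ((K * t)\<^sup>2 + Pu + Pv) 
   + (k * w * K\<^sup>2 * c - 2 * q * K * S * t * c - q * K\<^sup>2 * s * p) * (K * t)
   + (- (k * w * S * c) - q * K * t * c + q * S * s * p + q * w * (1 + s) - k * c * p) * (- (K * S * t * (1 - s)) - K\<^sup>2 * c * p / 2) / 2
   + (- (k * w * S * c) - q * K * t * c + q * S * s * p - q * w * (1 - s) - k * c * p) * (- (K * S * t * (1 + s)) + K\<^sup>2 * c * p / 2) / 2
   + B * Pu + C * Pv = 0"
proof -
  \<comment> \<open>The nested form lets the simplifier reduce squares inside right-associated
    products.\<close>
  have r: "S * (S * x) = (1 - K * K) * x" "s * (s * x) = (1 - c * c) * x" "q * (q * x) = (1 - k * k) * x" for x
    using assms by (metis mult.assoc)+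
  show ?thesis unfolding Pu Pv B C p t w by (simp add: power2_eq_square field_simps r assms(1-3))
qed
text \<open>The sphere equation supplies the sum of the squared moduli, so \<open>x\<close> and
  their difference determine the orbit. The time on the profile may be any smooth function near the
  point, which allows different local parameters on one hypersurface.\<close>

lemma profile_minimal:
  fixes t :: "ambient \<Rightarrow> real"
  assumes sol: "profile_solution \<psi> \<beta> \<theta>" and cp: "\<And>s. cos (\<psi> s) > 0" "\<And>s. cos (\<theta> s) > 0"
    and emb: "embedded_hypersurface M" and p: "(x, z1, z2) \<in> M" "(x, z1, z2) \<in> U"
    and U: "open U" "smooth_on U t"
    and M: "\<And>y w1 w2. (y, w1, w2) \<in> M \<Longrightarrow> (y, w1, w2) \<in> U \<Longrightarrow> y = sin (\<theta> (t (y, w1, w2))) \<and>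
              (cmod w2)\<^sup>2 - (cmod w1)\<^sup>2 = (cos (\<theta> (t (y, w1, w2))))\<^sup>2 * sin (\<psi> (t (y, w1, w2)))"
  shows "\<exists>U' \<nu>. (x, z1, z2) \<in> U' \<and> unit_normal_field M U' \<nu> \<and> mean_curvature M \<nu> (x, z1, z2) = 0"
proof -
  define \<psi>' \<beta>' \<theta>' where "\<psi>' s = sin (\<beta> s) * cos (\<psi> s)"
    and "\<beta>' s = - (3/2 * sin (\<theta> s) * (sin (\<beta> s) * cos (\<psi> s))) - sin (\<psi> s) * cos (\<beta> s)"
    and "\<theta>' s = - (1/2 * (cos (\<theta> s) * (cos (\<psi> s) * cos (\<beta> s))))" for s
  note d = profile_solutionD[OF sol, folded \<psi>'_def \<beta>'_def \<theta>'_def]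
  note sm = profile_smooth[OF sol]
  \<comment> \<open>The normal is the direction of the curve turned by a right angle in the orbit
    space, multiplied by \<open>cos \<theta> * cos \<psi>\<close> to clear denominators.\<close>
  define u v A B C where "u s = (cos (\<theta> s))\<^sup>2 * (1 - sin (\<psi> s)) / 2"
    and "v s = (cos (\<theta> s))\<^sup>2 * (1 + sin (\<psi> s)) / 2"
    and "A s = sin (\<beta> s) * (cos (\<theta> s))\<^sup>2 * cos (\<psi> s)"
    and "B s = - (sin (\<beta> s) * sin (\<theta> s) * cos (\<psi> s)) - cos (\<beta> s) * (1 + sin (\<psi> s))"
    and "C s = - (sin (\<beta> s) * sin (\<theta> s) * cos (\<psi> s)) + cos (\<beta> s) * (1 - sin (\<psi> s))" for s
  define u' v' where "u' s = - (cos (\<theta> s) * sin (\<theta> s) * \<theta>' s * (1 - sin (\<psi> s))) - (cos (\<theta> s))\<^sup>2 * cos (\<psi> s) * \<psi>' s / 2"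
    and "v' s = - (cos (\<theta> s) * sin (\<theta> s) * \<theta>' s * (1 + sin (\<psi> s))) + (cos (\<theta> s))\<^sup>2 * cos (\<psi> s) * \<psi>' s / 2" for s
  define X' where "X' s = cos (\<theta> s) * \<theta>' s" for s
  define a b c where
    "a s = cos (\<beta> s) * \<beta>' s * (cos (\<theta> s))\<^sup>2 * cos (\<psi> s) - 2 * sin (\<beta> s) * cos (\<theta> s) * sin (\<theta> s) * \<theta>' s * cos (\<psi> s)
        - sin (\<beta> s) * (cos (\<theta> s))\<^sup>2 * sin (\<psi> s) * \<psi>' s"
    and "b s = - (cos (\<beta> s) * \<beta>' s * sin (\<theta> s) * cos (\<psi> s)) - sin (\<beta> s) * cos (\<theta> s) * \<theta>' s * cos (\<psi> s)
        + sin (\<beta> s) * sin (\<theta> s) * sin (\<psi> s) * \<psi>' s + sin (\<beta> s) * \<beta>' s * (1 + sin (\<psi> s)) - cos (\<beta> s) * cos (\<psi> s) * \<psi>' s"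
    and "c s = - (cos (\<beta> s) * \<beta>' s * sin (\<theta> s) * cos (\<psi> s)) - sin (\<beta> s) * cos (\<theta> s) * \<theta>' s * cos (\<psi> s)
        + sin (\<beta> s) * sin (\<theta> s) * sin (\<psi> s) * \<psi>' s - sin (\<beta> s) * \<beta>' s * (1 - sin (\<psi> s)) - cos (\<beta> s) * cos (\<psi> s) * \<psi>' s" for s
  have dX: "((\<lambda>s. sin (\<theta> s)) has_real_derivative X' s) (at s)" for s
    unfolding X'_def by (rule derivative_eq_intros d refl)+
  have du: "(u has_real_derivative u' s) (at s)" for s
  proof -
    have "((\<lambda>s. (cos (\<theta> s))\<^sup>2 * (1 - sin (\<psi> s))) has_real_derivative 2 * u' s) (at s)"
      by (rule derivative_eq_intros d refl)+ (simp add: u'_def power2_eq_square algebra_simps)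
    from DERIV_cdivide[OF this, of 2] show ?thesis by (simp add: u_def[abs_def])
  qed
  have dv: "(v has_real_derivative v' s) (at s)" for s
  proof -
    have "((\<lambda>s. (cos (\<theta> s))\<^sup>2 * (1 + sin (\<psi> s))) has_real_derivative 2 * v' s) (at s)"
      by (rule derivative_eq_intros d refl)+ (simp add: v'_def power2_eq_square algebra_simps)
    from DERIV_cdivide[OF this, of 2] show ?thesis by (simp add: v_def[abs_def])
  qed
  have dA: "(A has_real_derivative a s) (at s)" for s
    unfolding A_def[abs_def] a_def
    by (rule derivative_eq_intros d refl)+ (simp add: power2_eq_square algebra_simps)
  have dB: "(B has_real_derivative b s) (at s)" for s
    unfolding B_def[abs_def] b_def
    by (rule derivative_eq_intros d refl)+ (simp add: power2_eq_square algebra_simps)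
  have dC: "(C has_real_derivative c s) (at s)" for s
    unfolding C_def[abs_def] c_def
    by (rule derivative_eq_intros d refl)+ (simp add: power2_eq_square algebra_simps)
  have sc: "(sin y)\<^sup>2 = 1 - (cos y)\<^sup>2" for y :: real by (rule sin_squared_eq)
  have ss: "sin y * sin y = 1 - cos y * cos y" for y :: real using sc[of y] by (simp only: power2_eq_square)
  have s1: "1 - sin (\<psi> s) > 0" "1 + sin (\<psi> s) > 0" for s
  proof -
    have "(sin (\<psi> s))\<^sup>2 < 1" using cp(1)[of s] by (simp add: sc)
    then have "\<bar>sin (\<psi> s)\<bar> < 1" by (simp only: abs_square_less_1)
    then show "1 - sin (\<psi> s) > 0" "1 + sin (\<psi> s) > 0" by linarith+
  qed
  have uv: "u s > 0" "v s > 0" for s using cp(2)[of s] s1[of s] by (simp_all add: u_def v_def)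
  define \<tau> where "\<tau> = t (x, z1, z2)"
  have Mi: "y = sin (\<theta> (t (y, w1, w2))) \<and> (cmod w1)\<^sup>2 = u (t (y, w1, w2)) \<and> (cmod w2)\<^sup>2 = v (t (y, w1, w2))"
    if "(y, w1, w2) \<in> M" "(y, w1, w2) \<in> U" for y w1 w2
  proof -
    define r where "r = t (y, w1, w2)"
    have m: "y = sin (\<theta> r)" "(cmod w2)\<^sup>2 - (cmod w1)\<^sup>2 = (cos (\<theta> r))\<^sup>2 * sin (\<psi> r)" using M[OF that] by (auto simp: r_def)
    have "(y, w1, w2) \<in> S4" using that(1) emb unfolding embedded_hypersurface_def by blast
    then have "(cmod w1)\<^sup>2 + (cmod w2)\<^sup>2 = (cos (\<theta> r))\<^sup>2" by (simp add: S4_def m(1) sc)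
    then have "(cmod w1)\<^sup>2 = u r \<and> (cmod w2)\<^sup>2 = v r" using m(2) unfolding u_def v_def by (simp add: algebra_simps)
    then show ?thesis using m(1) unfolding r_def by blast
  qed
  \<comment> \<open>Along a regular profile all orbits are 2-dimensional tori, so the first
    alternative of \<open>curv\<close> applies.\<close>
  have z: "z1 \<noteq> 0" "z2 \<noteq> 0" using Mi[OF p] uv by (metis norm_zero power_zero_numeral less_irrefl)+
  show ?thesis
  proof (rule rotational_minimal[OF emb p U _ open_UNIV, where X = "\<lambda>s. sin (\<theta> s)" and X' = X' and u = u and u' = u'
        and v = v and v' = v' and A = A and B = B and C = C and a = "a \<tau>" and b = "b \<tau>" and c = "c \<tau>" and \<tau> = \<tau>])
    show "smooth_on UNIV u" "smooth_on UNIV v" "smooth_on UNIV A" "smooth_on UNIV B" "smooth_on UNIV C"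
      unfolding u_def[abs_def] v_def[abs_def] A_def[abs_def] B_def[abs_def] C_def[abs_def]
      by (intro smooth_intros open_UNIV sm; simp)+
    show "A s * sin (\<theta> s) + B s * u s + C s * v s = 0" for s
      unfolding A_def B_def C_def u_def v_def by (rule profile_normal_identity1)
    show "A s * X' s + B s * u' s / 2 + C s * v' s / 2 = 0" for s
    proof -
      have "A s * X' s + B s * u' s / 2 + C s * v' s / 2 =
          cos (\<theta> s) * \<theta>' s * sin (\<beta> s) * cos (\<psi> s) + (cos (\<theta> s))\<^sup>2 * cos (\<psi> s) * cos (\<beta> s) * \<psi>' s / 2"
        unfolding A_def B_def C_def X'_def u'_def v'_def by (rule profile_normal_identity2) simp_all
      also have "\<dots> = 0" by (simp add: \<theta>'_def \<psi>'_def power2_eq_square)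
      finally show ?thesis .
    qed
    show "sin (\<theta> s) * X' s + u' s / 2 + v' s / 2 = 0" for s
      unfolding X'_def u'_def v'_def by (simp add: field_simps)
    have "(A \<tau>)\<^sup>2 + (B \<tau>)\<^sup>2 * u \<tau> + (C \<tau>)\<^sup>2 * v \<tau> = (cos (\<theta> \<tau>))\<^sup>2 * (cos (\<psi> \<tau>))\<^sup>2"
      unfolding A_def B_def C_def u_def v_def by (rule profile_norm_identity) (rule ss)+
    then show "(A \<tau>)\<^sup>2 + (B \<tau>)\<^sup>2 * u \<tau> + (C \<tau>)\<^sup>2 * v \<tau> > 0" using cp[of \<tau>] by simp
    show "X' \<tau> \<noteq> 0 \<or> u' \<tau> \<noteq> 0 \<or> v' \<tau> \<noteq> 0"
    proof (rule ccontr)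
      \<comment> \<open>A vanishing speed would make \<open>sin \<beta>\<close> and
        \<open>cos \<beta>\<close> zero at once.\<close>
      assume n: "\<not> ?thesis"
      then have "\<theta>' \<tau> = 0" using cp(2)[of \<tau>] by (simp add: X'_def)
      then have "\<psi>' \<tau> = 0" using n cp[of \<tau>] by (simp add: u'_def)
      then have "sin (\<beta> \<tau>) = 0" "cos (\<beta> \<tau>) = 0" using \<open>\<theta>' \<tau> = 0\<close> cp[of \<tau>] by (auto simp: \<psi>'_def \<theta>'_def)
      then show False using sin_cos_squared_add[of "\<beta> \<tau>"] by simp
    qed
    have Pu: "(u' \<tau>)\<^sup>2 / (4 * u \<tau>) = ((1 - sin (\<psi> \<tau>)) * (sin (\<theta> \<tau>))\<^sup>2 * (\<theta>' \<tau>)\<^sup>2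
        + sin (\<theta> \<tau>) * \<theta>' \<tau> * cos (\<theta> \<tau>) * cos (\<psi> \<tau>) * \<psi>' \<tau> + (cos (\<theta> \<tau>))\<^sup>2 * (1 + sin (\<psi> \<tau>)) * (\<psi>' \<tau>)\<^sup>2 / 4) / 2" (is "_ = ?Pu")
    proof -
      have "(u' \<tau>)\<^sup>2 = ?Pu * (4 * u \<tau>)"
        unfolding u'_def u_def by (rule profile_speed_identity1) (rule ss)
      then show ?thesis using uv(1)[of \<tau>] by simp
    qed
    have Pv: "(v' \<tau>)\<^sup>2 / (4 * v \<tau>) = ((1 + sin (\<psi> \<tau>)) * (sin (\<theta> \<tau>))\<^sup>2 * (\<theta>' \<tau>)\<^sup>2
        - sin (\<theta> \<tau>) * \<theta>' \<tau> * cos (\<theta> \<tau>) * cos (\<psi> \<tau>) * \<psi>' \<tau> + (cos (\<theta> \<tau>))\<^sup>2 * (1 - sin (\<psi> \<tau>)) * (\<psi>' \<tau>)\<^sup>2 / 4) / 2" (is "_ = ?Pv")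
    proof -
      have "(v' \<tau>)\<^sup>2 = ?Pv * (4 * v \<tau>)"
        unfolding v'_def v_def by (rule profile_speed_identity2) (rule ss)
      then show ?thesis using uv(2)[of \<tau>] by simp
    qed
    have "(B \<tau> + C \<tau>) * ((X' \<tau>)\<^sup>2 + ?Pu + ?Pv) + a \<tau> * X' \<tau> + b \<tau> * u' \<tau> / 2 + c \<tau> * v' \<tau> / 2 + B \<tau> * ?Pu + C \<tau> * ?Pv = 0"
      unfolding X'_def a_def b_def c_def u'_def v'_def
      by (rule profile_curvature_identity[OF ss ss ss \<psi>'_def \<theta>'_def \<beta>'_def B_def C_def refl refl])
    then have "(B \<tau> + C \<tau>) * ((X' \<tau>)\<^sup>2 + (u' \<tau>)\<^sup>2 / (4 * u \<tau>) + (v' \<tau>)\<^sup>2 / (4 * v \<tau>))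
          + a \<tau> * X' \<tau> + b \<tau> * u' \<tau> / 2 + c \<tau> * v' \<tau> / 2
          + B \<tau> * (u' \<tau>)\<^sup>2 / (4 * u \<tau>) + C \<tau> * (v' \<tau>)\<^sup>2 / (4 * v \<tau>) = 0"
      unfolding times_divide_eq_right[symmetric, of "B \<tau>"] times_divide_eq_right[symmetric, of "C \<tau>"] Pu Pv by simp
    then show "(z1 \<noteq> 0 \<and> z2 \<noteq> 0 \<and> (B \<tau> + C \<tau>) * ((X' \<tau>)\<^sup>2 + (u' \<tau>)\<^sup>2 / (4 * u \<tau>) + (v' \<tau>)\<^sup>2 / (4 * v \<tau>))
          + a \<tau> * X' \<tau> + b \<tau> * u' \<tau> / 2 + c \<tau> * v' \<tau> / 2
          + B \<tau> * (u' \<tau>)\<^sup>2 / (4 * u \<tau>) + C \<tau> * (v' \<tau>)\<^sup>2 / (4 * v \<tau>) = 0) \<or>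
        z1 \<noteq> 0 \<and> z2 = 0 \<and> B \<tau> + 2 * C \<tau> = 0 \<or> z1 = 0 \<and> z2 \<noteq> 0 \<and> 2 * B \<tau> + C \<tau> = 0"
      using z by blast
  qed (use Mi dX du dv dA dB dC in \<open>auto simp: \<tau>_def\<close>)
qed

section \<open>The hypertorus and the Clifford hypersurface\<close>

lemma S1_invariantI:
  assumes "\<And>x z1 z2 w1 w2. (x, z1, z2) \<in> M \<Longrightarrow> cmod w1 = cmod z1 \<Longrightarrow> cmod w2 = cmod z2 \<Longrightarrow> (x, w1, w2) \<in> M"
  shows "S1_invariant M"
  unfolding S1_invariant_def
proof
  fix \<theta>
  have inc: "suspended_hopf_action (cis \<phi>) p \<in> M" if "p \<in> M" for \<phi> p
    using that assms by (cases p) (auto simp: suspended_hopf_action_def norm_mult)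
  show "suspended_hopf_action (cis \<theta>) ` M = M"
  proof
    show "suspended_hopf_action (cis \<theta>) ` M \<subseteq> M" using inc by blast
    show "M \<subseteq> suspended_hopf_action (cis \<theta>) ` M"
    proof
      fix p assume "p \<in> M"
      then have "suspended_hopf_action (cis (- \<theta>)) p \<in> M" by (rule inc)
      moreover have "p = suspended_hopf_action (cis \<theta>) (suspended_hopf_action (cis (- \<theta>)) p)"
        by (cases p) (simp add: suspended_hopf_action_def cis_mult flip: mult.assoc)
      ultimately show "p \<in> suspended_hopf_action (cis \<theta>) ` M" by blast
    qed
  qed
qed

lemma minimal_hypersurfaceI:
  assumes "embedded_hypersurface M"
    "\<And>x z1 z2. (x, z1, z2) \<in> M \<Longrightarrow> \<exists>U \<nu>. (x, z1, z2) \<in> U \<and> unit_normal_field M U \<nu> \<and> mean_curvature M \<nu> (x, z1, z2) = 0"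
  shows "minimal_hypersurface M"
  unfolding minimal_hypersurface_def using assms by auto

lemma smooth_on_sgn [smooth_intros]:
  fixes f :: "'a::euclidean_space \<Rightarrow> complex"
  assumes "open U" "smooth_on U f" "\<And>x. x \<in> U \<Longrightarrow> f x \<noteq> 0"
  shows "smooth_on U (\<lambda>x. sgn (f x))"
proof -
  have pos: "(Re (f x))\<^sup>2 + (Im (f x))\<^sup>2 > 0" if "x \<in> U" for x
    using assms(3)[OF that] by (simp add: sum_power2_gt_zero_iff complex_eq_iff)
  have "smooth_on U (\<lambda>x. (1 / sqrt ((Re (f x))\<^sup>2 + (Im (f x))\<^sup>2)) *\<^sub>R f x)"
    by (intro smooth_intros assms pos) (use pos in force)+
  then show ?thesis
    by (subst smooth_on_cong[OF assms(1), of _ "\<lambda>x. (1 / sqrt ((Re (f x))\<^sup>2 + (Im (f x))\<^sup>2)) *\<^sub>R f x"])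
      (simp_all add: sgn_div_norm cmod_def inverse_eq_divide)
qed

lemma real_cmod_scaleR_sgn: "z \<noteq> 0 \<Longrightarrow> cmod z *\<^sub>R sgn z = z"
  by (simp add: sgn_div_norm)

lemma minimal_torus:
  "\<exists>M. minimal_hypersurface M \<and> S1_invariant M \<and>
    M diffeomorphic (sphere (0 :: complex) 1 \<times> sphere (0 :: complex) 1 \<times> sphere (0 :: complex) 1)"
proof -
  obtain \<psi> \<beta> \<theta> :: "real \<Rightarrow> real" and \<sigma> :: real where
    desc: "descending_profile \<psi> \<beta> \<theta>" and i: "\<psi> 0 = 0" "\<beta> 0 = pi/2" and \<sigma>: "\<sigma> > 0" "\<theta> \<sigma> = 0" "\<beta> \<sigma> = 0"
    and \<theta>p: "\<And>t. 0 \<le> t \<Longrightarrow> t < \<sigma> \<Longrightarrow> 0 < \<theta> t" and \<beta>p: "\<And>t. 0 \<le> t \<Longrightarrow> t < \<sigma> \<Longrightarrow> 0 < \<beta> t"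
    and \<beta>u: "\<And>t. 0 < t \<Longrightarrow> t \<le> \<sigma> \<Longrightarrow> \<beta> t < pi/2" and \<psi>p: "\<And>t. 0 < t \<Longrightarrow> t \<le> \<sigma> \<Longrightarrow> 0 < \<psi> t"
    by (rule torus_profile) (rule that; assumption)
  interpret descending_profile \<psi> \<beta> \<theta> by (rule desc)
  note cp = cos_\<psi>_pos cos_\<theta>_pos
  define \<psi>' \<beta>' \<theta>' where "\<psi>' s = sin (\<beta> s) * cos (\<psi> s)"
    and "\<beta>' s = - (3/2 * sin (\<theta> s) * (sin (\<beta> s) * cos (\<psi> s))) - sin (\<psi> s) * cos (\<beta> s)"
    and "\<theta>' s = - (1/2 * (cos (\<theta> s) * (cos (\<psi> s) * cos (\<beta> s))))" for s
  note d = profile_solutionD[OF sol, folded \<psi>'_def \<beta>'_def \<theta>'_def]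
  note sm = profile_smooth[OF sol]
  have refl_d: "((\<lambda>t. f (a - t)) has_real_derivative - f' (a - t)) (at t)"
    if "\<And>t. (f has_real_derivative f' t) (at t)" for f f' a t
  proof -
    have "((\<lambda>t. a - t) has_real_derivative - 1) (at t)" by (auto intro!: derivative_eq_intros)
    from DERIV_chain'[OF this that] show ?thesis by simp
  qed
  note dr = refl_d[OF d(1)] refl_d[OF d(2)] refl_d[OF d(3)]
  \<comment> \<open>Exchange of \<open>z1\<close> and \<open>z2\<close>, with time reversed about
    \<open>0\<close>. It preserves the initial values \<open>\<psi> = 0\<close> and
    \<open>\<beta> = pi/2\<close>, so by uniqueness it preserves the profile.\<close>
  have "profile_solution (\<lambda>t. - \<psi> (0 - t)) (\<lambda>t. pi - \<beta> (0 - t)) (\<lambda>t. \<theta> (0 - t))"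
    unfolding profile_solution_def
  proof (intro allI conjI)
    fix t
    show "((\<lambda>t. - \<psi> (0 - t)) has_real_derivative sin (pi - \<beta> (0 - t)) * cos (- \<psi> (0 - t))) (at t)"
      using DERIV_minus[OF dr(1)[of 0 t]] by (simp add: \<psi>'_def)
    show "((\<lambda>t. pi - \<beta> (0 - t)) has_real_derivative - (3/2 * sin (\<theta> (0 - t)) * (sin (pi - \<beta> (0 - t)) * cos (- \<psi> (0 - t))))
        - sin (- \<psi> (0 - t)) * cos (pi - \<beta> (0 - t))) (at t)"
      by (rule DERIV_cong[OF DERIV_diff[OF DERIV_const dr(2)[of 0 t]]]) (simp add: \<beta>'_def algebra_simps)
    show "((\<lambda>t. \<theta> (0 - t)) has_real_derivative - (1/2 * (cos (\<theta> (0 - t)) * (cos (- \<psi> (0 - t)) * cos (pi - \<beta> (0 - t)))))) (at t)"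
      using dr(3)[of 0 t] by (simp add: \<theta>'_def)
  qed
  from profile_solution_unique[OF this sol, of 0]
  have R2: "\<psi> (- t) = - \<psi> t" "\<beta> (- t) = pi - \<beta> t" "\<theta> (- t) = \<theta> t" for t
    using i by (simp_all add: neg_eq_iff_add_eq_0 algebra_simps eq_neg_iff_add_eq_0)
  \<comment> \<open>The reflection of \<open>x\<close>, with time reversed about
    \<open>\<sigma>\<close>; here \<open>\<theta> \<sigma> = \<beta> \<sigma> = 0\<close> gives the
    invariance.\<close>
  have "profile_solution (\<lambda>t. \<psi> (2 * \<sigma> - t)) (\<lambda>t. - \<beta> (2 * \<sigma> - t)) (\<lambda>t. - \<theta> (2 * \<sigma> - t))"
    unfolding profile_solution_def
  proof (intro allI conjI)
    fix t
    show "((\<lambda>t. \<psi> (2 * \<sigma> - t)) has_real_derivative sin (- \<beta> (2 * \<sigma> - t)) * cos (\<psi> (2 * \<sigma> - t))) (at t)"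
      using dr(1)[of "2 * \<sigma>" t] by (simp add: \<psi>'_def)
    show "((\<lambda>t. - \<beta> (2 * \<sigma> - t)) has_real_derivative - (3/2 * sin (- \<theta> (2 * \<sigma> - t)) * (sin (- \<beta> (2 * \<sigma> - t)) * cos (\<psi> (2 * \<sigma> - t))))
        - sin (\<psi> (2 * \<sigma> - t)) * cos (- \<beta> (2 * \<sigma> - t))) (at t)"
      by (rule DERIV_cong[OF DERIV_minus[OF dr(2)[of "2 * \<sigma>" t]]]) (simp add: \<beta>'_def algebra_simps)
    show "((\<lambda>t. - \<theta> (2 * \<sigma> - t)) has_real_derivative - (1/2 * (cos (- \<theta> (2 * \<sigma> - t)) * (cos (\<psi> (2 * \<sigma> - t)) * cos (- \<beta> (2 * \<sigma> - t)))))) (at t)"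
      using DERIV_minus[OF dr(3)[of "2 * \<sigma>" t]] by (simp add: \<theta>'_def)
  qed
  from profile_solution_unique[OF this sol, of \<sigma>]
  have R1: "\<psi> (2 * \<sigma> - t) = \<psi> t" "- \<beta> (2 * \<sigma> - t) = \<beta> t" "- \<theta> (2 * \<sigma> - t) = \<theta> t" for t
    using \<sigma> by simp_all
  \<comment> \<open>The profile drawn in the plane with coordinates \<open>x\<close> and
    \<open>|z2|^2 - |z1|^2\<close>.\<close>
  define X Y where "X t = sin (\<theta> t)" and "Y t = (cos (\<theta> t))\<^sup>2 * sin (\<psi> t)" for t
  have sym: "X (- t) = X t" "Y (- t) = - Y t" "X (2 * \<sigma> - t) = - X t" "Y (2 * \<sigma> - t) = Y t" for t
  proof -
    have "\<theta> (2 * \<sigma> - t) = - \<theta> t" using R1(3)[of t] by simp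
    then show "X (- t) = X t" "Y (- t) = - Y t" "X (2 * \<sigma> - t) = - X t" "Y (2 * \<sigma> - t) = Y t"
      by (simp_all add: X_def Y_def R2 R1(1))
  qed
  define X' Y' where "X' t = cos (\<theta> t) * \<theta>' t"
    and "Y' t = - (2 * cos (\<theta> t) * sin (\<theta> t) * \<theta>' t * sin (\<psi> t)) + (cos (\<theta> t))\<^sup>2 * cos (\<psi> t) * \<psi>' t" for t
  have dX: "(X has_real_derivative X' t) (at t)" for t
    unfolding X_def[abs_def] X'_def by (rule derivative_eq_intros d refl)+
  have dY: "(Y has_real_derivative Y' t) (at t)" for t
    unfolding Y_def[abs_def] Y'_def by (rule derivative_eq_intros d refl)+ (simp add: power2_eq_square algebra_simps)
  have smXY: "smooth_on UNIV X" "smooth_on UNIV Y"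
    unfolding X_def[abs_def] Y_def[abs_def] by (intro smooth_intros open_UNIV sm)+
  \<comment> \<open>The angular momentum of \<open>(X, Y)\<close> about the origin. Both summands
    are nonnegative on the quarter \<open>[0, \<sigma>]\<close>, the reflections spread positivity
    to \<open>[- \<sigma>, 2 * \<sigma>]\<close>, and star-shapedness follows.\<close>
  define D where "D t = (cos (\<theta> t))\<^sup>2 * cos (\<psi> t) * (1/2 * (sin (\<psi> t) * cos (\<beta> t)) * (1 + (sin (\<theta> t))\<^sup>2) + cos (\<psi> t) * (sin (\<theta> t) * sin (\<beta> t)))" for t
  have D: "Y' t * X t - Y t * X' t = D t" for t
  proof -
    have "cos (\<theta> t) * cos (\<theta> t) = 1 - sin (\<theta> t) * sin (\<theta> t)"
      using sin_cos_squared_add2[of "\<theta> t"] unfolding power2_eq_square by argo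
    then have r: "cos (\<theta> t) * (cos (\<theta> t) * x) = (1 - sin (\<theta> t) * sin (\<theta> t)) * x" for x by (metis mult.assoc)
    show ?thesis unfolding D_def X_def Y_def X'_def Y'_def \<theta>'_def \<psi>'_def
      by (simp add: power2_eq_square field_simps r)
  qed
  have D0: "D t > 0" if t: "0 \<le> t" "t \<le> \<sigma>" for t
  proof -
    have a: "sin (\<psi> t) \<ge> 0" using \<psi>p[of t] i(1) t \<psi>_range[of t] pi_gt_zero
      by (cases "t = 0") (auto intro!: sin_ge_zero simp: abs_less_iff less_imp_le)
    have b: "\<beta> t \<ge> 0" "\<beta> t \<le> pi/2"
    proof -
      show "\<beta> t \<ge> 0" using \<beta>p[of t] \<sigma>(3) t by (cases "t = \<sigma>") (simp_all add: less_imp_le)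
      show "\<beta> t \<le> pi/2" using \<beta>u[of t] i(2) t by (cases "t = 0") (simp_all add: less_imp_le)
    qed
    have c: "\<theta> t \<ge> 0" using \<theta>p[of t] \<sigma>(2) t by (cases "t = \<sigma>") auto
    have cb: "cos (\<beta> t) \<ge> 0" using b pi_gt_zero by (intro cos_ge_zero) linarith+
    have sb: "sin (\<beta> t) \<ge> 0" using b pi_gt_zero by (intro sin_ge_zero) linarith+
    have st: "sin (\<theta> t) \<ge> 0" using c \<theta>_range[of t] pi_gt_zero by (intro sin_ge_zero) linarith+
    have p1: "1/2 * (sin (\<psi> t) * cos (\<beta> t)) * (1 + (sin (\<theta> t))\<^sup>2) \<ge> 0" using a cb by simp
    have p2: "cos (\<psi> t) * (sin (\<theta> t) * sin (\<beta> t)) \<ge> 0" using cp(1)[of t] st sb by simp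
    have "1/2 * (sin (\<psi> t) * cos (\<beta> t)) * (1 + (sin (\<theta> t))\<^sup>2) + cos (\<psi> t) * (sin (\<theta> t) * sin (\<beta> t)) > 0"
    proof (cases "t = \<sigma>")
      case True
      have "sin (\<psi> t) > 0" using \<psi>p[of t] \<psi>_range[of t] True \<sigma>(1) pi_gt_zero by (intro sin_gt_zero) auto
      then have "1/2 * (sin (\<psi> t) * cos (\<beta> t)) * (1 + (sin (\<theta> t))\<^sup>2) > 0" by (simp add: True \<sigma>)
      then show ?thesis using p2 by linarith
    next
      case False
      then have "\<theta> t > 0" "\<beta> t > 0" using \<theta>p \<beta>p t by auto
      then have "sin (\<theta> t) > 0" "sin (\<beta> t) > 0" using \<theta>_range[of t] b pi_gt_zero by (auto intro!: sin_gt_zero)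
      then have "cos (\<psi> t) * (sin (\<theta> t) * sin (\<beta> t)) > 0" using cp(1)[of t] by simp
      then show ?thesis using p1 by linarith
    qed
    then show ?thesis unfolding D_def using cp[of t] by (intro mult_pos_pos) auto
  qed
  have Dm: "D (- t) = D t" for t by (simp add: D_def R2)
  have Dr: "D (2 * \<sigma> - t) = D t" for t
  proof -
    have "\<theta> (2 * \<sigma> - t) = - \<theta> t" "\<beta> (2 * \<sigma> - t) = - \<beta> t" using R1(2,3)[of t] by simp_all
    then show ?thesis by (simp add: D_def R1(1))
  qed
  have Dpos: "D t > 0" if "- \<sigma> \<le> t" "t \<le> 2 * \<sigma>" for t
  proof -
    consider "t < 0" | "0 \<le> t" "t \<le> \<sigma>" | "\<sigma> < t" by linarith
    then show ?thesis
    proof cases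
      case 1
      then show ?thesis using D0[of "- t"] Dm[of t] that by simp
    next
      case 2
      then show ?thesis by (rule D0)
    next
      case 3
      then show ?thesis using D0[of "2 * \<sigma> - t"] Dr[of t] that by simp
    qed
  qed
  have Xpos: "X t > 0" if "t \<in> {-\<sigma><..<\<sigma>}" for t
  proof -
    have "X s > 0" if "0 \<le> s" "s < \<sigma>" for s
      unfolding X_def using \<theta>p[OF that] \<theta>_range[of s] pi_gt_zero by (intro sin_gt_zero) auto
    then show ?thesis using that sym(1)[of t] by (cases "t \<ge> 0") (auto, metis neg_0_le_iff_le linear minus_less_iff)
  qed
  have Ypos: "Y t > 0" if "t \<in> {0<..<2 * \<sigma>}" for t
  proof -
    have *: "Y s > 0" if "0 < s" "s \<le> \<sigma>" for s
    proof -
      have "sin (\<psi> s) > 0" using \<psi>p[OF that] \<psi>_range[of s] pi_gt_zero by (intro sin_gt_zero) auto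
      then show ?thesis using cp(2)[of s] by (simp add: Y_def)
    qed
    show ?thesis using that *[of t] *[of "2 * \<sigma> - t"] sym(4)[of t] by (cases "t \<le> \<sigma>") auto
  qed
  have X0: "X 0 > 0" "X \<sigma> = 0" "Y \<sigma> > 0" using Xpos[of 0] Ypos[of \<sigma>] \<sigma> by (auto simp: X_def)
  have contXY: "isCont X t" "isCont Y t" for t using DERIV_isCont dX dY by blast+
  \<comment> \<open>Slopes as local coordinates, one where \<open>X > 0\<close> and one where
    \<open>Y > 0\<close>. Their derivatives are \<open>D / X^2\<close> and \<open>D / Y^2\<close>,
    so each can be inverted smoothly.\<close>
  define K1 K2 where "K1 t = Y t / X t" and "K2 t = - X t / Y t" for t
  obtain g1 where g1: "open (K1 ` {-\<sigma><..<\<sigma>})" "smooth_on (K1 ` {-\<sigma><..<\<sigma>}) g1" "\<And>t. t \<in> {-\<sigma><..<\<sigma>} \<Longrightarrow> g1 (K1 t) = t"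
  proof (rule smooth_inverse_increasing[of "-\<sigma>" \<sigma> K1 "\<lambda>t. D t / (X t * X t)"])
    show "smooth_on {-\<sigma><..<\<sigma>} K1"
      unfolding K1_def[abs_def] using Xpos
      by (intro smooth_intros smXY[THEN smooth_on_subset]) (auto simp: less_imp_neq[THEN not_sym])
    show "(K1 has_real_derivative D t / (X t * X t)) (at t)" if "t \<in> {-\<sigma><..<\<sigma>}" for t
      unfolding K1_def[abs_def] D[symmetric] using DERIV_divide[OF dY dX] Xpos[OF that] by simp
    show "D t / (X t * X t) > 0" if "t \<in> {-\<sigma><..<\<sigma>}" for t using Dpos[of t] Xpos[OF that] that \<sigma>(1) by simp
  qed (rule that; assumption)
  obtain g2 where g2: "open (K2 ` {0<..<2 * \<sigma>})" "smooth_on (K2 ` {0<..<2 * \<sigma>}) g2" "\<And>t. t \<in> {0<..<2 * \<sigma>} \<Longrightarrow> g2 (K2 t) = t"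
  proof (rule smooth_inverse_increasing[of 0 "2 * \<sigma>" K2 "\<lambda>t. D t / (Y t * Y t)"])
    show "smooth_on {0<..<2 * \<sigma>} K2"
      unfolding K2_def[abs_def] using Ypos
      by (intro smooth_intros smXY[THEN smooth_on_subset]) (auto simp: less_imp_neq[THEN not_sym])
    show "(K2 has_real_derivative D t / (Y t * Y t)) (at t)" if "t \<in> {0<..<2 * \<sigma>}" for t
    proof -
      have "(K2 has_real_derivative (- X' t * Y t - - X t * Y' t) / (Y t * Y t)) (at t)"
        unfolding K2_def[abs_def] using Ypos[OF that] by (intro DERIV_divide DERIV_minus dX dY) simp
      then show ?thesis unfolding D[symmetric] by (simp add: mult.commute)
    qed
    show "D t / (Y t * Y t) > 0" if "t \<in> {0<..<2 * \<sigma>}" for t using Dpos[of t] Ypos[OF that] that \<sigma>(1) by simp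
  qed (rule that; assumption)
  \<comment> \<open>At \<open>- \<sigma>\<close> and \<open>\<sigma>\<close> the abscissa
    \<open>X\<close> vanishes while \<open>Y\<close> has opposite signs, so every slope occurs in
    between and \<open>g1\<close> lives on the whole line.\<close>
  have s1: "\<exists>t\<in>{-\<sigma><..<\<sigma>}. K1 t = k" for k
  proof -
    have "\<exists>t\<ge>-\<sigma>. t \<le> \<sigma> \<and> Y t - k * X t = 0"
      by (rule IVT) (use \<sigma>(1) X0 sym(1,2)[of \<sigma>] contXY in \<open>auto intro!: continuous_intros\<close>)
    then obtain t where t: "-\<sigma> \<le> t" "t \<le> \<sigma>" "Y t - k * X t = 0" by blast
    have "t \<noteq> \<sigma>" "t \<noteq> - \<sigma>" using t(3) X0 sym(1,2)[of \<sigma>] by auto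
    then have "t \<in> {-\<sigma><..<\<sigma>}" using t by auto
    then show ?thesis using t(3) Xpos[of t] by (intro bexI[of _ t]) (auto simp: K1_def field_simps)
  qed
  have s2: "\<exists>t\<in>{0<..<2 * \<sigma>}. K2 t = k" for k
  proof -
    have z: "X (2 * \<sigma>) = - X 0" "Y (2 * \<sigma>) = Y 0" "Y 0 = 0" using sym(3,4)[of 0] sym(2)[of 0] by auto
    have "\<exists>t\<ge>0. t \<le> 2 * \<sigma> \<and> - X t - k * Y t = 0"
      by (rule IVT) (use \<sigma>(1) X0 z contXY in \<open>auto intro!: continuous_intros\<close>)
    then obtain t where t: "0 \<le> t" "t \<le> 2 * \<sigma>" "- X t - k * Y t = 0" by blast
    have "t \<noteq> 0" "t \<noteq> 2 * \<sigma>" using t(3) X0 z by auto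
    then have "t \<in> {0<..<2 * \<sigma>}" using t by auto
    then show ?thesis using t(3) Ypos[of t] by (intro bexI[of _ t]) (auto simp: K2_def field_simps)
  qed
  have g1': "g1 k \<in> {-\<sigma><..<\<sigma>}" "K1 (g1 k) = k" for k using s1[of k] g1(3) by auto
  have g2': "g2 k \<in> {0<..<2 * \<sigma>}" "K2 (g2 k) = k" for k using s2[of k] g2(3) by auto
  have smg: "smooth_on UNIV g1" "smooth_on UNIV g2"
    using g1(2) g2(2) s1 s2 by (metis UNIV_eq_I image_eqI)+
  define \<gamma> where "\<gamma> t = complex_of_real (X t) + \<i> * complex_of_real (Y t)" for t
  have sm\<gamma>: "smooth_on UNIV \<gamma>" unfolding \<gamma>_def[abs_def] by (intro smooth_intros open_UNIV smXY)
  have \<gamma>ri: "Re (\<gamma> t) = X t" "Im (\<gamma> t) = Y t" for t by (simp_all add: \<gamma>_def)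
  \<comment> \<open>One half of the curve and its antipodal image; they close up because
    \<open>\<gamma> (t - 2 * \<sigma>) = - \<gamma> t\<close>.\<close>
  define \<Gamma> where "\<Gamma> = {q. \<exists>t\<in>{-\<sigma><..\<sigma>}. q = \<gamma> t \<or> q = - \<gamma> t}"
  \<comment> \<open>The point of \<open>\<Gamma>\<close> on the ray through \<open>w\<close>: the
    inverse of radial projection.\<close>
  define P where "P w = (if Re w > 0 then \<gamma> (g1 (Im w / Re w)) else if Re w < 0 then - \<gamma> (g1 (Im w / Re w))
    else if Im w > 0 then \<gamma> \<sigma> else - \<gamma> \<sigma>)" for w
  have P\<Gamma>: "P w = q" if q: "q \<in> \<Gamma>" "q = r *\<^sub>R w" "r > 0" for q w r
  proof -
    obtain t where t: "t \<in> {-\<sigma><..\<sigma>}" "q = \<gamma> t \<or> q = - \<gamma> t" using q(1) unfolding \<Gamma>_def by blast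
    have rw: "Re q = r * Re w" "Im q = r * Im w" using q(2) by simp_all
    show ?thesis
    proof (cases "t = \<sigma>")
      case True
      have "Re q = 0" using t(2) X0 True \<gamma>ri by auto
      then have "Re w = 0" using rw q(3) by simp
      moreover have "(q = \<gamma> t \<and> Im w > 0) \<or> (q = - \<gamma> t \<and> Im w < 0)"
        using t(2)
      proof
        assume "q = \<gamma> t"
        moreover from this have "r * Im w > 0" using rw(2) X0 True \<gamma>ri(2)[of \<sigma>] by simp
        ultimately show ?thesis using q(3) by (simp add: zero_less_mult_iff)
      next
        assume "q = - \<gamma> t"
        moreover from this have "r * Im w < 0" using rw(2) X0 True \<gamma>ri(2)[of \<sigma>] by simp
        ultimately show ?thesis using q(3) by (simp add: mult_less_0_iff)
      qed
      ultimately show ?thesis by (auto simp: P_def True)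
    next
      case False
      then have tI: "t \<in> {-\<sigma><..<\<sigma>}" using t(1) by auto
      have "Im w / Re w = Im q / Re q" using rw q(3) by simp
      also have "\<dots> = K1 t" using t(2) \<gamma>ri by (auto simp: K1_def)
      finally have g: "g1 (Im w / Re w) = t" using g1(3)[OF tI] by simp
      from t(2) show ?thesis
      proof
        assume *: "q = \<gamma> t"
        then have "r * Re w > 0" using rw Xpos[OF tI] \<gamma>ri by simp
        then show ?thesis using q(3) g * by (simp add: P_def zero_less_mult_iff)
      next
        assume *: "q = - \<gamma> t"
        then have "r * Re w < 0" using rw Xpos[OF tI] \<gamma>ri by simp
        then have "Re w < 0" using q(3) by (simp add: mult_less_0_iff)
        then show ?thesis using g * by (simp add: P_def)
      qed
    qed
  qed
  have shift: "\<gamma> t = - \<gamma> (t - 2 * \<sigma>)" for t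
    using sym(1,2)[of "2 * \<sigma> - t"] sym(3,4)[of t] by (simp add: \<gamma>_def)
  have \<Gamma>U: "\<gamma> t \<in> \<Gamma>" "- \<gamma> t \<in> \<Gamma>" if "t \<in> {-\<sigma><..<2 * \<sigma>}" for t
  proof -
    have "\<exists>s\<in>{-\<sigma><..\<sigma>}. \<gamma> t = \<gamma> s \<or> \<gamma> t = - \<gamma> s"
    proof (cases "t \<le> \<sigma>")
      case False
      then show ?thesis using that shift[of t] by (intro bexI[of _ "t - 2 * \<sigma>"]) auto
    qed (use that in auto)
    then show "\<gamma> t \<in> \<Gamma>" "- \<gamma> t \<in> \<Gamma>" unfolding \<Gamma>_def by force+
  qed
  have P1: "P w = \<gamma> (g1 (Im w / Re w))" if "Re w > 0" for w using that by (simp add: P_def)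
  have P2: "P w = - \<gamma> (g1 (Im w / Re w))" if "Re w < 0" for w using that by (simp add: P_def)
  have h2: "\<gamma> (g2 (- Re w / Im w)) = (Y (g2 (- Re w / Im w)) / Im w) *\<^sub>R w" if "Im w \<noteq> 0" for w
  proof -
    define t where "t = g2 (- Re w / Im w)"
    have "- X t / Y t = - Re w / Im w" "Y t > 0" using g2'[of "- Re w / Im w"] Ypos[of t] by (auto simp: K2_def t_def)
    then have "X t = Y t / Im w * Re w" using that by (simp add: field_simps)
    then show ?thesis unfolding t_def[symmetric] using that by (simp add: complex_eq_iff \<gamma>ri)
  qed
  have P3: "P w = \<gamma> (g2 (- Re w / Im w))" if "Im w > 0" for w
  proof (rule P\<Gamma>)
    show "\<gamma> (g2 (- Re w / Im w)) \<in> \<Gamma>" using g2'(1)[of "- Re w / Im w"] \<sigma>(1) by (intro \<Gamma>U) auto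
    show "\<gamma> (g2 (- Re w / Im w)) = (Y (g2 (- Re w / Im w)) / Im w) *\<^sub>R w" using that by (intro h2) simp
    show "Y (g2 (- Re w / Im w)) / Im w > 0" using that Ypos[OF g2'(1)] by simp
  qed
  have P4: "P w = - \<gamma> (g2 (- Re w / Im w))" if "Im w < 0" for w
  proof (rule P\<Gamma>)
    show "- \<gamma> (g2 (- Re w / Im w)) \<in> \<Gamma>" using g2'(1)[of "- Re w / Im w"] \<sigma>(1) by (intro \<Gamma>U) auto
    show "- \<gamma> (g2 (- Re w / Im w)) = (- (Y (g2 (- Re w / Im w)) / Im w)) *\<^sub>R w" using that h2[of w] by simp
    show "- (Y (g2 (- Re w / Im w)) / Im w) > 0" using that Ypos[OF g2'(1)] by (simp add: divide_pos_neg)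
  qed
  have Pw: "P w \<in> \<Gamma> \<and> (\<exists>r>0. P w = r *\<^sub>R w)" if "w \<noteq> 0" for w
  proof -
    consider "Re w > 0" | "Re w < 0" | "Re w = 0" "Im w > 0" | "Re w = 0" "Im w < 0"
      using \<open>w \<noteq> 0\<close> by (metis complex_eq_iff linorder_cases zero_complex.sel)
    then show ?thesis
    proof cases
      case 1
      define t where "t = g1 (Im w / Re w)"
      have t: "t \<in> {-\<sigma><..<\<sigma>}" "Y t / X t = Im w / Re w" using g1'[of "Im w / Re w"] by (auto simp: t_def K1_def)
      have "\<gamma> t = (X t / Re w) *\<^sub>R w" using 1 t(2) Xpos[OF t(1)] by (simp add: complex_eq_iff \<gamma>ri field_simps)
      then show ?thesis using 1 P1[OF 1] Xpos[OF t(1)] \<Gamma>U[of t] t(1) \<sigma>(1) by (auto simp: t_def[symmetric] intro!: exI[of _ "X t / Re w"])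
    next
      case 2
      define t where "t = g1 (Im w / Re w)"
      have t: "t \<in> {-\<sigma><..<\<sigma>}" "Y t / X t = Im w / Re w" using g1'[of "Im w / Re w"] by (auto simp: t_def K1_def)
      have "- \<gamma> t = (- (X t / Re w)) *\<^sub>R w" using 2 t(2) Xpos[OF t(1)] by (simp add: complex_eq_iff \<gamma>ri field_simps)
      moreover have "- (X t / Re w) > 0" using 2 Xpos[OF t(1)] by (simp add: divide_pos_neg)
      moreover have "- \<gamma> t \<in> \<Gamma>" using \<Gamma>U[of t] t(1) \<sigma>(1) by auto
      ultimately show ?thesis using P2[OF 2] unfolding t_def by metis
    next
      case 3
      have "Y (g2 (- Re w / Im w)) / Im w > 0" using 3 Ypos[OF g2'(1)] by simp
      moreover have "\<gamma> (g2 (- Re w / Im w)) \<in> \<Gamma>" using g2'(1)[of "- Re w / Im w"] \<sigma>(1) by (intro \<Gamma>U) auto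
      ultimately show ?thesis using P3[OF 3(2)] h2[of w] 3(2) by (metis less_irrefl)
    next
      case 4
      have "- (Y (g2 (- Re w / Im w)) / Im w) > 0" using 4 Ypos[OF g2'(1)] by (simp add: divide_pos_neg)
      moreover have "- \<gamma> (g2 (- Re w / Im w)) \<in> \<Gamma>" using g2'(1)[of "- Re w / Im w"] \<sigma>(1) by (intro \<Gamma>U) auto
      moreover have "- \<gamma> (g2 (- Re w / Im w)) = (- (Y (g2 (- Re w / Im w)) / Im w)) *\<^sub>R w" using 4 h2[of w] by simp
      ultimately show ?thesis using P4[OF 4(2)] by metis
    qed
  qed
  have opR: "open {w. Re w > 0}" "open {w. Re w < 0}" "open {w. Im w > 0}" "open {w. Im w < 0}"
    by (intro open_Collect_less continuous_intros)+
  have sm1: "smooth_on {w. Re w > 0} (\<lambda>w. \<gamma> (g1 (Im w / Re w)))" "smooth_on {w. Re w < 0} (\<lambda>w. - \<gamma> (g1 (Im w / Re w)))"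
    "smooth_on {w. Im w > 0} (\<lambda>w. \<gamma> (g2 (- Re w / Im w)))" "smooth_on {w. Im w < 0} (\<lambda>w. - \<gamma> (g2 (- Re w / Im w)))"
    by (intro smooth_intros opR smooth_on_compose[OF sm\<gamma>] smooth_on_compose[OF smg(1)] smooth_on_compose[OF smg(2)] open_UNIV UNIV_I; auto)+
  have smP: "smooth_map (sphere 0 1) P"
    unfolding smooth_map_def
  proof
    fix w :: complex assume "w \<in> sphere 0 1"
    then have "w \<noteq> 0" by auto
    then consider "Re w > 0" | "Re w < 0" | "Im w > 0" | "Im w < 0"
      by (metis complex_eq_iff linorder_cases zero_complex.sel)
    then show "\<exists>U g. open U \<and> w \<in> U \<and> smooth_on U g \<and> (\<forall>y\<in>sphere 0 1 \<inter> U. g y = P y)"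
    proof cases
      case 1
      then show ?thesis using sm1(1) opR(1) P1 by (intro exI[of _ "{w. Re w > 0}"] exI conjI) auto
    next
      case 2
      then show ?thesis using sm1(2) opR(2) P2 by (intro exI[of _ "{w. Re w < 0}"] exI conjI) auto
    next
      case 3
      then show ?thesis using sm1(3) opR(3) P3 by (intro exI[of _ "{w. Im w > 0}"] exI conjI) auto
    next
      case 4
      then show ?thesis using sm1(4) opR(4) P4 by (intro exI[of _ "{w. Im w < 0}"] exI conjI) auto
    qed
  qed
  define Q :: "ambient \<Rightarrow> complex" where "Q p = complex_of_real (fst p) + \<i> * complex_of_real ((cmod (snd (snd p)))\<^sup>2 - (cmod (fst (snd p)))\<^sup>2)" for p
  have Qri: "Re (Q p) = fst p" "Im (Q p) = (cmod (snd (snd p)))\<^sup>2 - (cmod (fst (snd p)))\<^sup>2" for p by (simp_all add: Q_def)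
  have smQ: "smooth_on U Q" if "open U" for U unfolding Q_def[abs_def] by (intro smooth_intros that)
  define M where "M = {p \<in> S4. Q p \<in> \<Gamma>}"
  have \<Gamma>pos: "1 - (Re q)\<^sup>2 - Im q > 0" "1 - (Re q)\<^sup>2 + Im q > 0" "q \<noteq> 0" if "q \<in> \<Gamma>" for q
  proof -
    obtain t where t: "t \<in> {-\<sigma><..\<sigma>}" "q = \<gamma> t \<or> q = - \<gamma> t" using \<open>q \<in> \<Gamma>\<close> unfolding \<Gamma>_def by blast
    have "(sin (\<psi> t))\<^sup>2 < 1" using cp(1)[of t] by (simp add: sin_squared_eq)
    then have s: "1 - sin (\<psi> t) > 0" "1 + sin (\<psi> t) > 0" unfolding abs_square_less_1 by linarith+
    have c: "(cos (\<theta> t))\<^sup>2 > 0" using cp(2)[of t] by simp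
    have "1 - (Re q)\<^sup>2 = (cos (\<theta> t))\<^sup>2" using t(2) by (auto simp: \<gamma>ri X_def cos_squared_eq)
    moreover have "Im q = (cos (\<theta> t))\<^sup>2 * sin (\<psi> t) \<or> Im q = - ((cos (\<theta> t))\<^sup>2 * sin (\<psi> t))" using t(2) by (auto simp: \<gamma>ri Y_def)
    moreover have "(cos (\<theta> t))\<^sup>2 * (1 - sin (\<psi> t)) > 0" "(cos (\<theta> t))\<^sup>2 * (1 + sin (\<psi> t)) > 0" using s c by simp_all
    ultimately show "1 - (Re q)\<^sup>2 - Im q > 0" "1 - (Re q)\<^sup>2 + Im q > 0" by (auto simp: algebra_simps)
    have "\<gamma> t \<noteq> 0"
    proof (cases "t = \<sigma>")
      case True
      then show ?thesis using X0 \<gamma>ri(2)[of t] by auto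
    next
      case False
      then show ?thesis using Xpos[of t] t(1) \<gamma>ri(1)[of t] by auto
    qed
    then show "q \<noteq> 0" using t(2) by auto
  qed
  have Mz: "(cmod z1)\<^sup>2 = (1 - (Re (Q (x, z1, z2)))\<^sup>2 - Im (Q (x, z1, z2))) / 2"
    "(cmod z2)\<^sup>2 = (1 - (Re (Q (x, z1, z2)))\<^sup>2 + Im (Q (x, z1, z2))) / 2" if "(x, z1, z2) \<in> S4" for x z1 z2
    using that by (simp_all add: Qri S4_def)
  have Mnz: "z1 \<noteq> 0" "z2 \<noteq> 0" if "(x, z1, z2) \<in> M" for x z1 z2
    using Mz[of x z1 z2] \<Gamma>pos(1,2)[of "Q (x, z1, z2)"] that unfolding M_def by auto
  \<comment> \<open>On the sphere \<open>2 * |z1|^2 = 1 - x^2 - y\<close> and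
    \<open>2 * |z2|^2 = 1 - x^2 + y\<close>, so the planar point determines both radii.\<close>
  define G where "G = (\<lambda>(q, w1, w2). (Re q, sqrt ((1 - (Re q)\<^sup>2 - Im q) / 2) *\<^sub>R w1, sqrt ((1 - (Re q)\<^sup>2 + Im q) / 2) *\<^sub>R w2) :: ambient)"
  define V :: "(complex \<times> complex \<times> complex) set" where
    "V = {y. 0 < 1 - (Re (fst y))\<^sup>2 - Im (fst y)} \<inter> {y. 0 < 1 - (Re (fst y))\<^sup>2 + Im (fst y)}"
  have opV: "open V" unfolding V_def by (intro open_Int open_Collect_less continuous_intros)
  have smG: "smooth_on V G" unfolding G_def case_prod_beta by (intro smooth_intros opV) (auto simp: V_def)
  let ?T = "sphere (0::complex) 1 \<times> sphere (0::complex) 1 \<times> sphere (0::complex) 1"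
  \<comment> \<open>Three unit complex numbers: the direction of the planar point, which is a
    coordinate on the star-shaped curve, and the phases of \<open>z1\<close> and
    \<open>z2\<close>.\<close>
  define f where "f p = (sgn (Q p), sgn (fst (snd p)), sgn (snd (snd p)))" for p
  define g where "g y = G (P (fst y), fst (snd y), snd (snd y))" for y
  have QG: "Q (G (q, w1, w2)) = q" "G (q, w1, w2) \<in> S4" if q: "q \<in> \<Gamma>" "cmod w1 = 1" "cmod w2 = 1" for q w1 w2
  proof -
    note pos = \<Gamma>pos(1,2)[OF q(1)]
    show "Q (G (q, w1, w2)) = q" using pos q by (simp add: complex_eq_iff Qri G_def power_mult_distrib field_simps)
    show "G (q, w1, w2) \<in> S4" using pos q by (simp add: G_def S4_def power_mult_distrib field_simps)
  qed
  have "diffeomorphism M ?T f g"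
  proof (rule diffeomorphismI)
    define U where "U = {p :: ambient. Q p \<noteq> 0} \<inter> {p. fst (snd p) \<noteq> 0} \<inter> {p. snd (snd p) \<noteq> 0}"
    have opU: "open U" unfolding U_def
      by (intro open_Int open_Collect_neq continuous_intros smooth_on_imp_continuous_on[OF smQ[OF open_UNIV]])
    show "smooth_map M f"
    proof (rule smooth_on_imp_smooth_map[OF opU])
      show "M \<subseteq> U" 
      proof
        fix p assume p: "p \<in> M"
        obtain x z1 z2 where pz: "p = (x, z1, z2)" by (cases p)
        show "p \<in> U" using Mnz[of x z1 z2] \<Gamma>pos(3)[of "Q p"] p by (simp add: U_def M_def pz)
      qed
      show "smooth_on U f" unfolding f_def[abs_def] by (intro smooth_intros opU smQ[OF opU]) (auto simp: U_def)
    qed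
    have "smooth_map ?T (\<lambda>y. (P (fst y), fst (snd y), snd (snd y)))"
    proof (intro smooth_map_Pair)
      show "smooth_map ?T (\<lambda>y. P (fst y))"
        by (rule smooth_map_compose[OF _ smP]) (auto intro!: smooth_on_imp_smooth_map[of UNIV] smooth_intros)
    qed (auto intro!: smooth_on_imp_smooth_map[of UNIV] smooth_intros)
    then show "smooth_map ?T g" unfolding g_def[abs_def]
    proof (rule smooth_map_compose_smooth_on[OF smG opV])
      show "(\<lambda>y. (P (fst y), fst (snd y), snd (snd y))) ` ?T \<subseteq> V"
      proof
        fix z assume "z \<in> (\<lambda>y. (P (fst y), fst (snd y), snd (snd y))) ` ?T"
        then obtain y where y: "y \<in> ?T" "z = (P (fst y), fst (snd y), snd (snd y))" by blast
        have "fst y \<noteq> 0" using y(1) by (auto simp: mem_Times_iff)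
        then have "P (fst y) \<in> \<Gamma>" using Pw by blast
        then show "z \<in> V" using \<Gamma>pos by (simp add: V_def y(2))
      qed
    qed
    show "f p \<in> ?T \<and> g (f p) = p" if p: "p \<in> M" for p
    proof -
      obtain x z1 z2 where pz: "p = (x, z1, z2)" by (cases p)
      have nz: "z1 \<noteq> 0" "z2 \<noteq> 0" "Q p \<noteq> 0" "Q p \<in> \<Gamma>" "p \<in> S4" using Mnz p \<Gamma>pos(3) by (auto simp: pz M_def)
      have "P (sgn (Q p)) = Q p"
        by (rule P\<Gamma>[OF nz(4), of "cmod (Q p)"]) (use nz in \<open>simp_all add: real_cmod_scaleR_sgn\<close>)
      then have "g (f p) = G (Q p, sgn z1, sgn z2)" by (simp add: f_def g_def pz)
      also have "\<dots> = (x, cmod z1 *\<^sub>R sgn z1, cmod z2 *\<^sub>R sgn z2)"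
        using Mz[of x z1 z2, symmetric] nz(5) by (simp add: G_def pz Qri(1))
      also have "\<dots> = p" using nz by (simp add: real_cmod_scaleR_sgn pz)
      finally show ?thesis using nz by (simp add: f_def pz norm_sgn)
    qed
    show "g y \<in> M \<and> f (g y) = y" if y: "y \<in> ?T" for y
    proof -
      obtain w w1 w2 where yw: "y = (w, w1, w2)" by (cases y)
      have n: "cmod w = 1" "cmod w1 = 1" "cmod w2 = 1" using y by (auto simp: yw)
      then have "w \<noteq> 0" by auto
      then obtain r where r: "P w \<in> \<Gamma>" "r > 0" "P w = r *\<^sub>R w" using Pw by blast
      note q = QG[OF r(1) n(2,3)]
      note pos = \<Gamma>pos(1,2)[OF r(1)]
      have gy: "g y = G (P w, w1, w2)" by (simp add: g_def yw)
      have "g y \<in> M" unfolding M_def gy using q r(1) by simp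
      moreover have "Q (g y) = r *\<^sub>R w" using q(1) r(3) gy by metis
      then have "sgn (Q (g y)) = w" using r(2) n by (simp add: sgn_scaleR sgn_div_norm)
      moreover have "sgn (fst (snd (g y))) = w1" "sgn (snd (snd (g y))) = w2"
        unfolding gy G_def using pos n by (simp_all add: sgn_scaleR sgn_div_norm)
      ultimately show ?thesis by (simp add: f_def yw)
    qed
  qed
  then have dT: "M diffeomorphic ?T" unfolding diffeomorphic_def by blast
  have "locally_euclidean TYPE(real \<times> real \<times> real) ?T"
    by (intro locally_euclidean_Times locally_euclidean_sphere) simp_all
  then have "locally_euclidean TYPE(real^3) ?T" by (rule locally_euclidean_change_type) simp
  with dT have emb: "embedded_hypersurface M" by (intro embedded_hypersurfaceI) (auto simp: M_def)
  \<comment> \<open>The half of \<open>\<Gamma>\<close> traced by \<open>- \<gamma>\<close> is a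
    profile as well, with the direction turned by \<open>pi\<close>.\<close>
  have sol': "profile_solution (\<lambda>t. - \<psi> t) (\<lambda>t. \<beta> t - pi) (\<lambda>t. - \<theta> t)"
    unfolding profile_solution_def
  proof (intro allI conjI)
    fix t
    show "((\<lambda>t. - \<psi> t) has_real_derivative sin (\<beta> t - pi) * cos (- \<psi> t)) (at t)"
      using DERIV_minus[OF d(1)[of t]] by (simp add: \<psi>'_def sin_diff)
    show "((\<lambda>t. \<beta> t - pi) has_real_derivative - (3/2 * sin (- \<theta> t) * (sin (\<beta> t - pi) * cos (- \<psi> t))) - sin (- \<psi> t) * cos (\<beta> t - pi)) (at t)"
      using DERIV_diff[OF d(2)[of t] DERIV_const, of pi] by (simp add: \<beta>'_def sin_diff cos_diff)
    show "((\<lambda>t. - \<theta> t) has_real_derivative - (1/2 * (cos (- \<theta> t) * (cos (- \<psi> t) * cos (\<beta> t - pi))))) (at t)"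
      using DERIV_minus[OF d(3)[of t]] by (simp add: \<theta>'_def cos_diff)
  qed
  have PQ: "P (Q p) = Q p" if "p \<in> M" for p
    by (rule P\<Gamma>[of _ 1]) (use that in \<open>auto simp: M_def\<close>)
  have opQ: "open {p. Re (Q p) > 0}" "open {p. Re (Q p) < 0}" "open {p. Im (Q p) > 0}" "open {p. Im (Q p) < 0}"
    by (intro open_Collect_less continuous_intros smooth_on_imp_continuous_on[OF smQ[OF open_UNIV]])+
  have smt: "smooth_on {p. Re (Q p) > 0} (\<lambda>p. g1 (Im (Q p) / Re (Q p)))" "smooth_on {p. Re (Q p) < 0} (\<lambda>p. g1 (Im (Q p) / Re (Q p)))"
    "smooth_on {p. Im (Q p) > 0} (\<lambda>p. g2 (- Re (Q p) / Im (Q p)))" "smooth_on {p. Im (Q p) < 0} (\<lambda>p. g2 (- Re (Q p) / Im (Q p)))"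
    by (intro smooth_intros smQ opQ smooth_on_compose[OF smg(1)] smooth_on_compose[OF smg(2)] open_UNIV UNIV_I; auto)+
  have min: "minimal_hypersurface M"
  proof (rule minimal_hypersurfaceI[OF emb])
    fix x z1 z2 assume p: "(x, z1, z2) \<in> M"
    have "Q (x, z1, z2) \<noteq> 0" using p \<Gamma>pos(3) by (auto simp: M_def)
    then consider "Re (Q (x, z1, z2)) > 0" | "Re (Q (x, z1, z2)) < 0" | "Im (Q (x, z1, z2)) > 0" | "Im (Q (x, z1, z2)) < 0"
      by (metis complex_eq_iff linorder_cases zero_complex.sel)
    then show "\<exists>U \<nu>. (x, z1, z2) \<in> U \<and> unit_normal_field M U \<nu> \<and> mean_curvature M \<nu> (x, z1, z2) = 0"
    proof cases
      case 1
      show ?thesis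
      proof (rule profile_minimal[OF sol cp emb p _ opQ(1) smt(1)])
        fix y w1 w2 assume a: "(y, w1, w2) \<in> M" "(y, w1, w2) \<in> {p. Re (Q p) > 0}"
        then have "Q (y, w1, w2) = \<gamma> (g1 (Im (Q (y, w1, w2)) / Re (Q (y, w1, w2))))" using PQ[OF a(1)] P1 by simp
        from arg_cong[OF this, of Re] arg_cong[OF this, of Im]
        show "y = sin (\<theta> (g1 (Im (Q (y, w1, w2)) / Re (Q (y, w1, w2))))) \<and> (cmod w2)\<^sup>2 - (cmod w1)\<^sup>2 =
          (cos (\<theta> (g1 (Im (Q (y, w1, w2)) / Re (Q (y, w1, w2))))))\<^sup>2 * sin (\<psi> (g1 (Im (Q (y, w1, w2)) / Re (Q (y, w1, w2)))))"
          unfolding \<gamma>ri X_def Y_def by (simp only: Qri fst_conv snd_conv)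
      qed (use 1 in simp)
    next
      case 2
      show ?thesis
      proof (rule profile_minimal[OF sol' _ _ emb p _ opQ(2) smt(2)])
        fix y w1 w2 assume a: "(y, w1, w2) \<in> M" "(y, w1, w2) \<in> {p. Re (Q p) < 0}"
        then have "Q (y, w1, w2) = - \<gamma> (g1 (Im (Q (y, w1, w2)) / Re (Q (y, w1, w2))))" using PQ[OF a(1)] P2 by simp
        from arg_cong[OF this, of Re] arg_cong[OF this, of Im]
        show "y = sin (- \<theta> (g1 (Im (Q (y, w1, w2)) / Re (Q (y, w1, w2))))) \<and> (cmod w2)\<^sup>2 - (cmod w1)\<^sup>2 =
          (cos (- \<theta> (g1 (Im (Q (y, w1, w2)) / Re (Q (y, w1, w2))))))\<^sup>2 * sin (- \<psi> (g1 (Im (Q (y, w1, w2)) / Re (Q (y, w1, w2)))))"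
          unfolding uminus_complex.sel \<gamma>ri X_def Y_def by (simp only: Qri fst_conv snd_conv sin_minus cos_minus mult_minus_right)
      qed (use 2 cp in simp_all)
    next
      case 3
      show ?thesis
      proof (rule profile_minimal[OF sol cp emb p _ opQ(3) smt(3)])
        fix y w1 w2 assume a: "(y, w1, w2) \<in> M" "(y, w1, w2) \<in> {p. Im (Q p) > 0}"
        then have "Q (y, w1, w2) = \<gamma> (g2 (- Re (Q (y, w1, w2)) / Im (Q (y, w1, w2))))" using PQ[OF a(1)] P3 by simp
        from arg_cong[OF this, of Re] arg_cong[OF this, of Im]
        show "y = sin (\<theta> (g2 (- Re (Q (y, w1, w2)) / Im (Q (y, w1, w2))))) \<and> (cmod w2)\<^sup>2 - (cmod w1)\<^sup>2 =
          (cos (\<theta> (g2 (- Re (Q (y, w1, w2)) / Im (Q (y, w1, w2))))))\<^sup>2 * sin (\<psi> (g2 (- Re (Q (y, w1, w2)) / Im (Q (y, w1, w2)))))"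
          unfolding \<gamma>ri X_def Y_def by (simp only: Qri fst_conv snd_conv)
      qed (use 3 in simp)
    next
      case 4
      show ?thesis
      proof (rule profile_minimal[OF sol' _ _ emb p _ opQ(4) smt(4)])
        fix y w1 w2 assume a: "(y, w1, w2) \<in> M" "(y, w1, w2) \<in> {p. Im (Q p) < 0}"
        then have "Q (y, w1, w2) = - \<gamma> (g2 (- Re (Q (y, w1, w2)) / Im (Q (y, w1, w2))))" using PQ[OF a(1)] P4 by simp
        from arg_cong[OF this, of Re] arg_cong[OF this, of Im]
        show "y = sin (- \<theta> (g2 (- Re (Q (y, w1, w2)) / Im (Q (y, w1, w2))))) \<and> (cmod w2)\<^sup>2 - (cmod w1)\<^sup>2 =
          (cos (- \<theta> (g2 (- Re (Q (y, w1, w2)) / Im (Q (y, w1, w2))))))\<^sup>2 * sin (- \<psi> (g2 (- Re (Q (y, w1, w2)) / Im (Q (y, w1, w2)))))"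
          unfolding uminus_complex.sel \<gamma>ri X_def Y_def by (simp only: Qri fst_conv snd_conv sin_minus cos_minus mult_minus_right)
      qed (use 4 cp in simp_all)
    qed
  qed
  have "S1_invariant M" by (rule S1_invariantI) (auto simp: M_def S4_def Q_def)
  with min dT show ?thesis by blast
qed

text \<open>Up to normalisation the normal is \<open>(x, -2 * z1, z2)\<close>, orthogonal to the
  position because \<open>x^2 + |z2|^2\<close> is twice \<open>|z1|^2\<close>. Its derivative is
  \<open>-2\<close> along the circle and \<open>1\<close> in both directions of the 2-sphere, so the
  trace vanishes.\<close>

lemma minimal_S1_times_S2:
  "\<exists>M. minimal_hypersurface M \<and> S1_invariant M \<and> M diffeomorphic (sphere (0 :: complex) 1 \<times> sphere (0 :: real^3) 1)"
proof -
  define M :: "ambient set" where "M = {(x, z1, z2). (cmod z1)\<^sup>2 = 1/3 \<and> x\<^sup>2 + (cmod z2)\<^sup>2 = 2/3}"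
  let ?N = "sphere (0 :: complex) 1 \<times> sphere (0 :: real \<times> complex) 1"
  have sph: "y \<in> sphere 0 1 \<longleftrightarrow> (fst y)\<^sup>2 + (cmod (snd y))\<^sup>2 = 1" for y :: "real \<times> complex"
    by (cases y) (simp add: norm_prod_def)
  have "diffeomorphism M ?N (\<lambda>p. (sqrt 3 *\<^sub>R fst (snd p), sqrt (3/2) *\<^sub>R fst p, sqrt (3/2) *\<^sub>R snd (snd p)))
    (\<lambda>y. (sqrt (2/3) *\<^sub>R fst (snd y), sqrt (1/3) *\<^sub>R fst y, sqrt (2/3) *\<^sub>R snd (snd y)))"
  proof (rule diffeomorphismI)
    have r: "sqrt (1/3) * sqrt 3 = 1" "sqrt (2/3) * sqrt (3/2) = 1" by (simp_all flip: real_sqrt_mult)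
    show "(sqrt 3 *\<^sub>R fst (snd p), sqrt (3/2) *\<^sub>R fst p, sqrt (3/2) *\<^sub>R snd (snd p)) \<in> ?N \<and>
      (sqrt (2/3) *\<^sub>R fst (snd (sqrt 3 *\<^sub>R fst (snd p), sqrt (3/2) *\<^sub>R fst p, sqrt (3/2) *\<^sub>R snd (snd p))),
       sqrt (1/3) *\<^sub>R fst (sqrt 3 *\<^sub>R fst (snd p), sqrt (3/2) *\<^sub>R fst p, sqrt (3/2) *\<^sub>R snd (snd p)),
       sqrt (2/3) *\<^sub>R snd (snd (sqrt 3 *\<^sub>R fst (snd p), sqrt (3/2) *\<^sub>R fst p, sqrt (3/2) *\<^sub>R snd (snd p)))) = p" if "p \<in> M" for p
    proof -
      obtain x z1 z2 where p: "p = (x, z1, z2)" by (cases p)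
      have m: "(cmod z1)\<^sup>2 = 1/3" "x\<^sup>2 + (cmod z2)\<^sup>2 = 2/3" using that by (auto simp: M_def p)
      have "(cmod (sqrt 3 *\<^sub>R z1))\<^sup>2 = 1" using m by (simp add: power_mult_distrib)
      then have "cmod (sqrt 3 *\<^sub>R z1) = 1" using power2_eq_1_iff[of "cmod (sqrt 3 *\<^sub>R z1)"] norm_ge_zero[of "sqrt 3 *\<^sub>R z1"] by linarith
      moreover have "(sqrt (3/2) * x)\<^sup>2 + (cmod (sqrt (3/2) *\<^sub>R z2))\<^sup>2 = 3/2 * (x\<^sup>2 + (cmod z2)\<^sup>2)" by (simp add: power_mult_distrib algebra_simps)
      ultimately have "sqrt 3 *\<^sub>R z1 \<in> sphere 0 1" "(sqrt (3/2) * x, sqrt (3/2) *\<^sub>R z2) \<in> sphere 0 1"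
        unfolding sph using m by simp_all
      then show ?thesis using r by (simp add: p del: mem_sphere_0 mem_sphere)
    qed
    show "(sqrt (2/3) *\<^sub>R fst (snd y), sqrt (1/3) *\<^sub>R fst y, sqrt (2/3) *\<^sub>R snd (snd y)) \<in> M \<and>
      (sqrt 3 *\<^sub>R fst (snd (sqrt (2/3) *\<^sub>R fst (snd y), sqrt (1/3) *\<^sub>R fst y, sqrt (2/3) *\<^sub>R snd (snd y))),
       sqrt (3/2) *\<^sub>R fst (sqrt (2/3) *\<^sub>R fst (snd y), sqrt (1/3) *\<^sub>R fst y, sqrt (2/3) *\<^sub>R snd (snd y)),
       sqrt (3/2) *\<^sub>R snd (snd (sqrt (2/3) *\<^sub>R fst (snd y), sqrt (1/3) *\<^sub>R fst y, sqrt (2/3) *\<^sub>R snd (snd y)))) = y" if "y \<in> ?N" for y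
    proof -
      obtain w a b where y: "y = (w, a, b)" by (cases y)
      have m: "cmod w = 1" "a\<^sup>2 + (cmod b)\<^sup>2 = 1" using that sph[of "(a, b)"] by (auto simp: y simp del: mem_sphere_0)
      have "(sqrt (2/3) * a)\<^sup>2 + (cmod (sqrt (2/3) *\<^sub>R b))\<^sup>2 = 2/3 * (a\<^sup>2 + (cmod b)\<^sup>2)" by (simp add: power_mult_distrib algebra_simps)
      then show ?thesis using m r by (simp add: y M_def power_mult_distrib mult.commute[of "sqrt 3"] mult.commute[of "sqrt (3/2)"])
    qed
  qed (auto intro!: smooth_on_imp_smooth_map[of UNIV] smooth_intros)
  then have d1: "M diffeomorphic ?N" unfolding diffeomorphic_def by blast
  have "locally_euclidean TYPE(real \<times> (real \<times> real)) ?N"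
    by (intro locally_euclidean_Times locally_euclidean_sphere) simp_all
  then have "locally_euclidean TYPE(real^3) ?N" by (rule locally_euclidean_change_type) simp
  with d1 have emb: "embedded_hypersurface M"
    by (intro embedded_hypersurfaceI[of M ?N]) (auto simp: M_def S4_def)
  have d2: "?N diffeomorphic (sphere (0 :: complex) 1 \<times> sphere (0 :: real^3) 1)"
  proof -
    obtain f g where fg: "diffeomorphism (sphere (0 :: real \<times> complex) 1) (sphere (0 :: real^3) 1) f g"
      using diffeomorphic_sphere[where 'a = "real \<times> complex" and 'b = "real^3"] unfolding diffeomorphic_def by auto
    note d = diffeomorphismD[OF fg]
    have "diffeomorphism ?N (sphere (0 :: complex) 1 \<times> sphere (0 :: real^3) 1) (\<lambda>y. (fst y, f (snd y))) (\<lambda>y. (fst y, g (snd y)))"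
    proof (rule diffeomorphismI)
      show "smooth_map ?N (\<lambda>y. (fst y, f (snd y)))"
        by (intro smooth_map_Pair smooth_map_compose[OF _ d(1)]) (auto intro!: smooth_on_imp_smooth_map[of UNIV] smooth_intros)
      show "smooth_map (sphere (0 :: complex) 1 \<times> sphere (0 :: real^3) 1) (\<lambda>y. (fst y, g (snd y)))"
        by (intro smooth_map_Pair smooth_map_compose[OF _ d(2)]) (auto intro!: smooth_on_imp_smooth_map[of UNIV] smooth_intros)
    qed (use d(3-6) in \<open>auto simp del: mem_sphere_0 mem_sphere\<close>)
    then show ?thesis unfolding diffeomorphic_def by blast
  qed
  have min: "minimal_hypersurface M"
  proof (rule minimal_hypersurfaceI[OF emb])
    fix x z1 z2 assume p: "(x, z1, z2) \<in> M"
    then have m: "(cmod z1)\<^sup>2 = 1/3" "(cmod z2)\<^sup>2 = 2/3 - x\<^sup>2" by (auto simp: M_def)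
    show "\<exists>U \<nu>. (x, z1, z2) \<in> U \<and> unit_normal_field M U \<nu> \<and> mean_curvature M \<nu> (x, z1, z2) = 0"
    proof (rule rotational_minimal[OF emb p UNIV_I open_UNIV _ UNIV_I open_UNIV, where t = fst and X = "\<lambda>s. s" and X' = "\<lambda>s. 1"
          and u = "\<lambda>s. 1/3" and u' = "\<lambda>s. 0" and v = "\<lambda>s. 2/3 - s\<^sup>2" and v' = "\<lambda>s. - (2 * s)"
          and A = "\<lambda>s. s" and B = "\<lambda>s. -2" and C = "\<lambda>s. 1" and a = 1 and b = 0 and c = 0 and \<tau> = x])
      have nz: "z1 \<noteq> 0" using m(1) by auto
      show "x\<^sup>2 + (- 2)\<^sup>2 * (1/3) + 1\<^sup>2 * (2/3 - x\<^sup>2) > 0" by simp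
      show "(z1 \<noteq> 0 \<and> z2 \<noteq> 0 \<and> (- 2 + 1) * (1\<^sup>2 + 0\<^sup>2 / (4 * (1/3)) + (- (2 * x))\<^sup>2 / (4 * (2/3 - x\<^sup>2))) + 1 * 1 + 0 * 0 / 2 + 0 * - (2 * x) / 2
         + - 2 * 0\<^sup>2 / (4 * (1/3)) + 1 * (- (2 * x))\<^sup>2 / (4 * (2/3 - x\<^sup>2)) = 0)
       \<or> (z1 \<noteq> 0 \<and> z2 = 0 \<and> - 2 + 2 * (1::real) = 0) \<or> (z1 = 0 \<and> z2 \<noteq> 0 \<and> 2 * (- 2) + (1::real) = 0)"
        using nz by (cases "z2 = 0") simp_all
    qed (auto intro!: smooth_intros derivative_eq_intros simp: M_def power2_eq_square)
  qed
  have "S1_invariant M" by (rule S1_invariantI) (auto simp: M_def)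
  with min diffeomorphic_trans[OF d1 d2] show ?thesis by blast
qed

section \<open>Spheres given by a graph\<close>

lemma has_derivative_imp_has_real_derivative:
  fixes f :: "real \<Rightarrow> real"
  assumes "(f has_derivative f') (at x)"
  shows "(f has_real_derivative f' 1) (at x)"
proof (rule has_derivative_imp_has_field_derivative[OF assms])
  interpret bounded_linear f' using assms by (rule has_derivative_bounded_linear)
  show "y * f' 1 = f' y" for y using scaleR[of y 1] by simp
qed

text \<open>Differentiation in \<open>s\<close> produces one more factor \<open>z\<close>; the power
  \<open>z ^ j\<close> closes the induction. The average keeps the full order of differentiability
  of \<open>g\<close>.\<close>

lemma Ck_on_average:
  fixes g :: "real \<Rightarrow> real"
  assumes "a < 0" "0 < b" "Ck_on k {a<..<b} g"
  shows "Ck_on k {a<..<b} (\<lambda>s. integral {0..1} (\<lambda>z. z ^ j * g (s * z)))"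
  using assms(3)
proof (induction k arbitrary: g j)
  have range: "s * z \<in> {a<..<b}" if "s \<in> {a<..<b}" "z \<in> {0..1}" for s z
  proof -
    have "(1 - z) *\<^sub>R 0 + z *\<^sub>R s \<in> {a<..<b}"
      by (rule convexD[OF convex_real_interval(8)]) (use assms(1,2) that in auto)
    then show ?thesis by (simp add: mult.commute)
  qed
  have cont: "continuous_on ({a<..<b} \<times> {0..1}) (\<lambda>(s, z). z ^ j * g (s * z))" if "continuous_on {a<..<b} g" for g :: "real \<Rightarrow> real" and j
    unfolding case_prod_beta
    by (intro continuous_intros continuous_on_compose2[OF that]) (use range in auto)
  {
    case 0
    then show ?case using integral_continuous_on_param[of "{a<..<b}" 0 1 "\<lambda>s z. z ^ j * g (s * z)"] cont by simp
  next
    case (Suc k)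
    define g' where "g' x = frechet_derivative g (at x) 1" for x
    have ck: "Ck_on k {a<..<b} g'" unfolding g'_def[abs_def] using Suc.prems by (rule Ck_on_SucE(2))
    have d: "(g has_real_derivative g' x) (at x)" if x: "x \<in> {a<..<b}" for x
      unfolding g'_def by (rule has_derivative_imp_has_real_derivative[OF Ck_on_SucE(1)[OF Suc.prems x]])
    note cg = Ck_on_imp_continuous_on[OF Suc.prems] Ck_on_imp_continuous_on[OF ck]
    show ?case
    proof (rule Ck_on_real_SucI[OF open_greaterThanLessThan _ Suc.IH[OF ck, of "Suc j"]])
      fix s assume s: "s \<in> {a<..<b}"
      have "((\<lambda>s. integral (cbox 0 1) (\<lambda>z. z ^ j * g (s * z))) has_field_derivative
          integral (cbox 0 1) (\<lambda>z. z ^ Suc j * g' (s * z))) (at s within {a<..<b})"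
      proof (rule leibniz_rule_field_derivative[OF _ _ _ s])
        show "((\<lambda>s. z ^ j * g (s * z)) has_real_derivative z ^ Suc j * g' (s * z)) (at s within {a<..<b})"
          if "s \<in> {a<..<b}" "z \<in> cbox 0 1" for s z
        proof (rule has_field_derivative_at_within)
          have "((\<lambda>s. s * z) has_real_derivative z) (at s)" by (auto intro!: derivative_eq_intros)
          from DERIV_chain'[OF this d[OF range]] that
          have "((\<lambda>s. g (s * z)) has_real_derivative g' (s * z) * z) (at s)" by (simp add: mult.commute)
          from DERIV_cmult[OF this, of "z ^ j"]
          show "((\<lambda>s. z ^ j * g (s * z)) has_real_derivative z ^ Suc j * g' (s * z)) (at s)" by (simp add: ac_simps)
        qed
        show "(\<lambda>z. z ^ j * g (s * z)) integrable_on cbox 0 1" if "s \<in> {a<..<b}" for s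
          by (intro integrable_continuous continuous_intros continuous_on_compose2[OF cg(1)]) (use range[OF that] in auto)
        show "continuous_on ({a<..<b} \<times> cbox 0 1) (\<lambda>(s, z). z ^ Suc j * g' (s * z))"
          using cont[OF cg(2), of "Suc j"] by (simp only: cbox_interval)
      qed simp
      then show "((\<lambda>s. integral {0..1} (\<lambda>z. z ^ j * g (s * z))) has_vector_derivative
          integral {0..1} (\<lambda>z. z ^ Suc j * g' (s * z))) (at s)"
        using at_within_open[OF s open_greaterThanLessThan]
        by (simp only: cbox_interval has_real_derivative_iff_has_vector_derivative)
    qed
  }
qed

text \<open>Hadamard's lemma: \<open>F x\<close> is the mean of \<open>f'\<close> over the segment
  from \<open>c\<close> to \<open>x\<close>.\<close>

lemma smooth_on_factor_zero:
  fixes f f' :: "real \<Rightarrow> real"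
  assumes f: "smooth_on {a<..<b} f" and c: "a < c" "c < b" "f c = 0"
    and d: "\<And>x. x \<in> {a<..<b} \<Longrightarrow> (f has_real_derivative f' x) (at x)"
  obtains F where "smooth_on {a<..<b} F" "\<And>x. x \<in> {a<..<b} \<Longrightarrow> f x = (x - c) * F x" "F c = f' c"
proof -
  have sf': "smooth_on {a<..<b} f'" by (rule smooth_on_real_derivative[OF open_greaterThanLessThan f d])
  define g where "g y = f' (c + y)" for y
  define F where "F x = integral {0..1} (\<lambda>z. g ((x - c) * z))" for x
  have sg: "smooth_on {a - c<..<b - c} g" unfolding g_def[abs_def]
    by (rule smooth_on_compose[OF sf']) (auto intro!: smooth_intros)
  have "smooth_on {a - c<..<b - c} (\<lambda>s. integral {0..1} (\<lambda>z. g (s * z)))"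
    unfolding smooth_on_def
  proof
    fix k
    show "Ck_on k {a - c<..<b - c} (\<lambda>s. integral {0..1} (\<lambda>z. g (s * z)))"
      using Ck_on_average[of "a - c" "b - c" k g 0] c sg unfolding smooth_on_def by simp
  qed
  then have sF: "smooth_on {a<..<b} F" unfolding F_def[abs_def]
    by (rule smooth_on_compose) (auto intro!: smooth_intros)
  have F: "f x = (x - c) * F x" if x: "x \<in> {a<..<b}" for x
  proof -
    have r: "c + (x - c) * z \<in> {a<..<b}" if "z \<in> {0..1}" for z
    proof -
      have "c + (x - c) * z = (1 - z) *\<^sub>R c + z *\<^sub>R x" by (simp add: algebra_simps)
      moreover have "\<dots> \<in> {a<..<b}"
        by (rule convexD[OF convex_real_interval(8)]) (use c x that in auto)
      ultimately show ?thesis by simp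
    qed
    have "((\<lambda>z. (x - c) * f' (c + (x - c) * z)) has_integral f (c + (x - c) * 1) - f (c + (x - c) * 0)) {0..1}"
    proof (rule fundamental_theorem_of_calculus)
      fix z :: real assume "z \<in> {0..1}"
      have "((\<lambda>z. c + (x - c) * z) has_real_derivative x - c) (at z)" by (auto intro!: derivative_eq_intros)
      from DERIV_chain'[OF this d[OF r[OF \<open>z \<in> {0..1}\<close>]]]
      show "((\<lambda>z. f (c + (x - c) * z)) has_vector_derivative (x - c) * f' (c + (x - c) * z)) (at z within {0..1})"
        by (simp add: has_real_derivative_iff_has_vector_derivative mult.commute has_vector_derivative_at_within)
    qed simp
    from integral_unique[OF this] show ?thesis by (simp add: F_def g_def c(3))
  qed
  have "F c = f' c" by (simp add: F_def g_def)
  with sF F show ?thesis by (rule that)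
qed

text \<open>The condition \<open>curv\<close> for a graph over \<open>x\<close> with squared radii
  \<open>w * (1 - h) / 2\<close> and \<open>w * (1 + h) / 2\<close> and normal coefficients
  \<open>w * g\<close>, \<open>1 + h - x * g\<close>, \<open>- (1 - h + x * g)\<close>. The equation
  for \<open>gp\<close> is this condition solved for the derivative of \<open>g\<close>.\<close>

lemma graph_curvature_identity:
  fixes x h g :: real
  assumes w: "w = 1 - x\<^sup>2" "w \<noteq> 0" and h: "1 - h \<noteq> 0" "1 + h \<noteq> 0"
    and gp: "gp = - (2 / w) * (h - 3/2 * x * g + g\<^sup>2 * (2 * h - 3/2 * x * g) / (1 - h\<^sup>2))"
    and up: "up = - (x * (1 - h)) - g" and vp: "vp = - (x * (1 + h)) + g"
  shows "(1 + h - x * g + - (1 - h + x * g)) * (1 + up\<^sup>2 / (4 * (w * (1 - h) / 2)) + vp\<^sup>2 / (4 * (w * (1 + h) / 2)))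
    + (- (2 * x * g) + w * gp) + (2 * g / w - g - x * gp) * up / 2 + (2 * g / w - g - x * gp) * vp / 2
    + (1 + h - x * g) * up\<^sup>2 / (4 * (w * (1 - h) / 2)) + - (1 - h + x * g) * vp\<^sup>2 / (4 * (w * (1 + h) / 2)) = 0"
proof -
  \<comment> \<open>Absorbing the quotient into \<open>K\<close> leaves a polynomial identity modulo
    \<open>K * ((1 - h) * (1 + h)) = g^2\<close>.\<close>
  define K where "K = g\<^sup>2 / (1 - h\<^sup>2)"
  have hh: "1 - h\<^sup>2 = (1 - h) * (1 + h)" by (simp add: power2_eq_square algebra_simps)
  have K: "K * ((1 - h) * (1 + h)) = g\<^sup>2" unfolding K_def hh using h by simp
  define Pu Pv where "Pu = (x\<^sup>2 * (1 - h) + 2 * x * g + K * (1 + h)) / 2" and "Pv = (x\<^sup>2 * (1 + h) - 2 * x * g + K * (1 - h)) / 2"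
  have Pu: "up\<^sup>2 / (4 * (w * (1 - h) / 2)) = Pu / w"
  proof -
    have "up\<^sup>2 = Pu * (2 * (1 - h))" unfolding up Pu_def using K by (simp add: power2_eq_square) algebra
    moreover have "4 * (w * (1 - h) / 2) = w * (2 * (1 - h))" by simp
    ultimately have "up\<^sup>2 / (4 * (w * (1 - h) / 2)) = Pu * (2 * (1 - h)) / (w * (2 * (1 - h)))" by presburger
    also have "\<dots> = Pu / w" by (rule mult_divide_mult_cancel_right) (use h in simp)
    finally show ?thesis .
  qed
  have Pv: "vp\<^sup>2 / (4 * (w * (1 + h) / 2)) = Pv / w"
  proof -
    have "vp\<^sup>2 = Pv * (2 * (1 + h))" unfolding vp Pv_def using K by (simp add: power2_eq_square) algebra
    moreover have "4 * (w * (1 + h) / 2) = w * (2 * (1 + h))" by simp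
    ultimately have "vp\<^sup>2 / (4 * (w * (1 + h) / 2)) = Pv * (2 * (1 + h)) / (w * (2 * (1 + h)))" by presburger
    also have "\<dots> = Pv / w" by (rule mult_divide_mult_cancel_right) (use h in simp)
    finally show ?thesis .
  qed
  define G where "G = w * gp"
  have G: "G = - 2 * (h - 3/2 * x * g + K * (2 * h - 3/2 * x * g))" unfolding G_def gp K_def using w(2) by simp
  have gpw: "gp = G / w" using w(2) by (simp add: G_def)
  have e: "(1 + h - x * g) * up\<^sup>2 / (4 * (w * (1 - h) / 2)) = (1 + h - x * g) * (Pu / w)"
    "- (1 - h + x * g) * vp\<^sup>2 / (4 * (w * (1 + h) / 2)) = - (1 - h + x * g) * (Pv / w)"
    unfolding Pu[symmetric] Pv[symmetric] by simp_all
  have "(1 + h - x * g + - (1 - h + x * g)) * (w + Pu + Pv)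
    + w * (- (2 * x * g) + G) + (2 * g - w * g - x * G) * up / 2 + (2 * g - w * g - x * G) * vp / 2
    + (1 + h - x * g) * Pu + - (1 - h + x * g) * Pv = 0"
    using K unfolding Pu_def Pv_def G up vp w(1) by (simp add: field_simps power2_eq_square)
  then have "((1 + h - x * g + - (1 - h + x * g)) * (w + Pu + Pv)
    + w * (- (2 * x * g) + G) + (2 * g - w * g - x * G) * up / 2 + (2 * g - w * g - x * G) * vp / 2
    + (1 + h - x * g) * Pu + - (1 - h + x * g) * Pv) / w = 0" by simp
  then show ?thesis unfolding e Pu Pv gpw using w(2) by (simp add: add_divide_distrib diff_divide_distrib distrib_left distrib_right left_diff_distrib right_diff_distrib)
qed

text \<open>\<open>h\<close> is \<open>sin \<psi>\<close> as a function of \<open>x\<close>. The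
  value of \<open>g\<close> at \<open>x0\<close> is the nonzero one for which the singular quotient
  can stay bounded as \<open>h\<close> tends to \<open>-1\<close>, since there
  \<open>2 * h = 3/2 * x * g\<close>. One circle of the orbit shrinks at \<open>x0\<close> and the
  other at \<open>- x0\<close>, which produces a 3-sphere.\<close>

lemma minimal_graph_sphere:
  fixes h g :: "real \<Rightarrow> real"
  assumes x0: "0 < x0" "x0 < x0'" "x0' < 1"
    and sm: "smooth_on {-x0'<..<x0'} h" "smooth_on {-x0'<..<x0'} g"
    and odd: "\<And>x. x \<in> {-x0'<..<x0'} \<Longrightarrow> h (- x) = - h x" "\<And>x. x \<in> {-x0'<..<x0'} \<Longrightarrow> g (- x) = g x"
    and hb: "\<And>x. x \<in> {-x0<..<x0} \<Longrightarrow> \<bar>h x\<bar> < 1" and ends: "h x0 = - 1" "g x0 = - 4 / (3 * x0)"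
    and dh: "\<And>x. x \<in> {-x0'<..<x0'} \<Longrightarrow> (h has_real_derivative 2 * g x / (1 - x\<^sup>2)) (at x)"
    and dg: "\<And>x. x \<in> {-x0<..<x0} \<Longrightarrow> (g has_real_derivative - (2 / (1 - x\<^sup>2)) *
          (h x - 3/2 * x * g x + (g x)\<^sup>2 * (2 * h x - 3/2 * x * g x) / (1 - (h x)\<^sup>2))) (at x)"
  shows "\<exists>M. minimal_hypersurface M \<and> S1_invariant M \<and> M diffeomorphic sphere (0 :: real^4) 1 \<and> \<not> equatorial M"
proof -
  let ?J = "{-x0'<..<x0'}"
  have opJ: "open ?J" by simp
  have wpos: "1 - x\<^sup>2 > 0" if "x \<in> ?J" for x
    using that x0 abs_square_less_1[of x] by auto
  \<comment> \<open>The squared moduli of \<open>z1\<close> and \<open>z2\<close>. As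
    \<open>(1 - x^2) * h' = 2 * g\<close>, their derivatives are polynomial in \<open>x\<close>,
    \<open>h\<close>, \<open>g\<close> and remain regular at the ends.\<close>
  define u v where "u x = (1 - x\<^sup>2) * (1 - h x) / 2" and "v x = (1 - x\<^sup>2) * (1 + h x) / 2" for x
  define u' v' where "u' x = - (x * (1 - h x)) - g x" and "v' x = - (x * (1 + h x)) + g x" for x
  have du: "(u has_real_derivative u' x) (at x)" and dv: "(v has_real_derivative v' x) (at x)" if "x \<in> ?J" for x
  proof -
    define d where "d = 2 * g x / (1 - x\<^sup>2)"
    have w: "d * (1 - x\<^sup>2) = 2 * g x" using wpos[OF that] by (simp add: d_def)
    note dhx = dh[OF that, folded d_def]
    show "(u has_real_derivative u' x) (at x)" unfolding u_def[abs_def]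
      by (rule derivative_eq_intros dhx refl)+ (use w in \<open>simp_all add: u'_def field_simps\<close>)
    show "(v has_real_derivative v' x) (at x)" unfolding v_def[abs_def]
      by (rule derivative_eq_intros dhx refl)+ (use w in \<open>simp_all add: v'_def field_simps\<close>)
  qed
  have smuv: "smooth_on ?J u" "smooth_on ?J v"
    unfolding u_def[abs_def] v_def[abs_def] by (intro smooth_intros opJ sm | simp)+
  have x0J: "x0 \<in> ?J" "-x0 \<in> ?J" using x0 by auto
  have endm: "h (- x0) = 1" "g (- x0) = - 4 / (3 * x0)" using odd[OF x0J(1)] ends by simp_all
  have v0: "v x0 = 0" "v' x0 = - 4 / (3 * x0)" using ends by (simp_all add: v_def v'_def)
  \<comment> \<open>\<open>v\<close> has a simple zero at \<open>x0\<close>, since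
    \<open>v' x0\<close> is not zero. The factor left after division is smooth and positive on the
    closed segment; oddness of \<open>h\<close> transfers this to \<open>u\<close> at
    \<open>- x0\<close>.\<close>
  obtain F where F: "smooth_on ?J F" "\<And>x. x \<in> ?J \<Longrightarrow> v x = (x - x0) * F x" "F x0 = v' x0"
    by (rule smooth_on_factor_zero[OF smuv(2) _ _ v0(1) dv]) (use x0 in auto)
  define V U where "V x = - F x" and "U x = V (- x)" for x
  have smV: "smooth_on ?J V" unfolding V_def[abs_def] by (intro smooth_intros opJ F)
  have smU: "smooth_on ?J U" unfolding U_def[abs_def]
    by (rule smooth_on_compose[OF smV]) (auto intro!: smooth_intros)
  have vV: "v x = (x0 - x) * V x" if "x \<in> ?J" for x using F(2)[OF that] by (simp add: V_def algebra_simps)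
  have uU: "u x = (x0 + x) * U x" if "x \<in> ?J" for x
  proof -
    have "u x = v (- x)" using odd(1)[OF that] by (simp add: u_def v_def)
    then show ?thesis using vV[of "- x"] that by (simp add: U_def)
  qed
  have vpos: "v x > 0" if "-x0 \<le> x" "x < x0" for x
  proof -
    have "1 + h x > 0"
    proof (cases "x = - x0")
      case True then show ?thesis using endm by simp
    next
      case False then show ?thesis using hb[of x] that by auto
    qed
    then show ?thesis using wpos[of x] that x0 by (simp add: v_def)
  qed
  have Vpos: "V x > 0" if "-x0 \<le> x" "x \<le> x0" for x
  proof (cases "x = x0")
    case True then show ?thesis using F(3) v0(2) x0 by (simp add: V_def)
  next
    case False
    then have "(x0 - x) * V x > 0" using vpos[of x] vV[of x] that x0 by simp
    then show ?thesis using that False by (simp add: zero_less_mult_iff)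
  qed
  have Upos: "U x > 0" if "-x0 \<le> x" "x \<le> x0" for x using Vpos[of "- x"] that by (simp add: U_def)
  have uv: "u x + v x = 1 - x\<^sup>2" for x by (simp add: u_def v_def field_simps)
  define M :: "ambient set" where "M = {(x, z1, z2). \<bar>x\<bar> \<le> x0 \<and> (cmod z1)\<^sup>2 = u x \<and> (cmod z2)\<^sup>2 = v x}"
  have MS: "M \<subseteq> S4" using uv by (auto simp: M_def S4_def add.assoc)
  \<comment> \<open>An open neighbourhood of the closed segment on which both factors are positive,
    so that their square roots are smooth.\<close>
  define J' where "J' = ?J \<inter> V -` {0<..} \<inter> (?J \<inter> U -` {0<..})"
  have opJ': "open J'" unfolding J'_def
    by (intro open_Int continuous_open_preimage smooth_on_imp_continuous_on smV smU) auto
  have J': "x \<in> J'" if "\<bar>x\<bar> \<le> x0" for x using that x0 Vpos[of x] Upos[of x] by (auto simp: J'_def)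
  have J'D: "x \<in> ?J" "V x > 0" "U x > 0" if "x \<in> J'" for x using that by (auto simp: J'_def)
  have smVU: "smooth_on J' V" "smooth_on J' U" using smV smU by (auto elim!: smooth_on_subset simp: J'_def)
  let ?N = "sphere (0 :: complex \<times> complex) 1"
  have sphN: "y \<in> ?N \<longleftrightarrow> (cmod (fst y))\<^sup>2 + (cmod (snd y))\<^sup>2 = 1" for y :: "complex \<times> complex"
    by (cases y) (simp add: norm_prod_def)
  define X where "X y = x0 * ((cmod (fst y))\<^sup>2 - (cmod (snd y))\<^sup>2)" for y :: "complex \<times> complex"
  \<comment> \<open>The two components have squared moduli \<open>(x0 + x) / (2 * x0)\<close> and
    \<open>(x0 - x) / (2 * x0)\<close>: they sum to \<open>1\<close>, and \<open>x\<close> is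
    recovered from their difference. The map is smooth across the end orbits because
    \<open>U\<close> and \<open>V\<close> do not vanish there.\<close>
  define f where "f p = ((1 / sqrt (2 * x0 * U (fst p))) *\<^sub>R fst (snd p), (1 / sqrt (2 * x0 * V (fst p))) *\<^sub>R snd (snd p))" for p :: ambient
  define k where "k y = (X y, sqrt (2 * x0 * U (X y)) *\<^sub>R fst y, sqrt (2 * x0 * V (X y)) *\<^sub>R snd y)" for y
  have smX: "smooth_on W X" if "open W" for W unfolding X_def[abs_def] by (intro smooth_intros that)
  have Xb: "\<bar>X y\<bar> \<le> x0" "x0 + X y = 2 * x0 * (cmod (fst y))\<^sup>2" "x0 - X y = 2 * x0 * (cmod (snd y))\<^sup>2" if "y \<in> ?N" for y
  proof -
    have y: "(cmod (snd y))\<^sup>2 = 1 - (cmod (fst y))\<^sup>2" using sphN that by (simp add: algebra_simps)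
    show p: "x0 + X y = 2 * x0 * (cmod (fst y))\<^sup>2" by (simp add: X_def y algebra_simps)
    have y': "(cmod (fst y))\<^sup>2 = 1 - (cmod (snd y))\<^sup>2" using y by simp
    show m: "x0 - X y = 2 * x0 * (cmod (snd y))\<^sup>2" unfolding X_def y' by (simp add: algebra_simps)
    have "x0 + X y \<ge> 0" "x0 - X y \<ge> 0" unfolding p m using x0 by simp_all
    then show "\<bar>X y\<bar> \<le> x0" by simp
  qed
  have "diffeomorphism M ?N f k"
  proof (rule diffeomorphismI)
    have op: "open (fst -` J' :: ambient set)" by (intro open_vimage_fst opJ')
    show "smooth_map M f"
    proof (rule smooth_on_imp_smooth_map[OF op])
      show "M \<subseteq> fst -` J'" using J' by (auto simp: M_def)
      have s: "smooth_on (fst -` J') (\<lambda>p::ambient. V (fst p))" "smooth_on (fst -` J') (\<lambda>p::ambient. U (fst p))"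
        by (rule smooth_on_compose[OF smVU(1) _ op opJ'] smooth_on_compose[OF smVU(2) _ op opJ'];
            auto intro!: smooth_intros op)+
      show "smooth_on (fst -` J') f" unfolding f_def[abs_def]
        by (intro smooth_intros op s) (use J'D x0 in \<open>auto intro!: mult_pos_pos simp: less_imp_neq[symmetric]\<close>)
    qed
    have op2: "open (X -` J')" using continuous_open_preimage[OF smooth_on_imp_continuous_on[OF smX[OF open_UNIV]] open_UNIV opJ'] by simp
    show "smooth_map ?N k"
    proof (rule smooth_on_imp_smooth_map[OF op2])
      show "?N \<subseteq> X -` J'" using J' Xb(1) by blast
      have s: "smooth_on (X -` J') (\<lambda>y. V (X y))" "smooth_on (X -` J') (\<lambda>y. U (X y))"
        by (rule smooth_on_compose[OF smVU(1) _ op2 opJ'] smooth_on_compose[OF smVU(2) _ op2 opJ'];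
            auto intro!: smX op2)+
      show "smooth_on (X -` J') k" unfolding k_def[abs_def]
        by (intro smooth_intros smX op2 s) (use J'D x0 in \<open>auto intro!: mult_pos_pos\<close>)
    qed
    show "f p \<in> ?N \<and> k (f p) = p" if p: "p \<in> M" for p
    proof -
      obtain x z1 z2 where pz: "p = (x, z1, z2)" by (cases p)
      have m: "\<bar>x\<bar> \<le> x0" "(cmod z1)\<^sup>2 = u x" "(cmod z2)\<^sup>2 = v x" using p by (auto simp: M_def pz)
      have xJ: "x \<in> ?J" using m(1) x0 by auto
      have pos: "2 * x0 * U x > 0" "2 * x0 * V x > 0" using Upos[of x] Vpos[of x] m(1) x0 by simp_all
      have n: "(cmod (fst (f p)))\<^sup>2 = (x0 + x) / (2 * x0)" "(cmod (snd (f p)))\<^sup>2 = (x0 - x) / (2 * x0)"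
        using pos m(2,3) uU[OF xJ] vV[OF xJ] x0
        by (simp_all add: f_def pz power_mult_distrib power_divide real_sqrt_pow2 zero_less_mult_iff)
      have "f p \<in> ?N" unfolding sphN n using x0 by (simp add: field_simps)
      moreover have "k (f p) = p"
      proof -
        have "X (f p) = x" unfolding X_def n using x0 by (simp add: field_simps)
        moreover have "U x \<noteq> 0" "V x \<noteq> 0" using pos by auto
        ultimately show ?thesis using pos x0 by (simp add: k_def f_def pz)
      qed
      ultimately show ?thesis by blast
    qed
    show "k y \<in> M \<and> f (k y) = y" if y: "y \<in> ?N" for y
    proof -
      note b = Xb[OF y]
      have xJ: "X y \<in> ?J" using b(1) x0 by auto
      have pos: "2 * x0 * U (X y) > 0" "2 * x0 * V (X y) > 0" using Upos[of "X y"] Vpos[of "X y"] b(1) x0 by simp_all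
      have "k y \<in> M" unfolding M_def k_def using b(1) pos uU[OF xJ] vV[OF xJ] unfolding b(2,3)
        by (simp add: power_mult_distrib real_sqrt_pow2)
      moreover have "U (X y) \<noteq> 0" "V (X y) \<noteq> 0" using pos by auto
      then have "f (k y) = y" using pos x0 by (simp add: f_def k_def)
      ultimately show ?thesis by blast
    qed
  qed
  then have dN: "M diffeomorphic ?N" unfolding diffeomorphic_def by blast
  have "locally_euclidean TYPE(real^3) ?N" by (rule locally_euclidean_sphere) simp
  with MS dN have emb: "embedded_hypersurface M" by (intro embedded_hypersurfaceI)
  have d4: "M diffeomorphic sphere (0 :: real^4) 1"
    by (rule diffeomorphic_trans[OF dN diffeomorphic_sphere]) simp
  have min: "minimal_hypersurface M"
  proof (rule minimal_hypersurfaceI[OF emb])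
    fix x z1 z2 assume p: "(x, z1, z2) \<in> M"
    then have m: "\<bar>x\<bar> \<le> x0" "(cmod z1)\<^sup>2 = u x" "(cmod z2)\<^sup>2 = v x" by (auto simp: M_def)
    have xJ: "x \<in> ?J" using m(1) x0 by auto
    note w = wpos[OF xJ]
    define hp gp where "hp = 2 * g x / (1 - x\<^sup>2)" and "gp = frechet_derivative g (at x) 1"
    have dgx: "(g has_real_derivative gp) (at x)"
      unfolding gp_def by (rule has_derivative_imp_has_real_derivative[OF smooth_on_has_derivative[OF sm(2) xJ]])
    have dhx: "(h has_real_derivative hp) (at x)" unfolding hp_def by (rule dh[OF xJ])
    have xs: "x = x0 \<or> x = - x0 \<or> x \<in> {-x0<..<x0}" using m(1) by auto
    have op: "open (fst -` ?J :: ambient set)" by (intro open_vimage_fst opJ)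
    show "\<exists>U \<nu>. (x, z1, z2) \<in> U \<and> unit_normal_field M U \<nu> \<and> mean_curvature M \<nu> (x, z1, z2) = 0"
    proof (rule rotational_minimal[OF emb p _ op _ _ opJ smuv, where t = fst and X = "\<lambda>s. s" and X' = "\<lambda>s. 1"
          and u' = u' and v' = v' and A = "\<lambda>x. (1 - x\<^sup>2) * g x" and B = "\<lambda>x. 1 + h x - x * g x" and C = "\<lambda>x. - (1 - h x + x * g x)"
          and a = "- (2 * x * g x) + (1 - x\<^sup>2) * gp" and b = "hp - g x - x * gp" and c = "hp - g x - x * gp" and \<tau> = x])
      show "(x, z1, z2) \<in> fst -` ?J" using xJ by simp
      show "smooth_on (fst -` ?J) (fst :: ambient \<Rightarrow> real)" by (intro smooth_on_fst op smooth_on_id)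
      show "smooth_on ?J (\<lambda>x. (1 - x\<^sup>2) * g x)" "smooth_on ?J (\<lambda>x. 1 + h x - x * g x)" "smooth_on ?J (\<lambda>x. - (1 - h x + x * g x))"
        by (intro smooth_intros opJ sm)+
      show "y = fst (y, w1, w2) \<and> (cmod w1)\<^sup>2 = u (fst (y, w1, w2)) \<and> (cmod w2)\<^sup>2 = v (fst (y, w1, w2))"
        if "(y, w1, w2) \<in> M" for y w1 w2 using that by (auto simp: M_def)
      show "(1 - s\<^sup>2) * g s * s + (1 + h s - s * g s) * u s + - (1 - h s + s * g s) * v s = 0" for s
        by (simp add: u_def v_def field_simps power2_eq_square)
      show "(1 - s\<^sup>2) * g s * 1 + (1 + h s - s * g s) * u' s / 2 + - (1 - h s + s * g s) * v' s / 2 = 0" for s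
        by (simp add: u'_def v'_def field_simps power2_eq_square)
      show "s * 1 + u' s / 2 + v' s / 2 = 0" for s by (simp add: u'_def v'_def field_simps)
      have N: "((1 - x\<^sup>2) * g x)\<^sup>2 + (1 + h x - x * g x)\<^sup>2 * u x + (- (1 - h x + x * g x))\<^sup>2 * v x = (1 - x\<^sup>2) * (1 - (h x)\<^sup>2 + (g x)\<^sup>2)"
        by (simp add: u_def v_def field_simps power2_eq_square)
      \<comment> \<open>Inside, this is positive since \<open>\<bar>h\<bar> < 1\<close>; at the ends
        it is so because \<open>g\<close> is not zero.\<close>
      have "1 - (h x)\<^sup>2 + (g x)\<^sup>2 > 0"
      proof (cases "x \<in> {-x0<..<x0}")
        case True
        then have "(h x)\<^sup>2 < 1" using hb abs_square_less_1 by blast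
        then show ?thesis by (simp add: add_pos_nonneg)
      next
        case False
        then have "(h x)\<^sup>2 = 1" "g x \<noteq> 0" using xs ends endm x0 by auto
        then show ?thesis by simp
      qed
      then show "((1 - x\<^sup>2) * g x)\<^sup>2 + (1 + h x - x * g x)\<^sup>2 * u x + (- (1 - h x + x * g x))\<^sup>2 * v x > 0"
        unfolding N using w by simp
      show "((\<lambda>x. (1 - x\<^sup>2) * g x) has_real_derivative - (2 * x * g x) + (1 - x\<^sup>2) * gp) (at x)"
        by (rule derivative_eq_intros dgx refl)+ (simp add: algebra_simps)
      show "((\<lambda>x. 1 + h x - x * g x) has_real_derivative hp - g x - x * gp) (at x)"
        by (rule derivative_eq_intros dgx dhx refl)+ (simp add: algebra_simps)
      show "((\<lambda>x. - (1 - h x + x * g x)) has_real_derivative hp - g x - x * gp) (at x)"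
        by (rule derivative_eq_intros dgx dhx refl)+ (simp add: algebra_simps)
      have "(z1 \<noteq> 0 \<and> z2 \<noteq> 0 \<and> (1 + h x - x * g x + - (1 - h x + x * g x)) * (1\<^sup>2 + (u' x)\<^sup>2 / (4 * u x) + (v' x)\<^sup>2 / (4 * v x)) +
          (- (2 * x * g x) + (1 - x\<^sup>2) * gp) * 1 + (hp - g x - x * gp) * u' x / 2 + (hp - g x - x * gp) * v' x / 2 +
          (1 + h x - x * g x) * (u' x)\<^sup>2 / (4 * u x) + - (1 - h x + x * g x) * (v' x)\<^sup>2 / (4 * v x) = 0)" if xi: "x \<in> {-x0<..<x0}"
      proof -
        have hx: "1 - h x > 0" "1 + h x > 0" using hb[OF xi] by auto
        have "gp = - (2 / (1 - x\<^sup>2)) * (h x - 3/2 * x * g x + (g x)\<^sup>2 * (2 * h x - 3/2 * x * g x) / (1 - (h x)\<^sup>2))"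
          using DERIV_unique[OF dgx dg[OF xi]] .
        from graph_curvature_identity[OF refl _ _ _ this u'_def v'_def] w hx
        have "(1 + h x - x * g x + - (1 - h x + x * g x)) * (1\<^sup>2 + (u' x)\<^sup>2 / (4 * u x) + (v' x)\<^sup>2 / (4 * v x)) +
          (- (2 * x * g x) + (1 - x\<^sup>2) * gp) * 1 + (hp - g x - x * gp) * u' x / 2 + (hp - g x - x * gp) * v' x / 2 +
          (1 + h x - x * g x) * (u' x)\<^sup>2 / (4 * u x) + - (1 - h x + x * g x) * (v' x)\<^sup>2 / (4 * v x) = 0"
          unfolding u_def v_def hp_def by (simp only: power_one mult_1_right)
        moreover have "(cmod z1)\<^sup>2 > 0" "(cmod z2)\<^sup>2 > 0" unfolding m using w hx by (simp_all add: u_def v_def)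
        ultimately show ?thesis by simp
      qed
      \<comment> \<open>For \<open>h = -1\<close> the collapsed-orbit condition reads
        \<open>- 3 * x * g - 4 = 0\<close>, which is the prescribed end value of
        \<open>g\<close>.\<close>
      moreover have "z1 \<noteq> 0 \<and> z2 = 0 \<and> 1 + h x - x * g x + 2 * - (1 - h x + x * g x) = 0" if "x = x0"
        using m(2,3) that w x0 ends by (auto simp: u_def v_def)
      moreover have "z1 = 0 \<and> z2 \<noteq> 0 \<and> 2 * (1 + h x - x * g x) + - (1 - h x + x * g x) = 0" if "x = - x0"
        using m(2,3) that w x0 endm by (auto simp: u_def v_def)
      ultimately show "(z1 \<noteq> 0 \<and> z2 \<noteq> 0 \<and> (1 + h x - x * g x + - (1 - h x + x * g x)) * (1\<^sup>2 + (u' x)\<^sup>2 / (4 * u x) + (v' x)\<^sup>2 / (4 * v x)) +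
          (- (2 * x * g x) + (1 - x\<^sup>2) * gp) * 1 + (hp - g x - x * gp) * u' x / 2 + (hp - g x - x * gp) * v' x / 2 +
          (1 + h x - x * g x) * (u' x)\<^sup>2 / (4 * u x) + - (1 - h x + x * g x) * (v' x)\<^sup>2 / (4 * v x) = 0) \<or>
        (z1 \<noteq> 0 \<and> z2 = 0 \<and> 1 + h x - x * g x + 2 * - (1 - h x + x * g x) = 0) \<or>
        (z1 = 0 \<and> z2 \<noteq> 0 \<and> 2 * (1 + h x - x * g x) + - (1 - h x + x * g x) = 0)" using xs by argo
    qed (use du dv in \<open>auto intro!: derivative_eq_intros\<close>)
  qed
  have inv: "S1_invariant M" by (rule S1_invariantI) (auto simp: M_def)
  have "\<not> equatorial M"
  proof
    assume "equatorial M"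
    then obtain n where n: "n \<in> S4" "M = {p \<in> S4. p \<bullet> n = 0}" unfolding equatorial_def by blast
    \<comment> \<open>Two points of \<open>M\<close> that differ in the sign of \<open>z1\<close>
      force the normal of the equator to have no \<open>x\<close> component. The equator then
      contains \<open>(1, 0, 0)\<close>, while \<open>\<bar>x\<bar> \<le> x0 < 1\<close> on
      \<open>M\<close>.\<close>
    define r where "r = complex_of_real (sqrt (u x0))"
    have u0: "u x0 = 1 - x0\<^sup>2" using ends by (simp add: u_def)
    have "(cmod r)\<^sup>2 = u x0" using wpos[OF x0J(1)] u0 by (simp add: r_def)
    then have "(x0, r, 0) \<in> M" "(x0, - r, 0) \<in> M" using x0 v0 by (simp_all add: M_def)
    then have "(x0, r, 0) \<bullet> n = 0" "(x0, - r, 0) \<bullet> n = 0" unfolding n(2) by auto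
    then have "x0 * fst n = 0" by (cases n) simp
    then have "fst n = 0" using x0 by simp
    then have "(1, 0, 0) \<in> M" unfolding n(2) by (cases n) (simp add: S4_def)
    then show False using x0 by (simp add: M_def)
  qed
  with min inv d4 show ?thesis by blast
qed

section \<open>Profiles starting on the singular orbits\<close>

text \<open>With \<open>s = 1 + sin \<psi>\<close> as variable, \<open>x = sin \<theta>\<close> and
  \<open>l = cos \<beta> / (sin \<beta> * cos \<psi>)\<close>, the profile system reads
  \<open>\<theta>' = - 1/2 * cos \<theta> * l\<close> and \<open>(s * l)' = pole_rate s x l\<close>.
  The boundary \<open>z2 = 0\<close> is \<open>s = 0\<close>, a singular point of the second
  equation.\<close>

definition pole_rate :: "real \<Rightarrow> real \<Rightarrow> real \<Rightarrow> real" where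
  "pole_rate s x l = (3/2 * x + s * l) / (2 - s) + s * l\<^sup>2 * (3/2 * x - l * (1 - s))"

text \<open>An exact divided difference with one coefficient per variable; Lipschitz and growth
  bounds can be read off from the coefficients.\<close>

lemma pole_rate_difference:
  assumes "s \<noteq> 2"
  shows "pole_rate s x l - pole_rate s x' l' = (x - x') * (3 / (2 * (2 - s)) + 3/2 * s * l\<^sup>2)
     + (l - l') * (s / (2 - s) + 3/2 * s * x' * (l + l') - s * (1 - s) * (l\<^sup>2 + l * l' + l'\<^sup>2))"
proof -
  define r where "r = 1 / (2 - s)"
  have "pole_rate s x l = (3/2 * x + s * l) * r + s * l\<^sup>2 * (3/2 * x - l * (1 - s))" for x l
    by (simp add: pole_rate_def r_def)
  moreover have "3 / (2 * (2 - s)) = 3/2 * r" "s / (2 - s) = s * r" by (simp_all add: r_def)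
  ultimately show ?thesis by (simp only:) (simp add: field_simps power2_eq_square)
qed

text \<open>At \<open>s = 0\<close> the coefficients are \<open>3/4\<close> and \<open>0\<close>;
  the range \<open>1/1000\<close> keeps them near these values. That \<open>4/5 + 1/20 < 1\<close>
  is what makes averaging the rate a contraction.\<close>

lemma pole_rate_coefficients:
  fixes s x l l' :: real
  assumes s: "\<bar>s\<bar> \<le> 1/1000" and b: "\<bar>x\<bar> \<le> 1" "\<bar>l\<bar> \<le> 1" "\<bar>l'\<bar> \<le> 1"
  shows "\<bar>3 / (2 * (2 - s)) + 3/2 * s * l\<^sup>2\<bar> \<le> 4/5" "3 / (2 * (2 - s)) + 3/2 * s * l\<^sup>2 \<ge> 7/10"
    "\<bar>s / (2 - s) + 3/2 * s * x * (l + l') - s * (1 - s) * (l\<^sup>2 + l * l' + l'\<^sup>2)\<bar> \<le> 1/20"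
proof -
  have pr: "\<bar>p * q\<bar> \<le> a * b" if "\<bar>p\<bar> \<le> a" "\<bar>q\<bar> \<le> b" for p q a b :: real
    unfolding abs_mult by (rule mult_mono) (use that abs_ge_zero[of p] in linarith)+
  have s2: "2 - s > 0" "2 - s \<ge> 1999/1000" "2 - s \<le> 2001/1000" using s by auto
  have a: "3 / (2 * (2 - s)) \<le> 76/100" "3 / (2 * (2 - s)) \<ge> 74/100" using s2 by (simp_all add: field_simps)
  have "\<bar>l\<^sup>2\<bar> \<le> 1" using b by (simp add: abs_square_le_1)
  with s have "\<bar>s * l\<^sup>2\<bar> \<le> 1/1000 * 1" by (intro pr)
  with a show "\<bar>3 / (2 * (2 - s)) + 3/2 * s * l\<^sup>2\<bar> \<le> 4/5" "3 / (2 * (2 - s)) + 3/2 * s * l\<^sup>2 \<ge> 7/10" by (auto simp: abs_le_iff)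
  have "\<bar>s / (2 - s)\<bar> \<le> 1/1000" using s s2 by (simp add: abs_le_iff field_simps)
  moreover have "\<bar>s * (x * (l + l'))\<bar> \<le> 1/1000 * (1 * 2)" using s b by (intro pr) auto
  moreover have "\<bar>s * ((1 - s) * (l\<^sup>2 + l * l' + l'\<^sup>2))\<bar> \<le> 1/1000 * (2 * 3)"
  proof (intro pr s)
    have "\<bar>l * l'\<bar> \<le> 1 * 1" "\<bar>l * l\<bar> \<le> 1 * 1" "\<bar>l' * l'\<bar> \<le> 1 * 1" by (intro pr b)+
    then show "\<bar>l\<^sup>2 + l * l' + l'\<^sup>2\<bar> \<le> 3" unfolding power2_eq_square by linarith
    show "\<bar>1 - s\<bar> \<le> 2" using s by linarith
  qed
  moreover have "\<bar>p + 3/2 * q - r\<bar> \<le> 1/20" if "\<bar>p\<bar> \<le> 1/1000" "\<bar>q\<bar> \<le> 1/1000 * (1 * 2)" "\<bar>r\<bar> \<le> 1/1000 * (2 * 3)" for p q r :: real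
    using that by linarith
  ultimately have "\<bar>s / (2 - s) + 3/2 * (s * (x * (l + l'))) - s * ((1 - s) * (l\<^sup>2 + l * l' + l'\<^sup>2))\<bar> \<le> 1/20" by blast
  then show "\<bar>s / (2 - s) + 3/2 * s * x * (l + l') - s * (1 - s) * (l\<^sup>2 + l * l' + l'\<^sup>2)\<bar> \<le> 1/20"
    by (simp only: mult.assoc)
qed

lemma pole_rate_lipschitz:
  assumes s: "\<bar>s\<bar> \<le> 1/1000" and b: "\<bar>x'\<bar> \<le> 1" "\<bar>l\<bar> \<le> 1" "\<bar>l'\<bar> \<le> 1"
  shows "\<bar>pole_rate s x l - pole_rate s x' l'\<bar> \<le> 4/5 * \<bar>x - x'\<bar> + 1/20 * \<bar>l - l'\<bar>"
proof -
  have "s \<noteq> 2" using s by auto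
  note c = pole_rate_coefficients[OF s b]
  have "\<bar>(x - x') * (3 / (2 * (2 - s)) + 3/2 * s * l\<^sup>2)\<bar> \<le> \<bar>x - x'\<bar> * (4/5)"
    unfolding abs_mult using c(1) by (intro mult_left_mono) auto
  moreover have "\<bar>(l - l') * (s / (2 - s) + 3/2 * s * x' * (l + l') - s * (1 - s) * (l\<^sup>2 + l * l' + l'\<^sup>2))\<bar> \<le> \<bar>l - l'\<bar> * (1/20)"
    unfolding abs_mult using c(3) by (intro mult_left_mono) auto
  ultimately show ?thesis unfolding pole_rate_difference[OF \<open>s \<noteq> 2\<close>]
    using order_trans[OF abs_triangle_ineq add_mono] by (metis mult.commute)
qed

text \<open>Comparison with \<open>pole_rate s 0 0 = 0\<close>. The lower bound later keeps
  \<open>l\<close> away from zero in proportion to \<open>sin c\<close>.\<close>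

lemma pole_rate_bounds:
  assumes s: "\<bar>s\<bar> \<le> 1/1000" and l: "\<bar>l\<bar> \<le> 1"
  shows "\<bar>pole_rate s x l\<bar> \<le> 4/5 * \<bar>x\<bar> + 1/20 * \<bar>l\<bar>" "x \<ge> 0 \<Longrightarrow> pole_rate s x l \<ge> 7/10 * x - 1/20 * \<bar>l\<bar>"
proof -
  have z: "pole_rate s 0 0 = 0" by (simp add: pole_rate_def)
  show "\<bar>pole_rate s x l\<bar> \<le> 4/5 * \<bar>x\<bar> + 1/20 * \<bar>l\<bar>"
    using pole_rate_lipschitz[OF s _ l, of 0 0 x] z by simp
  assume x: "x \<ge> 0"
  have "s \<noteq> 2" using s by auto
  note c = pole_rate_coefficients[OF s _ l, of 0 0]
  have "x * (3 / (2 * (2 - s)) + 3/2 * s * l\<^sup>2) \<ge> x * (7/10)" using c(2) x by (intro mult_left_mono) auto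
  moreover have "\<bar>l * (s / (2 - s) + 3/2 * s * 0 * (l + 0) - s * (1 - s) * (l\<^sup>2 + l * 0 + 0\<^sup>2))\<bar> \<le> \<bar>l\<bar> * (1/20)"
    unfolding abs_mult using c(3) by (intro mult_left_mono) auto
  moreover have "pole_rate s x l = x * (3 / (2 * (2 - s)) + 3/2 * s * l\<^sup>2) + l * (s / (2 - s) + 3/2 * s * 0 * (l + 0) - s * (1 - s) * (l\<^sup>2 + l * 0 + 0\<^sup>2))"
    using pole_rate_difference[OF \<open>s \<noteq> 2\<close>, of x l 0 0] z by simp
  ultimately show "pole_rate s x l \<ge> 7/10 * x - 1/20 * \<bar>l\<bar>" by linarith
qed

lemma unit_integral_bounds:
  fixes f :: "real \<Rightarrow> real"
  assumes f: "continuous_on {0..1} f" and b: "\<And>z. z \<in> {0..1} \<Longrightarrow> m \<le> f z \<and> f z \<le> M"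
  shows "m \<le> integral {0..1} f" "integral {0..1} f \<le> M"
proof -
  have i: "f integrable_on {0..1}" by (rule integrable_continuous_real[OF f])
  have "integral {0..1} (\<lambda>z::real. m) \<le> integral {0..1} f" by (rule integral_le) (use i b in auto)
  then show "m \<le> integral {0..1} f" by simp
  have "integral {0..1} f \<le> integral {0..1} (\<lambda>z::real. M)" by (rule integral_le) (use i b in auto)
  then show "integral {0..1} f \<le> M" by simp
qed

text \<open>The integrated equations, rescaled to \<open>{0..1}\<close>: \<open>l\<close> is the
  average of the rate over the segment from \<open>0\<close> to \<open>s\<close>, which makes sense
  at \<open>s = 0\<close> and for both signs of \<open>s\<close>. The height at which the profile
  leaves \<open>z2 = 0\<close> is \<open>c\<close>.\<close>

definition pole_solution :: "real \<Rightarrow> (real \<Rightarrow> real) \<Rightarrow> (real \<Rightarrow> real) \<Rightarrow> bool" where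
  "pole_solution c \<theta> l \<longleftrightarrow> continuous_on {-1/1000..1/1000} \<theta> \<and> continuous_on {-1/1000..1/1000} l \<and>
    (\<forall>s\<in>{-1/1000..1/1000}. \<bar>l s\<bar> \<le> 1 \<and>
      \<theta> s = c - s * integral {0..1} (\<lambda>z. 1/2 * cos (\<theta> (s * z)) * l (s * z)) \<and>
      l s = integral {0..1} (\<lambda>z. pole_rate (s * z) (sin (\<theta> (s * z))) (l (s * z))))"

text \<open>All heights are solved for at once, so that continuity in \<open>c\<close> at fixed
  \<open>s\<close>, the input for shooting, comes from the fixed point theorem.\<close>

lemma pole_solution_family:
  obtains \<theta> l :: "real \<Rightarrow> real \<Rightarrow> real"
  where "\<And>s. continuous_on UNIV (\<theta> s)" "\<And>s. continuous_on UNIV (l s)"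
    "\<And>c. 0 \<le> c \<Longrightarrow> c \<le> pi/2 \<Longrightarrow> pole_solution c (\<lambda>s. \<theta> s c) (\<lambda>s. l s c)"
proof -
  \<comment> \<open>Clamping makes the kernel bounded and Lipschitz everywhere. The fixed point
    stays in the clamped range, so the clamps disappear again.\<close>
  define cl :: "real \<Rightarrow> real \<Rightarrow> real" where "cl r x = max (- r) (min r x)" for r x
  have cl: "\<bar>cl r x\<bar> \<le> r" if "r \<ge> 0" for r x using that by (auto simp: cl_def)
  have cl_id: "cl r x = x" if "\<bar>x\<bar> \<le> r" for r x using that by (auto simp: cl_def)
  have cl_lip: "\<bar>cl r x - cl r y\<bar> \<le> \<bar>x - y\<bar>" for r x y by (auto simp: cl_def max_def min_def)
  have cl_cont [continuous_intros]: "continuous_on A (\<lambda>x. cl r (f x))" if "continuous_on A f" for A r and f :: "'z::topological_space \<Rightarrow> real"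
    unfolding cl_def by (intro continuous_intros that)
  \<comment> \<open>The constant \<open>c\<close> stands under the integral over
    \<open>{0..1}\<close>, so that both equations have the form of one Volterra equation in
    \<open>(s, c)\<close>.\<close>
  define G :: "real \<times> real \<Rightarrow> real \<Rightarrow> real \<times> real \<Rightarrow> real \<times> real" where
    "G p z w = (max 0 (min (pi/2) (snd p)) - cl (1/1000) (fst p) * (1/2 * cos (fst w) * cl 1 (snd w)),
      pole_rate (cl (1/1000) (fst p * z)) (sin (fst w)) (cl 1 (snd w)))" for p z w
  have clb: "\<bar>cl (1/1000) x\<bar> \<le> 1/1000" "\<bar>cl 1 x\<bar> \<le> 1" for x by (rule cl; simp)+
  have prb: "\<bar>pole_rate (cl (1/1000) y) (sin a) (cl 1 b)\<bar> \<le> 1" for y a b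
    using pole_rate_bounds(1)[OF clb, of y "sin a" b] abs_sin_le_one[of a] clb(2)[of b] by linarith
  have ne: "2 - cl (1/1000) x \<noteq> 0" for x using cl[of "1/1000" x] by auto
  have norm_le: "norm (a, b) \<le> \<bar>a\<bar> + \<bar>b\<bar>" for a b :: real using norm_Pair_le[of a b] by simp
  have comp: "\<bar>fst w - fst w'\<bar> \<le> norm (w - w')" "\<bar>snd w - snd w'\<bar> \<le> norm (w - w')" for w w' :: "real \<times> real"
    using norm_fst_le[of "fst w - fst w'" "snd w - snd w'"] norm_snd_le[of "snd w - snd w'" "fst w - fst w'"]
    by (simp_all add: minus_prod_def)
  have cG: "continuous_on UNIV (\<lambda>(p, z, w). G p z w)"
      unfolding G_def pole_rate_def case_prod_beta by (intro continuous_intros ballI ne)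
  have c\<sigma>: "continuous_on UNIV (\<lambda>(p :: real \<times> real, z). (fst p * z, snd p))"
      unfolding case_prod_beta by (intro continuous_intros)
  have bG: "norm (G p z w) \<le> 10" for p z w
    proof -
      have "\<bar>cos (fst w) * cl 1 (snd w)\<bar> \<le> 1 * 1" unfolding abs_mult by (intro mult_mono cl) auto
      then have "\<bar>cl (1/1000) (fst p) * (cos (fst w) * cl 1 (snd w))\<bar> \<le> 1/1000 * 1"
        unfolding abs_mult[of "cl (1/1000) (fst p)"] by (intro mult_mono cl) auto
      moreover have "\<bar>max 0 (min (pi/2) (snd p))\<bar> \<le> 2" using pi_less_4 pi_gt_zero by (auto simp: max_def min_def)
      ultimately have "\<bar>fst (G p z w)\<bar> \<le> 5" by (simp add: G_def)
      moreover have "\<bar>snd (G p z w)\<bar> \<le> 1"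
        unfolding G_def snd_conv by (rule prb)
      ultimately show ?thesis using norm_le[of "fst (G p z w)" "snd (G p z w)"] by simp
    qed
  \<comment> \<open>The equation for \<open>\<theta>\<close> contributes \<open>1/1000\<close> and
    the rate \<open>4/5 + 1/20\<close>, in total less than \<open>9/10\<close>.\<close>
  have lG: "norm (G p z w - G p z w') \<le> 9/10 * norm (w - w')" for p z w w'
    proof -
      have c: "\<bar>cos (fst w) - cos (fst w')\<bar> \<le> norm (w - w')" "\<bar>sin (fst w) - sin (fst w')\<bar> \<le> norm (w - w')"
        "\<bar>cl 1 (snd w) - cl 1 (snd w')\<bar> \<le> norm (w - w')"
        using order_trans[OF abs_cos_diff_le comp(1)] order_trans[OF abs_sin_diff_le comp(1)] order_trans[OF cl_lip comp(2)] .
      have "\<bar>(cos (fst w) - cos (fst w')) * cl 1 (snd w)\<bar> \<le> norm (w - w') * 1"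
        "\<bar>cos (fst w') * (cl 1 (snd w) - cl 1 (snd w'))\<bar> \<le> 1 * norm (w - w')"
        unfolding abs_mult by (intro mult_mono cl c; simp)+
      then have "\<bar>cos (fst w) * cl 1 (snd w) - cos (fst w') * cl 1 (snd w')\<bar> \<le> 2 * norm (w - w')"
        by (simp add: algebra_simps)
      then have "\<bar>cl (1/1000) (fst p) * (cos (fst w) * cl 1 (snd w) - cos (fst w') * cl 1 (snd w'))\<bar> \<le> 1/1000 * (2 * norm (w - w'))"
        unfolding abs_mult[of "cl (1/1000) (fst p)"] by (intro mult_mono cl) auto
      moreover have "fst (G p z w - G p z w') = - (1/2 * (cl (1/1000) (fst p) * (cos (fst w) * cl 1 (snd w) - cos (fst w') * cl 1 (snd w'))))"
        by (simp add: G_def algebra_simps)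
      ultimately have "\<bar>fst (G p z w - G p z w')\<bar> \<le> 1/1000 * norm (w - w')" by simp
      moreover have "\<bar>snd (G p z w - G p z w')\<bar> \<le> 4/5 * \<bar>sin (fst w) - sin (fst w')\<bar> + 1/20 * \<bar>cl 1 (snd w) - cl 1 (snd w')\<bar>"
        unfolding G_def by (simp only: snd_conv snd_diff, rule pole_rate_lipschitz[OF clb(1) abs_sin_le_one clb(2) clb(2)])
      moreover have "norm D \<le> \<bar>fst D\<bar> + \<bar>snd D\<bar>" for D using norm_le[of "fst D" "snd D"] by simp
      moreover have "n \<le> 9/10 * N" if "f \<le> 1/1000 * N" "s \<le> 4/5 * a + 1/20 * b" "n \<le> f + s" "a \<le> N" "b \<le> N" "0 \<le> N" for n f s a b N :: real
        using that by linarith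
      ultimately show ?thesis using c(2,3) norm_ge_zero by blast
    qed
  have k: "(\<lambda>z::real. 9/10 :: real) integrable_on {0..1}" "integral {0..1} (\<lambda>z::real. 9/10 :: real) \<le> 9/10"
    "(0::real) \<le> 9/10" "(9/10 :: real) < 1"
    by (rule integrable_const_ivl) simp_all
  obtain v where v: "continuous_on UNIV v" "\<And>p. v p = integral {0..1} (\<lambda>z. G p z (v (fst p * z, snd p)))"
    by (rule volterra_fixed_point[where k = "\<lambda>_ _. 9/10", OF cG c\<sigma> bG lG k(1-3) k(3,4)]) (rule that; assumption)
  define \<theta> l where "\<theta> s c = fst (v (s, c))" and "l s c = snd (v (s, c))" for s c
  have cv: "continuous_on A (\<lambda>z. v (f z, g z))" if "continuous_on A f" "continuous_on A g" for A and f g :: "real \<Rightarrow> real"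
    by (rule continuous_on_compose2[OF v(1)]) (auto intro!: continuous_intros that)
  have Gi: "continuous_on {0..1} (\<lambda>z. G p z (v (fst p * z, snd p)))" for p
    unfolding G_def pole_rate_def by (intro continuous_intros ballI ne cv)
  have vi: "fst (v p) = integral {0..1} (\<lambda>z. fst (G p z (v (fst p * z, snd p))))"
    "snd (v p) = integral {0..1} (\<lambda>z. snd (G p z (v (fst p * z, snd p))))" for p
    using integral_linear[OF integrable_continuous_real[OF Gi[of p]] bounded_linear_fst]
      integral_linear[OF integrable_continuous_real[OF Gi[of p]] bounded_linear_snd] v(2)[of p] by (simp_all add: o_def)
  have l1: "\<bar>snd (v p)\<bar> \<le> 1" for p
  proof -
    have "- 1 \<le> snd (G p z w) \<and> snd (G p z w) \<le> 1" for z w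
      using prb[of "fst p * z" "fst w" "snd w"] unfolding G_def snd_conv by linarith
    then show ?thesis unfolding vi(2) using unit_integral_bounds[OF continuous_on_snd[OF Gi[of p]], of "- 1" 1] by simp
  qed
  show thesis
  proof (rule that[of \<theta> l])
    show "continuous_on UNIV (\<theta> s)" "continuous_on UNIV (l s)" for s
      unfolding \<theta>_def[abs_def] l_def[abs_def] by (intro continuous_intros cv)+
    fix c :: real assume c: "0 \<le> c" "c \<le> pi/2"
    show "pole_solution c (\<lambda>s. \<theta> s c) (\<lambda>s. l s c)"
      unfolding pole_solution_def
    proof (intro conjI ballI)
      show "continuous_on {-1/1000..1/1000} (\<lambda>s. \<theta> s c)" "continuous_on {-1/1000..1/1000} (\<lambda>s. l s c)"
        unfolding \<theta>_def l_def by (intro continuous_intros cv)+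
      fix s :: real assume s: "s \<in> {-1/1000..1/1000}"
      show "\<bar>l s c\<bar> \<le> 1" unfolding l_def by (rule l1)
      have cl1: "cl 1 (snd (v p)) = snd (v p)" for p by (rule cl_id[OF l1])
      have cs: "cl (1/1000) s = s" "max 0 (min (pi/2) c) = c" using s c by (auto simp: cl_def)
      have csz: "cl (1/1000) (s * z) = s * z" if "z \<in> {0..1}" for z
      proof (rule cl_id)
        have "\<bar>s * z\<bar> \<le> \<bar>s\<bar>" using that by (simp add: abs_mult mult_left_le)
        then show "\<bar>s * z\<bar> \<le> 1/1000" using s by auto
      qed
      have i: "(\<lambda>z. 1/2 * cos (\<theta> (s * z) c) * l (s * z) c) integrable_on {0..1}"
        unfolding \<theta>_def l_def by (intro integrable_continuous_real continuous_intros cv)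
      have "\<theta> s c = integral {0..1} (\<lambda>z. c - s * (1/2 * cos (\<theta> (s * z) c) * l (s * z) c))"
        unfolding \<theta>_def l_def using vi(1)[of "(s, c)"] by (simp add: G_def cl1 cs)
      also have "\<dots> = c - s * integral {0..1} (\<lambda>z. 1/2 * cos (\<theta> (s * z) c) * l (s * z) c)"
        using has_integral_diff[OF has_integral_const_real[of c 0 1] has_integral_mult_right[OF integrable_integral[OF i], of s]]
        by (intro integral_unique) simp
      finally show "\<theta> s c = c - s * integral {0..1} (\<lambda>z. 1/2 * cos (\<theta> (s * z) c) * l (s * z) c)" .
      have "l s c = integral {0..1} (\<lambda>z. snd (G (s, c) z (v (s * z, c))))" unfolding l_def using vi(2)[of "(s, c)"] by simp
      also have "\<dots> = integral {0..1} (\<lambda>z. pole_rate (s * z) (sin (\<theta> (s * z) c)) (l (s * z) c))"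
        by (rule integral_cong) (simp add: G_def cl1 csz \<theta>_def l_def)
      finally show "l s c = integral {0..1} (\<lambda>z. pole_rate (s * z) (sin (\<theta> (s * z) c)) (l (s * z) c))" .
    qed
  qed
qed

section \<open>Estimates and regularity of a single pole solution\<close>

context
  fixes c :: real and \<theta> l :: "real \<Rightarrow> real"
  assumes sol: "pole_solution c \<theta> l" and c: "0 \<le> c" "c \<le> pi/2"
begin

lemma pole_solution_continuous: "continuous_on {-1/1000..1/1000} \<theta>" "continuous_on {-1/1000..1/1000} l"
  using sol unfolding pole_solution_def by blast+

lemma pole_solution_eq:
  assumes "s \<in> {-1/1000..1/1000}"
  shows "\<bar>l s\<bar> \<le> 1" "\<theta> s = c - s * integral {0..1} (\<lambda>z. 1/2 * cos (\<theta> (s * z)) * l (s * z))"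
    "l s = integral {0..1} (\<lambda>z. pole_rate (s * z) (sin (\<theta> (s * z))) (l (s * z)))"
  using sol assms unfolding pole_solution_def by blast+

lemma pole_range: "s \<in> {-1/1000..1/1000} \<Longrightarrow> z \<in> {0..1} \<Longrightarrow> s * z \<in> {-1/1000..1/1000::real}"
proof -
  assume s: "s \<in> {-1/1000..1/1000}" and z: "z \<in> {0..1}"
  have "\<bar>s * z\<bar> \<le> \<bar>s\<bar>" unfolding abs_mult using z by (intro mult_left_le) auto
  moreover have "\<bar>s\<bar> \<le> 1/1000" using s by auto
  ultimately have "\<bar>s * z\<bar> \<le> 1/1000" by linarith
  then show ?thesis by auto
qed

lemma pole_rate_continuous: "continuous_on {-1/1000..1/1000} (\<lambda>s. pole_rate s (sin (\<theta> s)) (l s))"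
  unfolding pole_rate_def by (intro continuous_intros pole_solution_continuous) auto

lemma pole_comp_continuous:
  fixes f :: "real \<Rightarrow> real"
  assumes "continuous_on {-1/1000..1/1000} f" "s \<in> {-1/1000..1/1000}"
  shows "continuous_on {0..1} (\<lambda>z. f (s * z))"
proof (rule continuous_on_compose2[OF assms(1)])
  show "(\<lambda>z. s * z) ` {0..1} \<subseteq> {-1/1000..1/1000}" using pole_range[OF assms(2)] by blast
qed (intro continuous_intros)

text \<open>The constant is \<open>1/1000\<close> for the length of the interval times
  \<open>1/2\<close> from the equation.\<close>

lemma pole_solution_near:
  assumes b: "\<And>s. s \<in> {-1/1000..1/1000} \<Longrightarrow> \<bar>cos (\<theta> s) * l s\<bar> \<le> B" and s: "s \<in> {-1/1000..1/1000}"
  shows "\<bar>\<theta> s - c\<bar> \<le> B / 2000"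
proof -
  let ?i = "integral {0..1} (\<lambda>z. 1/2 * cos (\<theta> (s * z)) * l (s * z))"
  have cont: "continuous_on {0..1} (\<lambda>z. 1/2 * cos (\<theta> (s * z)) * l (s * z))"
    by (intro continuous_intros pole_comp_continuous pole_solution_continuous s)
  have bd: "- (B / 2) \<le> 1/2 * cos (\<theta> (s * z)) * l (s * z) \<and> 1/2 * cos (\<theta> (s * z)) * l (s * z) \<le> B / 2" if "z \<in> {0..1}" for z
    using b[OF pole_range[OF s that]] by (auto simp: abs_le_iff)
  have "\<bar>?i\<bar> \<le> B / 2" using unit_integral_bounds[OF cont bd] by (simp add: abs_le_iff)
  then have "\<bar>s * ?i\<bar> \<le> 1/1000 * (B / 2)" unfolding abs_mult using s by (intro mult_mono) auto
  then show ?thesis using pole_solution_eq(2)[OF s] by simp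
qed

text \<open>All deviations are measured in proportion to \<open>sin c\<close> or
  \<open>cos c\<close>, so the bounds become exact at \<open>c = 0\<close> and
  \<open>c = pi/2\<close>. The maximum \<open>L\<close> of \<open>\<bar>l\<bar>\<close> is compared
  with itself: \<open>\<theta>\<close> differs from \<open>c\<close> by at most
  \<open>L / 2000\<close>, and then the rate bounds \<open>L\<close> by a multiple of
  \<open>sin c\<close>.\<close>

lemma pole_solution_bounds:
  assumes s: "s \<in> {-1/1000..1/1000}"
  shows "\<bar>l s\<bar> \<le> sin c" "l s \<ge> sin c / 2" "\<bar>sin (\<theta> s) - sin c\<bar> \<le> sin c / 1000"
    "\<bar>cos (\<theta> s) - cos c\<bar> \<le> cos c / 1000" "\<bar>\<theta> s - c\<bar> \<le> 1/1000" "\<bar>\<theta> s - c\<bar> \<le> cos c / 1000" "\<bar>\<theta> s - c\<bar> \<le> sin c / 1000"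
proof -
  let ?I = "{-1/1000..1/1000::real}"
  have ne: "?I \<noteq> {}" by simp
  have m: "sin c \<ge> 0" using c by (intro sin_ge_zero) auto
  have mc: "cos c \<ge> 0" using c by (intro cos_ge_zero) auto
  obtain s1 where s1: "s1 \<in> ?I" "\<And>s. s \<in> ?I \<Longrightarrow> \<bar>l s\<bar> \<le> \<bar>l s1\<bar>"
    using continuous_attains_sup[OF compact_Icc ne continuous_on_rabs[OF pole_solution_continuous(2)]] by blast
  define L where "L = \<bar>l s1\<bar>"
  have L: "\<bar>l s\<bar> \<le> L" if "s \<in> ?I" for s using s1(2)[OF that] by (simp add: L_def)
  have th: "\<bar>\<theta> s - c\<bar> \<le> L / 2000" if "s \<in> ?I" for s
  proof (rule pole_solution_near[OF _ that])
    fix s assume "s \<in> ?I"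
    have "\<bar>cos (\<theta> s)\<bar> * \<bar>l s\<bar> \<le> 1 * L" by (intro mult_mono L \<open>s \<in> ?I\<close>) auto
    then show "\<bar>cos (\<theta> s) * l s\<bar> \<le> L" by (simp add: abs_mult)
  qed
  have sn: "\<bar>sin (\<theta> s) - sin c\<bar> \<le> L / 2000" if "s \<in> ?I" for s
    using order_trans[OF abs_sin_diff_le th[OF that]] .
  have pc: "continuous_on {0..1} (\<lambda>z. pole_rate (s * z) (sin (\<theta> (s * z))) (l (s * z)))" if "s \<in> ?I" for s
    by (rule pole_comp_continuous[OF pole_rate_continuous that])
  have sz: "\<bar>s * z\<bar> \<le> 1/1000" if "s \<in> ?I" "z \<in> {0..1}" for s z using pole_range[OF that] by (auto simp: abs_le_iff)
  have up: "\<bar>pole_rate (s * z) (sin (\<theta> (s * z))) (l (s * z))\<bar> \<le> 4/5 * (sin c + L / 2000) + 1/20 * L"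
    if "s \<in> ?I" "z \<in> {0..1}" for s z
  proof -
    have "\<bar>sin (\<theta> (s * z))\<bar> \<le> sin c + L / 2000" using sn[OF pole_range[OF that]] m by linarith
    then have "4/5 * \<bar>sin (\<theta> (s * z))\<bar> \<le> 4/5 * (sin c + L / 2000)" by (rule mult_left_mono) simp
    moreover have "1/20 * \<bar>l (s * z)\<bar> \<le> 1/20 * L" using L[OF pole_range[OF that]] by (rule mult_left_mono) simp
    ultimately show ?thesis
      using pole_rate_bounds(1)[OF sz[OF that] pole_solution_eq(1)[OF pole_range[OF that]], of "sin (\<theta> (s * z))"] by linarith
  qed
  define M where "M = 4/5 * (sin c + L / 2000) + 1/20 * L"
  have upM: "- M \<le> pole_rate (s * z) (sin (\<theta> (s * z))) (l (s * z)) \<and> pole_rate (s * z) (sin (\<theta> (s * z))) (l (s * z)) \<le> M"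
    if "s \<in> ?I" "z \<in> {0..1}" for s z
    using up[OF that, folded M_def] unfolding abs_le_iff by linarith
  have "- M \<le> l s1" "l s1 \<le> M"
    unfolding pole_solution_eq(3)[OF s1(1)] using unit_integral_bounds[OF pc[OF s1(1)] upM[OF s1(1)]] by blast+
  then have "L \<le> M" unfolding L_def by linarith
  \<comment> \<open>The inequality is
    \<open>L * (1 - 1/20 - 1/2500) \<le> 4/5 * sin c\<close>.\<close>
  then have L1: "L \<le> 9/10 * sin c" using m unfolding M_def by argo
  show "\<bar>l s\<bar> \<le> sin c" using L[OF s] L1 m by linarith
  show "\<bar>sin (\<theta> s) - sin c\<bar> \<le> sin c / 1000" using sn[OF s] L1 m by linarith
  show "\<bar>\<theta> s - c\<bar> \<le> 1/1000" using th[OF s] L1 m sin_le_one[of c] by linarith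
  show "\<bar>\<theta> s - c\<bar> \<le> sin c / 1000" using th[OF s] L1 m by linarith
  have lo: "sin c / 2 \<le> pole_rate (s * z) (sin (\<theta> (s * z))) (l (s * z))" if "s \<in> ?I" "z \<in> {0..1}" for s z
  proof -
    have "sin (\<theta> (s * z)) \<ge> sin c - L / 2000" using sn[OF pole_range[OF that]] by linarith
    moreover have "sin (\<theta> (s * z)) \<ge> 0" using calculation L1 m by argo
    moreover have "\<bar>l (s * z)\<bar> \<le> L" using L[OF pole_range[OF that]] .
    ultimately show ?thesis
      using pole_rate_bounds(2)[OF sz[OF that] pole_solution_eq(1)[OF pole_range[OF that]], of "sin (\<theta> (s * z))"] L1 m by argo
  qed
  show "l s \<ge> sin c / 2"
    unfolding pole_solution_eq(3)[OF s] 
    by (rule unit_integral_bounds(1)[OF pc[OF s], where M = M]) (use lo[OF s] upM[OF s] in blast)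
  obtain s2 where s2: "s2 \<in> ?I" "\<And>s. s \<in> ?I \<Longrightarrow> \<bar>cos (\<theta> s)\<bar> \<le> \<bar>cos (\<theta> s2)\<bar>"
    using continuous_attains_sup[OF compact_Icc ne continuous_on_rabs[OF continuous_on_cos[OF pole_solution_continuous(1)]]] by blast
  \<comment> \<open>The same comparison for the maximum of \<open>\<bar>cos \<theta>\<bar>\<close>,
    now with \<open>\<bar>l\<bar> \<le> 1\<close>, gives the bounds in terms of
    \<open>cos c\<close>.\<close>
  define K where "K = \<bar>cos (\<theta> s2)\<bar>"
  have thK: "\<bar>\<theta> s - c\<bar> \<le> K / 2000" if "s \<in> ?I" for s
  proof (rule pole_solution_near[OF _ that])
    fix s assume "s \<in> ?I"
    have "\<bar>cos (\<theta> s)\<bar> * \<bar>l s\<bar> \<le> K * 1" unfolding K_def by (intro mult_mono s2 pole_solution_eq \<open>s \<in> ?I\<close>) auto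
    then show "\<bar>cos (\<theta> s) * l s\<bar> \<le> K" by (simp add: abs_mult)
  qed
  have cs: "\<bar>cos (\<theta> s) - cos c\<bar> \<le> K / 2000" if "s \<in> ?I" for s
    using order_trans[OF abs_cos_diff_le thK[OF that]] .
  have "K \<le> 11/10 * cos c" using cs[OF s2(1)] mc unfolding K_def by linarith
  then show "\<bar>cos (\<theta> s) - cos c\<bar> \<le> cos c / 1000" "\<bar>\<theta> s - c\<bar> \<le> cos c / 1000" using cs[OF s] thK[OF s] mc by linarith+
qed

lemma pole_solution_at_0: "\<theta> 0 = c" "l 0 = 3/4 * sin c"
proof -
  have 0: "0 \<in> {-1/1000..1/1000::real}" by simp
  show "\<theta> 0 = c" by (rule trans[OF pole_solution_eq(2)[OF 0]]) simp
  moreover have "l 0 = pole_rate 0 (sin (\<theta> 0)) (l 0)" by (rule trans[OF pole_solution_eq(3)[OF 0]]) simp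
  moreover have "pole_rate 0 x y = 3/4 * x" for x y by (simp add: pole_rate_def)
  ultimately show "l 0 = 3/4 * sin c" by metis
qed

lemma pole_solution_derivative:
  assumes s: "s \<in> {-1/1000<..<1/1000}"
  shows "(\<theta> has_real_derivative - (1/2 * cos (\<theta> s) * l s)) (at s)"
    "((\<lambda>s. s * l s) has_real_derivative pole_rate s (sin (\<theta> s)) (l s)) (at s)"
proof -
  let ?I = "{-1/1000<..<1/1000::real}"
  have s': "\<bar>s\<bar> < 1/1000" using s by auto
  have ev: "\<forall>\<^sub>F s in nhds s. s \<in> ?I" using s by (intro eventually_nhds_in_open) auto
  have c1: "continuous_on {-(1/1000)..1/1000} (\<lambda>s. 1/2 * cos (\<theta> s) * l s)"
    using pole_solution_continuous by (intro continuous_intros) auto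
  have c2: "continuous_on {-(1/1000)..1/1000} (\<lambda>s. pole_rate s (sin (\<theta> s)) (l s))"
    using pole_rate_continuous by simp
  have d1: "((\<lambda>t. t * integral {0..1} (\<lambda>z. 1/2 * cos (\<theta> (t * z)) * l (t * z))) has_real_derivative 1/2 * cos (\<theta> s) * l s) (at s)"
    using averaged_primitive_derivative[OF c1 s'] by (simp add: has_real_derivative_iff_has_vector_derivative)
  have d2: "((\<lambda>t. t * integral {0..1} (\<lambda>z. pole_rate (t * z) (sin (\<theta> (t * z))) (l (t * z)))) has_real_derivative pole_rate s (sin (\<theta> s)) (l s)) (at s)"
    using averaged_primitive_derivative[OF c2 s'] by (simp add: has_real_derivative_iff_has_vector_derivative)
  have "((\<lambda>t. c - t * integral {0..1} (\<lambda>z. 1/2 * cos (\<theta> (t * z)) * l (t * z))) has_real_derivative 0 - 1/2 * cos (\<theta> s) * l s) (at s)"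
    by (intro DERIV_diff DERIV_const d1)
  then show "(\<theta> has_real_derivative - (1/2 * cos (\<theta> s) * l s)) (at s)"
    by (subst DERIV_cong_ev[OF refl _ refl, where g = "\<lambda>t. c - t * integral {0..1} (\<lambda>z. 1/2 * cos (\<theta> (t * z)) * l (t * z))"])
      (use ev pole_solution_eq(2) in \<open>auto elim!: eventually_mono\<close>)
  show "((\<lambda>s. s * l s) has_real_derivative pole_rate s (sin (\<theta> s)) (l s)) (at s)"
    by (subst DERIV_cong_ev[OF refl _ refl, where g = "\<lambda>t. t * integral {0..1} (\<lambda>z. pole_rate (t * z) (sin (\<theta> (t * z))) (l (t * z)))"])
      (use ev pole_solution_eq(3) d2 in \<open>auto elim!: eventually_mono\<close>)
qed

text \<open>Away from \<open>0\<close> this is the quotient rule for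
  \<open>(s * l s) ^ Suc n / s ^ n\<close>. At \<open>0\<close> continuity of \<open>l\<close>
  suffices, thanks to the factor \<open>s\<close>.\<close>

lemma pole_solution_derivative_power:
  assumes s: "s \<in> {-1/1000<..<1/1000}"
  shows "((\<lambda>s. s * l s ^ Suc n) has_real_derivative Suc n * (pole_rate s (sin (\<theta> s)) (l s) * l s ^ n) - n * l s ^ Suc n) (at s)"
proof (cases "s = 0")
  case True
  have "isCont l 0" using pole_solution_continuous(2) by (rule continuous_on_interior) simp
  then have "isCont (\<lambda>s. l s ^ Suc n) 0" by (intro continuous_intros)
  then have "((\<lambda>s. s * l s ^ Suc n) has_real_derivative l 0 ^ Suc n) (at 0)"
    unfolding CARAT_DERIV by (intro exI[of _ "\<lambda>s. l s ^ Suc n"]) (simp add: mult.commute)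
  moreover have "pole_rate 0 (sin (\<theta> 0)) (l 0) = l 0" by (simp add: pole_rate_def pole_solution_at_0)
  ultimately show ?thesis using True by (simp add: algebra_simps)
next
  case False
  let ?R = "pole_rate s (sin (\<theta> s)) (l s)"
  have "((\<lambda>s. (s * l s) ^ Suc n) has_real_derivative Suc n * (?R * (s * l s) ^ n)) (at s)"
    using DERIV_power_Suc[OF pole_solution_derivative(2)[OF s], of n] by simp
  moreover have "((\<lambda>s. s ^ n) has_real_derivative n * s ^ (n - 1)) (at s)" using DERIV_pow[of n s] by simp
  ultimately have "((\<lambda>s. (s * l s) ^ Suc n / s ^ n) has_real_derivative
      (Suc n * (?R * (s * l s) ^ n) * s ^ n - (s * l s) ^ Suc n * (n * s ^ (n - 1))) / (s ^ n * s ^ n)) (at s)"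
    by (rule DERIV_divide) (use False in simp)
  moreover have "(Suc n * (?R * (s * l s) ^ n) * s ^ n - (s * l s) ^ Suc n * (n * s ^ (n - 1))) / (s ^ n * s ^ n)
      = Suc n * (?R * l s ^ n) - n * l s ^ Suc n"
    using False by (cases n) (simp_all add: field_simps power_mult_distrib)
  moreover have "\<forall>\<^sub>F s in nhds s. s * l s ^ Suc n = (s * l s) ^ Suc n / s ^ n"
    using eventually_nhds_in_open[of "- {0}" s] False by (auto elim!: eventually_mono simp: field_simps power_mult_distrib)
  ultimately show ?thesis by (subst DERIV_cong_ev[OF refl _ refl]) auto
qed

text \<open>Regularity improves by one order in each step: the products s * l s ^ n gain a derivative from the
  equation, hence so does the rate, and averaging the rate recovers l without loss.\<close>

lemma pole_solution_smooth: "smooth_on {-1/1000<..<1/1000} \<theta>" "smooth_on {-1/1000<..<1/1000} l"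
proof -
  let ?I = "{-1/1000<..<1/1000::real}"
  have op: "open ?I" by simp
  have mult: "Ck_on k ?I (\<lambda>x. f x * g x)" if "Ck_on k ?I f" "Ck_on k ?I g" for k and f g :: "real \<Rightarrow> real"
    using Ck_on_bounded_bilinear[OF bounded_bilinear_mult op that] .
  have diff: "Ck_on k ?I (\<lambda>x. f x - g x)" if "Ck_on k ?I f" "Ck_on k ?I g" for k and f g :: "real \<Rightarrow> real"
    using Ck_on_add[OF op that(1) Ck_on_bounded_linear_comp[OF bounded_linear_minus[OF bounded_linear_ident] op that(2)]] by simp
  have cmult: "Ck_on k ?I (\<lambda>x. a * f x)" if "Ck_on k ?I f" for k a and f :: "real \<Rightarrow> real"
    by (rule mult[OF Ck_on_const that])
  have pow: "Ck_on k ?I (\<lambda>x. f x ^ n)" if "Ck_on k ?I f" for k n and f :: "real \<Rightarrow> real"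
  proof (induction n)
    case 0 then show ?case by (simp only: power_0) (rule Ck_on_const)
  next
    case (Suc n) show ?case unfolding power_Suc by (rule mult[OF that Suc])
  qed
  have sc: "Ck_on k ?I (\<lambda>x. sin (f x))" "Ck_on k ?I (\<lambda>x. cos (f x))" if "Ck_on k ?I f" for k and f :: "real \<Rightarrow> real"
    using Ck_on_compose[OF op open_UNIV _ that, of sin] Ck_on_compose[OF op open_UNIV _ that, of cos] smooth_on_sin_cos[of UNIV]
    unfolding smooth_on_def by auto
  have idk: "Ck_on k ?I (\<lambda>x. x)" for k by (rule Ck_on_id[OF op])
  have "smooth_on ?I (\<lambda>s. 1 / (2 - s))" by (intro smooth_intros op) auto
  then have inv: "Ck_on k ?I (\<lambda>s. 1 / (2 - s))" for k unfolding smooth_on_def by blast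
  note ck = mult diff cmult pow sc idk inv Ck_on_add[OF op] Ck_on_const
  let ?R = "\<lambda>s. pole_rate s (sin (\<theta> s)) (l s)"
  \<comment> \<open>\<open>l\<close> enters the rate only in products
    \<open>s * l s ^ Suc n\<close>, whose derivatives contain no derivative of
    \<open>l\<close>.\<close>
  have R: "?R = (\<lambda>s. (3/2 * sin (\<theta> s) + s * l s ^ Suc 0) * (1 / (2 - s)) + ((3/2 * sin (\<theta> s)) * (s * l s ^ Suc 1) - s * l s ^ Suc 2
      + (s * l s ^ Suc 0) * (s * l s ^ Suc 1)))"
  proof
    fix s
    have "s * (l s)\<^sup>2 * (3/2 * sin (\<theta> s) - l s * (1 - s)) = (3/2 * sin (\<theta> s)) * (s * l s ^ Suc 1) - s * l s ^ Suc 2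
      + (s * l s ^ Suc 0) * (s * l s ^ Suc 1)"
      by (simp add: algebra_simps power2_eq_square eval_nat_numeral)
    then show "?R s = (3/2 * sin (\<theta> s) + s * l s ^ Suc 0) * (1 / (2 - s)) + ((3/2 * sin (\<theta> s)) * (s * l s ^ Suc 1) - s * l s ^ Suc 2
      + (s * l s ^ Suc 0) * (s * l s ^ Suc 1))"
      unfolding pole_rate_def by (simp only: power_one_right One_nat_def[symmetric] mult_1_right times_divide_eq_right)
  qed
  have "Ck_on k ?I \<theta> \<and> Ck_on k ?I l" for k
  proof (induction k)
    case 0
    show ?case using pole_solution_continuous by (auto elim!: continuous_on_subset)
  next
    case (Suc k)
    then have IH: "Ck_on k ?I \<theta>" "Ck_on k ?I l" by auto
    have Rk: "Ck_on k ?I ?R" unfolding R by (intro ck IH)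
    have pw: "Ck_on (Suc k) ?I (\<lambda>s. s * l s ^ Suc n)" for n
    proof (rule Ck_on_real_SucI[OF op])
      show "Ck_on k ?I (\<lambda>s. Suc n * (?R s * l s ^ n) - n * l s ^ Suc n)" by (intro ck IH Rk)
    qed (rule pole_solution_derivative_power[unfolded has_real_derivative_iff_has_vector_derivative])
    have "Ck_on k ?I (\<lambda>s. (- 1/2) * (cos (\<theta> s) * l s))" by (intro ck IH)
    then have th: "Ck_on (Suc k) ?I \<theta>"
    proof (rule Ck_on_real_SucI[OF op, rotated])
      fix s assume "s \<in> ?I"
      from pole_solution_derivative(1)[OF this]
      show "(\<theta> has_vector_derivative (- 1/2) * (cos (\<theta> s) * l s)) (at s)"
        by (simp add: has_real_derivative_iff_has_vector_derivative mult.assoc)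
    qed
    have "Ck_on (Suc k) ?I ?R" unfolding R by (intro ck th pw)
    from Ck_on_average[OF _ _ this, of 0] have "Ck_on (Suc k) ?I (\<lambda>s. integral {0..1} (\<lambda>z. ?R (s * z)))" by simp
    then have "Ck_on (Suc k) ?I l"
      by (subst Ck_on_cong[OF op, where g = "\<lambda>s. integral {0..1} (\<lambda>z. ?R (s * z))"]) (use pole_solution_eq(3) in auto)
    with th show ?case by blast
  qed
  then show "smooth_on ?I \<theta>" "smooth_on ?I l" unfolding smooth_on_def by blast+
qed

text \<open>\<open>sin c \<le> c\<close> and \<open>cos c \<le> pi/2 - c\<close> turn the
  proportional bounds into strict ones.\<close>

lemma pole_solution_range:
  assumes c': "0 < c" "c < pi/2" and s: "s \<in> {-1/1000..1/1000}"
  shows "0 < \<theta> s" "\<theta> s < pi/2" "l s > 0"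
proof -
  have m: "sin c > 0" "cos c > 0" using c' by (auto intro!: sin_gt_zero cos_gt_zero)
  note b = pole_solution_bounds[OF s]
  show "l s > 0" using b(2) m by linarith
  have "sin c \<le> c" using c'(1) by (intro sin_x_le_x) simp
  then show "0 < \<theta> s" using b(7) c'(1) by linarith
  have "cos c \<le> pi/2 - c" using sin_x_le_x[of "pi/2 - c"] c'(2) by (simp add: cos_sin_eq)
  then show "\<theta> s < pi/2" using b(6) c'(2) by linarith
qed

end

section \<open>The hypersphere\<close>

text \<open>The minimal surface equation for graphs \<open>h\<close> over \<open>x\<close>, as a
  first order equation for \<open>g = (1 - x^2) * h' / 2\<close>. For
  \<open>\<bar>x\<bar> < 1\<close> its singularities are \<open>h = 1\<close> and
  \<open>h = -1\<close>, the end orbits.\<close>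

definition graph_rate :: "real \<Rightarrow> real \<Rightarrow> real \<Rightarrow> real" where
  "graph_rate x h g = - (2 / (1 - x\<^sup>2)) * (h - 3/2 * x * g + g\<^sup>2 * (2 * h - 3/2 * x * g) / (1 - h\<^sup>2))"

text \<open>The point reflection on the level of graphs: \<open>h\<close> odd and \<open>g\<close>
  even is consistent with the equation.\<close>

lemma graph_rate_minus: "graph_rate (- x) (- h) g = - graph_rate x h g"
proof -
  have e: "2 * (- h) - 3/2 * (- x) * g = - (2 * h - 3/2 * x * g)" by simp
  have e': "- h - 3/2 * (- x) * g + - q = - (h - 3/2 * x * g + q)" for q by simp
  have "- h - 3/2 * (- x) * g + g\<^sup>2 * (2 * (- h) - 3/2 * (- x) * g) / (1 - (- h)\<^sup>2)
      = - (h - 3/2 * x * g + g\<^sup>2 * (2 * h - 3/2 * x * g) / (1 - h\<^sup>2))"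
    unfolding e power2_minus mult_minus_right[of "g\<^sup>2"] minus_divide_left[symmetric] e' ..
  then show ?thesis unfolding graph_rate_def by (simp only: power2_minus mult_minus_right)
qed

text \<open>Change of variables with \<open>h = s - 1\<close> and \<open>g = - 1 / l\<close>; the
  factor \<open>- 2 / ((1 - x^2) * l)\<close> is the derivative of \<open>s\<close> with respect to
  \<open>x\<close>.\<close>

lemma pole_graph_rate:
  assumes l': "s * l' = pole_rate s x l - l" and nz: "s \<noteq> 0" "s \<noteq> 2" "l \<noteq> 0"
  shows "l' / l\<^sup>2 * (- (2 / ((1 - x\<^sup>2) * l))) = graph_rate x (s - 1) (- 1 / l)"
proof -
  have s2: "2 - s \<noteq> 0" using nz by simp
  have hh: "1 - (s - 1)\<^sup>2 = s * (2 - s)" by (simp add: power2_eq_square algebra_simps)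
  define a where "a = l ^ 3 * (s - 1) + 3/2 * x * l\<^sup>2 + (2 * (s - 1) * l + 3/2 * x) / (s * (2 - s))"
  have "s * a = pole_rate s x l - l"
    unfolding a_def pole_rate_def using nz s2 by (simp add: field_simps power2_eq_square power3_eq_cube)
  with l' nz have l': "l' = a" by (metis mult_cancel_left)
  have "a / l ^ 3 = s - 1 - 3/2 * x * (- 1 / l) + (- 1 / l)\<^sup>2 * (2 * (s - 1) - 3/2 * x * (- 1 / l)) / (s * (2 - s))"
    unfolding a_def using nz s2 by (simp add: field_simps power2_eq_square power3_eq_cube)
  then have "graph_rate x (s - 1) (- 1 / l) = - (2 / (1 - x\<^sup>2)) * (a / l ^ 3)" unfolding graph_rate_def hh by simp
  then show ?thesis by (simp add: l' power2_eq_square power3_eq_cube mult.commute mult.left_commute)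
qed

text \<open>\<open>S, C, b, k, K\<close> stand for \<open>sin \<psi>, cos \<psi>, sin \<beta>, cos
  \<beta>, cos \<theta>\<close>. The first factor is the time derivative of
  \<open>g = - C * b / k\<close>, the second the derivative of time with respect to
  \<open>x\<close>.\<close>

lemma profile_graph_rate:
  fixes S C b k x K :: real
  assumes sc: "S\<^sup>2 + C\<^sup>2 = 1" and bk: "b\<^sup>2 + k\<^sup>2 = 1" and K: "K\<^sup>2 = 1 - x\<^sup>2" and nz: "C \<noteq> 0" "k \<noteq> 0" "K \<noteq> 0"
  shows "(S * (b * C) * b / k + C * (3/2 * x * (b * C) + S * k) / k\<^sup>2) * (- (1 / (1/2 * K\<^sup>2 * C * k))) = graph_rate x S (- (C * b / k))"
proof -
  define t where "t = b / k"
  have b: "b = t * k" using nz by (simp add: t_def)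
  have "(t\<^sup>2 + 1) * k\<^sup>2 = 1" using bk unfolding b by (simp add: algebra_simps power2_eq_square)
  then have k2: "1 / k\<^sup>2 = t\<^sup>2 + 1" using nz by (simp add: field_simps)
  have hh: "1 - S\<^sup>2 = C\<^sup>2" using sc by simp
  have "(S * (b * C) * b / k + C * (3/2 * x * (b * C) + S * k) / k\<^sup>2) * (- (1 / (1/2 * K\<^sup>2 * C * k)))
     = - (2 / K\<^sup>2) * (S * t\<^sup>2 + (3/2 * x * C * t + S) * (1 / k\<^sup>2))"
    unfolding b using nz by (simp add: field_simps power2_eq_square)
  also have "S * t\<^sup>2 + (3/2 * x * C * t + S) * (1 / k\<^sup>2) = S + 3/2 * x * C * t + t\<^sup>2 * (2 * S + 3/2 * x * C * t)"
    unfolding k2 by (simp add: field_simps power2_eq_square)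
  also have "S + 3/2 * x * C * t + t\<^sup>2 * (2 * S + 3/2 * x * C * t)
     = S - 3/2 * x * (- (C * b / k)) + (- (C * b / k))\<^sup>2 * (2 * S - 3/2 * x * (- (C * b / k))) / (1 - S\<^sup>2)"
    unfolding hh t_def using nz by (simp add: field_simps power2_eq_square)
  finally show ?thesis unfolding graph_rate_def K .
qed

lemma has_real_derivative_glue:
  fixes f g :: "real \<Rightarrow> real"
  assumes "(f has_real_derivative D) (at a)" "(g has_real_derivative D) (at a)" "f a = g a"
  shows "((\<lambda>x. if x \<le> a then f x else g x) has_real_derivative D) (at a)"
proof -
  have "((\<lambda>y. if y \<le> a then (f y - f a) / (y - a) else (g y - g a) / (y - a)) \<longlongrightarrow> D) (at a)"
    by (intro filterlim_If tendsto_mono[OF inf_le1]) (use assms(1,2) in \<open>simp_all add: has_field_derivative_iff\<close>)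
  moreover have "(\<lambda>y. if y \<le> a then (f y - f a) / (y - a) else (g y - g a) / (y - a))
     = (\<lambda>y. ((if y \<le> a then f y else g y) - (if a \<le> a then f a else g a)) / (y - a))"
    using assms(3) by (intro ext) auto
  ultimately show ?thesis unfolding has_field_derivative_iff by simp
qed

text \<open>The graph covers both sides of \<open>sin c\<close>, so smoothness of the hypersurface
  at its end orbit becomes smoothness at an interior point.\<close>

lemma pole_graph:
  assumes sol: "pole_solution c \<theta> l" and c: "0 < c" "c < pi/2"
  obtains h g :: "real \<Rightarrow> real" and a b :: real
  where "0 < a" "a < sin (\<theta> (1/2000))" "sin (\<theta> (1/2000)) < sin c" "sin c < b" "b < 1"
    "smooth_on {a<..<b} h" "smooth_on {a<..<b} g"
    "\<And>x. x \<in> {a<..<b} \<Longrightarrow> (h has_real_derivative 2 * g x / (1 - x\<^sup>2)) (at x)"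
    "\<And>x. x \<in> {a<..<b} \<Longrightarrow> x \<noteq> sin c \<Longrightarrow> (g has_real_derivative graph_rate x (h x) (g x)) (at x)"
    "\<And>x. a < x \<Longrightarrow> x < sin c \<Longrightarrow> \<bar>h x\<bar> < 1"
    "h (sin c) = - 1" "g (sin c) = - 4 / (3 * sin c)"
    "h (sin (\<theta> (1/2000))) = 1/2000 - 1" "g (sin (\<theta> (1/2000))) = - 1 / l (1/2000)"
proof -
  have c': "0 \<le> c" "c \<le> pi/2" using c by auto
  let ?I = "{-1/1000<..<1/1000::real}"
  have op: "open ?I" by simp
  note d = pole_solution_derivative[OF sol c'] and sm = pole_solution_smooth[OF sol c']
  have rng: "0 < \<theta> s" "\<theta> s < pi/2" "l s > 0" if "s \<in> ?I" for s
    using pole_solution_range[OF sol c' c, of s] that by auto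
  define X where "X s = sin (\<theta> s)" for s
  define f' where "f' s = 1/2 * (cos (\<theta> s))\<^sup>2 * l s" for s
  have cpos: "cos (\<theta> s) > 0" if "s \<in> ?I" for s using rng[OF that] by (intro cos_gt_zero) auto
  have df: "((\<lambda>s. - X s) has_real_derivative f' s) (at s)" if "s \<in> ?I" for s
    unfolding X_def f'_def by (rule derivative_eq_intros d[OF that] refl)+ (simp add: power2_eq_square)
  have fpos: "f' s > 0" if "s \<in> ?I" for s using cpos[OF that] rng[OF that] by (simp add: f'_def)
  have smf: "smooth_on ?I (\<lambda>s. - X s)" unfolding X_def by (intro smooth_intros op sm)
  obtain k where k: "open ((\<lambda>s. - X s) ` ?I)" "smooth_on ((\<lambda>s. - X s) ` ?I) k" "\<And>t. t \<in> ?I \<Longrightarrow> k (- X t) = t"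
    "\<And>y. y \<in> (\<lambda>s. - X s) ` ?I \<Longrightarrow> (k has_real_derivative 1 / f' (k y)) (at y)"
    by (rule smooth_inverse_increasing[OF smf, of f']) ((erule df), (erule fpos), (rule that; assumption))
  define S where "S x = k (- x)" for x
  have dec: "X t < X s" if "s < t" "s \<in> ?I" "t \<in> ?I" for s t
  proof -
    have "- X s < - X t"
    proof (rule DERIV_pos_imp_increasing[OF that(1)])
      fix r assume "s \<le> r" "r \<le> t"
      then have "r \<in> ?I" using that by auto
      then show "\<exists>y. ((\<lambda>s. - X s) has_real_derivative y) (at r) \<and> 0 < y" using df fpos by blast
    qed
    then show ?thesis by simp
  qed
  \<comment> \<open>\<open>x\<close> decreases in \<open>s\<close>: the value
    \<open>s = 1/1500\<close> gives the inner end, and \<open>s = -1/2000\<close> lies beyond the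
    orbit \<open>z2 = 0\<close>. The junction \<open>s = 1/2000\<close> is strictly between
    \<open>0\<close> and \<open>1/1500\<close>.\<close>
  define a b where "a = X (1/1500)" and "b = X (-1/2000)"
  have X0: "X 0 = sin c" by (simp add: X_def pole_solution_at_0[OF sol c'])
  have "continuous_on ?I X" using continuous_on_minus[OF smooth_on_imp_continuous_on[OF smf]] by simp
  then have contX: "continuous_on {-1/2000..1/1500} X" by (rule continuous_on_subset) auto
  have S: "S x \<in> ?I" "X (S x) = x" "- x \<in> (\<lambda>s. - X s) ` ?I" if "x \<in> {a<..<b}" for x
  proof -
    have "\<exists>s\<ge>-1/2000. s \<le> 1/1500 \<and> X s = x"
      by (rule IVT2') (use that contX in \<open>auto simp: a_def b_def\<close>)
    then obtain s where s0: "- 1/2000 \<le> s" "s \<le> 1/1500" "X s = x" by blast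
    then have s: "s \<in> ?I" "X s = x" by auto
    then show "S x \<in> ?I" "X (S x) = x" "- x \<in> (\<lambda>s. - X s) ` ?I" using k(3)[OF s(1)] by (auto simp: S_def)
  qed
  have SX: "S (X s) = s" if "s \<in> ?I" for s using k(3)[OF that] by (simp add: S_def)
  have dS: "(S has_real_derivative - (1 / f' (S x))) (at x)" if "x \<in> {a<..<b}" for x
  proof -
    have "(uminus has_real_derivative - 1) (at x)" by (auto intro!: derivative_eq_intros)
    from DERIV_chain'[OF this k(4)[OF S(3)[OF that]]] show ?thesis by (simp add: S_def[abs_def])
  qed
  have opab: "open {a<..<b}" by simp
  have smS: "smooth_on {a<..<b} S" unfolding S_def[abs_def]
    by (rule smooth_on_compose[OF k(2) _ opab k(1)]) (use S(3) in \<open>auto intro!: smooth_intros\<close>)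
  have w: "(cos (\<theta> (S x)))\<^sup>2 = 1 - x\<^sup>2" if "x \<in> {a<..<b}" for x
    using S(2)[OF that] by (simp add: cos_squared_eq X_def)
  have lS: "l (S x) > 0" if "x \<in> {a<..<b}" for x using rng(3)[OF S(1)[OF that]] .
  define h g where "h x = S x - 1" and "g x = - 1 / l (S x)" for x
  have in_I: "(1/2000::real) \<in> ?I" "(0::real) \<in> ?I" "(1/1500::real) \<in> ?I" "(-1/2000::real) \<in> ?I" by auto
  have ord: "a < X (1/2000)" "X (1/2000) < sin c" "sin c < b"
    unfolding a_def b_def X0[symmetric] by (intro dec; simp)+
  show thesis
  proof (rule that[of a b h g])
    show "0 < a" unfolding a_def X_def using rng[OF in_I(3)] by (intro sin_gt_zero) auto
    show "a < sin (\<theta> (1/2000))" "sin (\<theta> (1/2000)) < sin c" "sin c < b" using ord by (simp_all add: X_def)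
    have "(sin (\<theta> (-1/2000)))\<^sup>2 < 1" using cpos[OF in_I(4)] by (simp add: sin_squared_eq)
    then show "b < 1" unfolding b_def X_def using abs_square_less_1 abs_less_iff by blast
    show "smooth_on {a<..<b} h" unfolding h_def[abs_def] by (intro smooth_intros opab smS)
    have "smooth_on {a<..<b} (\<lambda>x. l (S x))" by (rule smooth_on_compose[OF sm(2) smS opab op]) (rule S(1))
    then show "smooth_on {a<..<b} g" unfolding g_def[abs_def]
      by (rule smooth_on_divide[OF opab smooth_on_const]) (drule lS, simp)
    show "(h has_real_derivative 2 * g x / (1 - x\<^sup>2)) (at x)" if x: "x \<in> {a<..<b}" for x
    proof -
      have "2 * g x / (1 - x\<^sup>2) = - (1 / f' (S x))" unfolding g_def f'_def w[OF x] by simp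
      then show ?thesis unfolding h_def[abs_def] using DERIV_diff[OF dS[OF x] DERIV_const, of 1] by simp
    qed
    show "(g has_real_derivative graph_rate x (h x) (g x)) (at x)" if x: "x \<in> {a<..<b}" "x \<noteq> sin c" for x
    proof -
      define s where "s = S x"
      have s: "s \<in> ?I" "X s = x" using S[OF x(1)] by (simp_all add: s_def)
      then have "s \<noteq> 0" using X0 x(2) by auto
      obtain l' where l': "(l has_real_derivative l') (at s)"
        using has_derivative_imp_has_real_derivative[OF smooth_on_has_derivative[OF sm(2) s(1)]] by blast
      have "((\<lambda>s. s * l s) has_real_derivative l s + s * l') (at s)"
        by (rule derivative_eq_intros l' refl)+ simp
      from DERIV_unique[OF this d(2)[OF s(1)]] have "s * l' = pole_rate s x (l s) - l s" using s(2) by (simp add: X_def)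
      from pole_graph_rate[OF this \<open>s \<noteq> 0\<close>] s(1) rng(3)[OF s(1)]
      have r: "l' / (l s)\<^sup>2 * (- (2 / ((1 - x\<^sup>2) * l s))) = graph_rate x (h x) (g x)" by (simp add: h_def g_def s_def[symmetric])
      have "((\<lambda>x. l (S x)) has_real_derivative l' * - (1 / f' (S x))) (at x)"
        using DERIV_chain'[OF dS[OF x(1)], of l l'] l' by (simp add: s_def)
      from DERIV_divide[OF DERIV_const this, of "- 1"] lS[OF x(1)]
      have "((\<lambda>x. - 1 / l (S x)) has_real_derivative l' * - (1 / f' s) / (l s * l s)) (at x)" by (simp add: s_def)
      moreover have "l' * - (1 / f' s) / (l s * l s) = l' / (l s)\<^sup>2 * (- (2 / ((1 - x\<^sup>2) * l s)))"
        using w[OF x(1)] by (simp add: f'_def s_def[symmetric] power2_eq_square)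
      ultimately show ?thesis unfolding g_def[abs_def] using r by (simp add: g_def)
    qed
    show "\<bar>h x\<bar> < 1" if x: "a < x" "x < sin c" for x
    proof -
      have xi: "x \<in> {a<..<b}" using x ord by auto
      have "S x > 0"
      proof (rule ccontr)
        assume "\<not> S x > 0"
        then have "S x = 0 \<or> S x < 0" by auto
        then have "X 0 \<le> X (S x)" using dec[of "S x" 0] S(1)[OF xi] by auto
        then show False using S(2)[OF xi] X0 x by simp
      qed
      then show ?thesis using S(1)[OF xi] by (simp add: h_def)
    qed
    show "h (sin c) = - 1" using SX[OF in_I(2)] by (simp add: h_def X0)
    show "g (sin c) = - 4 / (3 * sin c)" using SX[OF in_I(2)] by (simp add: g_def X0 pole_solution_at_0[OF sol c'])
    have e: "S (sin (\<theta> (1/2000))) = 1/2000" using SX[OF in_I(1)] by (simp only: X_def)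
    show "h (sin (\<theta> (1/2000))) = 1/2000 - 1" "g (sin (\<theta> (1/2000))) = - 1 / l (1/2000)"
      unfolding h_def g_def e by (rule refl)+
  qed
qed

text \<open>The curve runs through the centre \<open>\<theta> = \<psi> = 0\<close> of the point
  reflection, so uniqueness makes it symmetric about time \<open>\<sigma>\<close>. As
  \<open>cos \<beta> > 0\<close> throughout, \<open>x\<close> is strictly decreasing along it and
  can serve as the variable.\<close>

lemma flow_graph:
  assumes desc: "descending_profile \<psi> \<beta> \<theta>" and \<sigma>: "\<sigma> > 0" "\<theta> \<sigma> = 0" "\<psi> \<sigma> = 0" "\<forall>t\<in>{0..\<sigma>}. 0 \<le> \<theta> t"
    and pos0: "cos (\<beta> 0) > 0"
  obtains h g :: "real \<Rightarrow> real" and d :: real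
  where "sin (\<theta> 0) < d" "d < 1" "\<And>x. x \<in> {-d<..<d} \<Longrightarrow> h (- x) = - h x" "\<And>x. x \<in> {-d<..<d} \<Longrightarrow> g (- x) = g x"
    "\<And>x. x \<in> {-d<..<d} \<Longrightarrow> \<bar>h x\<bar> < 1"
    "\<And>x. x \<in> {-d<..<d} \<Longrightarrow> (h has_real_derivative 2 * g x / (1 - x\<^sup>2)) (at x)"
    "\<And>x. x \<in> {-d<..<d} \<Longrightarrow> (g has_real_derivative graph_rate x (h x) (g x)) (at x)"
    "h (sin (\<theta> 0)) = sin (\<psi> 0)" "g (sin (\<theta> 0)) = - (cos (\<psi> 0) * sin (\<beta> 0) / cos (\<beta> 0))"
proof -
  interpret descending_profile \<psi> \<beta> \<theta> by (rule desc)
  note cp = cos_\<psi>_pos cos_\<theta>_pos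
  define \<psi>' \<beta>' \<theta>' where "\<psi>' s = sin (\<beta> s) * cos (\<psi> s)"
    and "\<beta>' s = - (3/2 * sin (\<theta> s) * (sin (\<beta> s) * cos (\<psi> s))) - sin (\<psi> s) * cos (\<beta> s)"
    and "\<theta>' s = - (1/2 * (cos (\<theta> s) * (cos (\<psi> s) * cos (\<beta> s))))" for s
  note d = profile_solutionD[OF sol, folded \<psi>'_def \<beta>'_def \<theta>'_def]
  note sm = profile_smooth[OF sol]
  have refl_d: "((\<lambda>t. f (2 * \<sigma> - t)) has_real_derivative - f' (2 * \<sigma> - t)) (at t)"
    if "\<And>t. (f has_real_derivative f' t) (at t)" for f f' t
  proof -
    have "((\<lambda>t. 2 * \<sigma> - t) has_real_derivative - 1) (at t)" by (auto intro!: derivative_eq_intros)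
    from DERIV_chain'[OF this that] show ?thesis by simp
  qed
  have "profile_solution (\<lambda>t. - \<psi> (2 * \<sigma> - t)) (\<lambda>t. \<beta> (2 * \<sigma> - t)) (\<lambda>t. - \<theta> (2 * \<sigma> - t))"
    unfolding profile_solution_def
  proof (intro allI conjI)
    fix t
    show "((\<lambda>t. - \<psi> (2 * \<sigma> - t)) has_real_derivative sin (\<beta> (2 * \<sigma> - t)) * cos (- \<psi> (2 * \<sigma> - t))) (at t)"
      using DERIV_minus[OF refl_d[OF d(1)]] by (simp add: \<psi>'_def)
    show "((\<lambda>t. \<beta> (2 * \<sigma> - t)) has_real_derivative - (3/2 * sin (- \<theta> (2 * \<sigma> - t)) * (sin (\<beta> (2 * \<sigma> - t)) * cos (- \<psi> (2 * \<sigma> - t))))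
        - sin (- \<psi> (2 * \<sigma> - t)) * cos (\<beta> (2 * \<sigma> - t))) (at t)"
      by (rule DERIV_cong[OF refl_d[OF d(2)]]) (simp add: \<beta>'_def)
    show "((\<lambda>t. - \<theta> (2 * \<sigma> - t)) has_real_derivative - (1/2 * (cos (- \<theta> (2 * \<sigma> - t)) * (cos (- \<psi> (2 * \<sigma> - t)) * cos (\<beta> (2 * \<sigma> - t)))))) (at t)"
      using DERIV_minus[OF refl_d[OF d(3)]] by (simp add: \<theta>'_def)
  qed
  from profile_solution_unique[OF this sol, of \<sigma>]
  have R: "- \<psi> (2 * \<sigma> - t) = \<psi> t" "\<beta> (2 * \<sigma> - t) = \<beta> t" "- \<theta> (2 * \<sigma> - t) = \<theta> t" for t using \<sigma> by simp_all
  have Rs: "sin (\<psi> (2 * \<sigma> - t)) = - sin (\<psi> t)" "cos (\<psi> (2 * \<sigma> - t)) = cos (\<psi> t)" "sin (\<theta> (2 * \<sigma> - t)) = - sin (\<theta> t)" for t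
    using R(1,3)[of t] by (metis sin_minus minus_minus, metis cos_minus, metis sin_minus minus_minus)
  have c\<beta>1: "cos (\<beta> t) > 0" if "0 \<le> t" "t \<le> \<sigma>" for t
    using cos_\<beta>_pos[OF \<sigma>(4), of t] pos0 that by (cases "t = 0") auto
  have "\<forall>\<^sub>F t in at 0. cos (\<beta> t) > 0"
    using order_tendstoD(1)[OF isCont_tendsto_compose[OF isCont_cos profile_continuous(2)[OF sol, of 0, unfolded isCont_def]] pos0] by simp
  \<comment> \<open>Going back slightly before time \<open>0\<close> extends the graph beyond
    \<open>sin (\<theta> 0)\<close>, so that the junction is an interior point.\<close>
  then obtain \<epsilon> where \<epsilon>: "\<epsilon> > 0" "\<And>t. t \<noteq> 0 \<Longrightarrow> \<bar>t\<bar> < \<epsilon> \<Longrightarrow> cos (\<beta> t) > 0"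
    unfolding eventually_at by (auto simp: dist_real_def)
  let ?I = "{-\<epsilon><..<2 * \<sigma> + \<epsilon>}"
  have c\<beta>: "cos (\<beta> t) > 0" if t: "t \<in> ?I" for t
  proof -
    have l: "cos (\<beta> t) > 0" if "- \<epsilon> < t" "t \<le> \<sigma>" for t
      using \<epsilon>(2)[of t] c\<beta>1[of t] that by (cases "t < 0") auto
    show ?thesis
    proof (cases "t \<le> \<sigma>")
      case True then show ?thesis using l t by auto
    next
      case False
      then have "cos (\<beta> (2 * \<sigma> - t)) > 0" using t by (intro l) auto
      then show ?thesis by (simp add: R(2))
    qed
  qed
  define X where "X t = sin (\<theta> t)" for t
  define f' where "f' t = 1/2 * (cos (\<theta> t))\<^sup>2 * cos (\<psi> t) * cos (\<beta> t)" for t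
  have df: "((\<lambda>t. - X t) has_real_derivative f' t) (at t)" for t
    unfolding X_def f'_def by (rule derivative_eq_intros d refl)+ (simp add: \<theta>'_def power2_eq_square)
  have fpos: "f' t > 0" if "t \<in> ?I" for t unfolding f'_def using cp(1,2)[of t] c\<beta>[OF that]
    by (intro mult_pos_pos zero_less_power) simp_all
  have smf: "smooth_on UNIV (\<lambda>t. - X t)" unfolding X_def by (intro smooth_intros open_UNIV sm)
  obtain k where k: "open ((\<lambda>t. - X t) ` ?I)" "smooth_on ((\<lambda>t. - X t) ` ?I) k" "\<And>t. t \<in> ?I \<Longrightarrow> k (- X t) = t"
    "\<And>y. y \<in> (\<lambda>t. - X t) ` ?I \<Longrightarrow> (k has_real_derivative 1 / f' (k y)) (at y)"
    by (rule smooth_inverse_increasing[OF smooth_on_subset[OF smf subset_UNIV] df]) ((erule fpos), (rule that; assumption))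
  define T where "T x = k (- x)" for x
  have dec: "X t < X s" if "s < t" "s \<in> ?I" "t \<in> ?I" for s t
  proof -
    have "- X s < - X t"
    proof (rule DERIV_pos_imp_increasing[OF that(1)])
      fix r assume "s \<le> r" "r \<le> t"
      then have "r \<in> ?I" using that by auto
      then show "\<exists>y. ((\<lambda>s. - X s) has_real_derivative y) (at r) \<and> 0 < y" using df fpos by blast
    qed
    then show ?thesis by simp
  qed
  define e where "e = X (- \<epsilon> / 2)"
  have contX: "continuous_on A X" for A unfolding X_def by (intro continuous_intros profile_continuous_on[OF sol])
  have symX: "X (2 * \<sigma> - t) = - X t" for t by (simp add: X_def Rs)
  have em: "X (2 * \<sigma> + \<epsilon> / 2) = - e" using symX[of "- \<epsilon> / 2"] by (simp add: e_def)
  have T: "T x \<in> ?I" "X (T x) = x" "- x \<in> (\<lambda>t. - X t) ` ?I" if "x \<in> {-e<..<e}" for x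
  proof -
    have "\<exists>t\<ge>-\<epsilon>/2. t \<le> 2 * \<sigma> + \<epsilon> / 2 \<and> X t = x"
      by (rule IVT2') (use that em e_def contX \<epsilon>(1) \<sigma>(1) in simp_all)
    then obtain t where t0: "- \<epsilon>/2 \<le> t" "t \<le> 2 * \<sigma> + \<epsilon> / 2" "X t = x" by blast
    then have "t \<in> ?I" using \<epsilon>(1) by simp
    note t = this t0(3)
    then show "T x \<in> ?I" "X (T x) = x" "- x \<in> (\<lambda>t. - X t) ` ?I" using k(3)[OF t(1)] by (auto simp: T_def)
  qed
  have TX: "T (X t) = t" if "t \<in> ?I" for t using k(3)[OF that] by (simp add: T_def)
  have dT: "(T has_real_derivative - (1 / f' (T x))) (at x)" if "x \<in> {-e<..<e}" for x
  proof -
    have "(uminus has_real_derivative - 1) (at x)" by (auto intro!: derivative_eq_intros)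
    from DERIV_chain'[OF this k(4)[OF T(3)[OF that]]] show ?thesis by (simp add: T_def[abs_def])
  qed
  have Tm: "T (- x) = 2 * \<sigma> - T x" if x: "x \<in> {-e<..<e}" for x
    using TX[of "2 * \<sigma> - T x"] T(1)[OF x] by (simp add: symX T(2)[OF x])
  have w: "(cos (\<theta> (T x)))\<^sup>2 = 1 - x\<^sup>2" if "x \<in> {-e<..<e}" for x
    using T(2)[OF that] by (simp add: cos_squared_eq X_def)
  \<comment> \<open>With \<open>h = sin \<psi>\<close>, the quantity
    \<open>(1 - x^2) * h' / 2\<close> is \<open>- cos \<psi> * tan \<beta>\<close>.\<close>
  define h g where "h x = sin (\<psi> (T x))" and "g x = - (cos (\<psi> (T x)) * sin (\<beta> (T x)) / cos (\<beta> (T x)))" for x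
  show thesis
  proof (rule that[of e h g])
    show "sin (\<theta> 0) < e" using dec[of "- \<epsilon> / 2" 0] \<epsilon>(1) \<sigma>(1) by (simp add: e_def X_def)
    have "(sin (\<theta> (- \<epsilon> / 2)))\<^sup>2 < 1" using cp(2)[of "- \<epsilon> / 2"] by (simp add: sin_squared_eq)
    then show "e < 1" unfolding e_def X_def using abs_square_less_1 abs_less_iff by blast
    show "h (- x) = - h x" "g (- x) = g x" if "x \<in> {-e<..<e}" for x
      using Tm[OF that] by (simp_all add: h_def g_def Rs R)
    show "\<bar>h x\<bar> < 1" for x
    proof -
      have "(sin (\<psi> (T x)))\<^sup>2 < 1" using cp(1)[of "T x"] by (simp add: sin_squared_eq)
      then show ?thesis unfolding h_def by (simp add: abs_square_less_1)
    qed
    show "(h has_real_derivative 2 * g x / (1 - x\<^sup>2)) (at x)" if x: "x \<in> {-e<..<e}" for x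
    proof -
      have "((\<lambda>t. sin (\<psi> t)) has_real_derivative cos (\<psi> t) * \<psi>' t) (at t)" for t
        by (rule derivative_eq_intros d refl)+
      from DERIV_chain'[OF dT[OF x] this]
      have "((\<lambda>x. sin (\<psi> (T x))) has_real_derivative cos (\<psi> (T x)) * \<psi>' (T x) * - (1 / f' (T x))) (at x)" .
      moreover have "cos (\<psi> (T x)) * \<psi>' (T x) * - (1 / f' (T x)) = 2 * g x / (1 - x\<^sup>2)"
        using cp(1)[of "T x"] c\<beta>[OF T(1)[OF x]] w[OF x] cp(2)[of "T x"] by (simp add: \<psi>'_def f'_def g_def w[OF x, symmetric] field_simps)
      ultimately show ?thesis unfolding h_def[abs_def] by simp
    qed
    show "(g has_real_derivative graph_rate x (h x) (g x)) (at x)" if x: "x \<in> {-e<..<e}" for x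
    proof -
      define t where "t = T x"
      have ct: "cos (\<beta> t) > 0" using c\<beta>[OF T(1)[OF x]] by (simp add: t_def)
      have ne: "cos (\<psi> t) \<noteq> 0" "cos (\<beta> t) \<noteq> 0" "cos (\<theta> t) \<noteq> 0" using cp(1)[of t] cp(2)[of t] ct by simp_all
      have b2: "(sin (\<beta> t))\<^sup>2 = 1 - (cos (\<beta> t))\<^sup>2" by (simp add: sin_squared_eq)
      have xt: "x = sin (\<theta> t)" using T(2)[OF x] by (simp add: t_def X_def)
      let ?D = "sin (\<psi> t) * (sin (\<beta> t) * cos (\<psi> t)) * sin (\<beta> t) / cos (\<beta> t) + cos (\<psi> t) * (3/2 * x * (sin (\<beta> t) * cos (\<psi> t)) + sin (\<psi> t) * cos (\<beta> t)) / (cos (\<beta> t))\<^sup>2"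
      have "((\<lambda>t. - (cos (\<psi> t) * sin (\<beta> t) / cos (\<beta> t))) has_real_derivative
         - (((- (sin (\<psi> t) * \<psi>' t) * sin (\<beta> t) + cos (\<psi> t) * (cos (\<beta> t) * \<beta>' t)) * cos (\<beta> t) - cos (\<psi> t) * sin (\<beta> t) * (- (sin (\<beta> t) * \<beta>' t))) / (cos (\<beta> t) * cos (\<beta> t)))) (at t)"
        by (rule derivative_eq_intros d refl ne)+ (simp add: algebra_simps)
      moreover have "- (((- (s * p) * y + r * (k * q)) * k - r * y * (- (y * q))) / (k * k)) = s * p * y / k + r * (- q) / k\<^sup>2"
        if "k \<noteq> 0" "k\<^sup>2 + y\<^sup>2 = 1" for s p y r k q :: real
      proof -
        have num: "(- (s * p) * y + r * (k * q)) * k - r * y * (- (y * q)) = - (s * p * y * k) + r * q * (k\<^sup>2 + y\<^sup>2)"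
          by (simp add: algebra_simps power2_eq_square)
        show ?thesis unfolding num that(2) using that(1) by (simp add: field_simps power2_eq_square)
      qed
      note this[OF ne(2) sin_cos_squared_add2]
      moreover have "sin (\<psi> t) * \<psi>' t * sin (\<beta> t) / cos (\<beta> t) + cos (\<psi> t) * (- \<beta>' t) / (cos (\<beta> t))\<^sup>2 = ?D"
        by (simp add: \<psi>'_def \<beta>'_def xt)
      ultimately have "((\<lambda>t. - (cos (\<psi> t) * sin (\<beta> t) / cos (\<beta> t))) has_real_derivative ?D) (at t)" by metis
      from DERIV_chain'[OF dT[OF x] this[unfolded t_def]]
      have "((\<lambda>x. - (cos (\<psi> (T x)) * sin (\<beta> (T x)) / cos (\<beta> (T x)))) has_real_derivative ?D * - (1 / f' t)) (at x)" by (simp add: t_def)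
      moreover have "?D * - (1 / f' t) = graph_rate x (h x) (g x)"
        using profile_graph_rate[OF sin_cos_squared_add sin_cos_squared_add w[OF x, folded t_def] ne]
        by (simp add: f'_def h_def g_def t_def[symmetric])
      ultimately show ?thesis unfolding g_def[abs_def] by simp
    qed
    have "T (sin (\<theta> 0)) = 0" using TX[of 0] \<epsilon>(1) \<sigma>(1) by (simp add: X_def)
    then show "h (sin (\<theta> 0)) = sin (\<psi> 0)" "g (sin (\<theta> 0)) = - (cos (\<psi> 0) * sin (\<beta> 0) / cos (\<beta> 0))"
      by (simp_all add: h_def g_def)
  qed
qed

text \<open>Both graphs solve the same first order system for \<open>(h, g)\<close>. Equal values at
  \<open>x1\<close> force equal derivatives, so the glued pair is a differentiable solution across
  the junction and is smooth there by \<open>ode_smooth\<close>; at the end orbits smoothness is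
  inherited from \<open>h2\<close> and \<open>g2\<close>.\<close>

lemma glued_graph_sphere:
  fixes h1 g1 h2 g2 :: "real \<Rightarrow> real"
  assumes x: "0 < x1" "x1 < d" "d < 1" "0 < a" "a < x1" "x1 < x0" "x0 < b" "b < 1"
    and odd: "\<And>x. x \<in> {-d<..<d} \<Longrightarrow> h1 (- x) = - h1 x" "\<And>x. x \<in> {-d<..<d} \<Longrightarrow> g1 (- x) = g1 x"
    and b1: "\<And>x. x \<in> {-d<..<d} \<Longrightarrow> \<bar>h1 x\<bar> < 1" and b2: "\<And>x. a < x \<Longrightarrow> x < x0 \<Longrightarrow> \<bar>h2 x\<bar> < 1"
    and dh1: "\<And>x. x \<in> {-d<..<d} \<Longrightarrow> (h1 has_real_derivative 2 * g1 x / (1 - x\<^sup>2)) (at x)"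
    and dg1: "\<And>x. x \<in> {-d<..<d} \<Longrightarrow> (g1 has_real_derivative graph_rate x (h1 x) (g1 x)) (at x)"
    and sm2: "smooth_on {a<..<b} h2" "smooth_on {a<..<b} g2"
    and dh2: "\<And>x. x \<in> {a<..<b} \<Longrightarrow> (h2 has_real_derivative 2 * g2 x / (1 - x\<^sup>2)) (at x)"
    and dg2: "\<And>x. x \<in> {a<..<b} \<Longrightarrow> x \<noteq> x0 \<Longrightarrow> (g2 has_real_derivative graph_rate x (h2 x) (g2 x)) (at x)"
    and eq: "h1 x1 = h2 x1" "g1 x1 = g2 x1" and end2: "h2 x0 = - 1" "g2 x0 = - 4 / (3 * x0)"
  shows "\<exists>M. minimal_hypersurface M \<and> S1_invariant M \<and> M diffeomorphic sphere (0 :: real^4) 1 \<and> \<not> equatorial M"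
proof -
  define h where "h x = (if x < - x1 then - h2 (- x) else if x \<le> x1 then h1 x else h2 x)" for x
  define g where "g x = (if x < - x1 then g2 (- x) else if x \<le> x1 then g1 x else g2 x)" for x
  have odd': "h (- x) = - h x" "g (- x) = g x" for x
  proof -
    consider "x < - x1" | "x = - x1" | "\<bar>x\<bar> < x1" | "x = x1" | "x > x1" by linarith
    then show "h (- x) = - h x" "g (- x) = g x"
      by (cases; use x odd[of x] odd[of x1] in \<open>auto simp: h_def g_def\<close>)+
  qed
  have loc: "\<forall>\<^sub>F y in nhds x. h y = (if y \<le> x1 then h1 y else h2 y)" "\<forall>\<^sub>F y in nhds x. g y = (if y \<le> x1 then g1 y else g2 y)"
    if "x > - x1" for x
    using eventually_nhds_in_open[of "{- x1<..}" x] that by (auto elim!: eventually_mono simp: h_def g_def)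
  have pos: "(h has_real_derivative 2 * g y / (1 - y\<^sup>2)) (at y)"
      "y \<noteq> x0 \<Longrightarrow> (g has_real_derivative graph_rate y (h y) (g y)) (at y)" if y: "0 \<le> y" "y < b" for y
  proof -
    consider "y < x1" | "y = x1" | "y > x1" by linarith
    then have *: "((\<lambda>y. if y \<le> x1 then h1 y else h2 y) has_real_derivative 2 * g y / (1 - y\<^sup>2)) (at y) \<and>
      (y \<noteq> x0 \<longrightarrow> ((\<lambda>y. if y \<le> x1 then g1 y else g2 y) has_real_derivative graph_rate y (h y) (g y)) (at y))"
    proof cases
      case 1
      have e: "\<forall>\<^sub>F z in nhds y. z < x1" using 1 eventually_nhds_in_open[of "{..<x1}" y] by simp
      have yd: "y \<in> {-d<..<d}" "\<not> y < - x1" using 1 x y by auto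
      have "((\<lambda>y. if y \<le> x1 then h1 y else h2 y) has_real_derivative 2 * g1 y / (1 - y\<^sup>2)) (at y)"
        by (subst DERIV_cong_ev[OF refl _ refl, where g = h1]) (use e dh1[OF yd(1)] in \<open>auto elim!: eventually_mono\<close>)
      moreover have "((\<lambda>y. if y \<le> x1 then g1 y else g2 y) has_real_derivative graph_rate y (h1 y) (g1 y)) (at y)"
        by (subst DERIV_cong_ev[OF refl _ refl, where g = g1]) (use e dg1[OF yd(1)] in \<open>auto elim!: eventually_mono\<close>)
      ultimately show ?thesis using 1 yd by (simp add: h_def g_def)
    next
      case 2
      have i: "x1 \<in> {-d<..<d}" "x1 \<in> {a<..<b}" "x1 \<noteq> x0" "\<not> x1 < - x1" using x by auto
      have "((\<lambda>y. if y \<le> x1 then h1 y else h2 y) has_real_derivative 2 * g1 x1 / (1 - x1\<^sup>2)) (at x1)"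
        by (rule has_real_derivative_glue) (use dh1[OF i(1)] dh2[OF i(2)] eq in simp_all)
      moreover have "((\<lambda>y. if y \<le> x1 then g1 y else g2 y) has_real_derivative graph_rate x1 (h1 x1) (g1 x1)) (at x1)"
        by (rule has_real_derivative_glue) (use dg1[OF i(1)] dg2[OF i(2,3)] eq in simp_all)
      ultimately show ?thesis using 2 i(4) by (simp add: h_def g_def)
    next
      case 3
      have e: "\<forall>\<^sub>F z in nhds y. z > x1" using 3 eventually_nhds_in_open[of "{x1<..}" y] by simp
      have yd: "y \<in> {a<..<b}" "\<not> y < - x1" using 3 x y by auto
      have "((\<lambda>y. if y \<le> x1 then h1 y else h2 y) has_real_derivative 2 * g2 y / (1 - y\<^sup>2)) (at y)"
        by (subst DERIV_cong_ev[OF refl _ refl, where g = h2]) (use e dh2[OF yd(1)] in \<open>auto elim!: eventually_mono\<close>)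
      moreover have "y \<noteq> x0 \<Longrightarrow> ((\<lambda>y. if y \<le> x1 then g1 y else g2 y) has_real_derivative graph_rate y (h2 y) (g2 y)) (at y)"
        by (subst DERIV_cong_ev[OF refl _ refl, where g = g2]) (use e dg2[OF yd(1)] in \<open>auto elim!: eventually_mono\<close>)
      ultimately show ?thesis using 3 yd by (simp add: h_def g_def)
    qed
    have y1: "y > - x1" using y x by simp
    show "(h has_real_derivative 2 * g y / (1 - y\<^sup>2)) (at y)"
      by (subst DERIV_cong_ev[OF refl loc(1)[OF y1] refl]) (use * in blast)
    show "(g has_real_derivative graph_rate y (h y) (g y)) (at y)" if "y \<noteq> x0"
      by (subst DERIV_cong_ev[OF refl loc(2)[OF y1] refl]) (use * that in blast)
  qed
  have mirror: "((\<lambda>z. f (- z)) has_real_derivative - D) (at y)" if "(f has_real_derivative D) (at (- y))" for f D and y :: real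
  proof -
    have "(uminus has_real_derivative - 1) (at y)" by (auto intro!: derivative_eq_intros)
    from DERIV_chain'[OF this that] show ?thesis by simp
  qed
  have hg: "(\<lambda>z. - h (- z)) = h" "(\<lambda>z. g (- z)) = g" using odd' by auto
  have dh: "(h has_real_derivative 2 * g y / (1 - y\<^sup>2)) (at y)" if y: "y \<in> {-b<..<b}" for y
  proof (cases "y \<ge> 0")
    case True then show ?thesis using pos(1) y by simp
  next
    case False
    then have "(h has_real_derivative 2 * g (- y) / (1 - (- y)\<^sup>2)) (at (- y))" using y by (intro pos(1)) auto
    from DERIV_minus[OF mirror[OF this]] show ?thesis by (simp add: hg(1) odd')
  qed
  have dg: "(g has_real_derivative graph_rate y (h y) (g y)) (at y)" if y: "y \<in> {-x0<..<x0}" for y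
  proof (cases "y \<ge> 0")
    case True then show ?thesis using pos(2) y x by simp
  next
    case False
    then have "(g has_real_derivative graph_rate (- y) (h (- y)) (g (- y))) (at (- y))" using y x by (intro pos(2)) auto
    from mirror[OF this] show ?thesis by (simp add: hg(2) odd' graph_rate_minus)
  qed
  have hb: "\<bar>h y\<bar> < 1" if y: "y \<in> {-x0<..<x0}" for y
  proof -
    have p: "\<bar>h y\<bar> < 1" if "0 \<le> y" "y < x0" for y
      using b1[of y] b2[of y] that x by (auto simp: h_def)
    show ?thesis using p[of y] p[of "- y"] y odd'(1)[of y] by (cases "y \<ge> 0") auto
  qed
  \<comment> \<open>The domain on which the right-hand side is smooth; carrying \<open>x\<close> as
    a component makes the system autonomous.\<close>
  let ?V = "{p :: real \<times> real \<times> real. 0 < 1 - (fst p)\<^sup>2} \<inter> {p. 0 < 1 - (fst (snd p))\<^sup>2}"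
  have opV: "open ?V" by (intro open_Int open_Collect_less continuous_intros)
  have "smooth_on {-x0<..<x0} (\<lambda>y. (y, h y, g y))"
  proof (rule ode_smooth[OF _ opV, where F = "\<lambda>p. (1, 2 * snd (snd p) / (1 - (fst p)\<^sup>2), graph_rate (fst p) (fst (snd p)) (snd (snd p)))"])
    fix y assume y: "y \<in> {-x0<..<x0}"
    have "\<bar>y\<bar> < 1" using y x by auto
    then show "(y, h y, g y) \<in> ?V" using hb[OF y] by (simp add: abs_square_less_1)
    have yb: "y \<in> {-b<..<b}" using y x by auto
    show "((\<lambda>y. (y, h y, g y)) has_vector_derivative
      (1, 2 * snd (snd (y, h y, g y)) / (1 - (fst (y, h y, g y))\<^sup>2), graph_rate (fst (y, h y, g y)) (fst (snd (y, h y, g y))) (snd (snd (y, h y, g y))))) (at y)"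
      using dh[OF yb] dg[OF y]
      by (auto intro!: has_vector_derivative_Pair has_vector_derivative_id simp: has_real_derivative_iff_has_vector_derivative)
  next
    show "smooth_on ?V (\<lambda>p. (1, 2 * snd (snd p) / (1 - (fst p)\<^sup>2), graph_rate (fst p) (fst (snd p)) (snd (snd p))))"
      unfolding graph_rate_def by (intro smooth_intros opV) auto
  qed simp
  from smooth_on_fst[OF _ smooth_on_snd[OF _ this]] smooth_on_snd[OF _ smooth_on_snd[OF _ this]]
  have sm1: "smooth_on {-x0<..<x0} h" "smooth_on {-x0<..<x0} g" by simp_all
  have sm2': "smooth_on {x1<..<b} h" "smooth_on {x1<..<b} g"
    by (subst smooth_on_cong[where g = h2] smooth_on_cong[where g = g2];
        use x sm2 in \<open>auto simp: h_def g_def elim!: smooth_on_subset\<close>)+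
  have sm3: "smooth_on {-b<..<-x1} h" "smooth_on {-b<..<-x1} g"
  proof -
    have "smooth_on {-b<..<-x1} (\<lambda>y. - h (- y))" "smooth_on {-b<..<-x1} (\<lambda>y. g (- y))"
      by (intro smooth_on_minus smooth_on_compose[OF sm2'(1)] smooth_on_compose[OF sm2'(2)]; auto intro!: smooth_intros)+
    then show "smooth_on {-b<..<-x1} h" "smooth_on {-b<..<-x1} g" unfolding hg .
  qed
  \<comment> \<open>The middle interval is where the system is regular; the outer two contain the
    end orbits, where \<open>graph_rate\<close> is singular.\<close>
  have J: "{-b<..<b} = {-b<..<-x1} \<union> ({-x0<..<x0} \<union> {x1<..<b})" using x by auto
  have sm: "smooth_on {-b<..<b} h" "smooth_on {-b<..<b} g"
    unfolding J by (intro smooth_on_Un sm1 sm2' sm3 open_Un; simp)+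
  have ends: "h x0 = - 1" "g x0 = - 4 / (3 * x0)" using x end2 by (auto simp: h_def g_def)
  show ?thesis
    by (rule minimal_graph_sphere[OF _ x(7,8) sm odd' hb ends dh dg[unfolded graph_rate_def]]) (use x in simp)
qed

lemma minimal_sphere:
  "\<exists>M. minimal_hypersurface M \<and> S1_invariant M \<and> M diffeomorphic sphere (0 :: real^4) 1 \<and> \<not> equatorial M"
proof -
  obtain \<Theta> l :: "real \<Rightarrow> real \<Rightarrow> real" where fam: "\<And>s. continuous_on UNIV (\<Theta> s)" "\<And>s. continuous_on UNIV (l s)"
    "\<And>c. 0 \<le> c \<Longrightarrow> c \<le> pi/2 \<Longrightarrow> pole_solution c (\<lambda>s. \<Theta> s c) (\<lambda>s. l s c)"
    by (rule pole_solution_family) (rule that; assumption)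
  \<comment> \<open>The value of \<open>s\<close> at which the pole solution hands over to the
    regular flow, the midpoint of the positive half of its interval.\<close>
  define s1 :: real where "s1 = 1/2000"
  have s1: "s1 \<in> {-1/1000..1/1000}" by (simp add: s1_def)
  define \<psi>1 where "\<psi>1 = arcsin (s1 - 1)"
  have \<psi>1: "- (pi/2) < \<psi>1" "\<psi>1 < 0" "sin \<psi>1 = s1 - 1"
    using arcsin_lt_bounded[of "s1 - 1"] arcsin_less_mono[of "s1 - 1" 0] by (simp_all add: \<psi>1_def s1_def sin_arcsin)
  have C: "cos \<psi>1 > 0" using \<psi>1 by (intro cos_gt_zero_pi) auto
  \<comment> \<open>\<open>l = cos \<beta> / (sin \<beta> * cos \<psi>)\<close> solved for
    \<open>\<beta>\<close>, in a form that remains valid for \<open>l = 0\<close>, where it gives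
    \<open>pi/2\<close>.\<close>
  define q b where "q c = \<Theta> s1 c" and "b c = pi/2 - arctan (cos \<psi>1 * l s1 c)" for c
  have cosb: "cos (b c) = sin (arctan (cos \<psi>1 * l s1 c))" "sin (b c) = cos (arctan (cos \<psi>1 * l s1 c))" for c
    by (simp_all add: b_def cos_diff sin_diff)
  have bnd: "\<bar>l s1 c\<bar> \<le> sin c" "l s1 c \<ge> sin c / 2" "\<bar>sin (q c) - sin c\<bar> \<le> sin c / 1000" "\<bar>q c - c\<bar> \<le> cos c / 1000" "\<bar>q c - c\<bar> \<le> sin c / 1000"
    if "0 \<le> c" "c \<le> pi/2" for c
    using pole_solution_bounds[OF fam(3)[OF that] that s1] by (simp_all add: q_def)
  have sinpos: "sin c > 0" if "0 < c" "c \<le> pi/2" for c using that by (intro sin_gt_zero) auto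
  have lpos: "l s1 c > 0" if "0 < c" "c \<le> pi/2" for c using bnd(2)[of c] sinpos[OF that] that by simp
  obtain \<psi> \<beta> \<theta> :: "real \<Rightarrow> real" and c \<sigma> :: real where
    fl: "0 < c" "c < pi/2" "descending_profile \<psi> \<beta> \<theta>" "\<psi> 0 = \<psi>1" "\<beta> 0 = b c" "\<theta> 0 = q c" "\<sigma> > 0" "\<theta> \<sigma> = 0" "\<psi> \<sigma> = 0"
    "\<forall>t\<in>{0..\<sigma>}. 0 \<le> \<theta> t"
  proof (rule sphere_profile[of b q \<psi>1 "1/5 * (cos \<psi>1)\<^sup>2"])
    show "continuous_on {0..pi/2} b" unfolding b_def[abs_def]
      by (intro continuous_intros continuous_on_subset[OF fam(2)]) auto
    show "continuous_on {0..pi/2} q" unfolding q_def[abs_def] by (rule continuous_on_subset[OF fam(1)]) auto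
    show "0 < q c \<and> q c < pi/2" if "0 < c" "c < pi/2" for c
      using pole_solution_range[OF fam(3) _ _ that s1] that by (simp add: q_def)
    \<comment> \<open>The error bounds proportional to \<open>cos c\<close> and \<open>sin c\<close>
      vanish at these two heights.\<close>
    show "q (pi/2) = pi/2" "q 0 = 0" using bnd(4)[of "pi/2"] bnd(5)[of 0] by simp_all
    show "0 < b c \<and> b c < pi/2" if "0 < c" "c \<le> pi/2" for c
      using lpos[OF that] C arctan_ubound[of "cos \<psi>1 * l s1 c"] by (simp add: b_def)
    show "b 0 = pi/2" using bnd(1)[of 0] by (simp add: b_def)
    show "1/5 * (cos \<psi>1)\<^sup>2 > 0" using C by simp
    show "1/5 * (cos \<psi>1)\<^sup>2 * sin (q c) \<le> cos \<psi>1 * cos (b c)" if c: "0 < c" "c < pi/2" for c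
    proof -
      \<comment> \<open>\<open>y\<close> is the cotangent of \<open>b c\<close>. From
        \<open>0 \<le> y \<le> 1\<close> follows \<open>cos (b c) \<ge> y / 2\<close>, and
        \<open>l \<ge> sin c / 2\<close> makes this at least \<open>cos \<psi>1 * sin c / 4\<close>.
        Since \<open>sin (q c)\<close> exceeds \<open>sin c\<close> by at most a thousandth of it,
        the constant \<open>1/5\<close> is safe.\<close>
      define y where "y = cos \<psi>1 * l s1 c"
      have sc: "0 < sin c" "sin c \<le> 1" using sinpos[of c] c by simp_all
      have y0: "0 \<le> y" using C lpos[of c] c by (simp add: y_def)
      have bl: "\<bar>l s1 c\<bar> \<le> sin c" "\<bar>sin (q c) - sin c\<bar> \<le> sin c / 1000" using bnd(1,3)[of c] c by simp_all
      then have "0 \<le> l s1 c" "l s1 c \<le> 1" using sc lpos[of c] c by linarith+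
      then have "y \<le> 1 * 1" unfolding y_def by (intro mult_mono) auto
      then have "y\<^sup>2 \<le> 1" using y0 by (simp add: power_le_one)
      then have "sqrt (1 + y\<^sup>2) \<le> 2" by (intro real_le_lsqrt) simp_all
      moreover have "sqrt (1 + y\<^sup>2) > 0" by (simp add: add_pos_nonneg)
      ultimately have "y / sqrt (1 + y\<^sup>2) \<ge> y / 2" using y0 by (intro divide_left_mono) auto
      then have "cos (b c) \<ge> y / 2" unfolding cosb sin_arctan y_def .
      moreover have "y \<ge> cos \<psi>1 * (sin c / 2)" unfolding y_def using bnd(2)[of c] c C by (intro mult_left_mono) auto
      ultimately have "cos (b c) \<ge> cos \<psi>1 * (sin c / 4)" by simp
      moreover have "sin c / 4 \<ge> 1/5 * sin (q c)" using bl(2) sc by argo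
      then have "cos \<psi>1 * (sin c / 4) \<ge> cos \<psi>1 * (1/5 * sin (q c))" using C by (intro mult_left_mono) auto
      ultimately have "cos (b c) \<ge> cos \<psi>1 * (1/5 * sin (q c))" by linarith
      then have "cos \<psi>1 * cos (b c) \<ge> cos \<psi>1 * (cos \<psi>1 * (1/5 * sin (q c)))" using C by (intro mult_left_mono) auto
      then show ?thesis by (simp add: power2_eq_square mult.assoc mult.left_commute)
    qed
  qed (use \<psi>1 in \<open>auto intro: that\<close>)
  have c: "0 \<le> c" "c \<le> pi/2" using fl by auto
  obtain h2 g2 :: "real \<Rightarrow> real" and a d2 :: real where P:
    "0 < a" "a < sin (\<Theta> (1/2000) c)" "sin (\<Theta> (1/2000) c) < sin c" "sin c < d2" "d2 < 1"
    "smooth_on {a<..<d2} h2" "smooth_on {a<..<d2} g2"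
    "\<And>x. x \<in> {a<..<d2} \<Longrightarrow> (h2 has_real_derivative 2 * g2 x / (1 - x\<^sup>2)) (at x)"
    "\<And>x. x \<in> {a<..<d2} \<Longrightarrow> x \<noteq> sin c \<Longrightarrow> (g2 has_real_derivative graph_rate x (h2 x) (g2 x)) (at x)"
    "\<And>x. a < x \<Longrightarrow> x < sin c \<Longrightarrow> \<bar>h2 x\<bar> < 1"
    "h2 (sin c) = - 1" "g2 (sin c) = - 4 / (3 * sin c)"
    "h2 (sin (\<Theta> (1/2000) c)) = 1/2000 - 1" "g2 (sin (\<Theta> (1/2000) c)) = - 1 / l (1/2000) c"
    by (rule pole_graph[OF fam(3)[OF c] fl(1,2)]) (rule that; assumption)
  have lp: "l s1 c > 0" using lpos[OF fl(1) c(2)] .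
  have \<beta>0: "cos (\<beta> 0) > 0" unfolding fl(5) cosb using C lp by (auto intro!: sin_gt_zero arctan_ubound[THEN less_trans])
  obtain h1 g1 :: "real \<Rightarrow> real" and d where Q:
    "sin (\<theta> 0) < d" "d < 1" "\<And>x. x \<in> {-d<..<d} \<Longrightarrow> h1 (- x) = - h1 x" "\<And>x. x \<in> {-d<..<d} \<Longrightarrow> g1 (- x) = g1 x"
    "\<And>x. x \<in> {-d<..<d} \<Longrightarrow> \<bar>h1 x\<bar> < 1"
    "\<And>x. x \<in> {-d<..<d} \<Longrightarrow> (h1 has_real_derivative 2 * g1 x / (1 - x\<^sup>2)) (at x)"
    "\<And>x. x \<in> {-d<..<d} \<Longrightarrow> (g1 has_real_derivative graph_rate x (h1 x) (g1 x)) (at x)"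
    "h1 (sin (\<theta> 0)) = sin (\<psi> 0)" "g1 (sin (\<theta> 0)) = - (cos (\<psi> 0) * sin (\<beta> 0) / cos (\<beta> 0))"
    by (rule flow_graph[OF fl(3,7,8,9,10) \<beta>0]) (rule that; assumption)
  have x1: "sin (\<Theta> (1/2000) c) = sin (\<theta> 0)" unfolding fl(6) q_def s1_def ..
  have e1: "h1 (sin (\<theta> 0)) = h2 (sin (\<theta> 0))" using P(13) Q(8) \<psi>1(3) unfolding x1 fl(4) by (simp add: s1_def)
  \<comment> \<open>With cotangent \<open>cos \<psi>1 * l\<close> for \<open>\<beta>\<close>, the
    flow value \<open>- cos \<psi> * tan \<beta>\<close> equals the pole value
    \<open>- 1 / l\<close>.\<close>
  have e2: "g1 (sin (\<theta> 0)) = g2 (sin (\<theta> 0))"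
  proof -
    define y where "y = cos \<psi>1 * l s1 c"
    have y: "y > 0" using C lp by (simp add: y_def)
    have s: "sin (arctan y) = y * cos (arctan y)" by (simp add: sin_arctan cos_arctan)
    have "cos (arctan y) > 0" by (intro cos_gt_zero_pi arctan_lbound arctan_ubound)
    then have "cos \<psi>1 * cos (arctan y) / sin (arctan y) = cos \<psi>1 / y" unfolding s by simp
    also have "\<dots> = 1 / l s1 c" using C by (simp add: y_def)
    finally have "- (cos (\<psi> 0) * sin (\<beta> 0) / cos (\<beta> 0)) = - 1 / l s1 c"
      unfolding fl(4,5) cosb y_def by simp
    then show ?thesis using P(14) Q(9) unfolding x1 by (simp add: s1_def)
  qed
  show ?thesis
    by (rule glued_graph_sphere[OF _ Q(1,2) P(1) P(2)[unfolded x1] P(3)[unfolded x1] P(4,5) Q(3,4,5) P(10) Q(6,7) P(6,7,8,9) e1 e2 P(11,12)])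
      (use P(1,2) x1 in simp)
qed

theorem theorem1p2:
  shows "(\<exists>M. minimal_hypersurface M \<and> S1_invariant M \<and>
              M diffeomorphic sphere (0 :: real^4) 1 \<and> \<not> equatorial M) \<and>
         (\<exists>M. minimal_hypersurface M \<and> S1_invariant M \<and>
              M diffeomorphic
                (sphere (0 :: complex) 1 \<times> sphere (0 :: complex) 1 \<times> sphere (0 :: complex) 1)) \<and>
         (\<exists>M. minimal_hypersurface M \<and> S1_invariant M \<and>
              M diffeomorphic (sphere (0 :: complex) 1 \<times> sphere (0 :: real^3) 1))"
  by (intro conjI minimal_sphere minimal_torus minimal_S1_times_S2)

end
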